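(* Let $0<p<1$, $r,k\in\mathbb{N}$, and $\varphi(x)=\sqrt{1-x^2}$. There are constants $\delta_0>0$ and $C$, independent of $f$ and $\delta$, such that for every function $f$ on $[-1,1]$ with $f^{(r-1)}\in AC[-1,1]$ and $\varphi^rf^{(r)}\in L_1[-1,1]$, and every $\delta\in(0,\delta_0)$, $$\omega_{r+k}^\varphi(f,\delta)_p\le C\delta^r\Omega_k^\varphi(f^{(r)},\delta)_{p,\varphi^r}+C\delta^{r+\frac2p-2}\left(\sum_{\nu=[1/\delta]}^\infty\nu^{1-2p}E_{\nu-r}(f^{(r)})_{p,\varphi^r}^p\right)^{\frac1p}.$$
   Context: $\|f\|_p=\|f\|_{L_p[-1,1]}=\left(\int_{-1}^1|f(x)|^p\,dx\right)^{1/p}$; $[x]$ is the integer part of $x$. $AC[-1,1]$ is the set of absolutely continuous functions on $[-1,1]$; when $f^{(r-1)}\in AC[-1,1]$, $f^{(r)}$ denotes the a.e. defined derivative of $f^{(r-1)}$. $\mathcal{P}_n$ is the set of algebraic polynomials of degree at most $n$, and $E_n(g)_{p,w}=\inf_{P\in\mathcal{P}_n}\|w(g-P)\|_p$ for a weight $w$. For $s\in\mathbb{N}$ put $$\bar\Delta_{h\varphi(x)}^sg(x)=\sum_{j=0}^s(-1)^j\binom{s}{j}g\left(x+\left(\tfrac s2-j\right)h\varphi(x)\right)\quad\text{if }x\pm\tfrac s2h\varphi(x)\in[-1,1],$$ and $\bar\Delta_{h\varphi(x)}^sg(x)=0$ otherwise. The Ditzian–Totik modulus of smoothness is $\omega_s^\varphi(g,\delta)_p=\sup_{|h|\le\delta}\|\bar\Delta_{h\varphi}^sg\|_{L_p[-1,1]}$,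 and for $w=\varphi^\sigma$, $\sigma\ge0$, the weighted main part modulus is $\Omega_s^\varphi(g,\delta)_{p,w}=\sup_{|h|\le\delta}\|w\bar\Delta_{h\varphi}^sg\|_{L_p[-1+2s^2h^2,\,1-2s^2h^2]}$. The right-hand side of the inequality is allowed to be $+\infty$, in which case it is trivial. *)

theory Defs
  imports "HOL-Analysis.Analysis" "HOL-Computational_Algebra.Polynomial"
begin

(* Quasi-norms, moduli and best approximations are ennreal-valued, so that infinite values are
   meaningful without side conditions. Real powers on ennreal, intended for positive exponents only. *)
definition ennpowr :: "ennreal \<Rightarrow> real \<Rightarrow> ennreal" where
  "ennpowr x a = (if x = \<infinity> then \<infinity> else ennreal (enn2real x powr a))"

(* The Lebesgue (completed) measure makes the value insensitive to arbitrary values of f on null sets. *)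
definition Lp_norm :: "real \<Rightarrow> real set \<Rightarrow> (real \<Rightarrow> real) \<Rightarrow> ennreal" where
  "Lp_norm p S f = ennpowr (\<integral>\<^sup>+x\<in>S. ennreal (\<bar>f x\<bar> powr p) \<partial>lebesgue) (1 / p)"

(* Functions on [-1,1] are represented by functions on the whole real line; all notions below
   look only at their values on [-1,1]. *)

definition abs_continuous_on :: "real \<Rightarrow> real \<Rightarrow> (real \<Rightarrow> real) \<Rightarrow> bool" where
  "abs_continuous_on a b g \<longleftrightarrow>
    (\<forall>\<epsilon>>0. \<exists>\<eta>>0. \<forall>(n::nat) (l::nat \<Rightarrow> real) (u::nat \<Rightarrow> real).
       (\<forall>i<n. a \<le> l i \<and> l i \<le> u i \<and> u i \<le> b) \<and>
       pairwise (\<lambda>i j. {l i<..<u i} \<inter> {l j<..<u j} = {}) {..<n} \<and>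
       (\<Sum>i<n. u i - l i) < \<eta> \<longrightarrow>
       (\<Sum>i<n. \<bar>g (u i) - g (l i)\<bar>) < \<epsilon>)"

(* i-th derivative on [-1,1], one-sided at the endpoints; the value is arbitrary at points where
   the derivative does not exist. *)
primrec nderiv :: "nat \<Rightarrow> (real \<Rightarrow> real) \<Rightarrow> real \<Rightarrow> real" where
  "nderiv 0 f = f"
| "nderiv (Suc i) f = (\<lambda>x. vector_derivative (nderiv i f) (at x within {-1..1}))"

(* f^(m) exists everywhere on [-1,1] and is absolutely continuous there. In that case
   nderiv (Suc m) f is the almost everywhere defined derivative of f^(m). *)
definition nderiv_AC :: "nat \<Rightarrow> (real \<Rightarrow> real) \<Rightarrow> bool" where
  "nderiv_AC m f \<longleftrightarrow>
    (\<forall>i<m. nderiv i f differentiable_on {-1..1}) \<and> abs_continuous_on (-1) 1 (nderiv m f)"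

definition dt_phi :: "real \<Rightarrow> real" where
  "dt_phi x = sqrt (1 - x\<^sup>2)"

definition dt_diff :: "nat \<Rightarrow> real \<Rightarrow> (real \<Rightarrow> real) \<Rightarrow> real \<Rightarrow> real" where
  "dt_diff s h g x =
    (if x + real s / 2 * h * dt_phi x \<in> {-1..1} \<and> x - real s / 2 * h * dt_phi x \<in> {-1..1}
     then \<Sum>j\<le>s. (-1) ^ j * real (s choose j) * g (x + (real s / 2 - real j) * h * dt_phi x)
     else 0)"

definition dt_modulus :: "nat \<Rightarrow> (real \<Rightarrow> real) \<Rightarrow> real \<Rightarrow> real \<Rightarrow> ennreal" where
  "dt_modulus s g \<delta> p = (SUP h\<in>{-\<delta>..\<delta>}. Lp_norm p {-1..1} (dt_diff s h g))"

definition main_part_modulus ::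
  "nat \<Rightarrow> (real \<Rightarrow> real) \<Rightarrow> real \<Rightarrow> real \<Rightarrow> (real \<Rightarrow> real) \<Rightarrow> ennreal" where
  "main_part_modulus s g \<delta> p w =
    (SUP h\<in>{-\<delta>..\<delta>}.
       Lp_norm p {-1 + 2 * (real s)\<^sup>2 * h\<^sup>2 .. 1 - 2 * (real s)\<^sup>2 * h\<^sup>2} (\<lambda>x. w x * dt_diff s h g x))"

definition best_approx :: "nat \<Rightarrow> (real \<Rightarrow> real) \<Rightarrow> real \<Rightarrow> (real \<Rightarrow> real) \<Rightarrow> ennreal" where
  "best_approx n g p w =
    (INF P\<in>{P :: real poly. degree P \<le> n}. Lp_norm p {-1..1} (\<lambda>x. w x * (g x - poly P x)))"

end

theory Submission
  imports Defs "HOL-Complex_Analysis.Complex_Analysis"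
begin

text \<open>Let $N = [1/\delta]$ and let $P_j$ be near-best polynomials of degree $2^{j+1}N - r$ for $f^{(r)}$ in the
  quasi-norm with weight $\varphi^r$. Their r-fold antiderivatives $Q_j$ give
  $f = Q_0 + \sum_j (Q_{j+1} - Q_j)$, where the tail tends to zero because $\varphi^r(f^{(r)} - P_j)$ tends to zero
  in $L_1$ by the Nikolskii inequality. With $x = \cos\theta$ a weighted polynomial is a trigonometric polynomial
  whose values at distance $1/n$ are comparable to its $L_p$ means. For $Q_0$, of degree about $1/\delta$, this
  gives $\|\Delta^{r+k}Q_0\|_p \le C\delta^r\|\varphi^r\Delta^k P_0\|_p$, the latter norm over the main part
  with a small multiple of $\delta$ as step. A polynomial Q of degree $m \ge 1/\delta$ satisfies only
  $\|\Delta^{r+k}Q\|_p^p \le C\delta^{rp}(m\delta)^{2-2p}\|\varphi^r Q^{(r)}\|_p^p$, and summing this over the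
  dyadic increments produces the series of best approximations.\<close>

section \<open>Absolutely continuous functions are indefinite integrals\<close>

text \<open>For p < 1 the quasi-norm of a derivative does not control the function, because
  integrating f^(r) back to f needs local L_1 bounds. For a polynomial of degree m such bounds
  follow from L_p, at a price: the maximum of |T|^p is at most C m^2 times its mass, the square
  coming from the endpoints, so the p-th power of the L_1 norm costs m^(2-2p). The increments alone
  lose only (m \<delta>)^(1-p), a stencil meeting about m \<delta> cells of length 1/m; it is the
  weighted L_1 convergence of the telescoping series that asks for 2-2p, and this exponent is then
  used for the increments as well. Condensation turns a dyadic sum with m^(2-2p) into a full sum
  with \<nu>^(1-2p), and \<delta>^(rp) \<delta>^(2-2p) has the p-th root \<delta>^(r+2/p-2): these
  are the exponents of the theorem. The small multiple c of \<delta> as step serves an absorption.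
  Bounding a derivative by its difference leaves an error proportional to the mass being estimated,
  and this falls below one half only when step times degree is small. Since c <= 1, the step still
  takes part in the supremum that defines the modulus.\<close>

definition interval_family ::
  "real \<Rightarrow> real \<Rightarrow> 'i set \<Rightarrow> ('i \<Rightarrow> real) \<Rightarrow> ('i \<Rightarrow> real) \<Rightarrow> bool" where
  "interval_family a b I l u \<longleftrightarrow> (\<forall>i\<in>I. a \<le> l i \<and> l i \<le> u i \<and> u i \<le> b) \<and>
     pairwise (\<lambda>i j. {l i<..<u i} \<inter> {l j<..<u j} = {}) I"

lemma interval_family_bounds:
  assumes "interval_family a b I l u" "i \<in> I"
  shows "a \<le> l i" "l i \<le> u i" "u i \<le> b"
  using assms by (auto simp: interval_family_def)

lemma interval_family_disjnt:
  assumes "interval_family a b I l u" "i \<in> I" "j \<in> I" "i \<noteq> j"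
  shows "{l i<..<u i} \<inter> {l j<..<u j} = {}"
  using assms by (auto simp: interval_family_def pairwise_def)

text \<open>Clipping intervals at a point can leave degenerate ones outside the originals, so
  containment is demanded only of intervals with interior.\<close>

lemma interval_family_subintervals:
  assumes "interval_family a b I l u"
    and "\<And>i. i \<in> I \<Longrightarrow> a' \<le> l' i \<and> l' i \<le> u' i \<and> u' i \<le> b'"
    and "\<And>i. i \<in> I \<Longrightarrow> l' i < u' i \<Longrightarrow> l i \<le> l' i \<and> u' i \<le> u i"
  shows "interval_family a' b' I l' u'"
  unfolding interval_family_def pairwise_def
proof (intro conjI ballI impI)
  fix i j assume ij: "i \<in> I" "j \<in> I" "i \<noteq> j"
  show "{l' i<..<u' i} \<inter> {l' j<..<u' j} = {}"
  proof (rule ccontr)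
    assume "{l' i<..<u' i} \<inter> {l' j<..<u' j} \<noteq> {}"
    then obtain x where "x \<in> {l' i<..<u' i}" "x \<in> {l' j<..<u' j}" by blast
    then have x: "l' i < x" "x < u' i" "l' j < x" "x < u' j" by auto
    then have "x \<in> {l i<..<u i} \<inter> {l j<..<u j}"
      using assms(3)[OF ij(1)] assms(3)[OF ij(2)] by auto
    then show False using interval_family_disjnt[OF assms(1) ij] by auto
  qed
qed (use assms(2) in auto)

text \<open>Later families are indexed by pairs (pieces inside pieces) and by the members of a
  division. A bijection with an initial segment of the naturals brings them under the
  definition.\<close>

lemma abs_continuous_on_finite_family:
  assumes "abs_continuous_on a b G" and "0 < \<epsilon>"
  obtains \<eta> where "0 < \<eta>"
    "\<And>(I::'i set) l u. finite I \<Longrightarrow> interval_family a b I l u \<Longrightarrow> (\<Sum>i\<in>I. u i - l i) < \<eta> \<Longrightarrow>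
       (\<Sum>i\<in>I. \<bar>G (u i) - G (l i)\<bar>) < \<epsilon>"
proof -
  obtain \<eta> where \<eta>: "0 < \<eta>" and
    AC: "\<And>(n::nat) l u. (\<forall>i<n. a \<le> l i \<and> l i \<le> u i \<and> u i \<le> b) \<Longrightarrow>
       pairwise (\<lambda>i j. {l i<..<u i} \<inter> {l j<..<u j} = {}) {..<n} \<Longrightarrow>
       (\<Sum>i<n. u i - l i) < \<eta> \<Longrightarrow> (\<Sum>i<n. \<bar>G (u i) - G (l i)\<bar>) < \<epsilon>"
    using assms unfolding abs_continuous_on_def by meson
  show thesis
  proof
    fix I :: "'i set" and l u
    assume I: "finite I" "interval_family a b I l u" "(\<Sum>i\<in>I. u i - l i) < \<eta>"
    obtain h where h: "bij_betw h {..<card I} I"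
      using ex_bij_betw_nat_finite[OF I(1)] by (auto simp: atLeast0LessThan)
    have hI: "h i \<in> I" if "i < card I" for i using h that by (auto simp: bij_betw_def)
    have reindex: "(\<Sum>i<card I. F (h i)) = (\<Sum>i\<in>I. F i)" for F :: "'i \<Rightarrow> real"
      using sum.reindex_bij_betw[OF h] .
    have "(\<Sum>i<card I. \<bar>G ((u \<circ> h) i) - G ((l \<circ> h) i)\<bar>) < \<epsilon>"
    proof (rule AC)
      show "\<forall>i<card I. a \<le> (l \<circ> h) i \<and> (l \<circ> h) i \<le> (u \<circ> h) i \<and> (u \<circ> h) i \<le> b"
        using hI interval_family_bounds[OF I(2)] by auto
      show "pairwise (\<lambda>i j. {(l \<circ> h) i<..<(u \<circ> h) i} \<inter> {(l \<circ> h) j<..<(u \<circ> h) j} = {}) {..<card I}"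
        unfolding pairwise_def
      proof (intro ballI impI)
        fix i j assume "i \<in> {..<card I}" "j \<in> {..<card I}" "i \<noteq> j"
        then have "h i \<noteq> h j" using h by (auto simp: bij_betw_def inj_on_def)
        then show "{(l \<circ> h) i<..<(u \<circ> h) i} \<inter> {(l \<circ> h) j<..<(u \<circ> h) j} = {}"
          using interval_family_disjnt[OF I(2)] hI \<open>i \<in> _\<close> \<open>j \<in> _\<close> by auto
      qed
      show "(\<Sum>i<card I. (u \<circ> h) i - (l \<circ> h) i) < \<eta>"
        using I(3) reindex[of "\<lambda>i. u i - l i"] by simp
    qed
    then show "(\<Sum>i\<in>I. \<bar>G (u i) - G (l i)\<bar>) < \<epsilon>"
      using reindex[of "\<lambda>i. \<bar>G (u i) - G (l i)\<bar>"] by simp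
  qed (fact \<eta>)
qed

section \<open>Total variation\<close>

lemma interval_family_length_le:
  assumes "finite I" "interval_family a b I l u" "a \<le> b"
  shows "(\<Sum>i\<in>I. u i - l i) \<le> b - a"
proof -
  have "ennreal (\<Sum>i\<in>I. u i - l i) = (\<Sum>i\<in>I. emeasure lborel {l i<..<u i})"
    using interval_family_bounds[OF assms(2)] by (subst sum_ennreal[symmetric]) auto
  also have "\<dots> = emeasure lborel (\<Union>i\<in>I. {l i<..<u i})"
    using interval_family_disjnt[OF assms(2)] assms(1)
    by (intro sum_emeasure) (auto simp: disjoint_family_on_def)
  also have "\<dots> \<le> emeasure lborel {a..b}"
    using interval_family_bounds[OF assms(2)] by (intro emeasure_mono) force+
  also have "\<dots> = ennreal (b - a)" using assms(3) by simp
  finally show ?thesis using assms(3) by (simp add: ennreal_le_iff)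
qed

text \<open>The supremum of this set is the total variation. Nonoverlapping families with gaps
  replace partitions: the sums then have exactly the shape found in
  \<open>abs_continuous_on\<close>, and nothing has to be sorted.\<close>

definition variation_sums :: "(real \<Rightarrow> real) \<Rightarrow> real \<Rightarrow> real \<Rightarrow> real set" where
  "variation_sums G a b =
    {\<Sum>i<n. \<bar>G (u i) - G (l i)\<bar> |(n::nat) l u. interval_family a b {..<n} l u}"

definition variation :: "(real \<Rightarrow> real) \<Rightarrow> real \<Rightarrow> real \<Rightarrow> real" where
  "variation G a b = Sup (variation_sums G a b)"

lemma variation_sumsI:
  "interval_family a b {..<n::nat} l u \<Longrightarrow> (\<Sum>i<n. \<bar>G (u i) - G (l i)\<bar>) \<in> variation_sums G a b"
  by (auto simp: variation_sums_def)

lemma zero_in_variation_sums: "0 \<in> variation_sums G a b"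
  using variation_sumsI[of a b 0 "\<lambda>_. 0" "\<lambda>_. 0" G] by (simp add: interval_family_def)

text \<open>Each interval is cut at c by \<open>min\<close> and \<open>max\<close>. Only an interval
  with c inside is really divided, and there the triangle inequality works in the right
  direction.\<close>

lemma variation_sums_split:
  assumes "s \<in> variation_sums G a b" "a \<le> c" "c \<le> b"
  obtains s1 s2 where "s1 \<in> variation_sums G a c" "s2 \<in> variation_sums G c b" "s \<le> s1 + s2"
proof -
  obtain n :: nat and l u where fam: "interval_family a b {..<n} l u"
    and s: "s = (\<Sum>i<n. \<bar>G (u i) - G (l i)\<bar>)"
    using assms(1) by (auto simp: variation_sums_def)
  note B = interval_family_bounds[OF fam]
  have 1: "interval_family a c {..<n} (\<lambda>i. min (l i) c) (\<lambda>i. min (u i) c)"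
  proof (rule interval_family_subintervals[OF fam])
    fix i assume "i \<in> {..<n}"
    from B[OF this] assms(2,3) show
      "a \<le> min (l i) c \<and> min (l i) c \<le> min (u i) c \<and> min (u i) c \<le> c"
      "min (l i) c < min (u i) c \<Longrightarrow> l i \<le> min (l i) c \<and> min (u i) c \<le> u i"
      by (auto simp: min_def split: if_splits)
  qed
  have 2: "interval_family c b {..<n} (\<lambda>i. max (l i) c) (\<lambda>i. max (u i) c)"
  proof (rule interval_family_subintervals[OF fam])
    fix i assume "i \<in> {..<n}"
    from B[OF this] assms(2,3) show
      "c \<le> max (l i) c \<and> max (l i) c \<le> max (u i) c \<and> max (u i) c \<le> b"
      "max (l i) c < max (u i) c \<Longrightarrow> l i \<le> max (l i) c \<and> max (u i) c \<le> u i"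
      by (auto simp: max_def split: if_splits)
  qed
  have "s \<le> (\<Sum>i<n. \<bar>G (min (u i) c) - G (min (l i) c)\<bar>) + (\<Sum>i<n. \<bar>G (max (u i) c) - G (max (l i) c)\<bar>)"
    unfolding s sum.distrib[symmetric]
    by (intro sum_mono) (use B in \<open>auto simp: min_def max_def\<close>)
  then show thesis using that variation_sumsI[OF 1, of G] variation_sumsI[OF 2, of G] by blast
qed

text \<open>On an interval shorter than the \<eta> that belongs to tolerance 1 the variation is at
  most 1. The induction peels pieces of length \<eta>/2 off the right end.\<close>

lemma variation_sums_bdd:
  assumes AC: "abs_continuous_on a b G" and "a \<le> b"
  shows "bdd_above (variation_sums G a b)"
proof -
  obtain \<eta> where \<eta>: "0 < \<eta>" and
    *: "\<And>(I::nat set) l u. finite I \<Longrightarrow> interval_family a b I l u \<Longrightarrow> (\<Sum>i\<in>I. u i - l i) < \<eta> \<Longrightarrow>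
       (\<Sum>i\<in>I. \<bar>G (u i) - G (l i)\<bar>) < 1"
    by (rule abs_continuous_on_finite_family[OF AC zero_less_one]) (rule that, assumption, blast)
  have step: "s \<le> 1" if s_in: "s \<in> variation_sums G c d" and that: "a \<le> c" "c \<le> d" "d \<le> b" "d - c < \<eta>" for s c d
  proof -
    obtain n :: nat and l u where fam: "interval_family c d {..<n} l u"
      and s: "s = (\<Sum>i<n. \<bar>G (u i) - G (l i)\<bar>)"
      using s_in unfolding variation_sums_def by blast
    have "interval_family a b {..<n} l u"
      by (rule interval_family_subintervals[OF fam])
        (use interval_family_bounds[OF fam] that in \<open>force+\<close>)
    moreover have "(\<Sum>i<n. u i - l i) < \<eta>"
      using interval_family_length_le[OF _ fam] that by auto
    ultimately show ?thesis using *[of "{..<n}"] s by fastforce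
  qed
  have "s \<le> real n + 1" if "s \<in> variation_sums G a x" "a \<le> x" "x \<le> b" "x - a \<le> real n * (\<eta>/2)" for s x n
    using that
  proof (induction n arbitrary: s x)
    case 0
    then show ?case using step[of s a x] \<eta> by auto
  next
    case (Suc n)
    show ?case
    proof (cases "x - a \<le> \<eta>/2")
      case True
      then show ?thesis using step[of s a x] \<eta> Suc.prems by auto
    next
      case False
      define c where "c = x - \<eta>/2"
      have c: "a \<le> c" "c \<le> x" "c \<le> b" "x - c < \<eta>" "c - a \<le> real n * (\<eta>/2)"
        using False Suc.prems \<eta> by (auto simp: c_def algebra_simps)
      obtain s1 s2 where s12: "s1 \<in> variation_sums G a c" "s2 \<in> variation_sums G c x" "s \<le> s1 + s2"
        using variation_sums_split[OF Suc.prems(1) c(1,2)] .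
      have "s1 \<le> real n + 1" using Suc.IH[OF s12(1)] c by auto
      moreover have "s2 \<le> 1" using step[OF s12(2)] c Suc.prems by auto
      ultimately show ?thesis using s12(3) by simp
    qed
  qed
  note bd = this
  obtain n :: nat where "(b - a) / (\<eta>/2) \<le> real n" using real_arch_simple by blast
  then have "b - a \<le> real n * (\<eta>/2)" using \<eta> by (simp add: field_simps)
  then show ?thesis using bd[of _ b n] assms(2) unfolding bdd_above_def by blast
qed

lemma variation_upper:
  "\<lbrakk>bdd_above (variation_sums G a b); s \<in> variation_sums G a b\<rbrakk> \<Longrightarrow> s \<le> variation G a b"
  by (simp add: variation_def cSup_upper)

lemma variation_least:
  "(\<And>s. s \<in> variation_sums G a b \<Longrightarrow> s \<le> B) \<Longrightarrow> variation G a b \<le> B"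
  unfolding variation_def by (intro cSup_least) (use zero_in_variation_sums[of G a b] in auto)

lemma abs_continuous_on_subinterval:
  "\<lbrakk>abs_continuous_on a b G; a \<le> c; d \<le> b\<rbrakk> \<Longrightarrow> abs_continuous_on c d G"
  unfolding abs_continuous_on_def by (meson order_trans)

lemma variation_split_le:
  assumes "abs_continuous_on a b G" "a \<le> c" "c \<le> d" "d \<le> b"
  shows "variation G a d \<le> variation G a c + variation G c d"
proof (rule variation_least)
  fix s assume "s \<in> variation_sums G a d"
  then obtain s1 s2 where s: "s1 \<in> variation_sums G a c" "s2 \<in> variation_sums G c d" "s \<le> s1 + s2"
    using variation_sums_split[of s G a d c] assms by auto
  have "bdd_above (variation_sums G a c)" "bdd_above (variation_sums G c d)"
    using assms by (auto intro!: variation_sums_bdd intro: abs_continuous_on_subinterval)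
  then show "s \<le> variation G a c + variation G c d"
    using s variation_upper by (smt (verit))
qed

text \<open>The interval [c, d] can be appended to any family in [a, c]. The absolute value yields
  two monotonicities at once, that of the variation and that of the variation minus G, as the Jordan
  decomposition requires.\<close>

lemma variation_increment_ge:
  assumes AC: "abs_continuous_on a b G" and "a \<le> c" "c \<le> d" "d \<le> b"
  shows "variation G a c + \<bar>G d - G c\<bar> \<le> variation G a d"
proof -
  have bdd: "bdd_above (variation_sums G a d)"
    using assms by (auto intro!: variation_sums_bdd intro: abs_continuous_on_subinterval)
  have "variation G a c \<le> variation G a d - \<bar>G d - G c\<bar>"
  proof (rule variation_least)
    fix s assume "s \<in> variation_sums G a c"
    then obtain n :: nat and l u where fam: "interval_family a c {..<n} l u"
      and s: "s = (\<Sum>i<n. \<bar>G (u i) - G (l i)\<bar>)"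
      by (auto simp: variation_sums_def)
    note B = interval_family_bounds[OF fam]
    have "interval_family a d {..<Suc n} (l(n := c)) (u(n := d))"
      unfolding interval_family_def pairwise_def
    proof (intro conjI ballI impI)
      fix i j assume ij: "i \<in> {..<Suc n}" "j \<in> {..<Suc n}" "i \<noteq> j"
      show "{(l(n := c)) i<..<(u(n := d)) i} \<inter> {(l(n := c)) j<..<(u(n := d)) j} = {}"
      proof (cases "i < n \<and> j < n")
        case True
        then show ?thesis using interval_family_disjnt[OF fam, of i j] ij by auto
      next
        case False
        then have "i = n \<and> j < n \<or> i < n \<and> j = n" using ij by auto
        then show ?thesis using B(3)[of i] B(3)[of j] by force
      qed
    next
      fix i assume "i \<in> {..<Suc n}"
      then show "a \<le> (l(n := c)) i" "(l(n := c)) i \<le> (u(n := d)) i" "(u(n := d)) i \<le> d"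
        using B[of i] assms by (auto simp: less_Suc_eq)
    qed
    from variation_sumsI[OF this, of G] have "s + \<bar>G d - G c\<bar> \<in> variation_sums G a d"
      by (simp add: s)
    then show "s \<le> variation G a d - \<bar>G d - G c\<bar>"
      using variation_upper[OF bdd] by fastforce
  qed
  then show ?thesis by simp
qed

text \<open>Inside each given interval a family is chosen that nearly attains its variation. All
  chosen intervals together form a single family, indexed by pairs, of no greater total length, to
  which the absolute continuity of G applies.\<close>

lemma abs_continuous_on_variation:
  assumes AC: "abs_continuous_on a b G"
  shows "abs_continuous_on a b (variation G a)"
  unfolding abs_continuous_on_def
proof (intro allI impI)
  fix \<epsilon> :: real assume \<epsilon>: "0 < \<epsilon>"
  obtain \<eta> where \<eta>: "0 < \<eta>" and
    *: "\<And>(I::(nat \<times> nat) set) l u. finite I \<Longrightarrow> interval_family a b I l u \<Longrightarrow> (\<Sum>i\<in>I. u i - l i) < \<eta> \<Longrightarrow>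
       (\<Sum>i\<in>I. \<bar>G (u i) - G (l i)\<bar>) < \<epsilon>/2"
    by (rule abs_continuous_on_finite_family[OF AC half_gt_zero[OF \<epsilon>]]) (rule that, assumption, blast)
  show "\<exists>\<eta>>0. \<forall>(n::nat) l u.
       (\<forall>i<n. a \<le> l i \<and> l i \<le> u i \<and> u i \<le> b) \<and>
       pairwise (\<lambda>i j. {l i<..<u i} \<inter> {l j<..<u j} = {}) {..<n} \<and>
       (\<Sum>i<n. u i - l i) < \<eta> \<longrightarrow>
       (\<Sum>i<n. \<bar>variation G a (u i) - variation G a (l i)\<bar>) < \<epsilon>"
  proof (intro exI[of _ \<eta>] conjI allI impI)
    fix n :: nat and l u
    assume "(\<forall>i<n. a \<le> l i \<and> l i \<le> u i \<and> u i \<le> b) \<and>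
       pairwise (\<lambda>i j. {l i<..<u i} \<inter> {l j<..<u j} = {}) {..<n} \<and>
       (\<Sum>i<n. u i - l i) < \<eta>"
    then have fam: "interval_family a b {..<n} l u" and len: "(\<Sum>i<n. u i - l i) < \<eta>"
      by (auto simp: interval_family_def)
    note B = interval_family_bounds[OF fam, simplified]
    \<comment> \<open>The n errors of this size add up to at most \<epsilon>/2; the summand 1 covers
      n = 0.\<close>
    define \<theta> where "\<theta> = \<epsilon> / (2 * (real n + 1))"
    have \<theta>: "\<theta> > 0" using \<epsilon> by (simp add: \<theta>_def)
    have "\<exists>k L U. interval_family (l i) (u i) {..<k::nat} L U \<and>
             variation G (l i) (u i) - \<theta> \<le> (\<Sum>j<k. \<bar>G (U j) - G (L j)\<bar>)" for i
    proof -
      have "\<exists>s\<in>variation_sums G (l i) (u i). variation G (l i) (u i) - \<theta> < s"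
      proof (rule ccontr)
        assume "\<not> ?thesis"
        then have "variation G (l i) (u i) \<le> variation G (l i) (u i) - \<theta>"
          by (intro variation_least) (auto simp: not_less)
        then show False using \<theta> by simp
      qed
      then show ?thesis by (fastforce simp: variation_sums_def)
    qed
    then obtain k L U where fam': "\<And>i. interval_family (l i) (u i) {..<k i::nat} (L i) (U i)"
      and V: "\<And>i. variation G (l i) (u i) - \<theta> \<le> (\<Sum>j<k i. \<bar>G (U i j) - G (L i j)\<bar>)"
      by metis
    define I where "I = Sigma {..<n} (\<lambda>i. {..<k i})"
    have fin: "finite I" by (simp add: I_def)
    have sumI: "(\<Sum>x\<in>I. F x) = (\<Sum>i<n. \<Sum>j<k i. F (i, j))" for F :: "nat \<times> nat \<Rightarrow> real"
      unfolding I_def by (subst sum.Sigma) auto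
    have famI: "interval_family a b I (\<lambda>(i, j). L i j) (\<lambda>(i, j). U i j)"
      unfolding interval_family_def pairwise_def
    proof (intro conjI ballI impI)
      fix x assume "x \<in> I"
      then obtain i j where x: "x = (i, j)" "i < n" "j < k i" by (auto simp: I_def)
      have "l i \<le> L i j" "L i j \<le> U i j" "U i j \<le> u i"
        using interval_family_bounds[OF fam'[of i], of j] x by auto
      then show "a \<le> (case x of (i, j) \<Rightarrow> L i j)"
        "(case x of (i, j) \<Rightarrow> L i j) \<le> (case x of (i, j) \<Rightarrow> U i j)"
        "(case x of (i, j) \<Rightarrow> U i j) \<le> b" using B[of i] x by auto
    next
      fix x y assume xy: "x \<in> I" "y \<in> I" "x \<noteq> y"
      then obtain i j i' j' where x: "x = (i, j)" "i < n" "j < k i"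
        and y: "y = (i', j')" "i' < n" "j' < k i'" by (auto simp: I_def)
      have bd: "l i \<le> L i j" "U i j \<le> u i" "l i' \<le> L i' j'" "U i' j' \<le> u i'"
        using interval_family_bounds[OF fam'[of i], of j] interval_family_bounds[OF fam'[of i'], of j'] x y
        by auto
      show "{case x of (i, j) \<Rightarrow> L i j<..<case x of (i, j) \<Rightarrow> U i j} \<inter>
            {case y of (i, j) \<Rightarrow> L i j<..<case y of (i, j) \<Rightarrow> U i j} = {}"
      proof (cases "i = i'")
        case True
        then show ?thesis using interval_family_disjnt[OF fam'[of i], of j j'] x y xy by auto
      next
        case False
        then have "{l i<..<u i} \<inter> {l i'<..<u i'} = {}"
          using interval_family_disjnt[OF fam, of i i'] x y by auto
        moreover have "{L i j<..<U i j} \<subseteq> {l i<..<u i}" "{L i' j'<..<U i' j'} \<subseteq> {l i'<..<u i'}"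
          using bd by auto
        ultimately show ?thesis unfolding x(1) y(1) prod.case by blast
      qed
    qed
    have "(\<Sum>i<n. \<Sum>j<k i. U i j - L i j) \<le> (\<Sum>i<n. u i - l i)"
      using B by (intro sum_mono interval_family_length_le[OF _ fam']) auto
    then have "(\<Sum>x\<in>I. (case x of (i, j) \<Rightarrow> U i j) - (case x of (i, j) \<Rightarrow> L i j)) < \<eta>"
      using len by (simp add: sumI)
    from *[OF fin famI this]
    have sm: "(\<Sum>i<n. \<Sum>j<k i. \<bar>G (U i j) - G (L i j)\<bar>) < \<epsilon>/2" by (simp add: sumI)
    have "(\<Sum>i<n. \<bar>variation G a (u i) - variation G a (l i)\<bar>) \<le>
          (\<Sum>i<n. (\<Sum>j<k i. \<bar>G (U i j) - G (L i j)\<bar>) + \<theta>)"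
    proof (intro sum_mono)
      fix i assume i: "i \<in> {..<n}"
      have "variation G a (u i) \<le> variation G a (l i) + variation G (l i) (u i)"
        using variation_split_le[OF AC] B[of i] i by auto
      moreover have "variation G a (l i) + \<bar>G (u i) - G (l i)\<bar> \<le> variation G a (u i)"
        using variation_increment_ge[OF AC] B[of i] i by auto
      ultimately show "\<bar>variation G a (u i) - variation G a (l i)\<bar> \<le> (\<Sum>j<k i. \<bar>G (U i j) - G (L i j)\<bar>) + \<theta>"
        using V[of i] by linarith
    qed
    also have "\<dots> = (\<Sum>i<n. \<Sum>j<k i. \<bar>G (U i j) - G (L i j)\<bar>) + real n * \<theta>"
      by (simp add: sum.distrib)
    also have "real n * \<theta> \<le> \<epsilon>/2" using \<epsilon> by (simp add: \<theta>_def field_simps)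
    finally show "(\<Sum>i<n. \<bar>variation G a (u i) - variation G a (l i)\<bar>) < \<epsilon>" using sm by linarith
  qed (fact \<eta>)
qed

lemma abs_continuous_on_diff:
  assumes "abs_continuous_on a b G" "abs_continuous_on a b H"
  shows "abs_continuous_on a b (\<lambda>x. G x - H x)"
  unfolding abs_continuous_on_def
proof (intro allI impI)
  fix \<epsilon> :: real assume \<epsilon>: "0 < \<epsilon>"
  obtain \<eta>1 where \<eta>1: "0 < \<eta>1" and
    1: "\<And>(I::nat set) l u. finite I \<Longrightarrow> interval_family a b I l u \<Longrightarrow> (\<Sum>i\<in>I. u i - l i) < \<eta>1 \<Longrightarrow>
       (\<Sum>i\<in>I. \<bar>G (u i) - G (l i)\<bar>) < \<epsilon>/2"
    by (rule abs_continuous_on_finite_family[OF assms(1) half_gt_zero[OF \<epsilon>]]) (rule that, assumption, blast)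
  obtain \<eta>2 where \<eta>2: "0 < \<eta>2" and
    2: "\<And>(I::nat set) l u. finite I \<Longrightarrow> interval_family a b I l u \<Longrightarrow> (\<Sum>i\<in>I. u i - l i) < \<eta>2 \<Longrightarrow>
       (\<Sum>i\<in>I. \<bar>H (u i) - H (l i)\<bar>) < \<epsilon>/2"
    by (rule abs_continuous_on_finite_family[OF assms(2) half_gt_zero[OF \<epsilon>]]) (rule that, assumption, blast)
  show "\<exists>\<eta>>0. \<forall>(n::nat) l u.
       (\<forall>i<n. a \<le> l i \<and> l i \<le> u i \<and> u i \<le> b) \<and>
       pairwise (\<lambda>i j. {l i<..<u i} \<inter> {l j<..<u j} = {}) {..<n} \<and>
       (\<Sum>i<n. u i - l i) < \<eta> \<longrightarrow>
       (\<Sum>i<n. \<bar>(G (u i) - H (u i)) - (G (l i) - H (l i))\<bar>) < \<epsilon>"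
  proof (intro exI[of _ "min \<eta>1 \<eta>2"] conjI allI impI)
    fix n :: nat and l u
    assume A: "(\<forall>i<n. a \<le> l i \<and> l i \<le> u i \<and> u i \<le> b) \<and>
       pairwise (\<lambda>i j. {l i<..<u i} \<inter> {l j<..<u j} = {}) {..<n} \<and>
       (\<Sum>i<n. u i - l i) < min \<eta>1 \<eta>2"
    then have fam: "interval_family a b {..<n} l u" by (auto simp: interval_family_def)
    have "(\<Sum>i<n. \<bar>(G (u i) - H (u i)) - (G (l i) - H (l i))\<bar>) \<le>
      (\<Sum>i<n. \<bar>G (u i) - G (l i)\<bar>) + (\<Sum>i<n. \<bar>H (u i) - H (l i)\<bar>)"
      unfolding sum.distrib[symmetric] by (intro sum_mono) auto
    then show "(\<Sum>i<n. \<bar>(G (u i) - H (u i)) - (G (l i) - H (l i))\<bar>) < \<epsilon>"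
      using 1[OF _ fam] 2[OF _ fam] A by fastforce
  qed (use \<eta>1 \<eta>2 in auto)
qed

lemma abs_continuous_on_imp_continuous_on:
  assumes "abs_continuous_on a b G"
  shows "continuous_on {a..b} G"
  unfolding continuous_on_iff
proof (intro ballI allI impI)
  fix x \<epsilon> :: real assume x: "x \<in> {a..b}" and \<epsilon>: "0 < \<epsilon>"
  obtain \<eta> where \<eta>: "0 < \<eta>" and
    *: "\<And>(I::nat set) l u. finite I \<Longrightarrow> interval_family a b I l u \<Longrightarrow> (\<Sum>i\<in>I. u i - l i) < \<eta> \<Longrightarrow>
       (\<Sum>i\<in>I. \<bar>G (u i) - G (l i)\<bar>) < \<epsilon>"
    by (rule abs_continuous_on_finite_family[OF assms \<epsilon>]) (rule that, assumption, blast)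
  show "\<exists>d>0. \<forall>x'\<in>{a..b}. dist x' x < d \<longrightarrow> dist (G x') (G x) < \<epsilon>"
  proof (intro exI[of _ \<eta>] conjI ballI impI)
    fix y assume y: "y \<in> {a..b}" "dist y x < \<eta>"
    have "interval_family a b {0::nat} (\<lambda>_. min x y) (\<lambda>_. max x y)"
      using x y by (auto simp: interval_family_def)
    moreover have "max x y - min x y < \<eta>" using y by (auto simp: dist_real_def)
    ultimately have "\<bar>G (max x y) - G (min x y)\<bar> < \<epsilon>" using *[of "{0}"] by force
    then show "dist (G y) (G x) < \<epsilon>"
      by (cases "x \<le> y") (auto simp: dist_real_def)
  qed (fact \<eta>)
qed

section \<open>Stieltjes measures and their densities\<close>

lemma open_Union_countable_cbox:
  fixes U :: "real set"
  assumes "open U"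
  obtains c d :: "nat \<Rightarrow> real" where "U = (\<Union>k. {c k..d k})"
proof -
  define Q where "Q = {(x, y). x \<in> \<rat> \<and> y \<in> \<rat> \<and> {x..y::real} \<subseteq> U}"
  have "countable Q"
    by (rule countable_subset[OF _ countable_SIGMA[OF countable_rat countable_rat]]) (auto simp: Q_def)
  \<comment> \<open>The empty interval [1, 0] keeps Q nonempty, so that an enumeration exists even
    when U is empty.\<close>
  have ne: "(1, 0) \<in> Q" by (auto simp: Q_def)
  obtain q :: "nat \<Rightarrow> real \<times> real" where q: "range q = Q"
    using range_from_nat_into[OF _ \<open>countable Q\<close>] ne by blast
  have U: "U = (\<Union>(x, y)\<in>Q. {x..y})"
  proof (intro equalityI subsetI)
    fix z assume "z \<in> U"
    then obtain e where e: "e > 0" "cball z e \<subseteq> U" using assms open_contains_cball by blast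
    obtain x y where "x \<in> \<rat>" "y \<in> \<rat>" "z - e < x" "x < z" "z < y" "y < z + e"
      using Rats_dense_in_real[of "z - e" z] Rats_dense_in_real[of z "z + e"] e by auto
    moreover from this have "{x..y} \<subseteq> U" using e by (auto simp: cball_eq_atLeastAtMost subset_iff)
    ultimately show "z \<in> (\<Union>(x, y)\<in>Q. {x..y})" by (force simp: Q_def)
  qed (auto simp: Q_def)
  show thesis
    by (rule that[of "fst \<circ> q" "snd \<circ> q"]) (use U in \<open>auto simp: q[symmetric] split_beta\<close>)
qed

text \<open>A null set lies in an open set of length less than \<eta>, which is the increasing union
  of finite unions of closed intervals. A division makes each finite union nonoverlapping, and
  absolute continuity bounds its Stieltjes measure by \<epsilon>. Continuity of H removes atoms, so
  endpoints are harmless.\<close>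

lemma absolutely_continuous_interval_measure:
  assumes AC: "abs_continuous_on a b H" and "a \<le> b"
    and mono: "\<And>x y. x \<le> y \<Longrightarrow> H x \<le> H y"
    and const: "\<And>x. H x = H (max a (min x b))"
    and cont: "continuous_on UNIV H"
  shows "absolutely_continuous lborel (interval_measure H)"
  unfolding absolutely_continuous_def
proof
  fix N :: "real set" assume N: "N \<in> null_sets lborel"
  let ?\<mu> = "interval_measure H"
  have Icc: "emeasure ?\<mu> {x..y} = ennreal (H y - H x)" if "x \<le> y" for x y
    using that mono cont by (intro emeasure_interval_measure_Icc) auto
  have small: "emeasure ?\<mu> N \<le> ennreal \<epsilon>" if \<epsilon>: "0 < \<epsilon>" for \<epsilon> :: real
  proof -
    obtain \<eta> where \<eta>: "0 < \<eta>" and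
      *: "\<And>(I::real set set) l u. finite I \<Longrightarrow> interval_family a b I l u \<Longrightarrow> (\<Sum>i\<in>I. u i - l i) < \<eta> \<Longrightarrow>
         (\<Sum>i\<in>I. \<bar>H (u i) - H (l i)\<bar>) < \<epsilon>"
      by (rule abs_continuous_on_finite_family[OF AC \<epsilon>]) (rule that, assumption, blast)
    have "N \<in> sets lebesgue" using N by auto
    then obtain U where U: "open U" "N \<subseteq> U" "emeasure lebesgue (U - N) < ennreal \<eta>"
      using sets_lebesgue_outer_open[OF _ \<eta>] by metis
    have "emeasure lborel U = emeasure lborel (U - N)"
      using N U by (simp add: emeasure_Diff_null_set)
    also have "\<dots> = emeasure lebesgue (U - N)" using U N by auto
    finally have lenU: "emeasure lborel U < ennreal \<eta>" using U(3) by simp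
    obtain c d :: "nat \<Rightarrow> real" where cd: "U = (\<Union>k. {c k..d k})"
      using open_Union_countable_cbox[OF U(1)] .
    define S where "S n = (\<Union>k<n. {c k..d k})" for n
    have S_le: "emeasure ?\<mu> (S n) \<le> ennreal \<epsilon>" for n
    proof -
      define \<F> where "\<F> = (\<lambda>k. {c k..d k}) ` {..<n}"
      have "finite \<F>" by (simp add: \<F>_def)
      moreover have "\<exists>x y. K = cbox x y" if "K \<in> \<F>" for K
        using that unfolding \<F>_def cbox_interval by blast
      ultimately obtain p where "p division_of \<Union>\<F>"
        using elementary_unions_intervals[of \<F>] by blast
      then have p: "p division_of S n" by (simp add: S_def \<F>_def)
      note pD = division_ofD[OF p]
      have box: "K = {Inf K..Sup K} \<and> Inf K \<le> Sup K" if "K \<in> p" for K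
      proof -
        have "\<exists>x y. K = cbox x y" using pD(4)[OF that] by auto
        then obtain x y where xy: "K = cbox x y" by blast
        then have "x \<le> y" using pD(3)[OF that] by auto
        then show ?thesis using xy by auto
      qed
      \<comment> \<open>Since H is constant on either side of [a, b], clamping the ends of K to
        [a, b] leaves the increment of H over K unchanged.\<close>
      define l where "l K = max a (min (Inf K) b)" for K :: "real set"
      define u where "u K = max a (min (Sup K) b)" for K :: "real set"
      have disj: "{Inf K<..<Sup K} \<inter> {Inf J<..<Sup J} = {}" if "K \<in> p" "J \<in> p" "K \<noteq> J" for K J
        using pD(5)[OF that] box[OF that(1)] box[OF that(2)] by (metis interior_atLeastAtMost_real)
      have len: "(\<Sum>K\<in>p. Sup K - Inf K) < \<eta>"
      proof -
        have "ennreal (\<Sum>K\<in>p. Sup K - Inf K) = (\<Sum>K\<in>p. emeasure lborel {Inf K<..<Sup K})"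
          using box by (subst sum_ennreal[symmetric]) auto
        also have "\<dots> = emeasure lborel (\<Union>K\<in>p. {Inf K<..<Sup K})"
          using disj pD(1) by (intro sum_emeasure) (auto simp: disjoint_family_on_def)
        also have "\<dots> \<le> emeasure lborel U"
        proof (intro emeasure_mono UN_least)
          fix K assume K: "K \<in> p"
          have "{Inf K<..<Sup K} \<subseteq> K" using box[OF K] by (metis greaterThanLessThan_subseteq_atLeastAtMost_iff order_refl)
          also have "\<dots> \<subseteq> S n" using pD(2)[OF K] .
          finally show "{Inf K<..<Sup K} \<subseteq> U" by (auto simp: S_def cd)
        qed (use U(1) in auto)
        finally have "ennreal (\<Sum>K\<in>p. Sup K - Inf K) < ennreal \<eta>" using lenU by order
        then show ?thesis using box by (subst (asm) ennreal_less_iff) (auto intro!: sum_nonneg)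
      qed
      have fam: "interval_family a b p l u"
        unfolding interval_family_def pairwise_def
      proof (intro conjI ballI impI)
        fix K J assume KJ: "K \<in> p" "J \<in> p" "K \<noteq> J"
        have "{Inf K<..<Sup K} \<inter> {Inf J<..<Sup J} = {}" by (rule disj[OF KJ])
        moreover have "{l K<..<u K} \<subseteq> {Inf K<..<Sup K}" "{l J<..<u J} \<subseteq> {Inf J<..<Sup J}"
          by (auto simp: l_def u_def)
        ultimately show "{l K<..<u K} \<inter> {l J<..<u J} = {}" by blast
      next
        fix K assume "K \<in> p"
        then show "a \<le> l K" "l K \<le> u K" "u K \<le> b"
          using box[of K] \<open>a \<le> b\<close> by (auto simp: l_def u_def min_def max_def)
      qed
      have "(\<Sum>K\<in>p. u K - l K) \<le> (\<Sum>K\<in>p. Sup K - Inf K)"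
      proof (rule sum_mono)
        fix K assume "K \<in> p"
        from box[OF this] have "Inf K \<le> Sup K" by simp
        then show "u K - l K \<le> Sup K - Inf K" by (auto simp: l_def u_def min_def max_def)
      qed
      then have sm: "(\<Sum>K\<in>p. \<bar>H (u K) - H (l K)\<bar>) < \<epsilon>"
        using *[OF pD(1) fam] len by auto
      have "emeasure ?\<mu> (S n) = emeasure ?\<mu> (\<Union>K\<in>p. K)" using pD(6) by simp
      also have "\<dots> \<le> (\<Sum>K\<in>p. emeasure ?\<mu> K)"
      proof (rule emeasure_subadditive_finite[OF pD(1)])
        show "(\<lambda>K. K) ` p \<subseteq> sets ?\<mu>" using pD(4) by fastforce
      qed
      also have "\<dots> = (\<Sum>K\<in>p. ennreal \<bar>H (u K) - H (l K)\<bar>)"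
      proof (intro sum.cong refl)
        fix K assume K: "K \<in> p"
        have "emeasure ?\<mu> K = ennreal (H (Sup K) - H (Inf K))"
          using Icc box[OF K] by metis
        also have "H (Sup K) - H (Inf K) = \<bar>H (u K) - H (l K)\<bar>"
          using const[of "Sup K"] const[of "Inf K"] mono[of "Inf K" "Sup K"] box[OF K]
          by (simp add: l_def u_def)
        finally show "emeasure ?\<mu> K = ennreal \<bar>H (u K) - H (l K)\<bar>" .
      qed
      also have "\<dots> = ennreal (\<Sum>K\<in>p. \<bar>H (u K) - H (l K)\<bar>)" by (simp add: sum_ennreal)
      also have "\<dots> \<le> ennreal \<epsilon>" using sm by (intro ennreal_leI) simp
      finally show ?thesis .
    qed
    have "emeasure ?\<mu> N \<le> emeasure ?\<mu> (\<Union>n. S n)"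
      using U(2) cd by (intro emeasure_mono) (auto simp: S_def)
    also have "\<dots> = (SUP n. emeasure ?\<mu> (S n))"
      by (rule SUP_emeasure_incseq[symmetric]) (fastforce simp: S_def incseq_def)+
    also have "\<dots> \<le> ennreal \<epsilon>" using S_le by (intro SUP_least)
    finally show ?thesis .
  qed
  have "emeasure ?\<mu> N \<le> 0"
    by (rule ennreal_le_epsilon) (use small in auto)
  then show "N \<in> null_sets ?\<mu>" using N by (auto simp: null_sets_def)
qed

text \<open>The integrand is the Radon-Nikodym density of the Stieltjes measure of H, extended by
  constants outside [a, b].\<close>

lemma mono_AC_indefinite_integral:
  assumes AC: "abs_continuous_on a b H" and ab: "a \<le> b"
    and mono: "\<And>x y. a \<le> x \<Longrightarrow> x \<le> y \<Longrightarrow> y \<le> b \<Longrightarrow> H x \<le> H y"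
  obtains w where "integrable lborel w"
    "\<And>x y. a \<le> x \<Longrightarrow> x \<le> y \<Longrightarrow> y \<le> b \<Longrightarrow> (w has_integral (H y - H x)) {x..y}"
proof -
  define E where "E x = H (max a (min x b))" for x
  have clamp: "max a (min x b) \<in> {a..b}" for x using ab by auto
  have E_eq: "E x = H x" if "x \<in> {a..b}" for x using that by (auto simp: E_def)
  have contH: "continuous_on {a..b} H" by (rule abs_continuous_on_imp_continuous_on[OF AC])
  have contE: "continuous_on UNIV E" unfolding E_def
    by (rule continuous_on_compose2[OF contH]) (use clamp in \<open>auto intro!: continuous_intros\<close>)
  have monoE: "E x \<le> E y" if "x \<le> y" for x y
    unfolding E_def using that ab by (intro mono) auto
  have ACE: "abs_continuous_on a b E"
    using AC unfolding abs_continuous_on_def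
    by (smt (verit) E_eq atLeastAtMost_iff lessThan_iff sum.cong)
  have ac: "absolutely_continuous lborel (interval_measure E)"
    by (rule absolutely_continuous_interval_measure[OF ACE ab monoE _ contE]) (auto simp: E_def ab)
  have "\<exists>f\<in>borel_measurable lborel. density lborel f = interval_measure E"
    by (rule sigma_finite_measure.Radon_Nikodym[OF _ ac]) (auto intro: lborel.sigma_finite_measure_axioms)
  then obtain f where f: "f \<in> borel_measurable lborel" "density lborel f = interval_measure E" by blast
  have Icc: "(\<integral>\<^sup>+t. f t * indicator {x..y} t \<partial>lborel) = ennreal (E y - E x)" if "x \<le> y" for x y
  proof -
    have "emeasure (interval_measure E) {x..y} = ennreal (E y - E x)"
      using that monoE contE by (intro emeasure_interval_measure_Icc) auto
    then show ?thesis using f by (metis emeasure_density atLeastAtMost_borel sets_lborel)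
  qed
  \<comment> \<open>\<open>enn2real\<close> sends an infinite density to 0. By \<open>fin\<close>
    this happens on [a, b] only in a null set, so no integral changes.\<close>
  define w where "w t = enn2real (f t) * indicator {a..b} t" for t
  have w_meas: "w \<in> borel_measurable borel" using f unfolding w_def by measurable
  have fin: "AE t in lborel. f t * indicator {a..b} t \<noteq> \<infinity>"
    by (rule nn_integral_noteq_infinite) (use f(1) Icc[OF ab] in auto)
  have w_int: "(\<integral>\<^sup>+t. ennreal (w t) * indicator {x..y} t \<partial>lborel) = ennreal (E y - E x)"
    if "a \<le> x" "x \<le> y" "y \<le> b" for x y
  proof -
    have "(\<integral>\<^sup>+t. ennreal (w t) * indicator {x..y} t \<partial>lborel) = (\<integral>\<^sup>+t. f t * indicator {x..y} t \<partial>lborel)"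
      by (rule nn_integral_cong_AE, rule AE_mp[OF fin])
        (use that in \<open>auto simp: w_def indicator_def less_top intro!: AE_I2 split: if_splits\<close>)
    then show ?thesis using Icc that by simp
  qed
  have wnn: "0 \<le> w t" for t by (simp add: w_def)
  have "integrable lborel w"
  proof (rule integrableI_nonneg)
    have "(\<integral>\<^sup>+t. ennreal (w t) \<partial>lborel) = (\<integral>\<^sup>+t. ennreal (w t) * indicator {a..b} t \<partial>lborel)"
      by (intro nn_integral_cong) (auto simp: w_def indicator_def)
    then show "(\<integral>\<^sup>+t. ennreal (w t) \<partial>lborel) < \<infinity>" using w_int[of a b] ab by simp
  qed (use w_meas wnn in auto)
  moreover have "(w has_integral (H y - H x)) {x..y}" if "a \<le> x" "x \<le> y" "y \<le> b" for x y
  proof -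
    have "(\<integral>\<^sup>+t. ennreal (indicator {x..y} t * w t) \<partial>lborel) = ennreal (E y - E x)"
      unfolding w_int[OF that, symmetric] by (intro nn_integral_cong) (auto simp: indicator_def)
    then have "((\<lambda>t. indicator {x..y} t * w t) has_integral (E y - E x)) UNIV"
      using w_meas wnn monoE that(2) by (intro nn_integral_has_integral) auto
    moreover have "(\<lambda>t. indicator {x..y} t * w t) = (\<lambda>t. if t \<in> {x..y} then w t else 0)"
      by (auto simp: indicator_def)
    ultimately have "(w has_integral (E y - E x)) {x..y}"
      using has_integral_restrict_UNIV by metis
    then show ?thesis using E_eq that by auto
  qed
  ultimately show thesis using that by blast
qed

text \<open>Lebesgue differentiation along cubes with lower corner x; in dimension one these are the
  intervals to the right of x, hence only a right derivative results.\<close>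

lemma indefinite_integral_AE_right_derivative:
  fixes w :: "real \<Rightarrow> real"
  assumes "integrable lborel w"
  shows "AE x in lborel. ((\<lambda>h. integral {x..x + h} w / h) \<longlongrightarrow> w x) (at_right 0)"
proof -
  have "w integrable_on cbox c d" for c d
    using assms integrable_on_lborel integrable_on_subcbox by blast
  then obtain N where N: "negligible N" and
    *: "\<And>x e. \<lbrakk>x \<notin> N; 0 < e\<rbrakk> \<Longrightarrow> \<exists>d>0. \<forall>h. 0 < h \<and> h < d \<longrightarrow>
          norm (integral (cbox x (x + h *\<^sub>R One)) w /\<^sub>R h ^ DIM(real) - w x) < e"
    using integrable_ccontinuous_explicit[of w] by blast
  have lim: "((\<lambda>h. integral {x..x + h} w / h) \<longlongrightarrow> w x) (at_right 0)" if "x \<notin> N" for x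
    unfolding tendsto_iff eventually_at_right_field
  proof (intro allI impI)
    fix e :: real assume "0 < e"
    from *[OF that this] obtain d where "d > 0"
      "\<forall>h. 0 < h \<and> h < d \<longrightarrow> norm (integral (cbox x (x + h *\<^sub>R One)) w /\<^sub>R h ^ DIM(real) - w x) < e" by blast
    then show "\<exists>b>0. \<forall>y>0. y < b \<longrightarrow> dist (integral {x..x + y} w / y) (w x) < e"
      by (auto simp: dist_real_def divide_inverse_commute intro!: exI[of _ d])
  qed
  have "AE x in lebesgue. x \<notin> N"
    using N by (simp add: negligible_iff_null_sets AE_not_in)
  then have "AE x in lebesgue. ((\<lambda>h. integral {x..x + h} w / h) \<longlongrightarrow> w x) (at_right 0)"
    by (rule eventually_mono) (rule lim)
  then show ?thesis by (simp add: AE_completion_iff)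
qed

text \<open>The left derivative at x is the right derivative at -x of the reflected problem, and
  reflection preserves null sets.\<close>

lemma indefinite_integral_AE_derivative:
  fixes w :: "real \<Rightarrow> real"
  assumes w: "integrable lborel w" and
    G: "\<And>x y. a \<le> x \<Longrightarrow> x \<le> y \<Longrightarrow> y \<le> b \<Longrightarrow> (w has_integral (G y - G x)) {x..y}"
  shows "AE x in lborel. a < x \<longrightarrow> x < b \<longrightarrow> (G has_real_derivative w x) (at x)"
proof -
  have w': "integrable lborel (\<lambda>x. w (- x))"
    using lborel_integrable_real_affine[OF w, of "-1" 0] by simp
  have R: "AE x in lborel. ((\<lambda>h. integral {x..x + h} w / h) \<longlongrightarrow> w x) (at_right 0)"
    by (rule indefinite_integral_AE_right_derivative[OF w])
  have L0: "AE x in lborel. ((\<lambda>h. integral {x..x + h} (\<lambda>x. w (- x)) / h) \<longlongrightarrow> w (- x)) (at_right 0)"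
    by (rule indefinite_integral_AE_right_derivative[OF w'])
  have L: "AE x in lborel. ((\<lambda>h. integral {-x..-x + h} (\<lambda>x. w (- x)) / h) \<longlongrightarrow> w x) (at_right 0)"
  proof -
    have "AE x in distr lborel borel (\<lambda>x. - x :: real). ((\<lambda>h. integral {x..x + h} (\<lambda>x. w (- x)) / h) \<longlongrightarrow> w (- x)) (at_right 0)"
      by (subst lborel_distr_uminus) (rule L0)
    from AE_distrD[OF _ this] show ?thesis by simp
  qed
  from R L show ?thesis
  proof eventually_elim
    case (elim x)
    show ?case
    proof (intro impI)
      assume x: "a < x" "x < b"
      define D where "D h = (G (x + h) - G x) / h" for h
      have evR: "\<forall>\<^sub>F h in at_right 0. integral {x..x + h} w / h = D h"
        unfolding eventually_at_right_field
        by (intro exI[of _ "b - x"]) (use x G[of x] in \<open>auto simp: D_def integral_unique\<close>)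
      have evL: "\<forall>\<^sub>F h in at_right 0. integral {-x..-x + h} (\<lambda>x. w (- x)) / h = D (- h)"
        unfolding eventually_at_right_field
      proof (intro exI[of _ "x - a"] conjI allI impI)
        fix h assume h: "0 < h" "h < x - a"
        have "(w has_integral (G x - G (x - h))) {x - h..x}" using G[of "x - h" x] x h by auto
        then have "((\<lambda>x. w (- x)) has_integral (G x - G (x - h))) {-x..-(x - h)}"
          by (subst has_integral_reflect_real) auto
        then have "integral {-x..-x + h} (\<lambda>x. w (- x)) = G x - G (x - h)"
          by (auto simp: integral_unique)
        then show "integral {-x..-x + h} (\<lambda>x. w (- x)) / h = D (- h)"
          by (simp add: D_def minus_divide_left)
      qed (use x in auto)
      have "(D \<longlongrightarrow> w x) (at_right 0)" using elim(1) evR by (rule Lim_transform_eventually)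
      moreover have "((\<lambda>h. D (- h)) \<longlongrightarrow> w x) (at_right 0)"
        using elim(2) evL by (rule Lim_transform_eventually)
      then have "(D \<longlongrightarrow> w x) (at_left 0)"
        by (simp add: filterlim_at_left_to_right)
      ultimately have "(D \<longlongrightarrow> w x) (at 0)" by (simp add: filterlim_split_at)
      then show "(G has_real_derivative w x) (at x)" by (simp add: DERIV_def D_def[abs_def])
    qed
  qed
qed

text \<open>Jordan decomposition: with V the variation, G = V - (V - G) is a difference of
  nondecreasing absolutely continuous functions. The two endpoints are discarded as a null set, so
  that the one-sided derivative there does not matter.\<close>

lemma AC_indefinite_integral:
  assumes AC: "abs_continuous_on a b G" and ab: "a \<le> b"
  obtains w where "integrable lborel w" "w \<in> borel_measurable borel"
    "\<And>x y. a \<le> x \<Longrightarrow> x \<le> y \<Longrightarrow> y \<le> b \<Longrightarrow> (w has_integral (G y - G x)) {x..y}"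
    "AE x in lborel. x \<in> {a..b} \<longrightarrow> vector_derivative G (at x within {a..b}) = w x"
proof -
  let ?V = "variation G a"
  have ACV: "abs_continuous_on a b ?V" by (rule abs_continuous_on_variation[OF AC])
  have incr: "?V x + \<bar>G y - G x\<bar> \<le> ?V y" if "a \<le> x" "x \<le> y" "y \<le> b" for x y
    using variation_increment_ge[OF AC that] .
  obtain w1 where w1: "integrable lborel w1"
    "\<And>x y. a \<le> x \<Longrightarrow> x \<le> y \<Longrightarrow> y \<le> b \<Longrightarrow> (w1 has_integral (?V y - ?V x)) {x..y}"
    by (rule mono_AC_indefinite_integral[OF ACV ab]) (use incr in \<open>fastforce+\<close>)
  obtain w2 where w2: "integrable lborel w2"
    "\<And>x y. a \<le> x \<Longrightarrow> x \<le> y \<Longrightarrow> y \<le> b \<Longrightarrow> (w2 has_integral ((?V y - G y) - (?V x - G x))) {x..y}"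
    by (rule mono_AC_indefinite_integral[OF abs_continuous_on_diff[OF ACV AC] ab])
      (use incr in \<open>fastforce+\<close>)
  define w where "w x = w1 x - w2 x" for x
  have int: "integrable lborel w" unfolding w_def[abs_def] using w1(1) w2(1) by auto
  have hi: "(w has_integral (G y - G x)) {x..y}" if "a \<le> x" "x \<le> y" "y \<le> b" for x y
    using has_integral_diff[OF w1(2)[OF that] w2(2)[OF that]] by (simp add: w_def[abs_def])
  have "AE x in lborel. a < x \<longrightarrow> x < b \<longrightarrow> (G has_real_derivative w x) (at x)"
    by (rule indefinite_integral_AE_derivative[OF int]) (rule hi)
  moreover have "AE x in lborel. x \<noteq> a" "AE x in lborel. x \<noteq> b"
    using AE_lborel_singleton by auto
  ultimately have "AE x in lborel. x \<in> {a..b} \<longrightarrow> vector_derivative G (at x within {a..b}) = w x"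
  proof eventually_elim
    case (elim x)
    show ?case
    proof
      assume "x \<in> {a..b}"
      then have x: "a < x" "x < b" using elim by auto
      then have "(G has_vector_derivative w x) (at x)"
        using elim by (simp add: has_real_derivative_iff_has_vector_derivative)
      then have "(G has_vector_derivative w x) (at x within {a..b})"
        by (rule has_vector_derivative_at_within)
      then show "vector_derivative G (at x within {a..b}) = w x"
        using x vector_derivative_within_cbox[of a b x G "w x"] by (simp add: cbox_interval)
    qed
  qed
  then show thesis using that int hi by auto
qed

section \<open>Local bounds for weighted trigonometric polynomials\<close>

text \<open>T is a real trigonometric polynomial of degree at most d, encoded as q(z) z^(-d) on the
  unit circle. Coefficients never appear, and the maximum principle and Cauchy's estimate apply to
  q.\<close>

definition trig_poly :: "nat \<Rightarrow> (real \<Rightarrow> real) \<Rightarrow> bool" where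
  "trig_poly d T \<longleftrightarrow> (\<exists>q::complex poly. degree q \<le> 2 * d \<and>
     (\<forall>t. poly q (cis t) = cis (real d * t) * of_real (T t)))"

lemma trig_poly_const: "trig_poly 0 (\<lambda>_. c)"
  unfolding trig_poly_def by (rule exI[of _ "[:of_real c:]"]) auto

lemma trig_poly_mult:
  assumes "trig_poly d S" "trig_poly e T"
  shows "trig_poly (d + e) (\<lambda>t. S t * T t)"
proof -
  obtain p q where "degree p \<le> 2 * d" "\<And>t. poly p (cis t) = cis (real d * t) * of_real (S t)"
    "degree q \<le> 2 * e" "\<And>t. poly q (cis t) = cis (real e * t) * of_real (T t)"
    using assms unfolding trig_poly_def by blast
  moreover from this have "degree (p * q) \<le> 2 * (d + e)"
    by (intro order_trans[OF degree_mult_le]) simp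
  ultimately show ?thesis unfolding trig_poly_def
    by (intro exI[of _ "p * q"]) (auto simp: algebra_simps cis_mult[symmetric])
qed

lemma trig_poly_mono:
  assumes "trig_poly d T" "d \<le> e"
  shows "trig_poly e T"
proof -
  have "trig_poly (e - d) (\<lambda>_. 1)"
    unfolding trig_poly_def
    by (rule exI[of _ "monom 1 (e - d)"]) (auto simp: poly_monom Complex.DeMoivre degree_monom_eq)
  from trig_poly_mult[OF this assms(1)] assms(2) show ?thesis by simp
qed

lemma trig_poly_add:
  assumes "trig_poly d S" "trig_poly d T"
  shows "trig_poly d (\<lambda>t. S t + T t)"
proof -
  obtain p q where "degree p \<le> 2 * d" "\<And>t. poly p (cis t) = cis (real d * t) * of_real (S t)"
    "degree q \<le> 2 * d" "\<And>t. poly q (cis t) = cis (real d * t) * of_real (T t)"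
    using assms unfolding trig_poly_def by blast
  then show ?thesis unfolding trig_poly_def
    by (intro exI[of _ "p + q"]) (auto simp: algebra_simps intro: degree_add_le)
qed

lemma trig_poly_cos: "trig_poly 1 cos"
  unfolding trig_poly_def
proof (intro exI[of _ "[:1/2, 0, 1/2:]"] conjI allI)
  fix t :: real
  have "cos t * cos t = 1 - sin t * sin t"
    using sin_cos_squared_add[of t] by (simp add: power2_eq_square)
  then show "poly [:1/2, 0, 1/2:] (cis t) = cis (real 1 * t) * complex_of_real (cos t)"
    by (auto simp: complex_eq_iff field_simps)
qed auto

lemma trig_poly_sin: "trig_poly 1 sin"
  unfolding trig_poly_def
proof (intro exI[of _ "[:\<i>/2, 0, -\<i>/2:]"] conjI allI)
  fix t :: real
  have "cos t * cos t = 1 - sin t * sin t"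
    using sin_cos_squared_add[of t] by (simp add: power2_eq_square)
  then show "poly [:\<i>/2, 0, -\<i>/2:] (cis t) = cis (real 1 * t) * complex_of_real (sin t)"
    by (auto simp: complex_eq_iff field_simps)
qed auto

lemma trig_poly_power:
  assumes "trig_poly d T"
  shows "trig_poly (n * d) (\<lambda>t. T t ^ n)"
proof (induction n)
  case 0
  then show ?case using trig_poly_const[of 1] by simp
next
  case (Suc n)
  then show ?case using trig_poly_mult[OF assms Suc] by simp
qed

lemma trig_poly_poly_cos: "trig_poly (degree P) (\<lambda>t. poly P (cos t))"
proof (induction P)
  case 0
  then show ?case using trig_poly_const[of 0] by simp
next
  case (pCons a P)
  show ?case
  proof (cases "P = 0")
    case True
    then show ?thesis using trig_poly_const[of a] by simp
  next
    case False
    have "trig_poly (Suc (degree P)) (\<lambda>t. a + cos t * poly P (cos t))"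
      using trig_poly_mult[OF trig_poly_cos pCons(2)]
      by (intro trig_poly_add trig_poly_mono[OF trig_poly_const]) auto
    then show ?thesis using False by simp
  qed
qed

text \<open>With x = cos t the weight \<phi>^M becomes sin^M on [0, \<pi>], a trigonometric
  polynomial even for odd M, when \<phi>^M is not a polynomial in x. From here on the weight is part
  of the polynomial.\<close>

lemma trig_poly_weighted:
  assumes "M + degree P \<le> d"
  shows "trig_poly d (\<lambda>t. sin t ^ M * poly P (cos t))"
  using trig_poly_mult[OF trig_poly_power[OF trig_poly_sin, of M] trig_poly_poly_cos[of P]] assms
  by (auto intro: trig_poly_mono)

text \<open>In the disc of radius 1 + 1/D the polynomial grows by at most (1 + 1/D)^D <= e: outside
  the unit disc apply the maximum principle to the reversed polynomial at 1/z, which has the same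
  modulus on the circle. Cauchy's estimate with radius 1/D then gives the derivative. The factor e
  is not sharp, but only the order D matters.\<close>

lemma bernstein_circle:
  fixes q :: "complex poly"
  assumes deg: "degree q \<le> D" and D: "1 \<le> D" and M: "\<And>t. cmod (poly q (cis t)) \<le> M"
  shows "cmod (poly (pderiv q) (cis t)) \<le> exp 1 * real D * M"
proof -
  have M0: "0 \<le> M" using M[of 0] norm_ge_zero order_trans by blast
  have circle: "cmod (poly q z) \<le> M" if "cmod z = 1" for z
    using M[of "Arg z"] that by (metis cis_Arg norm_zero sgn_eq div_by_1 zero_neq_one of_real_1)
  have disc: "cmod (poly r z) \<le> M" if "cmod z \<le> 1" and r: "\<And>z. cmod z = 1 \<Longrightarrow> cmod (poly r z) \<le> M"
    for r :: "complex poly" and z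
  proof (rule maximum_modulus_frontier[of "poly r" "cball 0 1"])
    show "poly r holomorphic_on interior (cball 0 1)" by (intro holomorphic_intros)
    show "continuous_on (closure (cball 0 1)) (poly r)" by (intro continuous_intros)
    show "cmod (poly r z) \<le> M" if "z \<in> frontier (cball 0 1)" for z
      using that r by (auto simp: frontier_def)
  qed (use that in auto)
  have outer: "cmod (poly q z) \<le> exp 1 * M" if "cmod z \<le> 1 + 1 / real D" for z
  proof (cases "cmod z \<le> 1")
    case True
    then have "cmod (poly q z) \<le> M" using disc circle by blast
    also have "M \<le> exp 1 * M" using mult_right_mono[of 1 "exp 1" M] M0 by simp
    finally show ?thesis .
  next
    case False
    then have z: "z \<noteq> 0" by auto
    have "cmod (poly (reflect_poly q) (inverse z)) \<le> M"
    proof (rule disc)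
      show "cmod (inverse z) \<le> 1" using False by (simp add: norm_inverse inverse_le_1_iff)
      fix w :: complex assume "cmod w = 1"
      then have "w \<noteq> 0" and "cmod (inverse w) = 1" by (auto simp: norm_inverse)
      then show "cmod (poly (reflect_poly q) w) \<le> M"
        using circle[of "inverse w"] \<open>cmod w = 1\<close>
        by (simp add: poly_reflect_poly_nz norm_mult norm_power)
    qed
    moreover have "poly q z = z ^ degree q * poly (reflect_poly q) (inverse z)"
      using z by (simp add: poly_reflect_poly_nz field_simps)
    ultimately have "cmod (poly q z) \<le> cmod z ^ degree q * M"
      by (simp add: norm_mult norm_power mult_left_mono)
    also have "cmod z ^ degree q \<le> cmod z ^ D"
      using False deg by (intro power_increasing) auto
    also have "\<dots> \<le> (1 + 1 / real D) ^ D" using that by (intro power_mono) auto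
    also have "\<dots> \<le> exp (1 / real D) ^ D" by (intro power_mono exp_ge_add_one_self) auto
    also have "\<dots> = exp 1" using D by (simp flip: exp_of_nat_mult)
    finally show ?thesis using M0 by (simp add: mult_right_mono)
  qed
  have "cmod ((deriv ^^ 1) (poly q) (cis t)) \<le> fact 1 * (exp 1 * M) / (1 / real D) ^ 1"
  proof (rule Cauchy_inequality)
    show "poly q holomorphic_on ball (cis t) (1 / real D)" by (intro holomorphic_intros)
    show "continuous_on (cball (cis t) (1 / real D)) (poly q)" by (intro continuous_intros)
    show "0 < 1 / real D" using D by simp
    fix x assume "cmod (cis t - x) = 1 / real D"
    then have "cmod x \<le> 1 + 1 / real D"
      using norm_triangle_ineq4[of "cis t" "cis t - x"] by simp
    then show "cmod (poly q x) \<le> exp 1 * M" by (rule outer)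
  qed
  moreover have "deriv (poly q) (cis t) = poly (pderiv q) (cis t)"
    by (rule DERIV_imp_deriv[OF poly_DERIV])
  ultimately show ?thesis by (simp add: mult_ac)
qed

lemma has_vector_derivative_poly_cis:
  "((\<lambda>t. poly q (cis t)) has_vector_derivative (\<i> * cis t * poly (pderiv q) (cis t))) (at t within S)"
  for q :: "complex poly"
proof -
  have "((\<lambda>t. cis t) has_vector_derivative (\<i> * cis t)) (at t within S)"
    unfolding cis_conv_exp
    by (auto intro!: derivative_eq_intros has_vector_derivative_real_field simp: mult_ac)
  from field_vector_diff_chain_within[OF this, of "poly q" "poly (pderiv q) (cis t)"]
  show ?thesis by (auto simp: o_def mult_ac intro: poly_DERIV DERIV_subset)
qed

lemma poly_cis_lipschitz:
  fixes q :: "complex poly"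
  assumes "\<And>t. cmod (poly (pderiv q) (cis t)) \<le> B"
  shows "cmod (poly q (cis s) - poly q (cis t)) \<le> B * \<bar>s - t\<bar>"
proof -
  have "norm (poly q (cis s) - poly q (cis t)) \<le> B * norm (s - t)"
  proof (rule differentiable_bound[of UNIV])
    fix x :: real
    show "((\<lambda>t. poly q (cis t)) has_derivative (\<lambda>h. h *\<^sub>R (\<i> * cis x * poly (pderiv q) (cis x)))) (at x within UNIV)"
      using has_vector_derivative_poly_cis by (simp add: has_vector_derivative_def)
    show "onorm (\<lambda>h. h *\<^sub>R (\<i> * cis x * poly (pderiv q) (cis x))) \<le> B"
      by (rule onorm_le) (use assms in \<open>auto simp: norm_mult mult.commute[of B] intro!: mult_left_mono\<close>)
  qed auto
  then show ?thesis by simp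
qed

text \<open>The normalised Dirichlet sum centred at $\theta$, as an algebraic polynomial in $e^{it}$; its
  high powers are the localising kernels.\<close>

definition dirichlet_kernel :: "nat \<Rightarrow> real \<Rightarrow> complex poly" where
  "dirichlet_kernel m \<theta> = (\<Sum>j<m. monom (cis (- (real j * \<theta>)) / of_nat m) j)"

lemma dirichlet_kernel_cis:
  "poly (dirichlet_kernel m \<theta>) (cis t) = (\<Sum>j<m. cis (t - \<theta>) ^ j) / of_nat m"
  by (simp add: dirichlet_kernel_def poly_sum poly_monom Complex.DeMoivre sum_divide_distrib
      cis_mult algebra_simps)

lemma degree_dirichlet_kernel: "degree (dirichlet_kernel m \<theta>) \<le> m"
  unfolding dirichlet_kernel_def by (intro degree_sum_le) (auto intro: order_trans[OF degree_monom_le])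

lemma norm_dirichlet_kernel_le_1: "cmod (poly (dirichlet_kernel m \<theta>) (cis t)) \<le> 1"
proof -
  have "cmod (\<Sum>j<m. cis (t - \<theta>) ^ j) \<le> (\<Sum>j<m. 1)"
    by (intro sum_norm_le) (simp add: norm_power)
  then show ?thesis by (simp add: dirichlet_kernel_cis norm_divide divide_le_eq)
qed

lemma norm_cis_minus_1: "cmod (cis x - 1) = 2 * \<bar>sin (x / 2)\<bar>"
proof -
  have "(cmod (cis x - 1))\<^sup>2 = 2 - 2 * cos x"
    using sin_cos_squared_add[of x] by (simp add: cmod_power2 power2_diff)
  also have "\<dots> = (2 * \<bar>sin (x / 2)\<bar>)\<^sup>2"
    using cos_double_sin[of "x / 2"] by (simp add: power2_eq_square)
  finally show ?thesis by (subst (asm) power2_eq_iff_nonneg) auto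
qed

text \<open>The trivial bound 1 and the geometric series bound 1/|m sin| are squared and added,
  which gives one formula valid at all distances.\<close>

lemma norm_dirichlet_kernel_decay:
  assumes "1 \<le> m"
  shows "(cmod (poly (dirichlet_kernel m \<theta>) (cis t)))\<^sup>2 \<le> 2 / (1 + (real m * sin ((t - \<theta>) / 2))\<^sup>2)"
proof -
  let ?K = "cmod (poly (dirichlet_kernel m \<theta>) (cis t))"
  let ?s = "real m * sin ((t - \<theta>) / 2)"
  have "(cis (t - \<theta>) - 1) * (\<Sum>j<m. cis (t - \<theta>) ^ j) = cis (t - \<theta>) ^ m - 1"
    using power_diff_1_eq[of "cis (t - \<theta>)" m] by simp
  then have "2 * \<bar>sin ((t - \<theta>) / 2)\<bar> * cmod (\<Sum>j<m. cis (t - \<theta>) ^ j) = cmod (cis (t - \<theta>) ^ m - 1)"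
    by (metis norm_cis_minus_1 norm_mult)
  also have "\<dots> \<le> 2"
    using norm_triangle_ineq4[of "cis (t - \<theta>) ^ m" 1] by (simp add: norm_power)
  finally have "\<bar>sin ((t - \<theta>) / 2)\<bar> * cmod (\<Sum>j<m. cis (t - \<theta>) ^ j) \<le> 1" by simp
  moreover have "cmod (\<Sum>j<m. cis (t - \<theta>) ^ j) = real m * ?K"
    using assms by (simp add: dirichlet_kernel_cis norm_divide)
  ultimately have "\<bar>?s\<bar> * ?K \<le> 1" by (simp add: abs_mult mult_ac)
  then have "(\<bar>?s\<bar> * ?K)\<^sup>2 \<le> 1\<^sup>2" by (intro power_mono) auto
  then have "?s\<^sup>2 * ?K\<^sup>2 \<le> 1" by (simp add: power_mult_distrib)
  moreover have "?K\<^sup>2 \<le> 1\<^sup>2" using norm_dirichlet_kernel_le_1 by (intro power_mono) auto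
  ultimately have "?K\<^sup>2 * (1 + ?s\<^sup>2) \<le> 2" by (simp add: algebra_simps)
  moreover have "0 < 1 + ?s\<^sup>2" by (simp add: add_pos_nonneg)
  ultimately show ?thesis by (simp add: pos_le_divide_eq)
qed

text \<open>All angles j (t - \<theta>) with j < m have modulus at most 1 < \<pi>/3, so every
  summand has real part at least 1/2.\<close>

lemma norm_dirichlet_kernel_near:
  assumes "1 \<le> m" "\<bar>t - \<theta>\<bar> \<le> 1 / real m"
  shows "1 / 2 \<le> cmod (poly (dirichlet_kernel m \<theta>) (cis t))"
proof -
  have c: "1 / 2 \<le> cos (real j * (t - \<theta>))" if "j < m" for j
  proof -
    have "\<bar>real j * (t - \<theta>)\<bar> \<le> real m * (1 / real m)"
      unfolding abs_mult using that assms by (intro mult_mono) auto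
    then have le1: "\<bar>real j * (t - \<theta>)\<bar> \<le> 1" using assms by simp
    have "1 / 2 = cos (pi / 3)" by (simp add: cos_60)
    also have "\<dots> \<le> cos \<bar>real j * (t - \<theta>)\<bar>"
      using le1 pi_gt3 by (intro cos_monotone_0_pi_le) auto
    finally show ?thesis by (simp only: cos_abs_real)
  qed
  have "real m * (1 / 2) \<le> (\<Sum>j<m. cos (real j * (t - \<theta>)))"
    using sum_mono[of "{..<m}" "\<lambda>_. 1 / 2" "\<lambda>j. cos (real j * (t - \<theta>))"] c by simp
  also have "\<dots> = Re (\<Sum>j<m. cis (t - \<theta>) ^ j)" by (simp add: Complex.DeMoivre)
  also have "\<dots> \<le> cmod (\<Sum>j<m. cis (t - \<theta>) ^ j)" by (rule complex_Re_le_cmod)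
  finally show ?thesis using assms(1) by (simp add: dirichlet_kernel_cis norm_divide field_simps)
qed

text \<open>Concavity: the sine lies above its chord on [0, \<pi>/2].\<close>

lemma jordan_inequality:
  assumes "0 \<le> x" "x \<le> pi / 2"
  shows "2 * x / pi \<le> sin x"
proof -
  have "convex_on {0..pi/2} (\<lambda>x. - sin x)"
    by (rule f''_ge0_imp_convex[of _ _ "\<lambda>x. - cos x" sin])
      (auto intro!: derivative_eq_intros sin_ge_zero)
  from convex_onD[OF this, of "2 * x / pi" 0 "pi / 2"] assms show ?thesis
    by (auto simp: field_simps)
qed

lemma abs_le_abs_sin_half:
  assumes "\<bar>x\<bar> \<le> pi"
  shows "\<bar>x\<bar> \<le> pi * \<bar>sin (x / 2)\<bar>"
proof -
  have "\<bar>x\<bar> / pi \<le> sin (\<bar>x\<bar> / 2)" using jordan_inequality[of "\<bar>x\<bar> / 2"] assms by simp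
  also have "\<dots> \<le> \<bar>sin (x / 2)\<bar>" by (auto simp: abs_if)
  finally show ?thesis by (simp add: field_simps)
qed

text \<open>An average of |u|^p around \<theta> at scale 1/m. The factor |sin t| is the Jacobian of
  x = cos t. Two periods are integrated so that windows around any point of [-\<pi>, \<pi>], and
  small translates of them, stay inside.\<close>

definition local_mean :: "real \<Rightarrow> nat \<Rightarrow> (real \<Rightarrow> real) \<Rightarrow> real \<Rightarrow> ennreal" where
  "local_mean p m u \<theta> = (\<integral>\<^sup>+t\<in>{-2*pi..2*pi}.
     ennreal (\<bar>u t\<bar> powr p * \<bar>sin t\<bar> / (1 + (real m * sin ((t - \<theta>) / 2))\<^sup>2)) \<partial>lborel)"

text \<open>Multiply q by a power of the Dirichlet kernel centred at $\theta$ and let $t_1$ be a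
  point where the product is maximal. By Bernstein it stays above half its maximum near $t_1$, and
  the decay of the kernel pays for comparing $|\sin|$ near $t_1$ with $|\sin\theta|$.\<close>

lemma circle_local_bound:
  fixes p :: real and B :: nat
  assumes p: "0 < p"
  shows "\<exists>C>0. \<forall>m (q::complex poly) \<theta>. 1 \<le> m \<longrightarrow> degree q \<le> B * m \<longrightarrow>
    (\<exists>M\<ge>0. (\<forall>\<tau>. \<bar>\<tau> - \<theta>\<bar> \<le> 1 / real m \<longrightarrow>
               cmod (poly q (cis \<tau>)) \<le> M \<and> cmod (poly (pderiv q) (cis \<tau>)) \<le> C * real m * M) \<and>
         ennreal (M powr p * (\<bar>sin \<theta>\<bar> + 1 / real m))
           \<le> ennreal (C * real m) * local_mean p m (\<lambda>t. cmod (poly q (cis t))) \<theta>)"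
proof -
  \<comment> \<open>Then L p >= 2, so the p-th power of the kernel power, K = 2 L, decays at least
    like \<open>\<kappa>\<close> squared. One factor \<open>\<kappa>\<close> is the kernel of
    \<open>local_mean\<close>; the other is spent on comparing sines.\<close>
  define L where "L = nat \<lceil>2 / p\<rceil>"
  have Lp: "2 \<le> real L * p"
  proof -
    have "2 / p \<le> real L" unfolding L_def by linarith
    then show ?thesis using p by (simp add: field_simps)
  qed
  then have L1: "1 \<le> L" using p by (cases L) auto
  define K where "K = 2 * L"
  \<comment> \<open>Twice the Bernstein constant of S per unit of m, since S has degree at most (B +
    K) m. The radius \<open>\<rho>\<close> below equals 1/(e2 m).\<close>
  define e2 where "e2 = 2 * exp 1 * real (B + K)"
  have e2: "e2 \<ge> 2"
  proof -
    have "1 \<le> exp (1::real)" by simp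
    moreover have "1 \<le> real (B + K)" using L1 by (simp add: K_def)
    ultimately have "1 * 1 \<le> exp 1 * real (B + K)" by (intro mult_mono) auto
    then show ?thesis by (simp add: e2_def)
  qed
  define c1 where "c1 = 2 powr p * (2 powr p) ^ L"
  have c1: "c1 > 0" by (simp add: c1_def)
  define c3 where "c3 = 4 * (1 + 2 * e2) * c1"
  have c3: "c3 > 0" using e2 c1 by (simp add: c3_def)
  define Ca where "Ca = 2 ^ K * (e2 + exp 1 * real K * 2 ^ K)"
  define Cb where "Cb = (2 ^ K) powr p * (2 * c3 * e2)"
  define C where "C = max Ca Cb"
  have Ca: "Ca > 0" using e2 by (simp add: Ca_def add_pos_nonneg)
  have Cb: "Cb > 0" using e2 c3 by (simp add: Cb_def)
  show ?thesis
  proof (rule exI[of _ C], intro conjI allI impI)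
    show "C > 0" using Ca by (simp add: C_def)
  next
    fix m :: nat and q :: "complex poly" and \<theta> :: real
    assume m: "1 \<le> m" and deg: "degree q \<le> B * m"
    define k where "k = dirichlet_kernel m \<theta>"
    define S where "S = q * k ^ K"
    define D where "D = (B + K) * m"
    have D1: "1 \<le> D" using m L1 by (simp add: D_def K_def)
    have degK: "degree (k ^ K) \<le> K * m"
      unfolding k_def by (rule order_trans[OF degree_power_le]) (simp add: mult.commute degree_dirichlet_kernel)
    then have degS: "degree S \<le> D"
      using degree_mult_le[of q "k ^ K"] deg by (simp add: S_def D_def algebra_simps)
    have contS: "continuous_on {-pi..pi} (\<lambda>t. cmod (poly S (cis t)))"
      unfolding cis_conv_exp by (intro continuous_intros)
    have "\<exists>t1\<in>{-pi..pi}. \<forall>t\<in>{-pi..pi}. cmod (poly S (cis t)) \<le> cmod (poly S (cis t1))"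
      by (rule continuous_attains_sup[OF _ _ contS]) auto
    then obtain t1 where t1: "t1 \<in> {-pi..pi}"
      and max: "\<And>t. t \<in> {-pi..pi} \<Longrightarrow> cmod (poly S (cis t)) \<le> cmod (poly S (cis t1))" by blast
    define M where "M = cmod (poly S (cis t1))"
    have M0: "0 \<le> M" by (simp add: M_def)
    have SM: "cmod (poly S (cis t)) \<le> M" for t
    proof -
      have "cis (Arg (cis t)) = cis t" by (simp add: cis_Arg sgn_eq)
      moreover have "Arg (cis t) \<in> {-pi..pi}" using Arg_bounded[of "cis t"] by auto
      ultimately show ?thesis using max[of "Arg (cis t)"] by (simp add: M_def)
    qed
    have S': "cmod (poly (pderiv S) (cis t)) \<le> exp 1 * real D * M" for t
      by (rule bernstein_circle[OF degS D1 SM])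
    \<comment> \<open>Within this distance of t1 Bernstein's inequality costs at most half of the
      maximum M.\<close>
    define \<rho> where "\<rho> = 1 / (2 * exp 1 * real D)"
    have \<rho>e: "\<rho> = 1 / (e2 * real m)" by (simp add: \<rho>_def e2_def D_def mult_ac)
    have \<rho>0: "0 < \<rho>" using e2 m by (simp add: \<rho>e)
    have m\<rho>: "real m * \<rho> \<le> 1 / 2" using e2 m by (simp add: \<rho>e field_simps)
    then have \<rho>1: "\<rho> \<le> 1 / 2" using m \<rho>0 by (smt (verit) mult_le_cancel_right1 of_nat_1 of_nat_mono)
    define a where "a t = cmod (poly q (cis t))" for t
    define \<kappa> where "\<kappa> t = 1 / (1 + (real m * sin ((t - \<theta>) / 2))\<^sup>2)" for t
    have \<kappa>0: "0 < \<kappa> t" and \<kappa>1: "\<kappa> t \<le> 1" for t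
      by (auto simp: \<kappa>_def add_pos_nonneg)
    have kK: "cmod (poly (k ^ K) (cis t)) \<le> (2 * \<kappa> t) ^ L" for t
    proof -
      have "cmod (poly (k ^ K) (cis t)) = ((cmod (poly k (cis t)))\<^sup>2) ^ L"
        by (simp add: K_def power_mult norm_power)
      also have "\<dots> \<le> (2 * \<kappa> t) ^ L"
        using norm_dirichlet_kernel_decay[OF m, of \<theta> t] by (intro power_mono) (auto simp: k_def \<kappa>_def)
      finally show ?thesis .
    qed
    have Mle: "M powr p \<le> c1 * (a t powr p * (\<kappa> t)\<^sup>2)" if t: "\<bar>t - t1\<bar> \<le> \<rho>" for t
    proof -
      have "cmod (poly S (cis t) - poly S (cis t1)) \<le> exp 1 * real D * M * \<bar>t - t1\<bar>"
        by (rule poly_cis_lipschitz[OF S'])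
      also have "\<dots> \<le> exp 1 * real D * M * \<rho>" using t M0 by (intro mult_left_mono) auto
      also have "\<dots> = M / 2" using D1 by (simp add: \<rho>_def field_simps)
      finally have "M / 2 \<le> cmod (poly S (cis t))"
        unfolding M_def using norm_triangle_ineq2[of "poly S (cis t1)" "poly S (cis t)"]
        by (simp add: norm_minus_commute)
      also have "\<dots> = a t * cmod (poly (k ^ K) (cis t))" by (simp add: S_def a_def norm_mult)
      also have "\<dots> \<le> a t * (2 * \<kappa> t) ^ L" using kK by (intro mult_left_mono) (auto simp: a_def)
      finally have "M \<le> 2 * (a t * (2 * \<kappa> t) ^ L)" by simp
      then have "M powr p \<le> (2 * (a t * (2 * \<kappa> t) ^ L)) powr p"
        using M0 p by (intro powr_mono2) auto
      also have "\<dots> = 2 powr p * (a t powr p * ((2 * \<kappa> t) ^ L) powr p)"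
        using \<kappa>0[of t] by (simp add: powr_mult a_def)
      also have "((2 * \<kappa> t) ^ L) powr p = (2 powr p) ^ L * \<kappa> t powr (real L * p)"
        using \<kappa>0[of t]
        by (simp add: powr_mult powr_powr power_mult_distrib mult.commute[of p] flip: powr_realpow)
      also have "2 powr p * (a t powr p * ((2 powr p) ^ L * \<kappa> t powr (real L * p))) \<le>
          2 powr p * (a t powr p * ((2 powr p) ^ L * \<kappa> t powr 2))"
        using \<kappa>0 \<kappa>1 Lp by (intro mult_left_mono powr_mono') (auto simp: less_imp_le)
      also have "\<kappa> t powr 2 = (\<kappa> t)\<^sup>2" using \<kappa>0[of t] by simp
      finally show ?thesis by (simp add: c1_def mult_ac)
    qed
    define A where "A = \<bar>sin \<theta>\<bar> + 1 / real m"
    define \<Phi> where "\<Phi> t = a t powr p * \<bar>sin t\<bar> * \<kappa> t" for t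
    have \<Phi>0: "0 \<le> \<Phi> t" for t using \<kappa>0[of t] by (simp add: \<Phi>_def)
    \<comment> \<open>Two sample points are taken because |sin| may vanish at one of them: the sum
      of |sin| at u and at u + \<open>\<rho>\<close> is at least \<open>\<rho>\<close>/2, a multiple
      of 1/m.\<close>
    have key: "M powr p * A \<le> c3 * (\<Phi> u + \<Phi> (u + \<rho>))" if u: "u \<in> {t1 - \<rho>..t1}" for u
    proof -
      define x where "x = real m * \<bar>sin ((u - \<theta>) / 2)\<bar>"
      define Y where "Y = \<bar>sin u\<bar> + \<bar>sin (u + \<rho>)\<bar>"
      have x0: "0 \<le> x" by (simp add: x_def)
      have \<kappa>u: "1 / \<kappa> u = 1 + x\<^sup>2" by (simp add: \<kappa>_def x_def power_mult_distrib)
      have sin\<rho>: "\<rho> / 2 \<le> Y"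
      proof -
        have "\<rho> / 2 \<le> 2 * \<rho> / pi" using pi_less_4 \<rho>0 by (simp add: field_simps)
        also have "\<dots> \<le> sin \<rho>" using jordan_inequality[of \<rho>] \<rho>0 \<rho>1 pi_gt3 by simp
        also have "\<dots> = sin (u + \<rho>) * cos u - cos (u + \<rho>) * sin u"
          using sin_diff[of "u + \<rho>" u] by simp
        also have "\<dots> \<le> \<bar>sin (u + \<rho>)\<bar> * \<bar>cos u\<bar> + \<bar>cos (u + \<rho>)\<bar> * \<bar>sin u\<bar>"
          unfolding abs_mult[symmetric] by linarith
        also have "\<dots> \<le> \<bar>sin (u + \<rho>)\<bar> * 1 + 1 * \<bar>sin u\<bar>"
          by (intro add_mono mult_mono) auto
        finally show ?thesis by (simp add: Y_def)
      qed
      have Y0: "0 \<le> Y" by (simp add: Y_def)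
      have m_inv: "1 / real m = e2 * \<rho>" using e2 m by (simp add: \<rho>e)
      have minv: "1 / real m \<le> 2 * e2 * Y"
        using mult_left_mono[OF sin\<rho>, of "2 * e2"] e2 unfolding m_inv by simp
      \<comment> \<open>Moving from u to \<theta> changes the sine by at most 2x/m. This linear
        growth in x is absorbed by the spare factor 1/\<open>\<kappa>\<close> = 1 + x^2.\<close>
      have "\<bar>sin \<theta>\<bar> \<le> \<bar>sin u\<bar> + 2 * \<bar>sin ((u - \<theta>) / 2)\<bar>"
      proof -
        have "sin u - sin \<theta> = 2 * sin ((u - \<theta>) / 2) * cos ((u + \<theta>) / 2)"
          by (rule sin_diff_sin)
        then have "\<bar>sin u - sin \<theta>\<bar> = 2 * \<bar>sin ((u - \<theta>) / 2)\<bar> * \<bar>cos ((u + \<theta>) / 2)\<bar>"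
          by (simp add: abs_mult)
        also have "\<dots> \<le> 2 * \<bar>sin ((u - \<theta>) / 2)\<bar> * 1" by (intro mult_left_mono) auto
        finally show ?thesis by linarith
      qed
      also have "2 * \<bar>sin ((u - \<theta>) / 2)\<bar> = 2 * x * (1 / real m)" using m by (simp add: x_def)
      finally have "A \<le> \<bar>sin u\<bar> + (1 + 2 * x) * (1 / real m)" by (simp add: A_def algebra_simps)
      also have "\<dots> \<le> Y + (1 + 2 * x) * (2 * e2 * Y)"
        using minv x0 by (intro add_mono mult_left_mono) (auto simp: Y_def)
      also have "\<dots> \<le> (1 + 2 * e2) * Y * (1 + 2 * x)"
        using Y0 x0 by (simp add: algebra_simps)
      also have "\<dots> \<le> (1 + 2 * e2) * Y * (2 * (1 + x\<^sup>2))"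
      proof (intro mult_left_mono)
        have "0 \<le> (1 - x)\<^sup>2 + x\<^sup>2" by simp
        then show "1 + 2 * x \<le> 2 * (1 + x\<^sup>2)" by (simp add: power2_eq_square algebra_simps)
      qed (use Y0 e2 in auto)
      finally have "A \<le> 2 * (1 + 2 * e2) * (Y * (1 / \<kappa> u))" unfolding \<kappa>u by (simp only: mult_ac)
      then have A1: "A \<le> 2 * (1 + 2 * e2) * (Y / \<kappa> u)" by simp
      \<comment> \<open>A shift by \<open>\<rho>\<close> moves m sin(./2) by at most 1/2, which
        changes the kernel at most by a factor 2.\<close>
      have \<kappa>2: "1 / \<kappa> u \<le> 2 / \<kappa> (u + \<rho>)"
      proof -
        have "sin ((u - \<theta>) / 2) - sin ((u + \<rho> - \<theta>) / 2) =
            2 * sin (((u - \<theta>) / 2 - (u + \<rho> - \<theta>) / 2) / 2) * cos (((u - \<theta>) / 2 + (u + \<rho> - \<theta>) / 2) / 2)"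
          by (rule sin_diff_sin)
        also have "((u - \<theta>) / 2 - (u + \<rho> - \<theta>) / 2) / 2 = - (\<rho> / 4)" by (simp add: field_simps)
        finally have "\<bar>sin ((u - \<theta>) / 2) - sin ((u + \<rho> - \<theta>) / 2)\<bar> \<le> 2 * \<bar>sin (\<rho> / 4)\<bar> * 1"
          by (simp add: abs_mult) (intro mult_left_le, auto)
        also have "\<dots> \<le> \<rho> / 2" using abs_sin_x_le_abs_x[of "\<rho> / 4"] \<rho>0 by simp
        finally have "\<bar>sin ((u - \<theta>) / 2)\<bar> \<le> \<bar>sin ((u + \<rho> - \<theta>) / 2)\<bar> + \<rho> / 2" by linarith
        then have "x \<le> real m * (\<bar>sin ((u + \<rho> - \<theta>) / 2)\<bar> + \<rho> / 2)"
          unfolding x_def by (intro mult_left_mono) auto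
        also have "\<dots> \<le> real m * \<bar>sin ((u + \<rho> - \<theta>) / 2)\<bar> + 1 / 2"
          using m\<rho> by (simp add: algebra_simps)
        finally have "x \<le> real m * \<bar>sin ((u + \<rho> - \<theta>) / 2)\<bar> + 1 / 2" (is "_ \<le> ?y + 1 / 2") .
        then have "x\<^sup>2 \<le> (?y + 1 / 2)\<^sup>2" using x0 by (intro power_mono) auto
        also have "\<dots> \<le> 2 * ?y\<^sup>2 + 1"
        proof -
          have "0 \<le> (?y - 1 / 2)\<^sup>2" by simp
          then show ?thesis by (simp add: power2_eq_square algebra_simps)
        qed
        finally have "1 + x\<^sup>2 \<le> 2 * (1 + ?y\<^sup>2)" by simp
        moreover have "1 / \<kappa> (u + \<rho>) = 1 + ?y\<^sup>2"
          by (simp add: \<kappa>_def power_mult_distrib)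
        ultimately show ?thesis using \<kappa>u by (metis times_divide_eq_right mult.right_neutral)
      qed
      have pt: "M powr p * (\<bar>sin t\<bar> / \<kappa> t) \<le> c1 * \<Phi> t" if "\<bar>t - t1\<bar> \<le> \<rho>" for t
      proof -
        have "M powr p * (\<bar>sin t\<bar> / \<kappa> t) \<le> c1 * (a t powr p * (\<kappa> t)\<^sup>2) * (\<bar>sin t\<bar> / \<kappa> t)"
          using Mle[OF that] \<kappa>0[of t] by (intro mult_right_mono) auto
        also have "\<dots> = c1 * \<Phi> t" using \<kappa>0[of t] by (simp add: \<Phi>_def power2_eq_square)
        finally show ?thesis .
      qed
      have "Y / \<kappa> u \<le> \<bar>sin u\<bar> / \<kappa> u + 2 * (\<bar>sin (u + \<rho>)\<bar> / \<kappa> (u + \<rho>))"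
      proof -
        have "\<bar>sin (u + \<rho>)\<bar> * (1 / \<kappa> u) \<le> \<bar>sin (u + \<rho>)\<bar> * (2 / \<kappa> (u + \<rho>))"
          by (rule mult_left_mono[OF \<kappa>2]) simp
        then show ?thesis by (simp add: Y_def add_divide_distrib mult_ac)
      qed
      then have "A \<le> 2 * (1 + 2 * e2) * (\<bar>sin u\<bar> / \<kappa> u + 2 * (\<bar>sin (u + \<rho>)\<bar> / \<kappa> (u + \<rho>)))"
        using A1 e2 by (meson add_nonneg_nonneg mult_left_mono mult_nonneg_nonneg order_trans zero_le_numeral zero_le_one)
      then have "M powr p * A \<le> M powr p * (2 * (1 + 2 * e2) * (\<bar>sin u\<bar> / \<kappa> u + 2 * (\<bar>sin (u + \<rho>)\<bar> / \<kappa> (u + \<rho>))))"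
        by (rule mult_left_mono) simp
      also have "\<dots> = 2 * (1 + 2 * e2) * (M powr p * (\<bar>sin u\<bar> / \<kappa> u) + 2 * (M powr p * (\<bar>sin (u + \<rho>)\<bar> / \<kappa> (u + \<rho>))))"
      proof -
        have "w * (c * (y + 2 * z)) = c * (w * y + 2 * (w * z))" for w c y z :: real
          by (simp add: algebra_simps)
        then show ?thesis .
      qed
      also have "\<dots> \<le> 2 * (1 + 2 * e2) * (c1 * \<Phi> u + 2 * (c1 * \<Phi> (u + \<rho>)))"
        using pt[of u] pt[of "u + \<rho>"] u e2 by (intro mult_left_mono add_mono) auto
      also have "\<dots> \<le> 2 * (1 + 2 * e2) * (2 * (c1 * \<Phi> u) + 2 * (c1 * \<Phi> (u + \<rho>)))"
        using e2 c1 \<Phi>0[of u] by (intro mult_left_mono add_mono) auto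
      also have "\<dots> = c3 * (\<Phi> u + \<Phi> (u + \<rho>))" by (simp add: c3_def algebra_simps)
      finally show ?thesis .
    qed
    let ?LM = "local_mean p m (\<lambda>t. cmod (poly q (cis t))) \<theta>"
    have LM: "?LM = (\<integral>\<^sup>+t. ennreal (\<Phi> t) * indicator {-2*pi..2*pi} t \<partial>lborel)"
      by (simp add: local_mean_def \<Phi>_def a_def \<kappa>_def)
    have a_cont: "continuous_on UNIV a" unfolding a_def cis_conv_exp by (intro continuous_intros)
    have [measurable]: "a \<in> borel_measurable borel"
      by (rule borel_measurable_continuous_onI[OF a_cont])
    have [measurable]: "\<Phi> \<in> borel_measurable borel"
      unfolding \<Phi>_def[abs_def] \<kappa>_def by measurable
    have pi3: "pi > 3" by (rule pi_gt3)
    have I1: "(\<integral>\<^sup>+u. ennreal (\<Phi> u) * indicator {t1 - \<rho>..t1} u \<partial>lborel) \<le> ?LM"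
      unfolding LM using t1 \<rho>0 \<rho>1 pi3
      by (intro nn_integral_mono mult_left_mono) (auto simp: indicator_def)
    have I2: "(\<integral>\<^sup>+u. ennreal (\<Phi> (u + \<rho>)) * indicator {t1 - \<rho>..t1} u \<partial>lborel) \<le> ?LM"
    proof -
      have "?LM = (\<integral>\<^sup>+u. ennreal (\<Phi> (\<rho> + 1 * u)) * indicator {-2*pi..2*pi} (\<rho> + 1 * u) \<partial>lborel)"
        unfolding LM by (subst nn_integral_real_affine[of _ 1 \<rho>]) auto
      moreover have "(\<integral>\<^sup>+u. ennreal (\<Phi> (u + \<rho>)) * indicator {t1 - \<rho>..t1} u \<partial>lborel) \<le> \<dots>"
        using t1 \<rho>0 \<rho>1 pi3
        by (intro nn_integral_mono) (auto simp: indicator_def add.commute)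
      ultimately show ?thesis by simp
    qed
    \<comment> \<open>Averaging \<open>key\<close> over a window of length \<open>\<rho>\<close>;
      the reciprocal of the length, e2 m, is the factor m of the claim.\<close>
    have MA: "ennreal (M powr p * A) \<le> ennreal (2 * c3 * e2 * real m) * ?LM"
    proof -
      have "ennreal \<rho> * ennreal (M powr p * A) = (\<integral>\<^sup>+u. ennreal (M powr p * A) * indicator {t1 - \<rho>..t1} u \<partial>lborel)"
        using \<rho>0 by (simp add: nn_integral_cmult_indicator mult.commute)
      also have "\<dots> \<le> (\<integral>\<^sup>+u. ennreal c3 * (ennreal (\<Phi> u) * indicator {t1 - \<rho>..t1} u
                        + ennreal (\<Phi> (u + \<rho>)) * indicator {t1 - \<rho>..t1} u) \<partial>lborel)"
      proof (intro nn_integral_mono)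
        fix u
        show "ennreal (M powr p * A) * indicator {t1 - \<rho>..t1} u \<le>
          ennreal c3 * (ennreal (\<Phi> u) * indicator {t1 - \<rho>..t1} u + ennreal (\<Phi> (u + \<rho>)) * indicator {t1 - \<rho>..t1} u)"
          using key[of u] \<Phi>0 c3
          by (auto simp: indicator_def ennreal_mult[symmetric] ennreal_plus[symmetric] simp del: ennreal_plus intro!: ennreal_leI)
      qed
      also have "\<dots> = ennreal c3 * ((\<integral>\<^sup>+u. ennreal (\<Phi> u) * indicator {t1 - \<rho>..t1} u \<partial>lborel)
                        + (\<integral>\<^sup>+u. ennreal (\<Phi> (u + \<rho>)) * indicator {t1 - \<rho>..t1} u \<partial>lborel))"
        by (subst nn_integral_cmult) (auto simp: nn_integral_add)
      also have "\<dots> \<le> ennreal c3 * (?LM + ?LM)" using I1 I2 by (intro mult_left_mono add_mono) auto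
      finally have *: "ennreal \<rho> * ennreal (M powr p * A) \<le> ennreal c3 * (?LM + ?LM)" .
      have "ennreal (M powr p * A) = ennreal (1 / \<rho>) * (ennreal \<rho> * ennreal (M powr p * A))"
        using \<rho>0 by (simp add: mult.assoc[symmetric] ennreal_mult[symmetric])
      also have "\<dots> \<le> ennreal (1 / \<rho>) * (ennreal c3 * (?LM + ?LM))" using * by (rule mult_left_mono) simp
      also have "\<dots> = ennreal (2 * c3 * e2 * real m) * ?LM"
      proof -
        have "2 * c3 * e2 * real m = (1 / \<rho>) * c3 * 2" using \<rho>e by simp
        then have "ennreal (2 * c3 * e2 * real m) = ennreal (1 / \<rho>) * ennreal c3 * ennreal 2"
          using \<rho>0 c3 by (simp add: ennreal_mult[symmetric] del: ennreal_numeral)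
        then show ?thesis by (simp add: mult_2[symmetric] mult_ac)
      qed
      finally show ?thesis .
    qed
    show "\<exists>M\<ge>0. (\<forall>\<tau>. \<bar>\<tau> - \<theta>\<bar> \<le> 1 / real m \<longrightarrow>
               cmod (poly q (cis \<tau>)) \<le> M \<and> cmod (poly (pderiv q) (cis \<tau>)) \<le> C * real m * M) \<and>
         ennreal (M powr p * (\<bar>sin \<theta>\<bar> + 1 / real m)) \<le> ennreal (C * real m) * ?LM"
    \<comment> \<open>Within 1/m of \<theta> the Dirichlet kernel is at least 1/2, so passing from S
      back to q costs at most 2^K.\<close>
    proof (intro exI[of _ "2 ^ K * M"] conjI allI impI)
      fix \<tau> assume \<tau>: "\<bar>\<tau> - \<theta>\<bar> \<le> 1 / real m"
      let ?V = "cmod (poly (k ^ K) (cis \<tau>))"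
      have V: "1 \<le> 2 ^ K * ?V"
      proof -
        have "(1 / 2) ^ K \<le> ?V"
          using norm_dirichlet_kernel_near[OF m \<tau>] by (simp add: norm_power k_def power_mono del: power_divide)
        then show ?thesis by (simp add: field_simps)
      qed
      have qV: "cmod (poly q (cis \<tau>)) * ?V \<le> M" using SM[of \<tau>] by (simp add: S_def norm_mult)
      have up: "y \<le> 2 ^ K * (y * ?V)" if "0 \<le> y" for y
        using mult_left_mono[OF V that] by (simp add: mult_ac)
      show q_le: "cmod (poly q (cis \<tau>)) \<le> 2 ^ K * M"
        using up[of "cmod (poly q (cis \<tau>))"] qV by (smt (verit) mult_left_mono norm_ge_zero zero_le_power)
      have "cmod (poly (pderiv (k ^ K)) (cis \<tau>)) \<le> exp 1 * real (K * m) * 1"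
      proof (rule bernstein_circle[OF degK])
        show "1 \<le> K * m" using m L1 by (simp add: K_def)
        show "cmod (poly (k ^ K) (cis t)) \<le> 1" for t
          using norm_dirichlet_kernel_le_1[of m \<theta> t] by (simp add: norm_power k_def power_le_one)
      qed
      then have V': "cmod (poly (pderiv (k ^ K)) (cis \<tau>)) \<le> exp 1 * real (K * m)" by simp
      \<comment> \<open>The product rule solved for q': Bernstein's inequality is applied to S and
        to the kernel power, never to q itself, whose global maximum is out of control.\<close>
      have "cmod (poly (pderiv q) (cis \<tau>)) * ?V
          = cmod (poly (pderiv S) (cis \<tau>) - poly q (cis \<tau>) * poly (pderiv (k ^ K)) (cis \<tau>))"
        by (simp add: S_def pderiv_mult norm_mult[symmetric] algebra_simps)
      also have "\<dots> \<le> cmod (poly (pderiv S) (cis \<tau>)) + cmod (poly q (cis \<tau>)) * cmod (poly (pderiv (k ^ K)) (cis \<tau>))"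
        by (metis norm_mult norm_triangle_ineq4)
      also have "\<dots> \<le> exp 1 * real D * M + 2 ^ K * M * (exp 1 * real (K * m))"
        using S' q_le V' M0 by (intro add_mono mult_mono) auto
      also have "\<dots> \<le> real m * (e2 + exp 1 * real K * 2 ^ K) * M"
        using M0 by (simp add: D_def e2_def algebra_simps)
      finally have *: "cmod (poly (pderiv q) (cis \<tau>)) * ?V \<le> real m * (e2 + exp 1 * real K * 2 ^ K) * M" .
      have "cmod (poly (pderiv q) (cis \<tau>)) \<le> 2 ^ K * (cmod (poly (pderiv q) (cis \<tau>)) * ?V)"
        by (rule up) simp
      also have "\<dots> \<le> 2 ^ K * (real m * (e2 + exp 1 * real K * 2 ^ K) * M)"
        by (intro mult_left_mono *) simp
      also have "\<dots> = Ca * (real m * M)" by (simp add: Ca_def mult_ac)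
      also have "\<dots> \<le> C * (real m * M)" using M0 by (intro mult_right_mono) (auto simp: C_def)
      also have "\<dots> \<le> C * (real m * (2 ^ K * M))"
        using M0 Ca mult_right_mono[of 1 "2 ^ K" M] by (intro mult_left_mono) (auto simp: C_def)
      finally show "cmod (poly (pderiv q) (cis \<tau>)) \<le> C * real m * (2 ^ K * M)" by (simp add: mult.assoc)
    next
      have "ennreal ((2 ^ K * M) powr p * (\<bar>sin \<theta>\<bar> + 1 / real m)) = ennreal ((2 ^ K) powr p) * ennreal (M powr p * A)"
        using M0 by (simp add: A_def powr_mult ennreal_mult[symmetric] mult_ac)
      also have "\<dots> \<le> ennreal ((2 ^ K) powr p) * (ennreal (2 * c3 * e2 * real m) * ?LM)"
        using MA by (rule mult_left_mono) simp
      also have "\<dots> = ennreal (Cb * real m) * ?LM"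
        using c3 e2 by (simp add: Cb_def ennreal_mult mult.assoc)
      also have "\<dots> \<le> ennreal (C * real m) * ?LM"
        by (intro mult_right_mono ennreal_leI) (auto simp: C_def)
      finally show "ennreal ((2 ^ K * M) powr p * (\<bar>sin \<theta>\<bar> + 1 / real m)) \<le> ennreal (C * real m) * ?LM" .
    qed (use M0 in auto)
  qed
qed

lemma local_mean_measurable [measurable]:
  assumes [measurable]: "u \<in> borel_measurable borel"
  shows "local_mean p m u \<in> borel_measurable borel"
  unfolding local_mean_def[abs_def] by measurable

text \<open>The primitive is \<pi> times an arctangent, whose total increase is at most \<pi>; hence
  a bound free of m and s. The division by \<pi> anticipates |x|/\<pi> <= |sin(x/2)|.\<close>

lemma nn_integral_cauchy_kernel_le:
  assumes "1 \<le> m"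
  shows "(\<integral>\<^sup>+\<theta>\<in>{0..pi}. ennreal (real m / (1 + (real m * (s - \<theta>) / pi)\<^sup>2)) \<partial>lborel) \<le> ennreal (pi\<^sup>2)"
proof -
  define F where "F \<theta> = - pi * arctan (real m * (s - \<theta>) / pi)" for \<theta>
  have "((\<lambda>\<theta>. real m / (1 + (real m * (s - \<theta>) / pi)\<^sup>2)) has_integral (F pi - F 0)) {0..pi}"
  proof (rule fundamental_theorem_of_calculus)
    fix \<theta> :: real
    show "(F has_vector_derivative real m / (1 + (real m * (s - \<theta>) / pi)\<^sup>2)) (at \<theta> within {0..pi})"
      unfolding F_def[abs_def] has_real_derivative_iff_has_vector_derivative[symmetric]
      by (auto intro!: derivative_eq_intros simp: divide_simps)
  qed auto
  then have "(\<integral>\<^sup>+\<theta>\<in>{0..pi}. ennreal (real m / (1 + (real m * (s - \<theta>) / pi)\<^sup>2)) \<partial>lborel) = ennreal (F pi - F 0)"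
    by (rule nn_integral_has_integral_lebesgue'[rotated]) (auto simp: add_nonneg_nonneg)
  also have "F pi - F 0 \<le> pi\<^sup>2"
  proof -
    have "arctan (real m * (s - 0) / pi) - arctan (real m * (s - pi) / pi) \<le> pi"
      using arctan_bounded[of "real m * (s - 0) / pi"] arctan_bounded[of "real m * (s - pi) / pi"] by linarith
    from mult_left_mono[OF this, of pi] show ?thesis
      by (simp add: F_def power2_eq_square algebra_simps)
  qed
  finally show ?thesis by (simp add: ennreal_leI)
qed

text \<open>Some shift of x by a multiple of 2\<pi> lies in [-\<pi>, \<pi>], where the sine of the
  half angle dominates a linear function. Summing over all three shifts avoids naming it. The range
  3\<pi> is that of t - \<theta> with t in two periods and \<theta> in [0, \<pi>].\<close>

lemma periodic_kernel_le:
  assumes "1 \<le> m" "\<bar>x\<bar> \<le> 3 * pi"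
  shows "real m / (1 + (real m * sin (x / 2))\<^sup>2) \<le>
    (\<Sum>c\<in>{-2*pi, 0, 2*pi}. real m / (1 + (real m * (x - c) / pi)\<^sup>2))"
proof -
  define c where "c = (if x \<le> -pi then -2*pi else if pi \<le> x then 2*pi else 0)"
  have c: "c \<in> {-2*pi, 0, 2*pi}" "\<bar>x - c\<bar> \<le> pi"
    using assms(2) by (auto simp: c_def)
  have "\<bar>sin (x / 2)\<bar> = \<bar>sin ((x - c) / 2)\<bar>"
    using c(1) by (auto simp: diff_divide_distrib add_divide_distrib sin_diff sin_add)
  with abs_le_abs_sin_half[OF c(2)] have "\<bar>x - c\<bar> / pi \<le> \<bar>sin (x / 2)\<bar>"
    by (simp add: field_simps)
  then have "real m * (\<bar>x - c\<bar> / pi) \<le> real m * \<bar>sin (x / 2)\<bar>" by (rule mult_left_mono) simp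
  then have "\<bar>real m * (x - c) / pi\<bar> \<le> \<bar>real m * sin (x / 2)\<bar>" by (simp add: abs_mult)
  then have "(real m * (x - c) / pi)\<^sup>2 \<le> (real m * sin (x / 2))\<^sup>2" by (rule abs_le_square_iff[THEN iffD1])
  then have "real m / (1 + (real m * sin (x / 2))\<^sup>2) \<le> real m / (1 + (real m * (x - c) / pi)\<^sup>2)"
    by (intro divide_left_mono mult_pos_pos add_pos_nonneg) auto
  also have "\<dots> \<le> (\<Sum>c\<in>{-2*pi, 0, 2*pi}. real m / (1 + (real m * (x - c) / pi)\<^sup>2))"
    by (rule member_le_sum[OF c(1)]) (auto simp: add_nonneg_nonneg)
  finally show ?thesis .
qed

text \<open>Tonelli: for fixed t the kernel, multiplied by m, has integral at most 3\<pi>^2 in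
  \<theta>, one \<pi>^2 for each shift.\<close>

lemma nn_integral_local_mean_le:
  assumes m: "1 \<le> m" and [measurable]: "u \<in> borel_measurable borel"
  shows "(\<integral>\<^sup>+\<theta>\<in>{0..pi}. ennreal (real m) * local_mean p m u \<theta> \<partial>lborel) \<le>
    ennreal (3 * pi\<^sup>2) * (\<integral>\<^sup>+t\<in>{-2*pi..2*pi}. ennreal (\<bar>u t\<bar> powr p * \<bar>sin t\<bar>) \<partial>lborel)"
proof -
  define k where "k \<theta> t = real m / (1 + (real m * sin ((t - \<theta>) / 2))\<^sup>2)" for \<theta> t
  have [measurable]: "case_prod k \<in> borel_measurable (borel \<Otimes>\<^sub>M borel)"
    unfolding k_def[abs_def] by measurable
  have "(\<integral>\<^sup>+\<theta>\<in>{0..pi}. ennreal (real m) * local_mean p m u \<theta> \<partial>lborel) =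
     (\<integral>\<^sup>+\<theta>. \<integral>\<^sup>+t. ennreal (\<bar>u t\<bar> powr p * \<bar>sin t\<bar>) * indicator {-2*pi..2*pi} t *
        (ennreal (k \<theta> t) * indicator {0..pi} \<theta>) \<partial>lborel \<partial>lborel)"
    unfolding local_mean_def
    by (subst nn_integral_cmult[symmetric], measurable, subst nn_integral_multc[symmetric], measurable)
      (intro nn_integral_cong, auto simp: indicator_def k_def ennreal_mult[symmetric] add_nonneg_nonneg mult_ac)
  also have "\<dots> = (\<integral>\<^sup>+t. \<integral>\<^sup>+\<theta>. ennreal (\<bar>u t\<bar> powr p * \<bar>sin t\<bar>) * indicator {-2*pi..2*pi} t *
        (ennreal (k \<theta> t) * indicator {0..pi} \<theta>) \<partial>lborel \<partial>lborel)"
    by (rule lborel_pair.Fubini'[symmetric]) measurable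
  also have "\<dots> = (\<integral>\<^sup>+t. ennreal (\<bar>u t\<bar> powr p * \<bar>sin t\<bar>) * indicator {-2*pi..2*pi} t *
        (\<integral>\<^sup>+\<theta>. ennreal (k \<theta> t) * indicator {0..pi} \<theta> \<partial>lborel) \<partial>lborel)"
    by (intro nn_integral_cong nn_integral_cmult) measurable
  also have "\<dots> \<le> (\<integral>\<^sup>+t. ennreal (\<bar>u t\<bar> powr p * \<bar>sin t\<bar>) * indicator {-2*pi..2*pi} t * ennreal (3 * pi\<^sup>2) \<partial>lborel)"
  proof (intro nn_integral_mono)
    fix t
    have "(\<integral>\<^sup>+\<theta>. ennreal (k \<theta> t) * indicator {0..pi} \<theta> \<partial>lborel) \<le> ennreal (3 * pi\<^sup>2)" if t: "t \<in> {-2*pi..2*pi}"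
    proof -
      have "(\<integral>\<^sup>+\<theta>. ennreal (k \<theta> t) * indicator {0..pi} \<theta> \<partial>lborel) \<le>
        (\<integral>\<^sup>+\<theta>. (\<Sum>c\<in>{-2*pi, 0, 2*pi}. ennreal (real m / (1 + (real m * ((t - c) - \<theta>) / pi)\<^sup>2)) * indicator {0..pi} \<theta>) \<partial>lborel)"
      proof (intro nn_integral_mono)
        fix \<theta>
        show "ennreal (k \<theta> t) * indicator {0..pi} \<theta> \<le>
          (\<Sum>c\<in>{-2*pi, 0, 2*pi}. ennreal (real m / (1 + (real m * ((t - c) - \<theta>) / pi)\<^sup>2)) * indicator {0..pi} \<theta>)"
        proof (cases "\<theta> \<in> {0..pi}")
          case True
          then have "\<bar>t - \<theta>\<bar> \<le> 3 * pi" using t by auto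
          from periodic_kernel_le[OF m this]
          have "ennreal (k \<theta> t) \<le> ennreal (\<Sum>c\<in>{-2*pi, 0, 2*pi}. real m / (1 + (real m * ((t - c) - \<theta>) / pi)\<^sup>2))"
            unfolding k_def by (intro ennreal_leI) (simp add: algebra_simps)
          also have "\<dots> = (\<Sum>c\<in>{-2*pi, 0, 2*pi}. ennreal (real m / (1 + (real m * ((t - c) - \<theta>) / pi)\<^sup>2)))"
            by (rule sum_ennreal[symmetric]) (auto simp: add_nonneg_nonneg)
          finally show ?thesis using True by simp
        qed simp
      qed
      also have "\<dots> = (\<Sum>c\<in>{-2*pi, 0, 2*pi}. \<integral>\<^sup>+\<theta>. ennreal (real m / (1 + (real m * ((t - c) - \<theta>) / pi)\<^sup>2)) * indicator {0..pi} \<theta> \<partial>lborel)"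
        by (rule nn_integral_sum) measurable
      also have "\<dots> \<le> (\<Sum>c\<in>{-2*pi, 0, 2*pi::real}. ennreal (pi\<^sup>2))"
        by (intro sum_mono nn_integral_cauchy_kernel_le[OF m])
      also have "\<dots> = ennreal (\<Sum>c\<in>{-2*pi, 0, 2*pi::real}. pi\<^sup>2)"
        by (rule sum_ennreal) simp
      also have "(\<Sum>c\<in>{-2*pi, 0, 2*pi::real}. pi\<^sup>2) = 3 * pi\<^sup>2"
        by (subst sum.insert | simp)+
      finally show ?thesis .
    qed
    then show "ennreal (\<bar>u t\<bar> powr p * \<bar>sin t\<bar>) * indicator {-2*pi..2*pi} t *
        (\<integral>\<^sup>+\<theta>. ennreal (k \<theta> t) * indicator {0..pi} \<theta> \<partial>lborel)
      \<le> ennreal (\<bar>u t\<bar> powr p * \<bar>sin t\<bar>) * indicator {-2*pi..2*pi} t * ennreal (3 * pi\<^sup>2)"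
      by (cases "t \<in> {-2*pi..2*pi}") (auto intro!: mult_left_mono)
  qed
  also have "\<dots> = ennreal (3 * pi\<^sup>2) * (\<integral>\<^sup>+t\<in>{-2*pi..2*pi}. ennreal (\<bar>u t\<bar> powr p * \<bar>sin t\<bar>) \<partial>lborel)"
    by (subst nn_integral_multc) (auto simp: mult.commute)
  finally show ?thesis .
qed

text \<open>Two full periods consist of four reflected or translated copies of [0, \<pi>].\<close>

lemma nn_integral_even_periodic_le:
  fixes \<Psi> :: "real \<Rightarrow> ennreal"
  assumes [measurable]: "\<Psi> \<in> borel_measurable borel"
    and even: "\<And>t. \<Psi> (- t) = \<Psi> t" and per: "\<And>t. \<Psi> (t + 2 * pi) = \<Psi> t"
  shows "(\<integral>\<^sup>+t\<in>{-2*pi..2*pi}. \<Psi> t \<partial>lborel) \<le> 4 * (\<integral>\<^sup>+t\<in>{0..pi}. \<Psi> t \<partial>lborel)"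
proof -
  let ?I = "\<integral>\<^sup>+t\<in>{0..pi}. \<Psi> t \<partial>lborel"
  have aff: "(\<integral>\<^sup>+t. \<Psi> t * indicator A t \<partial>lborel) = ?I"
    if "c = 1 \<or> c = -1" and A: "A \<in> sets borel" "\<And>t. s + c * t \<in> A \<longleftrightarrow> t \<in> {0..pi}"
      and "\<And>t. \<Psi> (s + c * t) = \<Psi> t" for A s c
  proof -
    have [measurable]: "A \<in> sets borel" by (rule A)
    have "(\<integral>\<^sup>+t. \<Psi> t * indicator A t \<partial>lborel) = \<bar>c\<bar> * (\<integral>\<^sup>+t. \<Psi> (s + c * t) * indicator A (s + c * t) \<partial>lborel)"
      by (rule nn_integral_real_affine) (use that in auto)
    also have "\<bar>c\<bar> = 1" using that by auto
    also have "(\<integral>\<^sup>+t. \<Psi> (s + c * t) * indicator A (s + c * t) \<partial>lborel) = ?I"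
      using that by (intro nn_integral_cong) (auto simp: indicator_def)
    finally show ?thesis by simp
  qed
  have per': "\<Psi> (2 * pi + t) = \<Psi> t" "\<Psi> (t - 2 * pi) = \<Psi> t" "\<Psi> (2 * pi - t) = \<Psi> t" "\<Psi> (- (2 * pi) + t) = \<Psi> t" for t
    using per[of t] per[of "t - 2 * pi"] per[of "-t"] even[of t] by (auto simp: add_ac)
  have 1: "(\<integral>\<^sup>+t. \<Psi> t * indicator {-pi..0} t \<partial>lborel) = ?I"
    by (rule aff[of "-1" _ 0]) (auto simp: even)
  have 2: "(\<integral>\<^sup>+t. \<Psi> t * indicator {pi..2*pi} t \<partial>lborel) = ?I"
    by (rule aff[of "-1" _ "2*pi"]) (auto simp: per')
  have 3: "(\<integral>\<^sup>+t. \<Psi> t * indicator {-(2*pi)..-pi} t \<partial>lborel) = ?I"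
    by (rule aff[of "1" _ "-(2*pi)"]) (auto simp: per')
  have "(\<integral>\<^sup>+t\<in>{-2*pi..2*pi}. \<Psi> t \<partial>lborel) \<le> (\<integral>\<^sup>+t. \<Psi> t * indicator {-2*pi..-pi} t +
      (\<Psi> t * indicator {-pi..0} t + (\<Psi> t * indicator {0..pi} t + \<Psi> t * indicator {pi..2*pi} t)) \<partial>lborel)"
  proof (intro nn_integral_mono)
    fix t
    show "\<Psi> t * indicator {-2*pi..2*pi} t \<le> \<Psi> t * indicator {-2*pi..-pi} t +
      (\<Psi> t * indicator {-pi..0} t + (\<Psi> t * indicator {0..pi} t + \<Psi> t * indicator {pi..2*pi} t))"
      unfolding distrib_left[symmetric]
      by (intro mult_left_mono) (auto simp: indicator_def)
  qed
  also have "\<dots> = ?I + (?I + (?I + ?I))" by (simp add: nn_integral_add 1 2 3)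
  also have "\<dots> = 4 * ?I"
  proof -
    have "(4::ennreal) = 1 + (1 + (1 + 1))" by simp
    then show ?thesis by (simp only: distrib_right mult_1)
  qed
  finally show ?thesis .
qed

text \<open>Here T is q on the circle multiplied by a factor of modulus 1 and frequency d.
  Differentiating that factor adds d <= B m times the local maximum, whence the constant C + B. The
  local Lipschitz bound is in terms of the local, not the global, maximum.\<close>

lemma trig_poly_local_bound:
  fixes p :: real and B :: nat
  assumes p: "0 < p"
  shows "\<exists>C>0. \<forall>m d T \<theta>. 1 \<le> m \<longrightarrow> d \<le> B * m \<longrightarrow> trig_poly d T \<longrightarrow>
    (\<exists>M\<ge>0. (\<forall>\<tau>. \<bar>\<tau> - \<theta>\<bar> \<le> 1 / real m \<longrightarrow>
               \<bar>T \<tau>\<bar> \<le> M \<and> \<bar>T \<tau> - T \<theta>\<bar> \<le> C * (real m * \<bar>\<tau> - \<theta>\<bar>) * M) \<and>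
         ennreal (M powr p * (\<bar>sin \<theta>\<bar> + 1 / real m)) \<le> ennreal (C * real m) * local_mean p m T \<theta>)"
proof -
  obtain C where C: "C > 0" and
    *: "\<And>m (q::complex poly) \<theta>. 1 \<le> m \<Longrightarrow> degree q \<le> 2 * B * m \<Longrightarrow>
    (\<exists>M\<ge>0. (\<forall>\<tau>. \<bar>\<tau> - \<theta>\<bar> \<le> 1 / real m \<longrightarrow>
               cmod (poly q (cis \<tau>)) \<le> M \<and> cmod (poly (pderiv q) (cis \<tau>)) \<le> C * real m * M) \<and>
         ennreal (M powr p * (\<bar>sin \<theta>\<bar> + 1 / real m))
           \<le> ennreal (C * real m) * local_mean p m (\<lambda>t. cmod (poly q (cis t))) \<theta>)"
    using circle_local_bound[OF p, of "2 * B"] by meson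
  show ?thesis
  proof (rule exI[of _ "C + real B"], intro conjI allI impI)
    show "C + real B > 0" using C by simp
    fix m d T \<theta> assume m: "1 \<le> m" and d: "d \<le> B * m" and "trig_poly d T"
    then obtain q :: "complex poly" where q: "degree q \<le> 2 * d"
      "\<And>t. poly q (cis t) = cis (real d * t) * of_real (T t)" unfolding trig_poly_def by blast
    have Tq: "\<bar>T t\<bar> = cmod (poly q (cis t))" for t by (simp add: q norm_mult)
    have lm: "local_mean p m (\<lambda>t. cmod (poly q (cis t))) \<theta> = local_mean p m T \<theta>"
      unfolding local_mean_def by (simp add: Tq)
    have "degree q \<le> 2 * B * m" using q(1) d by simp
    from *[OF m this, of \<theta>] obtain M where M0: "M \<ge> 0" and
      M: "\<And>\<tau>. \<bar>\<tau> - \<theta>\<bar> \<le> 1 / real m \<Longrightarrow> cmod (poly q (cis \<tau>)) \<le> M"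
      "\<And>\<tau>. \<bar>\<tau> - \<theta>\<bar> \<le> 1 / real m \<Longrightarrow> cmod (poly (pderiv q) (cis \<tau>)) \<le> C * real m * M"
      and lb: "ennreal (M powr p * (\<bar>sin \<theta>\<bar> + 1 / real m)) \<le> ennreal (C * real m) * local_mean p m T \<theta>"
      unfolding lm by blast
    show "\<exists>M\<ge>0. (\<forall>\<tau>. \<bar>\<tau> - \<theta>\<bar> \<le> 1 / real m \<longrightarrow>
               \<bar>T \<tau>\<bar> \<le> M \<and> \<bar>T \<tau> - T \<theta>\<bar> \<le> (C + real B) * (real m * \<bar>\<tau> - \<theta>\<bar>) * M) \<and>
         ennreal (M powr p * (\<bar>sin \<theta>\<bar> + 1 / real m)) \<le> ennreal ((C + real B) * real m) * local_mean p m T \<theta>"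
    proof (intro exI[of _ M] conjI allI impI M0)
      fix \<tau> assume \<tau>: "\<bar>\<tau> - \<theta>\<bar> \<le> 1 / real m"
      show "\<bar>T \<tau>\<bar> \<le> M" using M(1)[OF \<tau>] Tq by simp
      define f where "f t = cis (- (real d * t)) * poly q (cis t)" for t
      have f: "f t = of_real (T t)" for t by (simp add: f_def q cis_mult mult.assoc[symmetric])
      let ?S = "{\<theta> - 1 / real m..\<theta> + 1 / real m}"
      let ?D = "\<lambda>t. cis (- (real d * t)) * (\<i> * cis t * poly (pderiv q) (cis t)) +
                  (- (\<i> * of_real (real d)) * cis (- (real d * t))) * poly q (cis t)"
      have "norm (f \<tau> - f \<theta>) \<le> ((C + real B) * real m * M) * norm (\<tau> - \<theta>)"
      proof (rule differentiable_bound[of ?S])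
        fix t assume t: "t \<in> ?S"
        have "((\<lambda>t. cis (- (real d * t))) has_vector_derivative (- (\<i> * of_real (real d)) * cis (- (real d * t)))) (at t within ?S)"
          unfolding cis_conv_exp
          by (auto intro!: derivative_eq_intros has_vector_derivative_real_field simp: mult_ac)
        from has_vector_derivative_mult[OF this has_vector_derivative_poly_cis[of q t ?S]]
        show "(f has_derivative (\<lambda>h. h *\<^sub>R ?D t)) (at t within ?S)"
          unfolding has_vector_derivative_def f_def[abs_def] .
        show "onorm (\<lambda>h. h *\<^sub>R ?D t) \<le> (C + real B) * real m * M"
        proof (rule onorm_le)
          fix h :: real
          have dB: "real d \<le> real (B * m)" using d by (rule of_nat_mono)
          have tt: "\<bar>t - \<theta>\<bar> \<le> 1 / real m" using t by auto
          have "cmod (?D t) \<le> cmod (poly (pderiv q) (cis t)) + real d * cmod (poly q (cis t))"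
            by (rule order_trans[OF norm_triangle_ineq]) (simp add: norm_mult)
          also have "\<dots> \<le> C * real m * M + real (B * m) * M"
            using M[OF tt] dB by (intro add_mono mult_mono) (auto simp del: of_nat_mult)
          also have "\<dots> = (C + real B) * real m * M" by (simp add: algebra_simps)
          finally show "norm (h *\<^sub>R ?D t) \<le> (C + real B) * real m * M * norm h"
            by (simp add: mult.commute[of "\<bar>h\<bar>"] mult_right_mono)
        qed
      qed (use \<tau> in auto)
      moreover have "norm (f \<tau> - f \<theta>) = \<bar>T \<tau> - T \<theta>\<bar>"
        unfolding f of_real_diff[symmetric] norm_of_real ..
      ultimately show "\<bar>T \<tau> - T \<theta>\<bar> \<le> (C + real B) * (real m * \<bar>\<tau> - \<theta>\<bar>) * M" by (simp add: mult_ac)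
    next
      have "ennreal (C * real m) * local_mean p m T \<theta> \<le> ennreal ((C + real B) * real m) * local_mean p m T \<theta>"
        by (intro mult_right_mono ennreal_leI) auto
      with lb show "ennreal (M powr p * (\<bar>sin \<theta>\<bar> + 1 / real m)) \<le> ennreal ((C + real B) * real m) * local_mean p m T \<theta>"
        by order
    qed
  qed
qed

text \<open>In the variable $x=\cos\theta$ the integral of $|T|^p\sin\theta$ is $\|\varphi^M P\|_p^p$.\<close>

definition weighted_trig :: "nat \<Rightarrow> real poly \<Rightarrow> real \<Rightarrow> real" where
  "weighted_trig M P \<theta> = sin \<theta> ^ M * poly P (cos \<theta>)"

definition trig_mass :: "real \<Rightarrow> nat \<Rightarrow> real poly \<Rightarrow> ennreal" where
  "trig_mass p M P = (\<integral>\<^sup>+\<theta>\<in>{0..pi}. ennreal (\<bar>weighted_trig M P \<theta>\<bar> powr p * sin \<theta>) \<partial>lborel)"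

lemma weighted_trig_measurable [measurable]: "weighted_trig M P \<in> borel_measurable borel"
  unfolding weighted_trig_def[abs_def] by (intro borel_measurable_continuous_onI continuous_intros)

text \<open>The form in which local estimates are used throughout: one function H dominates the p-th
  power of every local maximum b. Its integral costs no more than the total mass, which yields L_p
  estimates, and its supremum at most m times the mass, which yields the Nikolskii inequality. The
  summand 1/m beside the sine keeps the estimate meaningful at the endpoints.\<close>

lemma weighted_trig_local_bound:
  fixes p :: real and B :: nat
  assumes p: "0 < p"
  shows "\<exists>C>0. \<forall>m M (P :: real poly). 1 \<le> m \<longrightarrow> M + degree P \<le> B * m \<longrightarrow>
    (\<exists>H\<in>borel_measurable borel.
       (\<integral>\<^sup>+\<theta>\<in>{0..pi}. H \<theta> \<partial>lborel) \<le> ennreal C * trig_mass p M P \<and>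
       (\<forall>\<theta>. H \<theta> \<le> ennreal (C * real m) * trig_mass p M P) \<and>
       (\<forall>\<theta>. \<exists>b\<ge>0. (\<forall>\<tau>. \<bar>\<tau> - \<theta>\<bar> \<le> 1 / real m \<longrightarrow>
               \<bar>weighted_trig M P \<tau>\<bar> \<le> b \<and>
               \<bar>weighted_trig M P \<tau> - weighted_trig M P \<theta>\<bar> \<le> C * (real m * \<bar>\<tau> - \<theta>\<bar>) * b) \<and>
             ennreal (b powr p * (\<bar>sin \<theta>\<bar> + 1 / real m)) \<le> H \<theta>))"
proof -
  obtain C where C: "C > 0" and *: "\<forall>m d T \<theta>. 1 \<le> m \<longrightarrow> d \<le> B * m \<longrightarrow> trig_poly d T \<longrightarrow>
    (\<exists>M\<ge>0. (\<forall>\<tau>. \<bar>\<tau> - \<theta>\<bar> \<le> 1 / real m \<longrightarrow>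
               \<bar>T \<tau>\<bar> \<le> M \<and> \<bar>T \<tau> - T \<theta>\<bar> \<le> C * (real m * \<bar>\<tau> - \<theta>\<bar>) * M) \<and>
         ennreal (M powr p * (\<bar>sin \<theta>\<bar> + 1 / real m)) \<le> ennreal (C * real m) * local_mean p m T \<theta>)"
    using trig_poly_local_bound[OF p, of B] by (elim exE conjE) (rule that)
  \<comment> \<open>3\<pi>^2 from integrating the kernel, times 4 from the two periods.\<close>
  define C' where "C' = C * (12 * pi\<^sup>2)"
  have pi1: "1 \<le> pi\<^sup>2" using pi_gt3 by (simp add: power2_eq_square mult_ge1_I)
  have CC: "C \<le> C'" "4 * C \<le> C'" using pi1 C by (auto simp: C'_def)
  show ?thesis
  proof (rule exI[of _ C'], intro conjI allI impI)
    show "C' > 0" using C by (simp add: C'_def)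
    fix m M and P :: "real poly" assume m: "1 \<le> m" and deg: "M + degree P \<le> B * (m::nat)"
    let ?T = "weighted_trig M P"
    define \<Psi> where "\<Psi> t = ennreal (\<bar>?T t\<bar> powr p * \<bar>sin t\<bar>)" for t
    have [measurable]: "\<Psi> \<in> borel_measurable borel" unfolding \<Psi>_def[abs_def] by measurable
    have four: "(\<integral>\<^sup>+t\<in>{-2*pi..2*pi}. \<Psi> t \<partial>lborel) \<le> 4 * trig_mass p M P"
    proof -
      have "(\<integral>\<^sup>+t\<in>{-2*pi..2*pi}. \<Psi> t \<partial>lborel) \<le> 4 * (\<integral>\<^sup>+t\<in>{0..pi}. \<Psi> t \<partial>lborel)"
      proof (rule nn_integral_even_periodic_le)
        show "\<Psi> \<in> borel_measurable borel" by measurable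
      qed (auto simp: \<Psi>_def weighted_trig_def abs_mult power_abs)
      also have "(\<integral>\<^sup>+t\<in>{0..pi}. \<Psi> t \<partial>lborel) = trig_mass p M P"
        unfolding trig_mass_def \<Psi>_def
        by (intro nn_integral_cong) (auto simp: indicator_def sin_ge_zero)
      finally show ?thesis .
    qed
    define H where "H \<theta> = ennreal (C * real m) * local_mean p m ?T \<theta>" for \<theta>
    show "\<exists>H\<in>borel_measurable borel.
       (\<integral>\<^sup>+\<theta>\<in>{0..pi}. H \<theta> \<partial>lborel) \<le> ennreal C' * trig_mass p M P \<and>
       (\<forall>\<theta>. H \<theta> \<le> ennreal (C' * real m) * trig_mass p M P) \<and>
       (\<forall>\<theta>. \<exists>b\<ge>0. (\<forall>\<tau>. \<bar>\<tau> - \<theta>\<bar> \<le> 1 / real m \<longrightarrow>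
               \<bar>?T \<tau>\<bar> \<le> b \<and> \<bar>?T \<tau> - ?T \<theta>\<bar> \<le> C' * (real m * \<bar>\<tau> - \<theta>\<bar>) * b) \<and>
             ennreal (b powr p * (\<bar>sin \<theta>\<bar> + 1 / real m)) \<le> H \<theta>)"
    proof (intro bexI[of _ H] conjI allI)
      show [measurable]: "H \<in> borel_measurable borel" unfolding H_def[abs_def] by measurable
      have "(\<integral>\<^sup>+\<theta>\<in>{0..pi}. H \<theta> \<partial>lborel) = ennreal C * (\<integral>\<^sup>+\<theta>\<in>{0..pi}. ennreal (real m) * local_mean p m ?T \<theta> \<partial>lborel)"
        by (subst nn_integral_cmult[symmetric], measurable)
          (auto intro!: nn_integral_cong simp: H_def ennreal_mult C less_imp_le mult_ac)
      also have "\<dots> \<le> ennreal C * (ennreal (3 * pi\<^sup>2) * (4 * trig_mass p M P))"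
      proof (intro mult_left_mono)
        have "(\<integral>\<^sup>+\<theta>\<in>{0..pi}. ennreal (real m) * local_mean p m ?T \<theta> \<partial>lborel) \<le> ennreal (3 * pi\<^sup>2) * (\<integral>\<^sup>+t\<in>{-2*pi..2*pi}. \<Psi> t \<partial>lborel)"
          unfolding \<Psi>_def by (rule nn_integral_local_mean_le[OF m]) measurable
        also have "\<dots> \<le> ennreal (3 * pi\<^sup>2) * (4 * trig_mass p M P)" by (intro mult_left_mono four) auto
        finally show "(\<integral>\<^sup>+\<theta>\<in>{0..pi}. ennreal (real m) * local_mean p m ?T \<theta> \<partial>lborel) \<le> ennreal (3 * pi\<^sup>2) * (4 * trig_mass p M P)" .
      qed auto
      also have "\<dots> = ennreal C' * trig_mass p M P"
      proof -
        have "ennreal C' = ennreal C * ennreal (3 * pi\<^sup>2) * ennreal 4"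
          using C by (simp add: C'_def ennreal_mult[symmetric] del: ennreal_numeral)
        then show ?thesis by (simp add: mult_ac)
      qed
      finally show "(\<integral>\<^sup>+\<theta>\<in>{0..pi}. H \<theta> \<partial>lborel) \<le> ennreal C' * trig_mass p M P" .
    next
      fix \<theta>
      have "local_mean p m ?T \<theta> \<le> (\<integral>\<^sup>+t\<in>{-2*pi..2*pi}. \<Psi> t \<partial>lborel)"
        unfolding local_mean_def \<Psi>_def
      proof (intro nn_integral_mono mult_right_mono ennreal_leI)
        fix t
        have "\<bar>?T t\<bar> powr p * \<bar>sin t\<bar> / (1 + (real m * sin ((t - \<theta>) / 2))\<^sup>2) \<le> \<bar>?T t\<bar> powr p * \<bar>sin t\<bar> / 1"
          by (intro divide_left_mono) (auto intro: add_pos_nonneg)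
        then show "\<bar>?T t\<bar> powr p * \<bar>sin t\<bar> / (1 + (real m * sin ((t - \<theta>) / 2))\<^sup>2) \<le> \<bar>?T t\<bar> powr p * \<bar>sin t\<bar>" by simp
      qed auto
      also note four
      finally have "H \<theta> \<le> ennreal (C * real m) * (4 * trig_mass p M P)"
        unfolding H_def by (rule mult_left_mono) simp
      also have "\<dots> = ennreal (4 * C * real m) * trig_mass p M P"
      proof -
        have "ennreal (4 * C * real m) = ennreal (C * real m) * ennreal 4"
          using C by (simp add: ennreal_mult[symmetric] del: ennreal_numeral)
        then show ?thesis by (simp add: mult_ac)
      qed
      also have "\<dots> \<le> ennreal (C' * real m) * trig_mass p M P"
        using CC by (intro mult_right_mono ennreal_leI) auto
      finally show "H \<theta> \<le> ennreal (C' * real m) * trig_mass p M P" .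
    next
      fix \<theta>
      have "trig_poly (B * m) ?T" unfolding weighted_trig_def[abs_def] by (rule trig_poly_weighted[OF deg])
      from *[rule_format, OF m order_refl this, of \<theta>] obtain b where b: "b \<ge> 0"
        "\<And>\<tau>. \<bar>\<tau> - \<theta>\<bar> \<le> 1 / real m \<Longrightarrow> \<bar>?T \<tau>\<bar> \<le> b"
        "\<And>\<tau>. \<bar>\<tau> - \<theta>\<bar> \<le> 1 / real m \<Longrightarrow> \<bar>?T \<tau> - ?T \<theta>\<bar> \<le> C * (real m * \<bar>\<tau> - \<theta>\<bar>) * b"
        "ennreal (b powr p * (\<bar>sin \<theta>\<bar> + 1 / real m)) \<le> H \<theta>" unfolding H_def by blast
      have "C * (real m * \<bar>\<tau> - \<theta>\<bar>) * b \<le> C' * (real m * \<bar>\<tau> - \<theta>\<bar>) * b" for \<tau>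
        using CC b(1) by (intro mult_right_mono) auto
      then show "\<exists>b\<ge>0. (\<forall>\<tau>. \<bar>\<tau> - \<theta>\<bar> \<le> 1 / real m \<longrightarrow>
               \<bar>?T \<tau>\<bar> \<le> b \<and> \<bar>?T \<tau> - ?T \<theta>\<bar> \<le> C' * (real m * \<bar>\<tau> - \<theta>\<bar>) * b) \<and>
             ennreal (b powr p * (\<bar>sin \<theta>\<bar> + 1 / real m)) \<le> H \<theta>"
        using b by (meson order_trans)
    qed
  qed
qed

section \<open>Taylor remainders and the weighted $L_1$ estimate\<close>

definition central_diff :: "nat \<Rightarrow> real \<Rightarrow> (real \<Rightarrow> real) \<Rightarrow> real \<Rightarrow> real" where
  "central_diff s u F x = (\<Sum>j\<le>s. (-1) ^ j * real (s choose j) * F (x + (real s / 2 - real j) * u))"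

lemma sum_alternating_binomial_Suc:
  fixes f :: "nat \<Rightarrow> real"
  shows "(\<Sum>j\<le>Suc s. (-1) ^ j * real (Suc s choose j) * f j) =
    (\<Sum>j\<le>s. (-1) ^ j * real (s choose j) * f j) - (\<Sum>j\<le>s. (-1) ^ j * real (s choose j) * f (Suc j))"
proof -
  have "(\<Sum>j\<le>Suc s. (-1) ^ j * real (Suc s choose j) * f j) =
     f 0 + (\<Sum>j\<le>s. (-1) ^ Suc j * real (Suc s choose Suc j) * f (Suc j))"
    by (subst sum.atMost_Suc_shift) simp
  also have "(\<Sum>j\<le>s. (-1) ^ Suc j * real (Suc s choose Suc j) * f (Suc j)) =
     (\<Sum>j\<le>s. (-1) ^ Suc j * real (s choose Suc j) * f (Suc j)) - (\<Sum>j\<le>s. (-1) ^ j * real (s choose j) * f (Suc j))"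
    unfolding sum_subtractf[symmetric] by (intro sum.cong) (auto simp: algebra_simps)
  also have "f 0 + ((\<Sum>j\<le>s. (-1) ^ Suc j * real (s choose Suc j) * f (Suc j)) - (\<Sum>j\<le>s. (-1) ^ j * real (s choose j) * f (Suc j)))
     = (\<Sum>j\<le>Suc s. (-1) ^ j * real (s choose j) * f j) - (\<Sum>j\<le>s. (-1) ^ j * real (s choose j) * f (Suc j))"
    by (subst sum.atMost_Suc_shift) simp
  finally show ?thesis by simp
qed

lemma central_diff_Suc: "central_diff (Suc s) u F x = central_diff s u (\<lambda>y. F (y + u / 2) - F (y - u / 2)) x"
proof -
  have "central_diff (Suc s) u F x =
    (\<Sum>j\<le>s. (-1) ^ j * real (s choose j) * F (x + (real (Suc s) / 2 - real j) * u)) -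
    (\<Sum>j\<le>s. (-1) ^ j * real (s choose j) * F (x + (real (Suc s) / 2 - real (Suc j)) * u))"
    unfolding central_diff_def by (rule sum_alternating_binomial_Suc)
  also have "\<dots> = central_diff s u (\<lambda>y. F (y + u / 2) - F (y - u / 2)) x"
    unfolding central_diff_def sum_subtractf[symmetric]
  proof (intro sum.cong refl)
    fix j
    have "x + (real (Suc s) / 2 - real j) * u = x + (real s / 2 - real j) * u + u / 2"
      "x + (real (Suc s) / 2 - real (Suc j)) * u = x + (real s / 2 - real j) * u - u / 2"
      by (simp_all add: field_simps)
    then show "(-1) ^ j * real (s choose j) * F (x + (real (Suc s) / 2 - real j) * u) -
        (-1) ^ j * real (s choose j) * F (x + (real (Suc s) / 2 - real (Suc j)) * u) =
        (-1) ^ j * real (s choose j) * (F (x + (real s / 2 - real j) * u + u / 2) - F (x + (real s / 2 - real j) * u - u / 2))"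
      by (simp only: right_diff_distrib)
  qed
  finally show ?thesis .
qed

lemma central_diff_diff: "central_diff s u (\<lambda>y. F y - G y) x = central_diff s u F x - central_diff s u G x"
  unfolding central_diff_def sum_subtractf[symmetric] by (intro sum.cong) (auto simp: algebra_simps)

lemma higher_pderiv_shift:
  fixes P :: "real poly"
  shows "(pderiv ^^ s) (pcompose P [:c, 1:]) = pcompose ((pderiv ^^ s) P) [:c, 1:]"
  by (induction s) (auto simp: pderiv_pcompose pderiv_pCons)

lemma higher_pderiv_diff: "(pderiv ^^ s) (P - Q) = (pderiv ^^ s) P - (pderiv ^^ s) (Q :: real poly)"
  by (induction s) (auto simp: pderiv_diff)

lemma higher_pderiv_degree_less: "degree P < s \<Longrightarrow> (pderiv ^^ s) P = (0 :: real poly)"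
proof (induction s arbitrary: P)
  case (Suc s)
  show ?case
  proof (cases "degree P = 0")
    case True
    then have "pderiv P = 0" by (simp add: pderiv_eq_0_iff)
    moreover have "(pderiv ^^ n) 0 = (0 :: real poly)" for n by (induction n) auto
    ultimately show ?thesis by (simp add: funpow_Suc_right del: funpow.simps)
  next
    case False
    then have "degree (pderiv P) < s" using Suc.prems by (simp add: degree_pderiv)
    then show ?thesis using Suc.IH by (simp add: funpow_Suc_right del: funpow.simps)
  qed
qed simp

text \<open>One first-order difference is split off at each induction step. For a polynomial it is
  again a polynomial, R, so the mean value theorem can be applied to its derivative of order
  s.\<close>

lemma central_diff_poly_mean_value:
  "\<exists>\<xi>. \<bar>\<xi> - x\<bar> \<le> real s / 2 * \<bar>u\<bar> \<and> central_diff s u (poly P) x = u ^ s * poly ((pderiv ^^ s) P) \<xi>"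
proof (induction s arbitrary: P)
  case 0
  then show ?case by (intro exI[of _ x]) (simp add: central_diff_def)
next
  case (Suc s)
  define R where "R = pcompose P [:u/2, 1:] - pcompose P [:-(u/2), 1:]"
  have R: "poly R = (\<lambda>y. poly P (y + u / 2) - poly P (y - u / 2))"
    by (auto simp: R_def poly_pcompose add.commute)
  obtain \<xi> where \<xi>: "\<bar>\<xi> - x\<bar> \<le> real s / 2 * \<bar>u\<bar>" "central_diff s u (poly R) x = u ^ s * poly ((pderiv ^^ s) R) \<xi>"
    using Suc.IH by blast
  let ?Q = "(pderiv ^^ s) P"
  have "poly ((pderiv ^^ s) R) \<xi> = poly ?Q (\<xi> + u / 2) - poly ?Q (\<xi> - u / 2)"
    by (simp add: R_def higher_pderiv_diff higher_pderiv_shift poly_pcompose add.commute)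
  moreover have "\<exists>\<xi>'. \<bar>\<xi>' - \<xi>\<bar> \<le> \<bar>u\<bar> / 2 \<and> poly ?Q (\<xi> + u / 2) - poly ?Q (\<xi> - u / 2) = u * poly (pderiv ?Q) \<xi>'"
  proof (cases u "0 :: real" rule: linorder_cases)
    case less
    then have "\<xi> + u / 2 < \<xi> - u / 2" by simp
    from poly_MVT[OF this, of ?Q] obtain z where "z > \<xi> + u / 2" "z < \<xi> - u / 2"
      "poly ?Q (\<xi> - u / 2) - poly ?Q (\<xi> + u / 2) = (\<xi> - u / 2 - (\<xi> + u / 2)) * poly (pderiv ?Q) z" by blast
    moreover from this less have "\<bar>z - \<xi>\<bar> \<le> \<bar>u\<bar> / 2" by linarith
    ultimately show ?thesis by (intro exI[of _ z]) (auto simp: algebra_simps)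
  next
    case equal
    then show ?thesis by auto
  next
    case greater
    then have "\<xi> - u / 2 < \<xi> + u / 2" by simp
    from poly_MVT[OF this, of ?Q] obtain z where "z > \<xi> - u / 2" "z < \<xi> + u / 2"
      "poly ?Q (\<xi> + u / 2) - poly ?Q (\<xi> - u / 2) = (\<xi> + u / 2 - (\<xi> - u / 2)) * poly (pderiv ?Q) z" by blast
    moreover from this greater have "\<bar>z - \<xi>\<bar> \<le> \<bar>u\<bar> / 2" by linarith
    ultimately show ?thesis by (intro exI[of _ z]) auto
  qed
  ultimately obtain \<xi>' where \<xi>': "\<bar>\<xi>' - \<xi>\<bar> \<le> \<bar>u\<bar> / 2" "poly ((pderiv ^^ s) R) \<xi> = u * poly (pderiv ?Q) \<xi>'"
    by metis
  have "\<bar>\<xi>' - x\<bar> \<le> real (Suc s) / 2 * \<bar>u\<bar>"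
  proof -
    have "\<bar>\<xi>' - x\<bar> \<le> \<bar>\<xi>' - \<xi>\<bar> + \<bar>\<xi> - x\<bar>" by simp
    also have "\<dots> \<le> \<bar>u\<bar> / 2 + real s / 2 * \<bar>u\<bar>" using \<xi>(1) \<xi>'(1) by (rule add_mono[rotated])
    finally show ?thesis by (simp add: field_simps)
  qed
  moreover have "central_diff (Suc s) u (poly P) x = u ^ Suc s * poly ((pderiv ^^ Suc s) P) \<xi>'"
    using \<xi>(2) \<xi>'(2) by (simp add: central_diff_Suc R)
  ultimately show ?case by blast
qed

lemma central_diff_poly_eq_0: "degree P < s \<Longrightarrow> central_diff s u (poly P) x = 0"
  using central_diff_poly_mean_value[of x s u P] by (auto simp: higher_pderiv_degree_less)

lemma abs_has_integral_le_nn_integral: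
  fixes f :: "real \<Rightarrow> real"
  assumes "(f has_integral I) {x..y}" "f absolutely_integrable_on {x..y}"
  shows "ennreal \<bar>I\<bar> \<le> (\<integral>\<^sup>+t\<in>{x..y}. ennreal \<bar>f t\<bar> \<partial>lborel)"
proof -
  have int: "f integrable_on {x..y}" "(\<lambda>t. \<bar>f t\<bar>) integrable_on {x..y}"
    using assms(2) by (auto simp: absolutely_integrable_on_def)
  have "\<bar>integral {x..y} f\<bar> \<le> integral {x..y} (\<lambda>t. \<bar>f t\<bar>)"
    using integral_norm_bound_integral[OF int] by simp
  then have "\<bar>I\<bar> \<le> integral {x..y} (\<lambda>t. \<bar>f t\<bar>)" using assms(1) by (simp add: integral_unique)
  moreover have "(\<integral>\<^sup>+t\<in>{x..y}. ennreal \<bar>f t\<bar> \<partial>lborel) = ennreal (integral {x..y} (\<lambda>t. \<bar>f t\<bar>))"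
    by (rule nn_integral_has_integral_lebesgue'[OF _ integrable_integral[OF int(2)]]) auto
  ultimately show ?thesis by (simp add: ennreal_leI)
qed

text \<open>Makes \<open>measurable\<close> accept integrals over an interval whose ends depend on
  the outer variable.\<close>

lemma pred_mem_Icc [measurable (raw)]:
  fixes f g h :: "'a \<Rightarrow> real"
  assumes [measurable]: "f \<in> borel_measurable M" "g \<in> borel_measurable M" "h \<in> borel_measurable M"
  shows "Measurable.pred M (\<lambda>x. h x \<in> {f x..g x})"
  unfolding atLeastAtMost_iff by measurable

text \<open>A function D 0 with its derivatives D 1, ..., D (r - 1), and w as the derivative of
  order r in the integral sense only. The chain is kept apart from \<open>nderiv\<close> so that the
  same estimates apply to polynomials, to differences with polynomials and to reflections.\<close>

definition deriv_chain :: "nat \<Rightarrow> (nat \<Rightarrow> real \<Rightarrow> real) \<Rightarrow> (real \<Rightarrow> real) \<Rightarrow> real \<Rightarrow> real \<Rightarrow> bool" where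
  "deriv_chain r D w a b \<longleftrightarrow>
     (\<forall>i<r - 1. \<forall>t\<in>{a..b}. (D i has_vector_derivative D (Suc i) t) (at t within {a..b})) \<and>
     (\<forall>c d. a \<le> c \<longrightarrow> c \<le> d \<longrightarrow> d \<le> b \<longrightarrow> (w has_integral (D (r - 1) d - D (r - 1) c)) {c..d}) \<and>
     w absolutely_integrable_on {a..b} \<and> w \<in> borel_measurable borel"

text \<open>Taylor's formula with integral remainder, stopped one order early. The increment of the
  last derivative is then bounded by an integral of |w|, and Tonelli produces the power r - 1.
  Factorials are simply dropped.\<close>

lemma taylor_remainder_right:
  assumes ch: "deriv_chain r D w a b" and r: "1 \<le> r" and xy: "a \<le> x" "x \<le> y" "y \<le> b"
  shows "ennreal \<bar>D 0 y - (\<Sum>i<r. (y - x) ^ i / fact i * D i x)\<bar>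
    \<le> (\<integral>\<^sup>+t\<in>{x..y}. ennreal ((y - t) ^ (r - 1) * \<bar>w t\<bar>) \<partial>lborel)"
proof -
  have der: "\<And>i t. i < r - 1 \<Longrightarrow> t \<in> {a..b} \<Longrightarrow> (D i has_vector_derivative D (Suc i) t) (at t within {a..b})"
    and hi: "\<And>c d. a \<le> c \<Longrightarrow> c \<le> d \<Longrightarrow> d \<le> b \<Longrightarrow> (w has_integral (D (r - 1) d - D (r - 1) c)) {c..d}"
    and ai: "w absolutely_integrable_on {a..b}" and [measurable]: "w \<in> borel_measurable borel"
    using ch by (auto simp: deriv_chain_def)
  have incr: "ennreal \<bar>D (r - 1) d - D (r - 1) c\<bar> \<le> (\<integral>\<^sup>+t\<in>{c..d}. ennreal \<bar>w t\<bar> \<partial>lborel)"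
    if "a \<le> c" "c \<le> d" "d \<le> b" for c d
  proof (rule abs_has_integral_le_nn_integral[OF hi[OF that]])
    show "w absolutely_integrable_on {c..d}"
      by (rule set_integrable_subset[OF ai]) (use that in auto)
  qed
  show ?thesis
  proof (cases "r = 1")
    case True
    then show ?thesis using incr[of x y] xy by simp
  next
    case False
    \<comment> \<open>The formula is applied with r - 1 derivatives, since w need not be a
      derivative everywhere.\<close>
    define p where "p = r - 1"
    have p: "0 < p" "r = Suc p" using False r by (auto simp: p_def)
    have contD: "continuous_on {x..y} (D p)"
    proof -
      have "continuous_on {a..b} (\<lambda>t. D p a + integral {a..t} w)"
        using ai by (intro continuous_intros indefinite_integral_continuous_1)
          (auto simp: absolutely_integrable_on_def)
      moreover have "D p a + integral {a..t} w = D p t" if "t \<in> {a..b}" for t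
        using hi[of a t] that by (auto simp: p_def integral_unique)
      ultimately have "continuous_on {a..b} (D p)" by (rule continuous_on_eq)
      then show ?thesis by (rule continuous_on_subset) (use xy in auto)
    qed
    have 1: "((\<lambda>t. ((y - t) ^ (p - 1) / fact (p - 1)) *\<^sub>R D p t) has_integral
        D 0 y - (\<Sum>i<p. ((y - x) ^ i / fact i) *\<^sub>R D i x)) {x..y}"
    proof (rule Taylor_has_integral[OF p(1) refl _ xy(2)])
      fix i t assume "i < p" "x \<le> t" "t \<le> y"
      then have "(D i has_vector_derivative D (Suc i) t) (at t within {a..b})"
        using xy by (intro der) (auto simp: p_def)
      then show "(D i has_vector_derivative D (Suc i) t) (at t within {x..y})"
        by (rule has_vector_derivative_within_subset) (use xy in auto)
    qed
    have 2: "((\<lambda>t. (y - t) ^ (p - 1) / fact (p - 1)) has_integral (y - x) ^ p / fact p) {x..y}"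
    proof -
      have "((\<lambda>t. (y - t) ^ (p - 1) / fact (p - 1)) has_integral (- ((y - y) ^ p / fact p)) - (- ((y - x) ^ p / fact p))) {x..y}"
      proof (rule fundamental_theorem_of_calculus[OF xy(2)])
        fix t
        have "fact p = real p * fact (p - 1)" using p(1) by (simp add: fact_reduce)
        then show "((\<lambda>t. - ((y - t) ^ p / fact p)) has_vector_derivative (y - t) ^ (p - 1) / fact (p - 1)) (at t within {x..y})"
          unfolding has_real_derivative_iff_has_vector_derivative[symmetric]
          using p(1) by (auto intro!: derivative_eq_intros simp: field_simps)
      qed
      then show ?thesis using p(1) by (simp add: zero_power)
    qed
    \<comment> \<open>By \<open>2\<close>, subtracting the constant D p x supplies exactly the
      missing Taylor term of degree r - 1.\<close>
    define h where "h t = (y - t) ^ (p - 1) / fact (p - 1) * (D p t - D p x)" for t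
    have hI: "(h has_integral D 0 y - (\<Sum>i<r. (y - x) ^ i / fact i * D i x)) {x..y}"
    proof -
      have "(\<lambda>t. ((y - t) ^ (p - 1) / fact (p - 1)) *\<^sub>R D p t - (y - t) ^ (p - 1) / fact (p - 1) * D p x) = h"
        by (auto simp: h_def right_diff_distrib)
      moreover have "(D 0 y - (\<Sum>i<p. ((y - x) ^ i / fact i) *\<^sub>R D i x)) - (y - x) ^ p / fact p * D p x
         = D 0 y - (\<Sum>i<r. (y - x) ^ i / fact i * D i x)" by (simp add: p(2))
      ultimately show ?thesis
        using has_integral_diff[OF 1 has_integral_mult_left[OF 2, of "D p x"]] by metis
    qed
    have conth: "continuous_on {x..y} h" unfolding h_def by (intro continuous_intros contD) auto
    have "ennreal \<bar>D 0 y - (\<Sum>i<r. (y - x) ^ i / fact i * D i x)\<bar> \<le> (\<integral>\<^sup>+t\<in>{x..y}. ennreal \<bar>h t\<bar> \<partial>lborel)"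
      by (rule abs_has_integral_le_nn_integral[OF hI absolutely_integrable_continuous_real[OF conth]])
    also have "\<dots> \<le> (\<integral>\<^sup>+t. (\<integral>\<^sup>+\<tau>. ennreal \<bar>w \<tau>\<bar> * indicator {x..y} \<tau> *
          (ennreal ((y - \<tau>) ^ (p - 1)) * indicator {\<tau>..y} t) \<partial>lborel) \<partial>lborel)"
    proof (intro nn_integral_mono)
      fix t
      show "ennreal \<bar>h t\<bar> * indicator {x..y} t \<le> (\<integral>\<^sup>+\<tau>. ennreal \<bar>w \<tau>\<bar> * indicator {x..y} \<tau> *
          (ennreal ((y - \<tau>) ^ (p - 1)) * indicator {\<tau>..y} t) \<partial>lborel)"
      proof (cases "t \<in> {x..y}")
        case True
        have "\<bar>h t\<bar> \<le> (y - t) ^ (p - 1) * \<bar>D p t - D p x\<bar>"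
        proof -
          have "(y - t) ^ (p - 1) / fact (p - 1) \<le> (y - t) ^ (p - 1) / 1"
            using True by (intro divide_left_mono) (auto simp: fact_ge_1)
          from mult_right_mono[OF this, of "\<bar>D p t - D p x\<bar>"] show ?thesis using True
            by (simp add: h_def abs_mult power_abs)
        qed
        then have "ennreal \<bar>h t\<bar> \<le> ennreal ((y - t) ^ (p - 1)) * ennreal \<bar>D p t - D p x\<bar>"
          using True by (simp add: ennreal_leI flip: ennreal_mult)
        also have "\<dots> \<le> ennreal ((y - t) ^ (p - 1)) * (\<integral>\<^sup>+\<tau>\<in>{x..t}. ennreal \<bar>w \<tau>\<bar> \<partial>lborel)"
          using incr[of x t] True xy by (intro mult_left_mono) (auto simp: p_def)
        also have "\<dots> = (\<integral>\<^sup>+\<tau>. ennreal ((y - t) ^ (p - 1)) * (ennreal \<bar>w \<tau>\<bar> * indicator {x..t} \<tau>) \<partial>lborel)"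
          by (rule nn_integral_cmult[symmetric]) measurable
        also have "\<dots> \<le> (\<integral>\<^sup>+\<tau>. ennreal \<bar>w \<tau>\<bar> * indicator {x..y} \<tau> *
          (ennreal ((y - \<tau>) ^ (p - 1)) * indicator {\<tau>..y} t) \<partial>lborel)"
          using True by (intro nn_integral_mono)
            (auto simp: indicator_def mult.commute intro!: mult_left_mono ennreal_leI power_mono)
        finally show ?thesis using True by simp
      qed simp
    qed
    also have "\<dots> = (\<integral>\<^sup>+\<tau>. (\<integral>\<^sup>+t. ennreal \<bar>w \<tau>\<bar> * indicator {x..y} \<tau> *
          (ennreal ((y - \<tau>) ^ (p - 1)) * indicator {\<tau>..y} t) \<partial>lborel) \<partial>lborel)"
      by (rule lborel_pair.Fubini') measurable
    also have "\<dots> = (\<integral>\<^sup>+\<tau>. ennreal \<bar>w \<tau>\<bar> * indicator {x..y} \<tau> *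
          (ennreal ((y - \<tau>) ^ (p - 1)) * emeasure lborel {\<tau>..y}) \<partial>lborel)"
      by (intro nn_integral_cong) (simp add: nn_integral_cmult nn_integral_cmult_indicator)
    also have "\<dots> = (\<integral>\<^sup>+t\<in>{x..y}. ennreal ((y - t) ^ (r - 1) * \<bar>w t\<bar>) \<partial>lborel)"
    proof (intro nn_integral_cong)
      fix t
      have "(y - t) ^ (p - 1) * (y - t) = (y - t) ^ p" using p(1) by (simp flip: power_Suc2)
      then show "ennreal \<bar>w t\<bar> * indicator {x..y} t * (ennreal ((y - t) ^ (p - 1)) * emeasure lborel {t..y}) =
         ennreal ((y - t) ^ (r - 1) * \<bar>w t\<bar>) * indicator {x..y} t"
        by (auto simp: indicator_def p(2) mult.commute simp flip: ennreal_mult)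
    qed
    finally show ?thesis .
  qed
qed

text \<open>Carries the remainder estimate from the right of x to its left; odd derivatives change
  sign.\<close>

lemma deriv_chain_reflect:
  assumes ch: "deriv_chain r D w a b" and r: "1 \<le> r"
  shows "deriv_chain r (\<lambda>i t. (-1) ^ i * D i (- t)) (\<lambda>t. (-1) ^ r * w (- t)) (- b) (- a)"
  unfolding deriv_chain_def
proof (intro conjI allI impI ballI)
  fix i t assume i: "i < r - 1" and t: "t \<in> {- b..- a}"
  have "(D i has_vector_derivative D (Suc i) (- t)) (at (- t) within {a..b})"
    using ch i t by (auto simp: deriv_chain_def)
  then have "(D i has_vector_derivative D (Suc i) (- t)) (at (- t) within uminus ` {- b..- a})"
    by simp
  moreover have "(uminus has_vector_derivative (- 1)) (at t within {- b..- a})"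
    using has_vector_derivative_minus[OF has_vector_derivative_id] by simp
  ultimately have "((\<lambda>t. D i (- t)) has_vector_derivative - D (Suc i) (- t)) (at t within {- b..- a})"
    using vector_diff_chain_within[of uminus "-1" t "{- b..- a}" "D i"] by (fastforce simp: o_def)
  from has_vector_derivative_mult[OF has_vector_derivative_const[of "(-1) ^ i"] this]
  show "((\<lambda>t. (-1) ^ i * D i (- t)) has_vector_derivative (-1) ^ Suc i * D (Suc i) (- t)) (at t within {- b..- a})"
    by simp
next
  fix c d assume cd: "- b \<le> c" "c \<le> d" "d \<le> - a"
  have "(w has_integral (D (r - 1) (- c) - D (r - 1) (- d))) {- d..- c}"
    using ch cd by (auto simp: deriv_chain_def)
  then have "((\<lambda>t. w (- t)) has_integral (D (r - 1) (- c) - D (r - 1) (- d))) {c..d}"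
    using has_integral_reflect_real[of w "D (r - 1) (- c) - D (r - 1) (- d)" "- c" "- d"] by simp
  from has_integral_mult_right[OF this, of "(-1) ^ r"]
  show "((\<lambda>t. (-1) ^ r * w (- t)) has_integral (-1) ^ (r - 1) * D (r - 1) (- d) - (-1) ^ (r - 1) * D (r - 1) (- c)) {c..d}"
    using r by (cases r) (auto simp: algebra_simps)
next
  have "w absolutely_integrable_on {a..b}" using ch by (simp add: deriv_chain_def)
  then have "(\<lambda>t. w (- t)) absolutely_integrable_on {- b..- a}"
    using absolutely_integrable_reflect_real[where f = w] by simp
  then show "(\<lambda>t. (-1) ^ r * w (- t)) absolutely_integrable_on {- b..- a}"
    by (intro set_integrable_mult_right)
next
  have [measurable]: "w \<in> borel_measurable borel" using ch by (simp add: deriv_chain_def)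
  show "(\<lambda>t. (-1) ^ r * w (- t)) \<in> borel_measurable borel" by measurable
qed

lemma nn_integral_lborel_uminus:
  fixes f :: "real \<Rightarrow> ennreal"
  assumes [measurable]: "f \<in> borel_measurable borel"
  shows "(\<integral>\<^sup>+t. f (- t) \<partial>lborel) = (\<integral>\<^sup>+t. f t \<partial>lborel)"
  using nn_integral_real_affine[of f "-1" 0] by simp

lemma taylor_remainder_left:
  assumes ch: "deriv_chain r D w a b" and r: "1 \<le> r" and xy: "a \<le> y" "y \<le> x" "x \<le> b"
  shows "ennreal \<bar>D 0 y - (\<Sum>i<r. (y - x) ^ i / fact i * D i x)\<bar>
    \<le> (\<integral>\<^sup>+t\<in>{y..x}. ennreal ((t - y) ^ (r - 1) * \<bar>w t\<bar>) \<partial>lborel)"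
proof -
  have [measurable]: "w \<in> borel_measurable borel" using ch by (simp add: deriv_chain_def)
  have "(\<Sum>i<r. (- y - (- x)) ^ i / fact i * ((-1) ^ i * D i (- (- x)))) = (\<Sum>i<r. (y - x) ^ i / fact i * D i x)"
  proof (intro sum.cong refl)
    fix i
    have "(- y - (- x)) ^ i * (-1) ^ i = (y - x) ^ i" by (simp flip: power_mult_distrib)
    then show "(- y - (- x)) ^ i / fact i * ((-1) ^ i * D i (- (- x))) = (y - x) ^ i / fact i * D i x"
      by (simp add: field_simps)
  qed
  with taylor_remainder_right[OF deriv_chain_reflect[OF ch r] r, of "- x" "- y"] xy
  have "ennreal \<bar>D 0 y - (\<Sum>i<r. (y - x) ^ i / fact i * D i x)\<bar>
    \<le> (\<integral>\<^sup>+t\<in>{- x..- y}. ennreal ((- y - t) ^ (r - 1) * \<bar>(-1) ^ r * w (- t)\<bar>) \<partial>lborel)"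
    by simp
  also have "\<dots> = (\<integral>\<^sup>+t. ennreal ((- t - y) ^ (r - 1) * \<bar>w (- t)\<bar>) * indicator {y..x} (- t) \<partial>lborel)"
    by (intro nn_integral_cong) (auto simp: indicator_def abs_mult minus_diff_commute)
  also have "\<dots> = (\<integral>\<^sup>+t\<in>{y..x}. ennreal ((t - y) ^ (r - 1) * \<bar>w t\<bar>) \<partial>lborel)"
    by (rule nn_integral_lborel_uminus) measurable
  finally show ?thesis .
qed

text \<open>A difference of order s >= r annihilates the Taylor polynomial of degree r - 1 at x, so
  only remainders are left. The remainder at any node is at most the integral for the extreme node
  on that side, and the binomial coefficients add up to 2^s.\<close>

lemma central_diff_le_remainders:
  assumes ch: "deriv_chain r D w (-1) 1" and r: "1 \<le> r" "r \<le> s"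
    and a: "a = real s / 2 * \<bar>u\<bar>" and x: "-1 \<le> x - a" "x + a \<le> 1"
  shows "ennreal \<bar>central_diff s u (D 0) x\<bar> \<le> 2 ^ s *
    ((\<integral>\<^sup>+t\<in>{x..x + a}. ennreal ((x + a - t) ^ (r - 1) * \<bar>w t\<bar>) \<partial>lborel) +
     (\<integral>\<^sup>+t\<in>{x - a..x}. ennreal ((t - (x - a)) ^ (r - 1) * \<bar>w t\<bar>) \<partial>lborel))"
    (is "_ \<le> _ * ?R")
proof -
  define P where "P = pcompose (\<Sum>i<r. monom (D i x / fact i) i) [:- x, 1:]"
  have P: "poly P y = (\<Sum>i<r. (y - x) ^ i / fact i * D i x)" for y
    by (simp add: P_def poly_pcompose poly_sum poly_monom mult.commute)
  have "degree (\<Sum>i<r. monom (D i x / fact i) i) \<le> r - 1"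
    by (intro degree_sum_le) (auto intro: order_trans[OF degree_monom_le])
  then have degP: "degree P < s"
    using r degree_pcompose_le[of "\<Sum>i<r. monom (D i x / fact i) i" "[:- x, 1:]"] by (simp add: P_def)
  have a0: "0 \<le> a" by (simp add: a)
  have node: "ennreal \<bar>D 0 y - poly P y\<bar> \<le> ?R" if y: "\<bar>y - x\<bar> \<le> a" for y
  proof (cases "x \<le> y")
    case True
    have "ennreal \<bar>D 0 y - poly P y\<bar> \<le> (\<integral>\<^sup>+t\<in>{x..y}. ennreal ((y - t) ^ (r - 1) * \<bar>w t\<bar>) \<partial>lborel)"
      unfolding P by (rule taylor_remainder_right[OF ch r(1)]) (use True y x a0 in auto)
    also have "\<dots> \<le> (\<integral>\<^sup>+t\<in>{x..x + a}. ennreal ((x + a - t) ^ (r - 1) * \<bar>w t\<bar>) \<partial>lborel)"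
      using y by (intro nn_integral_mono)
        (auto simp: indicator_def intro!: ennreal_leI mult_right_mono power_mono)
    also have "\<dots> \<le> ?R" by simp
    finally show ?thesis .
  next
    case False
    have "ennreal \<bar>D 0 y - poly P y\<bar> \<le> (\<integral>\<^sup>+t\<in>{y..x}. ennreal ((t - y) ^ (r - 1) * \<bar>w t\<bar>) \<partial>lborel)"
      unfolding P by (rule taylor_remainder_left[OF ch r(1)]) (use False y x a0 in auto)
    also have "\<dots> \<le> (\<integral>\<^sup>+t\<in>{x - a..x}. ennreal ((t - (x - a)) ^ (r - 1) * \<bar>w t\<bar>) \<partial>lborel)"
      using y by (intro nn_integral_mono)
        (auto simp: indicator_def intro!: ennreal_leI mult_right_mono power_mono)
    also have "\<dots> \<le> ?R" by simp
    finally show ?thesis .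
  qed
  have "central_diff s u (D 0) x = central_diff s u (\<lambda>y. D 0 y - poly P y) x"
    by (simp add: central_diff_diff central_diff_poly_eq_0[OF degP])
  then have "\<bar>central_diff s u (D 0) x\<bar> \<le> (\<Sum>j\<le>s. real (s choose j) *
      \<bar>D 0 (x + (real s / 2 - real j) * u) - poly P (x + (real s / 2 - real j) * u)\<bar>)"
    unfolding central_diff_def by (intro order_trans[OF eq_refl[OF arg_cong[where f=abs]] order_trans[OF sum_abs]])
      (auto simp: abs_mult intro!: sum_mono)
  then have "ennreal \<bar>central_diff s u (D 0) x\<bar> \<le> ennreal (\<Sum>j\<le>s. real (s choose j) *
      \<bar>D 0 (x + (real s / 2 - real j) * u) - poly P (x + (real s / 2 - real j) * u)\<bar>)"
    by (rule ennreal_leI)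
  also have "\<dots> = (\<Sum>j\<le>s. ennreal (real (s choose j)) *
      ennreal \<bar>D 0 (x + (real s / 2 - real j) * u) - poly P (x + (real s / 2 - real j) * u)\<bar>)"
    by (subst sum_ennreal[symmetric]) (auto simp: ennreal_mult)
  also have "\<dots> \<le> (\<Sum>j\<le>s. ennreal (real (s choose j)) * ?R)"
  proof (intro sum_mono mult_left_mono node)
    fix j assume "j \<in> {..s}"
    then have "\<bar>real s / 2 - real j\<bar> \<le> real s / 2" by (auto simp: abs_if)
    from mult_right_mono[OF this, of "\<bar>u\<bar>"] show "\<bar>x + (real s / 2 - real j) * u - x\<bar> \<le> a"
      by (simp add: a abs_mult)
  qed auto
  also have "\<dots> = ennreal (\<Sum>j\<le>s. real (s choose j)) * ?R"
    by (simp add: sum_distrib_right[symmetric])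
  also have "(\<Sum>j\<le>s. real (s choose j)) = 2 ^ s"
    using choose_row_sum[of s] by (metis of_nat_numeral of_nat_power of_nat_sum)
  finally show ?thesis by (simp flip: ennreal_power)
qed

section \<open>The weight and the geometry of its stencils\<close>

lemma dt_phi_measurable [measurable]: "dt_phi \<in> borel_measurable borel"
  unfolding dt_phi_def[abs_def] by measurable

lemma dt_phi_minus [simp]: "dt_phi (- x) = dt_phi x"
  by (simp add: dt_phi_def)

lemma dt_phi_cos: "dt_phi (cos \<theta>) = \<bar>sin \<theta>\<bar>"
  using sin_squared_eq[of \<theta>] by (metis dt_phi_def real_sqrt_abs)

lemma dt_phi_nonneg: "x \<in> {-1..1} \<Longrightarrow> 0 \<le> dt_phi x"
  by (auto simp: dt_phi_def abs_square_le_1)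

lemma dt_phi_square: "x \<in> {-1..1} \<Longrightarrow> (dt_phi x)\<^sup>2 = (1 - x) * (1 + x)"
proof -
  assume "x \<in> {-1..1}"
  then have "0 \<le> 1 - x\<^sup>2" by (auto simp: abs_square_le_1)
  then show ?thesis by (simp add: dt_phi_def) (simp add: power2_eq_square algebra_simps)
qed

text \<open>The section at fixed t of the region of integration when the right remainder, integrated
  over x, is treated by Tonelli.\<close>

definition stencil_reach :: "real \<Rightarrow> real \<Rightarrow> real set" where
  "stencil_reach A t = {x. -1 \<le> x \<and> x < 1 \<and> x \<le> t \<and> t \<le> x + A * dt_phi x \<and> x + A * dt_phi x \<le> 1}"

text \<open>If x is more than four times as far from 1 as t, the half-stencil covers at least three
  quarters of the distance from x to 1. Squaring and cancelling 1 - x gives (9/16)(1 - x) <= A^2 (1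
  + x), and 1 - t is smaller than the left side. Thus t lies in the endpoint zone 1 - t <= A
  \<phi>(t).\<close>

lemma stencil_reach_near_end:
  assumes A: "0 \<le> A" and x: "x \<in> stencil_reach A t" and far: "4 * (1 - t) < 1 - x"
  shows "1 - t \<le> A * dt_phi t"
proof -
  have xs: "-1 \<le> x" "x < 1" "x \<le> t" "t \<le> x + A * dt_phi x" "t \<le> 1"
    using x by (auto simp: stencil_reach_def)
  define y where "y = A * dt_phi x"
  have "t \<le> x + y" using xs by (simp add: y_def)
  then have "3 / 4 * (1 - x) \<le> y" using far by argo
  then have "3 / 4 * (1 - x) \<le> A * dt_phi x" by (simp only: y_def)
  then have "(3 / 4 * (1 - x))\<^sup>2 \<le> (A * dt_phi x)\<^sup>2" using xs by (intro power_mono) auto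
  also have "\<dots> = A\<^sup>2 * ((1 - x) * (1 + x))" using xs by (simp add: power_mult_distrib dt_phi_square)
  also have "(3 / 4 * (1 - x))\<^sup>2 = (1 - x) * (9 / 16 * (1 - x))"
    by (simp add: power2_eq_square algebra_simps)
  finally have "(1 - x) * (9 / 16 * (1 - x)) \<le> (1 - x) * (A\<^sup>2 * (1 + x))"
    by (simp only: mult.left_commute)
  then have 1: "9 / 16 * (1 - x) \<le> A\<^sup>2 * (1 + x)" using xs by (subst (asm) mult_le_cancel_left_pos) auto
  have "A\<^sup>2 * (1 + x) \<le> A\<^sup>2 * (1 + t)" using xs by (intro mult_left_mono) auto
  with 1 have "9 / 16 * (1 - x) \<le> A\<^sup>2 * (1 + t)" by simp
  moreover have "1 - t \<le> 9 / 16 * (1 - x)" using far xs by argo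
  ultimately have "1 - t \<le> A\<^sup>2 * (1 + t)" by (rule order_trans[rotated])
  then have "(1 - t) * (1 - t) \<le> (1 - t) * (A\<^sup>2 * (1 + t))" using xs by (intro mult_left_mono) auto
  also have "\<dots> = (A * dt_phi t)\<^sup>2" using xs by (simp add: power_mult_distrib dt_phi_square mult_ac)
  finally have "(1 - t)\<^sup>2 \<le> (A * dt_phi t)\<^sup>2" by (simp add: power2_eq_square)
  then show ?thesis by (rule power2_le_imp_le) (use A xs dt_phi_nonneg in auto)
qed

lemma dt_phi_le_twice:
  assumes "-1 \<le> x" "x \<le> t" "t \<le> 1" "1 - x \<le> 4 * (1 - t)"
  shows "dt_phi x \<le> 2 * dt_phi t"
proof -
  have "(1 - x) * (1 + x) \<le> (4 * (1 - t)) * (1 + t)" using assms by (intro mult_mono) auto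
  moreover have "(2 * dt_phi t)\<^sup>2 = (4 * (1 - t)) * (1 + t)" "(dt_phi x)\<^sup>2 = (1 - x) * (1 + x)"
    using assms by (simp_all add: power_mult_distrib dt_phi_square)
  ultimately have "(dt_phi x)\<^sup>2 \<le> (2 * dt_phi t)\<^sup>2" by simp
  then show ?thesis by (rule power2_le_imp_le) (use assms dt_phi_nonneg[of t] in auto)
qed

text \<open>Either x and t are at comparable distance from 1 and \<phi>(x) <= 2\<phi>(t), or t is in
  the endpoint zone, where even the whole distance from t to 1 is at most A \<phi>(t).\<close>

lemma stencil_reach_pointwise:
  assumes A: "0 \<le> A" and x: "x \<in> stencil_reach A t"
  shows "x + A * dt_phi x - t \<le> 2 * A * dt_phi t"
proof (cases "4 * (1 - t) < 1 - x")
  case True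
  have "0 \<le> A * dt_phi t" using stencil_reach_near_end[OF A x True] x by (auto simp: stencil_reach_def)
  then show ?thesis using stencil_reach_near_end[OF A x True] x by (auto simp: stencil_reach_def)
next
  case False
  then have "dt_phi x \<le> 2 * dt_phi t" using x by (intro dt_phi_le_twice) (auto simp: stencil_reach_def)
  from mult_left_mono[OF this A] show ?thesis using x by (auto simp: stencil_reach_def)
qed

text \<open>An admissible right end forces A (1 + y) <= \<phi>(y), and y <= (1 + y)/2; so the slope
  -A y/\<phi>(y) of A \<phi> is at least -1/2. The argument uses the difference of \<phi>^2 instead
  of a derivative, because \<phi> is not differentiable at -1.\<close>

lemma stencil_end_expanding:
  assumes A: "0 \<le> A" and x: "-1 \<le> x" "x < x'" "x' < 1"
    and valid: "x + A * dt_phi x \<le> 1" "x' + A * dt_phi x' \<le> 1"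
  shows "(x' - x) / 2 \<le> (x' + A * dt_phi x') - (x + A * dt_phi x)"
proof -
  have lower: "A * (1 + y) \<le> dt_phi y" if y: "-1 \<le> y" "y < 1" "y + A * dt_phi y \<le> 1" for y
  proof -
    have "(A * dt_phi y)\<^sup>2 \<le> (1 - y)\<^sup>2" using y A dt_phi_nonneg[of y] by (intro power_mono) auto
    moreover have "(A * dt_phi y)\<^sup>2 = (1 - y) * (A\<^sup>2 * (1 + y))"
      using y by (simp add: power_mult_distrib dt_phi_square mult_ac)
    ultimately have "(1 - y) * (A\<^sup>2 * (1 + y)) \<le> (1 - y) * (1 - y)"
      by (simp add: power2_eq_square[of "1 - y"])
    then have "A\<^sup>2 * (1 + y) \<le> 1 - y" using y by (subst (asm) mult_le_cancel_left_pos) auto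
    then have "A\<^sup>2 * (1 + y) * (1 + y) \<le> (1 - y) * (1 + y)" using y by (intro mult_right_mono) auto
    moreover have "(A * (1 + y))\<^sup>2 = A\<^sup>2 * (1 + y) * (1 + y)" by (simp add: power2_eq_square mult_ac)
    ultimately have "(A * (1 + y))\<^sup>2 \<le> (dt_phi y)\<^sup>2" using y by (simp add: dt_phi_square)
    then show ?thesis by (rule power2_le_imp_le) (use y dt_phi_nonneg in auto)
  qed
  let ?f = "dt_phi x" and ?f' = "dt_phi x'"
  have "0 < (1 - x') * (1 + x')" using x by (intro mult_pos_pos) auto
  then have "0 < ?f'\<^sup>2" using x by (simp add: dt_phi_square)
  then have f': "0 < ?f'" using x dt_phi_nonneg[of x'] by (auto simp: less_le)
  have f: "0 \<le> ?f" using x by (intro dt_phi_nonneg) auto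
  have "2 * (A * (x + x')) \<le> A * (1 + x) + A * (1 + x')"
  proof -
    have "A * (x + x') \<le> A * 2" using x A by (intro mult_left_mono) auto
    then show ?thesis by (simp add: algebra_simps)
  qed
  also have "\<dots> \<le> ?f + ?f'" using lower[of x] lower[of x'] x valid by (intro add_mono) auto
  finally have "(x' - x) * (2 * (A * (x + x'))) \<le> (x' - x) * (?f + ?f')" using x by (intro mult_left_mono) auto
  moreover have "(x' - x) * (x + x') = (?f - ?f') * (?f + ?f')"
  proof -
    have "(?f - ?f') * (?f + ?f') = ?f\<^sup>2 - ?f'\<^sup>2" by (simp add: power2_eq_square algebra_simps)
    also have "\<dots> = (x' - x) * (x + x')" using x by (simp add: dt_phi_square algebra_simps)
    finally show ?thesis by simp
  qed
  then have "(x' - x) * (2 * (A * (x + x'))) = (2 * (A * (?f - ?f'))) * (?f + ?f')"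
    by (metis (no_types, opaque_lifting) mult.assoc mult.left_commute)
  ultimately have "(2 * (A * (?f - ?f'))) * (?f + ?f') \<le> (x' - x) * (?f + ?f')" by simp
  then have "2 * (A * (?f - ?f')) \<le> x' - x" using f f' by (subst (asm) mult_le_cancel_right_pos) auto
  then have "2 * (A * ?f) - 2 * (A * ?f') \<le> x' - x" by (simp add: right_diff_distrib)
  then show ?thesis by argo
qed

lemma stencil_reach_measurable [measurable]: "stencil_reach A t \<in> sets borel"
  unfolding stencil_reach_def by measurable

text \<open>With L = 2 A \<phi>(t), the points x comparable to t lie in [t - L, t], and the far ones
  in an interval of length 2L around any one of them. The integrand is at most L^n, so 3L bounds
  what is left.\<close>

lemma nn_integral_stencil_kernel_le:
  assumes A: "0 \<le> A" and t: "t \<in> {-1..1}"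
  shows "(\<integral>\<^sup>+x\<in>stencil_reach A t. ennreal ((x + A * dt_phi x - t) ^ n) \<partial>lborel)
    \<le> ennreal (3 * (2 * A * dt_phi t) ^ Suc n)"
proof -
  define L where "L = 2 * A * dt_phi t"
  have L0: "0 \<le> L" using A t dt_phi_nonneg[of t] by (simp add: L_def)
  let ?Sb = "{x \<in> stencil_reach A t. 4 * (1 - t) < 1 - x}"
  obtain x0 where x0: "?Sb \<subseteq> {x0 - L..x0 + L}"
  proof (cases "?Sb = {}")
    case True
    then show ?thesis using that[of 0] by auto
  next
    case False
    then obtain x0 where x0: "x0 \<in> ?Sb" by blast
    \<comment> \<open>The right ends of two far stencils both lie in [t, 1], which is short, and the
      end map expands distances by at least 1/2.\<close>
    have close: "y - x \<le> L" if "x \<in> ?Sb" "y \<in> ?Sb" "x < y" for x y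
    proof -
      have "(y - x) / 2 \<le> (y + A * dt_phi y) - (x + A * dt_phi x)"
        by (rule stencil_end_expanding[OF A]) (use that in \<open>auto simp: stencil_reach_def\<close>)
      also have "\<dots> \<le> 1 - t" using that by (auto simp: stencil_reach_def)
      also have "\<dots> \<le> A * dt_phi t" using stencil_reach_near_end[OF A, of x t] that by auto
      finally show ?thesis by (simp add: L_def)
    qed
    have "x \<in> {x0 - L..x0 + L}" if "x \<in> ?Sb" for x
      using close[OF that x0] close[OF x0 that] L0 by (cases x x0 rule: linorder_cases) auto
    then show ?thesis using that by blast
  qed
  have cover: "stencil_reach A t \<subseteq> {t - L..t} \<union> {x0 - L..x0 + L}"
  proof
    fix x assume x: "x \<in> stencil_reach A t"
    show "x \<in> {t - L..t} \<union> {x0 - L..x0 + L}"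
    proof (cases "4 * (1 - t) < 1 - x")
      case True
      then show ?thesis using x x0 by blast
    next
      case False
      have "dt_phi x \<le> 2 * dt_phi t"
        by (rule dt_phi_le_twice) (use x False in \<open>auto simp: stencil_reach_def\<close>)
      from mult_left_mono[OF this A] show ?thesis using x by (auto simp: stencil_reach_def L_def)
    qed
  qed
  have "(\<integral>\<^sup>+x\<in>stencil_reach A t. ennreal ((x + A * dt_phi x - t) ^ n) \<partial>lborel)
    \<le> (\<integral>\<^sup>+x. ennreal (L ^ n) * indicator ({t - L..t} \<union> {x0 - L..x0 + L}) x \<partial>lborel)"
  proof (intro nn_integral_mono)
    fix x
    show "ennreal ((x + A * dt_phi x - t) ^ n) * indicator (stencil_reach A t) x
      \<le> ennreal (L ^ n) * indicator ({t - L..t} \<union> {x0 - L..x0 + L}) x"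
    proof (cases "x \<in> stencil_reach A t")
      case True
      then have "(x + A * dt_phi x - t) ^ n \<le> L ^ n"
        using stencil_reach_pointwise[OF A True] unfolding L_def
        by (intro power_mono) (auto simp: stencil_reach_def)
      moreover have "x \<in> {t - L..t} \<union> {x0 - L..x0 + L}" using cover True by blast
      ultimately show ?thesis using True by (simp add: ennreal_leI)
    qed simp
  qed
  also have "\<dots> = ennreal (L ^ n) * emeasure lborel ({t - L..t} \<union> {x0 - L..x0 + L})"
    by (rule nn_integral_cmult_indicator) measurable
  also have "\<dots> \<le> ennreal (L ^ n) * (ennreal L + ennreal (2 * L))"
  proof (intro mult_left_mono order_trans[OF emeasure_subadditive] add_mono)
    show "emeasure lborel {t - L..t} \<le> ennreal L" using L0 by simp
    show "emeasure lborel {x0 - L..x0 + L} \<le> ennreal (2 * L)" using L0 by (simp add: ennreal_leI)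
  qed auto
  also have "\<dots> = ennreal (3 * L ^ Suc n)"
    using L0 by (simp flip: ennreal_plus ennreal_mult add: algebra_simps)
  finally show ?thesis by (simp add: L_def)
qed

text \<open>For n = r - 1 and A = s|h|/2 this is one of the two integrals that bound the difference
  of order s at x.\<close>

definition right_remainder :: "real \<Rightarrow> nat \<Rightarrow> (real \<Rightarrow> real) \<Rightarrow> real \<Rightarrow> ennreal" where
  "right_remainder A n w x =
    (\<integral>\<^sup>+t\<in>{x..x + A * dt_phi x}. ennreal ((x + A * dt_phi x - t) ^ n * \<bar>w t\<bar>) \<partial>lborel)"

definition left_remainder :: "real \<Rightarrow> nat \<Rightarrow> (real \<Rightarrow> real) \<Rightarrow> real \<Rightarrow> ennreal" where
  "left_remainder A n w x =
    (\<integral>\<^sup>+t\<in>{x - A * dt_phi x..x}. ennreal ((t - (x - A * dt_phi x)) ^ n * \<bar>w t\<bar>) \<partial>lborel)"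

lemma left_remainder_eq:
  assumes [measurable]: "w \<in> borel_measurable borel"
  shows "left_remainder A n w x = right_remainder A n (\<lambda>t. w (- t)) (- x)"
proof -
  have "left_remainder A n w x =
    (\<integral>\<^sup>+t. ennreal ((- t - (x - A * dt_phi x)) ^ n * \<bar>w (- t)\<bar>) * indicator {x - A * dt_phi x..x} (- t) \<partial>lborel)"
    unfolding left_remainder_def by (rule nn_integral_lborel_uminus[symmetric]) measurable
  also have "\<dots> = right_remainder A n (\<lambda>t. w (- t)) (- x)"
    unfolding right_remainder_def
    by (intro nn_integral_cong) (auto simp: indicator_def algebra_simps)
  finally show ?thesis .
qed

lemma right_remainder_measurable [measurable]:
  assumes [measurable]: "w \<in> borel_measurable borel"
  shows "right_remainder A n w \<in> borel_measurable borel"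
  unfolding right_remainder_def[abs_def] by measurable

lemma left_remainder_measurable [measurable]:
  assumes [measurable]: "w \<in> borel_measurable borel"
  shows "left_remainder A n w \<in> borel_measurable borel"
  unfolding left_remainder_def[abs_def] by measurable

text \<open>Tonelli and the kernel bound: n + 1 powers of A \<phi>(t) come out, so that n = r - 1
  produces exactly the weight \<phi>^r and the factor |h|^r.\<close>

lemma nn_integral_right_remainder_le:
  assumes A: "0 \<le> A" and [measurable]: "w \<in> borel_measurable borel"
  shows "(\<integral>\<^sup>+x\<in>{x. -1 \<le> x \<and> x \<le> 1 \<and> x + A * dt_phi x \<le> 1}. right_remainder A n w x \<partial>lborel)
    \<le> ennreal (3 * (2 * A) ^ Suc n) * (\<integral>\<^sup>+t\<in>{-1..1}. ennreal (dt_phi t ^ Suc n * \<bar>w t\<bar>) \<partial>lborel)"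
proof -
  let ?V = "{x. -1 \<le> x \<and> x \<le> 1 \<and> x + A * dt_phi x \<le> 1}"
  define K where "K x t = ennreal ((x + A * dt_phi x - t) ^ n) * indicator (stencil_reach A t) x" for x t
  have [measurable]: "case_prod K \<in> borel_measurable (borel \<Otimes>\<^sub>M borel)"
  proof -
    \<comment> \<open>The indicator of a set that moves with t is spelled out as a condition on both
      variables, to obtain joint measurability.\<close>
    have "K = (\<lambda>x t. ennreal ((x + A * dt_phi x - t) ^ n) *
       (if -1 \<le> x \<and> x < 1 \<and> x \<le> t \<and> t \<le> x + A * dt_phi x \<and> x + A * dt_phi x \<le> 1 then 1 else 0))"
      by (auto simp: K_def stencil_reach_def indicator_def fun_eq_iff)
    then show ?thesis by (simp only:) measurable
  qed
  have "(\<integral>\<^sup>+x\<in>?V. right_remainder A n w x \<partial>lborel) \<le>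
     (\<integral>\<^sup>+x. (\<integral>\<^sup>+t. ennreal \<bar>w t\<bar> * indicator {-1..1} t * K x t \<partial>lborel) \<partial>lborel)"
  proof (rule nn_integral_mono_AE)
    \<comment> \<open>\<open>stencil_reach\<close> excludes x = 1.\<close>
    have "AE x in lborel. x \<noteq> (1::real)" by (rule AE_lborel_singleton)
    then show "AE x in lborel. right_remainder A n w x * indicator ?V x \<le>
      (\<integral>\<^sup>+t. ennreal \<bar>w t\<bar> * indicator {-1..1} t * K x t \<partial>lborel)"
    proof eventually_elim
      case (elim x)
      show ?case
      proof (cases "x \<in> ?V")
        case True
        then have "right_remainder A n w x \<le> (\<integral>\<^sup>+t. ennreal \<bar>w t\<bar> * indicator {-1..1} t * K x t \<partial>lborel)"
          unfolding right_remainder_def using elim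
          by (intro nn_integral_mono)
            (auto simp: indicator_def K_def stencil_reach_def ennreal_mult mult.commute)
        then show ?thesis using True by simp
      qed simp
    qed
  qed
  also have "\<dots> = (\<integral>\<^sup>+t. (\<integral>\<^sup>+x. ennreal \<bar>w t\<bar> * indicator {-1..1} t * K x t \<partial>lborel) \<partial>lborel)"
    by (rule lborel_pair.Fubini'[symmetric]) measurable
  also have "\<dots> = (\<integral>\<^sup>+t. ennreal \<bar>w t\<bar> * indicator {-1..1} t * (\<integral>\<^sup>+x. K x t \<partial>lborel) \<partial>lborel)"
    by (intro nn_integral_cong nn_integral_cmult) measurable
  also have "\<dots> \<le> (\<integral>\<^sup>+t. ennreal (3 * (2 * A) ^ Suc n) * (ennreal (dt_phi t ^ Suc n * \<bar>w t\<bar>) * indicator {-1..1} t) \<partial>lborel)"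
  proof (intro nn_integral_mono)
    fix t
    show "ennreal \<bar>w t\<bar> * indicator {-1..1} t * (\<integral>\<^sup>+x. K x t \<partial>lborel) \<le>
      ennreal (3 * (2 * A) ^ Suc n) * (ennreal (dt_phi t ^ Suc n * \<bar>w t\<bar>) * indicator {-1..1} t)"
    proof (cases "t \<in> {-1..1}")
      case True
      have "(\<integral>\<^sup>+x. K x t \<partial>lborel) \<le> ennreal (3 * (2 * A * dt_phi t) ^ Suc n)"
        unfolding K_def by (rule nn_integral_stencil_kernel_le[OF A True])
      then have "ennreal \<bar>w t\<bar> * (\<integral>\<^sup>+x. K x t \<partial>lborel) \<le> ennreal \<bar>w t\<bar> * ennreal (3 * (2 * A * dt_phi t) ^ Suc n)"
        by (rule mult_left_mono) simp
      also have "\<dots> = ennreal (3 * (2 * A) ^ Suc n) * ennreal (dt_phi t ^ Suc n * \<bar>w t\<bar>)"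
        using A True dt_phi_nonneg[of t]
        by (simp flip: ennreal_mult add: power_mult_distrib mult_ac)
      finally show ?thesis using True by simp
    qed simp
  qed
  also have "\<dots> = ennreal (3 * (2 * A) ^ Suc n) * (\<integral>\<^sup>+t\<in>{-1..1}. ennreal (dt_phi t ^ Suc n * \<bar>w t\<bar>) \<partial>lborel)"
    by (rule nn_integral_cmult) measurable
  finally show ?thesis .
qed

lemma nn_integral_left_remainder_le:
  assumes A: "0 \<le> A" and [measurable]: "w \<in> borel_measurable borel"
  shows "(\<integral>\<^sup>+x\<in>{x. -1 \<le> x \<and> x \<le> 1 \<and> -1 \<le> x - A * dt_phi x}. left_remainder A n w x \<partial>lborel)
    \<le> ennreal (3 * (2 * A) ^ Suc n) * (\<integral>\<^sup>+t\<in>{-1..1}. ennreal (dt_phi t ^ Suc n * \<bar>w t\<bar>) \<partial>lborel)"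
proof -
  let ?V = "{x. -1 \<le> x \<and> x \<le> 1 \<and> x + A * dt_phi x \<le> 1}"
  have "(\<integral>\<^sup>+x\<in>{x. -1 \<le> x \<and> x \<le> 1 \<and> -1 \<le> x - A * dt_phi x}. left_remainder A n w x \<partial>lborel) =
    (\<integral>\<^sup>+x. right_remainder A n (\<lambda>t. w (- t)) (- x) * indicator ?V (- x) \<partial>lborel)"
    by (intro nn_integral_cong) (auto simp: left_remainder_eq indicator_def)
  also have "\<dots> = (\<integral>\<^sup>+x\<in>?V. right_remainder A n (\<lambda>t. w (- t)) x \<partial>lborel)"
    by (rule nn_integral_lborel_uminus) measurable
  also have "\<dots> \<le> ennreal (3 * (2 * A) ^ Suc n) * (\<integral>\<^sup>+t\<in>{-1..1}. ennreal (dt_phi t ^ Suc n * \<bar>w (- t)\<bar>) \<partial>lborel)"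
    by (rule nn_integral_right_remainder_le[OF A]) measurable
  also have "(\<integral>\<^sup>+t\<in>{-1..1}. ennreal (dt_phi t ^ Suc n * \<bar>w (- t)\<bar>) \<partial>lborel) =
    (\<integral>\<^sup>+t. ennreal (dt_phi (- t) ^ Suc n * \<bar>w (- t)\<bar>) * indicator {-1..1} (- t) \<partial>lborel)"
    by (intro nn_integral_cong) (auto simp: indicator_def)
  also have "\<dots> = (\<integral>\<^sup>+t\<in>{-1..1}. ennreal (dt_phi t ^ Suc n * \<bar>w t\<bar>) \<partial>lborel)"
    by (rule nn_integral_lborel_uminus) measurable
  finally show ?thesis .
qed

lemma dt_diff_central_diff:
  "dt_diff s h g x = (if x + real s / 2 * h * dt_phi x \<in> {-1..1} \<and> x - real s / 2 * h * dt_phi x \<in> {-1..1}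
     then central_diff s (h * dt_phi x) g x else 0)"
  by (simp add: dt_diff_def central_diff_def mult.assoc)

lemma dt_diff_le_remainders:
  assumes ch: "deriv_chain r D w (-1) 1" and r: "1 \<le> r" "r \<le> s" and A: "A = real s / 2 * \<bar>h\<bar>"
    and x: "x \<in> {-1..1}"
  shows "ennreal \<bar>dt_diff s h (D 0) x\<bar> \<le> 2 ^ s *
    (right_remainder A (r - 1) w x * indicator {x. -1 \<le> x \<and> x \<le> 1 \<and> x + A * dt_phi x \<le> 1} x +
     left_remainder A (r - 1) w x * indicator {x. -1 \<le> x \<and> x \<le> 1 \<and> -1 \<le> x - A * dt_phi x} x)"
proof (cases "x + A * dt_phi x \<le> 1 \<and> -1 \<le> x - A * dt_phi x")
  case True
  have "ennreal \<bar>central_diff s (h * dt_phi x) (D 0) x\<bar> \<le> 2 ^ s * (right_remainder A (r - 1) w x + left_remainder A (r - 1) w x)"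
    unfolding right_remainder_def left_remainder_def
    by (rule central_diff_le_remainders[OF ch r])
      (use True x dt_phi_nonneg[of x] in \<open>auto simp: A abs_mult\<close>)
  then show ?thesis using True x
    by (auto simp: dt_diff_central_diff intro: order_trans)
next
  case False
  have "dt_diff s h (D 0) x = 0"
    using False x by (auto simp: dt_diff_central_diff A abs_if split: if_splits)
  then show ?thesis by simp
qed

text \<open>A measurable majorant stands in for the difference itself: \<open>deriv_chain\<close>
  says nothing about measurability of D 0 on the line, and the integral will have to be
  additive.\<close>

lemma dt_diff_L1_majorant:
  assumes ch: "deriv_chain r D w (-1) 1" and r: "1 \<le> r" "r \<le> s"
  obtains M where "M \<in> borel_measurable borel"
    "\<And>x. x \<in> {-1..1} \<Longrightarrow> ennreal \<bar>dt_diff s h (D 0) x\<bar> \<le> M x"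
    "(\<integral>\<^sup>+x. M x \<partial>lborel) \<le> ennreal (6 * 2 ^ s * real s ^ r * \<bar>h\<bar> ^ r) *
       (\<integral>\<^sup>+t\<in>{-1..1}. ennreal (dt_phi t ^ r * \<bar>w t\<bar>) \<partial>lborel)"
proof
  have [measurable]: "w \<in> borel_measurable borel" using ch by (simp add: deriv_chain_def)
  define A where "A = real s / 2 * \<bar>h\<bar>"
  have A0: "0 \<le> A" by (simp add: A_def)
  let ?R = "\<lambda>x. right_remainder A (r - 1) w x * indicator {x. -1 \<le> x \<and> x \<le> 1 \<and> x + A * dt_phi x \<le> 1} x"
  let ?L = "\<lambda>x. left_remainder A (r - 1) w x * indicator {x. -1 \<le> x \<and> x \<le> 1 \<and> -1 \<le> x - A * dt_phi x} x"
  let ?M = "\<lambda>x. 2 ^ s * (?R x + ?L x)"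
  let ?I = "\<integral>\<^sup>+t\<in>{-1..1}. ennreal (dt_phi t ^ r * \<bar>w t\<bar>) \<partial>lborel"
  show "?M \<in> borel_measurable borel" by measurable
  show "ennreal \<bar>dt_diff s h (D 0) x\<bar> \<le> ?M x" if "x \<in> {-1..1}" for x
    by (rule dt_diff_le_remainders[OF ch r A_def that])
  have S: "Suc (r - 1) = r" using r by simp
  have "(\<integral>\<^sup>+x. ?M x \<partial>lborel) = 2 ^ s * ((\<integral>\<^sup>+x. ?R x \<partial>lborel) + (\<integral>\<^sup>+x. ?L x \<partial>lborel))"
    by (subst nn_integral_cmult, measurable, subst nn_integral_add, measurable)
  also have "\<dots> \<le> 2 ^ s * (ennreal (3 * (2 * A) ^ r) * ?I + ennreal (3 * (2 * A) ^ r) * ?I)"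
    using nn_integral_right_remainder_le[OF A0, of w "r - 1"] nn_integral_left_remainder_le[OF A0, of w "r - 1"]
    unfolding S by (intro mult_left_mono add_mono) auto
  also have "\<dots> = ennreal (6 * 2 ^ s * real s ^ r * \<bar>h\<bar> ^ r) * ?I"
  proof -
    have "(2 ^ s :: ennreal) = ennreal (2 ^ s)" by (simp flip: ennreal_power)
    moreover have "2 * A = real s * \<bar>h\<bar>" by (simp add: A_def)
    ultimately show ?thesis
      unfolding distrib_right[symmetric] mult.assoc[symmetric]
      by (simp flip: ennreal_plus ennreal_mult add: power_mult_distrib mult_ac)
  qed
  finally show "(\<integral>\<^sup>+x. ?M x \<partial>lborel) \<le> ennreal (6 * 2 ^ s * real s ^ r * \<bar>h\<bar> ^ r) * ?I" .
qed

section \<open>Polynomials of degree comparable to the inverse step\<close>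

text \<open>Substitution by the increasing function -cos on [0, \<pi>], followed by a
  reflection.\<close>

lemma nn_integral_cos_substitution:
  fixes f :: "real \<Rightarrow> ennreal"
  assumes [measurable]: "f \<in> borel_measurable borel"
  shows "(\<integral>\<^sup>+x\<in>{-1..1}. f x \<partial>lborel) = (\<integral>\<^sup>+\<theta>\<in>{0..pi}. f (cos \<theta>) * ennreal (sin \<theta>) \<partial>lborel)"
proof -
  have "(\<integral>\<^sup>+x. f (- x) * indicator {- cos 0..- cos pi} x \<partial>lborel) =
     (\<integral>\<^sup>+x. f (- (- cos x)) * ennreal (sin x) * indicator {0..pi} x \<partial>lborel)"
  proof (rule nn_integral_substitution_aux)
    show "(\<lambda>x. f (- x)) \<in> borel_measurable borel" by measurable
  qed (auto intro!: derivative_eq_intros continuous_intros sin_ge_zero)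
  moreover have "(\<integral>\<^sup>+x. f (- x) * indicator {- cos 0..- cos pi} x \<partial>lborel) =
      (\<integral>\<^sup>+x. f (- x) * indicator {-1..1} (- x) \<partial>lborel)"
    by (intro nn_integral_cong) (auto simp: indicator_def)
  moreover have "\<dots> = (\<integral>\<^sup>+x\<in>{-1..1}. f x \<partial>lborel)" by (rule nn_integral_lborel_uminus) measurable
  ultimately show ?thesis by simp
qed

lemma trig_mass_eq:
  "trig_mass p M P = (\<integral>\<^sup>+x\<in>{-1..1}. ennreal (\<bar>dt_phi x ^ M * poly P x\<bar> powr p) \<partial>lborel)"
proof -
  have [measurable]: "poly P \<in> borel_measurable borel"
    by (intro borel_measurable_continuous_onI continuous_intros)
  have "(\<integral>\<^sup>+x\<in>{-1..1}. ennreal (\<bar>dt_phi x ^ M * poly P x\<bar> powr p) \<partial>lborel) =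
    (\<integral>\<^sup>+\<theta>\<in>{0..pi}. ennreal (\<bar>dt_phi (cos \<theta>) ^ M * poly P (cos \<theta>)\<bar> powr p) * ennreal (sin \<theta>) \<partial>lborel)"
    by (rule nn_integral_cos_substitution) measurable
  also have "\<dots> = trig_mass p M P"
    unfolding trig_mass_def weighted_trig_def
    by (intro nn_integral_cong) (auto simp: indicator_def dt_phi_cos sin_ge_zero ennreal_mult)
  finally show ?thesis by simp
qed

text \<open>Continuity on a compact interval. Finiteness is what permits a fraction of the mass to
  be absorbed later.\<close>

lemma trig_mass_finite: "0 < p \<Longrightarrow> trig_mass p M P < \<infinity>"
proof -
  assume p: "0 < p"
  have "compact (weighted_trig M P ` {0..pi})"
    unfolding weighted_trig_def by (intro compact_continuous_image continuous_intros) auto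
  then obtain K where K: "\<And>\<theta>. \<theta> \<in> {0..pi} \<Longrightarrow> \<bar>weighted_trig M P \<theta>\<bar> \<le> K"
    using compact_imp_bounded bounded_iff by (metis imageI real_norm_def)
  have "trig_mass p M P \<le> (\<integral>\<^sup>+\<theta>. ennreal (K powr p) * indicator {0..pi} \<theta> \<partial>lborel)"
    unfolding trig_mass_def
  proof (intro nn_integral_mono)
    fix \<theta>
    have "\<bar>weighted_trig M P \<theta>\<bar> powr p * sin \<theta> \<le> K powr p * 1" if "\<theta> \<in> {0..pi}"
      using K[OF that] p that by (intro mult_mono powr_mono2) (auto simp: sin_ge_zero)
    then show "ennreal (\<bar>weighted_trig M P \<theta>\<bar> powr p * sin \<theta>) * indicator {0..pi} \<theta> \<le> ennreal (K powr p) * indicator {0..pi} \<theta>"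
      by (auto simp: indicator_def intro: ennreal_leI)
  qed
  also have "\<dots> = ennreal (K powr p) * ennreal pi" by (simp add: nn_integral_cmult_indicator)
  also have "\<dots> < \<infinity>" by (simp add: ennreal_mult_less_top)
  finally show ?thesis .
qed

text \<open>Write the difference of cosines as a product of sines; the sine of the mean angle is at
  least half of sin \<theta>. A stencil of half-width A \<phi>(x) thus becomes an angular window of
  half-width \<pi> A, independent of the position.\<close>

lemma angle_distance_le:
  assumes "\<theta> \<in> {0..pi}" "\<tau> \<in> {0..pi}" "0 \<le> A" "\<bar>cos \<tau> - cos \<theta>\<bar> \<le> A * sin \<theta>"
  shows "\<bar>\<tau> - \<theta>\<bar> \<le> pi * A"
proof (cases "sin \<theta> = 0")
  case True
  then have "cos \<tau> = cos \<theta>" using assms by simp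
  then have "\<tau> = \<theta>" using assms by (auto intro: cos_inj_pi)
  then show ?thesis using assms by simp
next
  case False
  then have sp: "0 < sin \<theta>" using sin_ge_zero[of \<theta>] assms by auto
  let ?s = "sin ((\<tau> + \<theta>) / 2)" and ?d = "\<bar>sin ((\<theta> - \<tau>) / 2)\<bar>"
  have s0: "0 \<le> ?s" using assms by (intro sin_ge_zero) auto
  have "sin \<theta> \<le> sin \<tau> + sin \<theta>" using assms by (simp add: sin_ge_zero)
  also have "\<dots> = 2 * ?s * cos ((\<tau> - \<theta>) / 2)" by (rule sin_plus_sin)
  also have "\<dots> \<le> 2 * ?s * 1" using s0 by (intro mult_left_mono) auto
  finally have "sin \<theta> * ?d \<le> 2 * ?s * ?d" by (intro mult_right_mono) auto
  also have "\<dots> = \<bar>cos \<tau> - cos \<theta>\<bar>"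
    using s0 by (simp add: cos_diff_cos abs_mult)
  also have "\<dots> \<le> sin \<theta> * A" using assms by (simp add: mult.commute)
  finally have "?d \<le> A" using sp by simp
  have "\<bar>\<theta> - \<tau>\<bar> \<le> pi * ?d" by (rule abs_le_abs_sin_half) (use assms in auto)
  also have "\<dots> \<le> pi * A" using \<open>?d \<le> A\<close> by simp
  finally show ?thesis by (simp add: abs_minus_commute)
qed

text \<open>Let Y be the distance from t to the right end and a the length of the half-stencil.
  Since the stencil ends before 1, Y (1 - x) <= a (1 - t); with 1 + x <= 1 + t this gives Y a <= (A
  \<phi>(t))^2. As Y <= a, the quantity Y^(s-1) a is at most (Y a)^(s/2) when s >= 2.\<close>

lemma stencil_point_bound:
  assumes A: "0 \<le> A" and x: "-1 \<le> x" "x \<le> t" "t \<le> x + A * dt_phi x" "x + A * dt_phi x \<le> 1" and s: "2 \<le> s"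
  shows "(x + A * dt_phi x - t) ^ (s - 1) * (A * dt_phi x) \<le> (A * dt_phi t) ^ s"
proof -
  define a where "a = A * dt_phi x"
  define Y where "Y = x + a - t"
  have Y: "0 \<le> Y" "Y \<le> a" using x by (auto simp: Y_def a_def)
  have a0: "0 \<le> a" using Y by linarith
  have t1: "t \<in> {-1..1}" "x \<in> {-1..1}" using x by auto
  have At: "0 \<le> A * dt_phi t" using A dt_phi_nonneg[OF t1(1)] by simp
  have Ya: "Y * a \<le> (A * dt_phi t)\<^sup>2"
  proof (cases "dt_phi x = 0")
    case True
    then show ?thesis by (simp add: a_def)
  next
    case False
    then have pos: "0 < (dt_phi x)\<^sup>2" by simp
    have "(t - x) * (a - (1 - x)) \<le> 0"
      using x by (intro mult_nonneg_nonpos) (auto simp: a_def)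
    then have "Y * (1 - x) \<le> a * (1 - t)" by (simp add: Y_def algebra_simps)
    then have "Y * (1 - x) * (a * (1 + x)) \<le> a * (1 - t) * (a * (1 + x))"
      using a0 x by (intro mult_right_mono) auto
    also have "\<dots> \<le> a * (1 - t) * (a * (1 + t))" using a0 x t1 by (intro mult_left_mono) auto
    finally have "Y * a * (dt_phi x)\<^sup>2 \<le> a\<^sup>2 * (dt_phi t)\<^sup>2"
      unfolding dt_phi_square[OF t1(1)] dt_phi_square[OF t1(2)] power2_eq_square[of a]
      by (simp only: mult_ac)
    also have "\<dots> = (A * dt_phi t)\<^sup>2 * (dt_phi x)\<^sup>2" by (simp add: a_def power_mult_distrib)
    finally show ?thesis using pos by simp
  qed
  define n where "n = s - 2"
  have n: "s = Suc (Suc n)" using s by (simp add: n_def)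
  have "(Y ^ (s - 1) * a)\<^sup>2 = (Y * a)\<^sup>2 * (Y * Y) ^ n"
    by (simp add: n power2_eq_square power_mult_distrib mult_ac)
  also have "\<dots> \<le> (Y * a)\<^sup>2 * (Y * a) ^ n"
    using Y by (intro mult_left_mono power_mono) auto
  also have "\<dots> = (Y * a) ^ s" by (simp add: n power2_eq_square)
  also have "\<dots> \<le> ((A * dt_phi t)\<^sup>2) ^ s" using Ya Y a0 by (intro power_mono) auto
  also have "\<dots> = ((A * dt_phi t) ^ s)\<^sup>2" by (simp flip: power_mult add: mult.commute)
  finally have "Y ^ (s - 1) * a \<le> (A * dt_phi t) ^ s" by (rule power2_le_imp_le) (use At in simp)
  then show ?thesis by (simp add: Y_def a_def)
qed

text \<open>The pointwise bound carries a factor 1/a, cancelled by integrating over an interval of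
  length a. The powers of \<phi> are attached to t and not to x, as the weighted supremum requires.
  If a = 0 the interval is a single point.\<close>

lemma right_remainder_le_sup:
  assumes A: "0 \<le> A" and x: "-1 \<le> x" "x + A * dt_phi x \<le> 1" and s: "2 \<le> s"
    and b: "\<And>t. t \<in> {-1..1} \<Longrightarrow> \<bar>t - x\<bar> \<le> A * dt_phi x \<Longrightarrow> dt_phi t ^ s * \<bar>w t\<bar> \<le> b"
  shows "right_remainder A (s - 1) w x \<le> ennreal (A ^ s * b)"
proof -
  define a where "a = A * dt_phi x"
  show ?thesis
  proof (cases "0 < a")
    case False
    have "right_remainder A (s - 1) w x = 0"
    proof -
      have "(\<integral>\<^sup>+t\<in>{x..x + a}. ennreal ((x + a - t) ^ (s - 1) * \<bar>w t\<bar>) \<partial>lborel) = (\<integral>\<^sup>+(t::real). 0 \<partial>lborel)"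
      proof (rule nn_integral_cong_AE)
        have "AE t in lborel. t \<noteq> x" by (rule AE_lborel_singleton)
        then show "AE t in lborel. ennreal ((x + a - t) ^ (s - 1) * \<bar>w t\<bar>) * indicator {x..x + a} t = 0"
          by eventually_elim (use False in \<open>auto simp: indicator_def\<close>)
      qed
      then show ?thesis by (simp add: right_remainder_def a_def)
    qed
    then show ?thesis by simp
  next
    case True
    have "right_remainder A (s - 1) w x \<le> (\<integral>\<^sup>+t. ennreal (A ^ s * b / a) * indicator {x..x + a} t \<partial>lborel)"
      unfolding right_remainder_def a_def[symmetric]
    proof (intro nn_integral_mono)
      fix t
      show "ennreal ((x + a - t) ^ (s - 1) * \<bar>w t\<bar>) * indicator {x..x + a} t \<le> ennreal (A ^ s * b / a) * indicator {x..x + a} t"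
      proof (cases "t \<in> {x..x + a}")
        case t: True
        have "(x + a - t) ^ (s - 1) * a * \<bar>w t\<bar> \<le> (A * dt_phi t) ^ s * \<bar>w t\<bar>"
          using t x unfolding a_def by (intro mult_right_mono stencil_point_bound[OF A _ _ _ _ s]) auto
        also have "\<dots> = A ^ s * (dt_phi t ^ s * \<bar>w t\<bar>)" by (simp add: power_mult_distrib)
        also have "\<dots> \<le> A ^ s * b" using A t x by (intro mult_left_mono b) (auto simp: a_def)
        finally have "(x + a - t) ^ (s - 1) * \<bar>w t\<bar> \<le> A ^ s * b / a" using True by (simp add: field_simps)
        then show ?thesis using t by (simp add: ennreal_leI)
      qed simp
    qed
    also have "\<dots> = ennreal (A ^ s * b / a) * ennreal a" using True by (simp add: nn_integral_cmult_indicator)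
    also have "\<dots> = ennreal (A ^ s * b)"
    proof -
      have "0 \<le> b" using b[of x] x True A
        by (smt (verit, best) a_def abs_ge_zero atLeastAtMost_iff dt_phi_nonneg mult_nonneg_nonneg zero_le_power diff_self abs_zero)
      then show ?thesis using True A by (simp flip: ennreal_mult)
    qed
    finally show ?thesis .
  qed
qed

lemma deriv_chain_poly: "deriv_chain s (\<lambda>i. poly ((pderiv ^^ i) Q)) (poly ((pderiv ^^ s) Q)) a b" if "1 \<le> s"
  unfolding deriv_chain_def
proof (intro conjI allI impI ballI)
  fix i t
  show "(poly ((pderiv ^^ i) Q) has_vector_derivative poly ((pderiv ^^ Suc i) Q) t) (at t within {a..b})"
    using poly_DERIV[of "(pderiv ^^ i) Q" t]
    by (auto simp: has_real_derivative_iff_has_vector_derivative intro: has_vector_derivative_at_within)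
next
  fix c d :: real assume "c \<le> d"
  then show "(poly ((pderiv ^^ s) Q) has_integral poly ((pderiv ^^ (s - 1)) Q) d - poly ((pderiv ^^ (s - 1)) Q) c) {c..d}"
  proof (rule fundamental_theorem_of_calculus)
    fix t
    have "(pderiv ^^ s) Q = pderiv ((pderiv ^^ (s - 1)) Q)" using that by (cases s) auto
    then show "(poly ((pderiv ^^ (s - 1)) Q) has_vector_derivative poly ((pderiv ^^ s) Q) t) (at t within {c..d})"
      using poly_DERIV[of "(pderiv ^^ (s - 1)) Q" t]
      by (auto simp: has_real_derivative_iff_has_vector_derivative intro: has_vector_derivative_at_within)
  qed
next
  show "poly ((pderiv ^^ s) Q) absolutely_integrable_on {a..b}"
    by (intro absolutely_integrable_continuous_real continuous_intros)
  show "poly ((pderiv ^^ s) Q) \<in> borel_measurable borel"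
    by (intro borel_measurable_continuous_onI continuous_intros)
qed

text \<open>Taylor remainders of full order s: the difference is governed by the weighted derivative
  of order s on the angular window that corresponds to the stencil.\<close>

lemma dt_diff_poly_le_sup:
  assumes s: "2 \<le> s" and A: "A = real s / 2 * \<bar>h\<bar>" and \<theta>: "\<theta> \<in> {0..pi}"
    and b: "\<And>\<tau>. \<bar>\<tau> - \<theta>\<bar> \<le> pi * A \<Longrightarrow> \<bar>weighted_trig s ((pderiv ^^ s) Q) \<tau>\<bar> \<le> b"
  shows "\<bar>dt_diff s h (poly Q) (cos \<theta>)\<bar> \<le> 2 ^ (s + 1) * A ^ s * b"
proof -
  let ?x = "cos \<theta>" and ?w = "poly ((pderiv ^^ s) Q)"
  have A0: "0 \<le> A" by (simp add: A)
  have b0: "0 \<le> b" using b[of \<theta>] A0 by auto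
  have x: "?x \<in> {-1..1}" by simp
  have wb: "dt_phi t ^ s * \<bar>?w t\<bar> \<le> b" if t: "t \<in> {-1..1}" "\<bar>t - ?x\<bar> \<le> A * dt_phi ?x" for t
  proof -
    have "\<bar>cos (arccos t) - cos \<theta>\<bar> \<le> A * sin \<theta>" using t \<theta> by (simp add: dt_phi_cos sin_ge_zero)
    then have "\<bar>arccos t - \<theta>\<bar> \<le> pi * A"
      using t by (intro angle_distance_le[OF \<theta> _ A0]) (auto simp: arccos_lbound arccos_ubound)
    from b[OF this] show ?thesis
      using t dt_phi_nonneg[OF t(1)]
      by (simp add: weighted_trig_def abs_mult power_abs sin_arccos flip: dt_phi_def)
  qed
  show ?thesis
  proof (cases "?x + A * dt_phi ?x \<le> 1 \<and> -1 \<le> ?x - A * dt_phi ?x")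
    case True
    have R: "right_remainder A (s - 1) ?w ?x \<le> ennreal (A ^ s * b)"
      using True x wb by (intro right_remainder_le_sup[OF A0 _ _ s]) auto
    have "left_remainder A (s - 1) ?w ?x = right_remainder A (s - 1) (\<lambda>t. ?w (- t)) (- ?x)"
      by (intro left_remainder_eq borel_measurable_continuous_onI continuous_intros)
    also have "\<dots> \<le> ennreal (A ^ s * b)"
    proof (rule right_remainder_le_sup[OF A0 _ _ s])
      fix t assume "t \<in> {-1..1}" "\<bar>t - - ?x\<bar> \<le> A * dt_phi (- ?x)"
      then show "dt_phi t ^ s * \<bar>?w (- t)\<bar> \<le> b" using wb[of "- t"] by (auto simp: abs_minus_commute add.commute)
    qed (use True x in auto)
    finally have L: "left_remainder A (s - 1) ?w ?x \<le> ennreal (A ^ s * b)" .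
    have "ennreal \<bar>dt_diff s h ((\<lambda>i. poly ((pderiv ^^ i) Q)) 0) ?x\<bar> \<le> 2 ^ s *
      (right_remainder A (s - 1) ?w ?x * indicator {x. -1 \<le> x \<and> x \<le> 1 \<and> x + A * dt_phi x \<le> 1} ?x +
       left_remainder A (s - 1) ?w ?x * indicator {x. -1 \<le> x \<and> x \<le> 1 \<and> -1 \<le> x - A * dt_phi x} ?x)"
      by (rule dt_diff_le_remainders[OF deriv_chain_poly _ _ A x]) (use s in auto)
    also have "\<dots> \<le> 2 ^ s * (ennreal (A ^ s * b) * 1 + ennreal (A ^ s * b) * 1)"
      by (intro mult_left_mono add_mono mult_mono R L) (auto simp: indicator_def)
    also have "\<dots> = ennreal (2 ^ (s + 1) * A ^ s * b)"
    proof -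
      have "(2 ^ s :: ennreal) = ennreal (2 ^ s)" by (simp flip: ennreal_power)
      then show ?thesis using A0 b0 by (simp flip: ennreal_plus ennreal_mult add: mult_ac)
    qed
    finally show ?thesis using A0 b0 by (simp add: ennreal_le_iff)
  next
    case False
    then have "dt_diff s h (poly Q) ?x = 0"
      by (auto simp: dt_diff_central_diff A abs_if split: if_splits)
    then show ?thesis using A0 b0 by simp
  qed
qed

lemma dt_diff_measurable [measurable]:
  assumes [measurable]: "g \<in> borel_measurable borel"
  shows "dt_diff s h g \<in> borel_measurable borel"
  unfolding dt_diff_def[abs_def] by measurable

lemma poly_measurable [measurable]: "poly P \<in> borel_measurable borel" for P :: "real poly"
  by (intro borel_measurable_continuous_onI continuous_intros)

text \<open>The step is so small that the angular window fits into 1/m, so one local maximum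
  controls the whole stencil, and integrating H costs only a constant.\<close>

lemma dt_diff_poly_upper:
  fixes p :: real and B s :: nat
  assumes p: "0 < p" and s: "2 \<le> s"
  shows "\<exists>C>0. \<forall>m Q h. 1 \<le> m \<longrightarrow> s + degree ((pderiv ^^ s) Q) \<le> B * m \<longrightarrow> pi * (real s / 2 * \<bar>h\<bar>) \<le> 1 / real m \<longrightarrow>
    (\<integral>\<^sup>+x\<in>{-1..1}. ennreal (\<bar>dt_diff s h (poly Q) x\<bar> powr p) \<partial>lborel)
      \<le> ennreal (C * (\<bar>h\<bar> ^ s) powr p) * trig_mass p s ((pderiv ^^ s) Q)"
proof -
  obtain C where C: "C > 0" and *: "\<forall>m M (P :: real poly). 1 \<le> m \<longrightarrow> M + degree P \<le> B * m \<longrightarrow>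
    (\<exists>H\<in>borel_measurable borel.
       (\<integral>\<^sup>+\<theta>\<in>{0..pi}. H \<theta> \<partial>lborel) \<le> ennreal C * trig_mass p M P \<and>
       (\<forall>\<theta>. H \<theta> \<le> ennreal (C * real m) * trig_mass p M P) \<and>
       (\<forall>\<theta>. \<exists>b\<ge>0. (\<forall>\<tau>. \<bar>\<tau> - \<theta>\<bar> \<le> 1 / real m \<longrightarrow>
               \<bar>weighted_trig M P \<tau>\<bar> \<le> b \<and>
               \<bar>weighted_trig M P \<tau> - weighted_trig M P \<theta>\<bar> \<le> C * (real m * \<bar>\<tau> - \<theta>\<bar>) * b) \<and>
             ennreal (b powr p * (\<bar>sin \<theta>\<bar> + 1 / real m)) \<le> H \<theta>))"
    using weighted_trig_local_bound[OF p, of B] by (elim exE conjE) (rule that)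
  define c where "c = 2 ^ (s + 1) * (real s / 2) ^ s"
  have c: "c > 0" using s by (simp add: c_def)
  show ?thesis
  proof (rule exI[of _ "c powr p * C"], intro conjI allI impI)
    show "c powr p * C > 0" using c C by simp
    fix m :: nat and Q :: "real poly" and h :: real
    assume m: "1 \<le> m" and deg: "s + degree ((pderiv ^^ s) Q) \<le> B * m" and h: "pi * (real s / 2 * \<bar>h\<bar>) \<le> 1 / real m"
    let ?G = "(pderiv ^^ s) Q"
    from *[rule_format, OF m deg] obtain H where [measurable]: "H \<in> borel_measurable borel"
      and HI: "(\<integral>\<^sup>+\<theta>\<in>{0..pi}. H \<theta> \<partial>lborel) \<le> ennreal C * trig_mass p s ?G"
      and Hb: "\<And>\<theta>. \<exists>b\<ge>0. (\<forall>\<tau>. \<bar>\<tau> - \<theta>\<bar> \<le> 1 / real m \<longrightarrow>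
               \<bar>weighted_trig s ?G \<tau>\<bar> \<le> b \<and>
               \<bar>weighted_trig s ?G \<tau> - weighted_trig s ?G \<theta>\<bar> \<le> C * (real m * \<bar>\<tau> - \<theta>\<bar>) * b) \<and>
             ennreal (b powr p * (\<bar>sin \<theta>\<bar> + 1 / real m)) \<le> H \<theta>"
      by blast
    have "(\<integral>\<^sup>+x\<in>{-1..1}. ennreal (\<bar>dt_diff s h (poly Q) x\<bar> powr p) \<partial>lborel) =
      (\<integral>\<^sup>+\<theta>\<in>{0..pi}. ennreal (\<bar>dt_diff s h (poly Q) (cos \<theta>)\<bar> powr p) * ennreal (sin \<theta>) \<partial>lborel)"
      by (rule nn_integral_cos_substitution) measurable
    also have "\<dots> \<le> (\<integral>\<^sup>+\<theta>. ennreal ((c * \<bar>h\<bar> ^ s) powr p) * (H \<theta> * indicator {0..pi} \<theta>) \<partial>lborel)"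
    proof (intro nn_integral_mono)
      fix \<theta>
      show "ennreal (\<bar>dt_diff s h (poly Q) (cos \<theta>)\<bar> powr p) * ennreal (sin \<theta>) * indicator {0..pi} \<theta>
        \<le> ennreal ((c * \<bar>h\<bar> ^ s) powr p) * (H \<theta> * indicator {0..pi} \<theta>)"
      proof (cases "\<theta> \<in> {0..pi}")
        case True
        obtain b where b: "b \<ge> 0" "\<And>\<tau>. \<bar>\<tau> - \<theta>\<bar> \<le> 1 / real m \<Longrightarrow> \<bar>weighted_trig s ?G \<tau>\<bar> \<le> b"
          "ennreal (b powr p * (\<bar>sin \<theta>\<bar> + 1 / real m)) \<le> H \<theta>" using Hb[of \<theta>] by blast
        have "\<bar>dt_diff s h (poly Q) (cos \<theta>)\<bar> \<le> 2 ^ (s + 1) * (real s / 2 * \<bar>h\<bar>) ^ s * b"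
          by (rule dt_diff_poly_le_sup[OF s refl True]) (use b(2) h in auto)
        also have "\<dots> = (c * \<bar>h\<bar> ^ s) * b" by (simp only: c_def power_mult_distrib mult_ac)
        finally have "\<bar>dt_diff s h (poly Q) (cos \<theta>)\<bar> powr p \<le> ((c * \<bar>h\<bar> ^ s) * b) powr p"
          using p by (intro powr_mono2) auto
        also have "\<dots> = (c * \<bar>h\<bar> ^ s) powr p * b powr p" using c b(1) by (simp add: powr_mult)
        finally have "\<bar>dt_diff s h (poly Q) (cos \<theta>)\<bar> powr p * sin \<theta> \<le> ((c * \<bar>h\<bar> ^ s) powr p * b powr p) * (\<bar>sin \<theta>\<bar> + 1 / real m)"
          using True by (intro mult_mono) (auto simp: sin_ge_zero)
        then have "ennreal (\<bar>dt_diff s h (poly Q) (cos \<theta>)\<bar> powr p * sin \<theta>) \<le> ennreal ((c * \<bar>h\<bar> ^ s) powr p) * ennreal (b powr p * (\<bar>sin \<theta>\<bar> + 1 / real m))"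
          by (simp flip: ennreal_mult add: mult.assoc ennreal_leI)
        also have "\<dots> \<le> ennreal ((c * \<bar>h\<bar> ^ s) powr p) * H \<theta>" by (intro mult_left_mono b) auto
        finally show ?thesis using True by (simp add: ennreal_mult sin_ge_zero)
      qed simp
    qed
    also have "\<dots> = ennreal ((c * \<bar>h\<bar> ^ s) powr p) * (\<integral>\<^sup>+\<theta>\<in>{0..pi}. H \<theta> \<partial>lborel)"
      by (rule nn_integral_cmult) measurable
    also have "\<dots> \<le> ennreal ((c * \<bar>h\<bar> ^ s) powr p) * (ennreal C * trig_mass p s ?G)"
      by (intro mult_left_mono HI) simp
    also have "\<dots> = ennreal (c powr p * C * (\<bar>h\<bar> ^ s) powr p) * trig_mass p s ?G"
      using c C by (simp add: powr_mult ennreal_mult mult_ac)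
    finally show "(\<integral>\<^sup>+x\<in>{-1..1}. ennreal (\<bar>dt_diff s h (poly Q) x\<bar> powr p) \<partial>lborel)
      \<le> ennreal (c powr p * C * (\<bar>h\<bar> ^ s) powr p) * trig_mass p s ?G" .
  qed
qed

text \<open>The uniform bound on H, divided by the summand 1/m, gives |T|^p <= C m^2 N with N the
  mass. Then |T| = |T|^(1-p) |T|^p is integrated with the first factor bounded; the square of m is
  the origin of the exponent 2 - 2p.\<close>

lemma nikolskii_weighted:
  fixes p :: real and B :: nat
  assumes p: "0 < p" "p < 1"
  shows "\<exists>C>0. \<forall>m M (P :: real poly). 1 \<le> m \<longrightarrow> M + degree P \<le> B * m \<longrightarrow>
    trig_mass 1 M P \<le> ennreal ((C * real m powr (2 - 2 * p) * enn2real (trig_mass p M P)) powr (1 / p))"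
proof -
  obtain C where C: "C > 0" and *: "\<forall>m M (P :: real poly). 1 \<le> m \<longrightarrow> M + degree P \<le> B * m \<longrightarrow>
    (\<exists>H\<in>borel_measurable borel.
       (\<integral>\<^sup>+\<theta>\<in>{0..pi}. H \<theta> \<partial>lborel) \<le> ennreal C * trig_mass p M P \<and>
       (\<forall>\<theta>. H \<theta> \<le> ennreal (C * real m) * trig_mass p M P) \<and>
       (\<forall>\<theta>. \<exists>b\<ge>0. (\<forall>\<tau>. \<bar>\<tau> - \<theta>\<bar> \<le> 1 / real m \<longrightarrow>
               \<bar>weighted_trig M P \<tau>\<bar> \<le> b \<and>
               \<bar>weighted_trig M P \<tau> - weighted_trig M P \<theta>\<bar> \<le> C * (real m * \<bar>\<tau> - \<theta>\<bar>) * b) \<and>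
             ennreal (b powr p * (\<bar>sin \<theta>\<bar> + 1 / real m)) \<le> H \<theta>))"
    using weighted_trig_local_bound[OF p(1), of B] by (elim exE conjE) (rule that)
  show ?thesis
  proof (rule exI[of _ "C powr (1 - p)"], intro conjI allI impI)
    show "C powr (1 - p) > 0" using C by simp
    fix m M and P :: "real poly" assume m: "1 \<le> (m::nat)" and deg: "M + degree P \<le> B * m"
    define N where "N = enn2real (trig_mass p M P)"
    have N: "trig_mass p M P = ennreal N" using trig_mass_finite[OF p(1), of M P] by (simp add: N_def)
    have N0: "0 \<le> N" by (simp add: N_def)
    define K where "K = C * (real m)\<^sup>2 * N"
    let ?T = "weighted_trig M P"
    from *[rule_format, OF m deg] obtain H where H: "\<And>\<theta>. H \<theta> \<le> ennreal (C * real m) * trig_mass p M P"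
      "\<And>\<theta>. \<exists>b\<ge>0. (\<forall>\<tau>. \<bar>\<tau> - \<theta>\<bar> \<le> 1 / real m \<longrightarrow>
               \<bar>?T \<tau>\<bar> \<le> b \<and> \<bar>?T \<tau> - ?T \<theta>\<bar> \<le> C * (real m * \<bar>\<tau> - \<theta>\<bar>) * b) \<and>
             ennreal (b powr p * (\<bar>sin \<theta>\<bar> + 1 / real m)) \<le> H \<theta>" by blast
    have Tp: "\<bar>?T \<theta>\<bar> powr p \<le> K" for \<theta>
    proof -
      obtain b where b: "b \<ge> 0" "\<And>\<tau>. \<bar>\<tau> - \<theta>\<bar> \<le> 1 / real m \<Longrightarrow> \<bar>?T \<tau>\<bar> \<le> b"
        "ennreal (b powr p * (\<bar>sin \<theta>\<bar> + 1 / real m)) \<le> H \<theta>" using H(2)[of \<theta>] by blast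
      have "ennreal (b powr p * (\<bar>sin \<theta>\<bar> + 1 / real m)) \<le> ennreal (C * real m * N)"
        using order_trans[OF b(3) H(1)] C N0 by (simp add: N ennreal_mult)
      then have "b powr p * (\<bar>sin \<theta>\<bar> + 1 / real m) \<le> C * real m * N" using C N0 by (simp add: ennreal_le_iff)
      moreover have "b powr p * (1 / real m) \<le> b powr p * (\<bar>sin \<theta>\<bar> + 1 / real m)" by (intro mult_left_mono) auto
      ultimately have "b powr p * (1 / real m) \<le> C * real m * N" by linarith
      then have "b powr p \<le> K" using m by (simp add: K_def field_simps power2_eq_square)
      moreover have "\<bar>?T \<theta>\<bar> powr p \<le> b powr p" using b(2)[of \<theta>] p by (intro powr_mono2) auto
      ultimately show ?thesis by linarith
    qed
    have T1: "\<bar>?T \<theta>\<bar> \<le> K powr ((1 - p) / p) * \<bar>?T \<theta>\<bar> powr p" for \<theta>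
    proof (cases "?T \<theta> = 0")
      case False
      have "\<bar>?T \<theta>\<bar> = \<bar>?T \<theta>\<bar> powr (1 - p) * \<bar>?T \<theta>\<bar> powr p" using False by (simp flip: powr_add)
      also have "\<bar>?T \<theta>\<bar> powr (1 - p) = (\<bar>?T \<theta>\<bar> powr p) powr ((1 - p) / p)" using p by (simp add: powr_powr)
      also have "\<dots> * \<bar>?T \<theta>\<bar> powr p \<le> K powr ((1 - p) / p) * \<bar>?T \<theta>\<bar> powr p"
        using Tp[of \<theta>] p by (intro mult_right_mono powr_mono2) auto
      finally show ?thesis .
    qed simp
    have "trig_mass 1 M P \<le> (\<integral>\<^sup>+\<theta>. ennreal (K powr ((1 - p) / p)) * (ennreal (\<bar>?T \<theta>\<bar> powr p * sin \<theta>) * indicator {0..pi} \<theta>) \<partial>lborel)"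
      unfolding trig_mass_def
    proof (intro nn_integral_mono)
      fix \<theta>
      have "\<bar>?T \<theta>\<bar> * sin \<theta> \<le> K powr ((1 - p) / p) * (\<bar>?T \<theta>\<bar> powr p * sin \<theta>)" if "\<theta> \<in> {0..pi}"
        using mult_right_mono[OF T1[of \<theta>], of "sin \<theta>"] that by (simp add: sin_ge_zero mult.assoc)
      then show "ennreal (\<bar>?T \<theta>\<bar> powr 1 * sin \<theta>) * indicator {0..pi} \<theta> \<le>
          ennreal (K powr ((1 - p) / p)) * (ennreal (\<bar>?T \<theta>\<bar> powr p * sin \<theta>) * indicator {0..pi} \<theta>)"
        by (auto simp: indicator_def sin_ge_zero intro!: ennreal_leI simp flip: ennreal_mult)
    qed
    also have "\<dots> = ennreal (K powr ((1 - p) / p)) * trig_mass p M P"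
      unfolding trig_mass_def by (rule nn_integral_cmult) measurable
    also have "\<dots> = ennreal (K powr ((1 - p) / p) * N)" by (simp add: N ennreal_mult N0)
    also have "K powr ((1 - p) / p) * N = (C powr (1 - p) * real m powr (2 - 2 * p) * N) powr (1 / p)"
    proof (cases "N = 0")
      case False
      then have Np: "N > 0" using N0 by simp
      have mp: "real m > 0" using m by simp
      have "(C powr (1 - p) * real m powr (2 - 2 * p) * N) powr (1 / p) =
          C powr ((1 - p) / p) * real m powr ((2 - 2 * p) / p) * N powr (1 / p)"
        using Np by (simp add: powr_mult powr_powr)
      moreover have "K powr ((1 - p) / p) = C powr ((1 - p) / p) * real m powr ((2 - 2 * p) / p) * N powr ((1 - p) / p)"
      proof -
        have "(real m)\<^sup>2 = real m powr 2" using mp by (simp add: powr_numeral)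
        then have "K = C * real m powr 2 * N" by (simp add: K_def)
        then have "K powr ((1 - p) / p) = C powr ((1 - p) / p) * real m powr (2 * ((1 - p) / p)) * N powr ((1 - p) / p)"
          by (simp only: powr_mult powr_powr)
        also have "2 * ((1 - p) / p) = (2 - 2 * p) / p" by (simp add: field_simps)
        finally show ?thesis .
      qed
      moreover have "N powr ((1 - p) / p) * N = N powr (1 / p)"
      proof -
        have "N powr ((1 - p) / p) * N = N powr ((1 - p) / p + 1)" using Np by (simp add: powr_add)
        also have "(1 - p) / p + 1 = 1 / p" using p by (simp add: field_simps)
        finally show ?thesis .
      qed
      ultimately show ?thesis by (simp add: mult.assoc)
    qed simp
    finally show "trig_mass 1 M P \<le> ennreal ((C powr (1 - p) * real m powr (2 - 2 * p) * enn2real (trig_mass p M P)) powr (1 / p))"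
      by (simp add: N_def)
  qed
qed

definition main_part :: "nat \<Rightarrow> real \<Rightarrow> real set" where
  "main_part s h = {-1 + 2 * (real s)\<^sup>2 * h\<^sup>2..1 - 2 * (real s)\<^sup>2 * h\<^sup>2}"

text \<open>After division by x + y both numbers lie in [0, 1], where z <= z^p.\<close>

lemma powr_subadditive:
  fixes x y :: real
  assumes "0 \<le> x" "0 \<le> y" "0 < p" "p \<le> 1"
  shows "(x + y) powr p \<le> x powr p + y powr p"
proof (cases "x + y = 0")
  case False
  then have s: "0 < x + y" using assms by simp
  have t: "z / (x + y) \<le> (z / (x + y)) powr p" if "0 \<le> z" "z \<le> x + y" for z
    using powr_mono'[of p 1 "z / (x + y)"] that s assms by simp
  have "1 = x / (x + y) + y / (x + y)" using s by (simp flip: add_divide_distrib)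
  also have "\<dots> \<le> (x / (x + y)) powr p + (y / (x + y)) powr p" using t assms by (intro add_mono) auto
  also have "\<dots> = (x powr p + y powr p) / (x + y) powr p"
    using assms s by (simp add: powr_divide add_divide_distrib)
  finally show ?thesis using s by (simp add: field_simps)
qed (use assms in simp)

lemma sin_square_le: "\<theta> \<in> {0..pi} \<Longrightarrow> (sin \<theta>)\<^sup>2 \<le> 2 * (1 - \<bar>cos \<theta>\<bar>)"
proof -
  have "(sin \<theta>)\<^sup>2 = (1 - \<bar>cos \<theta>\<bar>) * (1 + \<bar>cos \<theta>\<bar>)"
    using sin_squared_eq[of \<theta>] by (simp add: power2_eq_square algebra_simps)
  also have "\<dots> \<le> (1 - \<bar>cos \<theta>\<bar>) * 2" by (intro mult_left_mono) auto
  finally show ?thesis by simp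
qed

text \<open>On the part where $\sin\theta \ge 2kh$ the difference of P is a derivative at a nearby point,
  and the weighted derivative oscillates little at the scale h; the remaining part near the
  endpoints carries a small fraction of the total mass and is absorbed.\<close>

lemma poly_deriv_le_dt_diff:
  fixes p :: real and B r k :: nat
  assumes p: "0 < p" "p \<le> 1" and k: "1 \<le> k"
  shows "\<exists>C c. 0 < C \<and> 0 < c \<and> (\<forall>m P h. 1 \<le> m \<longrightarrow> (r + k) + degree ((pderiv ^^ k) P) \<le> B * m \<longrightarrow>
    0 < h \<longrightarrow> h * real m \<le> c \<longrightarrow>
    ennreal ((h ^ k) powr p) * trig_mass p (r + k) ((pderiv ^^ k) P) \<le>
      ennreal C * (\<integral>\<^sup>+x\<in>main_part k h. ennreal (\<bar>dt_phi x ^ r * dt_diff k h (poly P) x\<bar> powr p) \<partial>lborel))"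
proof -
  obtain C where C: "C > 0" and *: "\<forall>m M (P :: real poly). 1 \<le> m \<longrightarrow> M + degree P \<le> B * m \<longrightarrow>
    (\<exists>H\<in>borel_measurable borel.
       (\<integral>\<^sup>+\<theta>\<in>{0..pi}. H \<theta> \<partial>lborel) \<le> ennreal C * trig_mass p M P \<and>
       (\<forall>\<theta>. H \<theta> \<le> ennreal (C * real m) * trig_mass p M P) \<and>
       (\<forall>\<theta>. \<exists>b\<ge>0. (\<forall>\<tau>. \<bar>\<tau> - \<theta>\<bar> \<le> 1 / real m \<longrightarrow>
               \<bar>weighted_trig M P \<tau>\<bar> \<le> b \<and>
               \<bar>weighted_trig M P \<tau> - weighted_trig M P \<theta>\<bar> \<le> C * (real m * \<bar>\<tau> - \<theta>\<bar>) * b) \<and>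
             ennreal (b powr p * (\<bar>sin \<theta>\<bar> + 1 / real m)) \<le> H \<theta>))"
    using weighted_trig_local_bound[OF p(1), of B] by (elim exE conjE) (rule that)
  define a where "a = pi * (real k / 2)"
  have a: "a > 0" using k by (simp add: a_def)
  \<comment> \<open>Three demands on h m <= c: the angular shift a h is at most 1/m; the endpoint
    zone contributes at most a quarter of the mass; the oscillation of T over the shift contributes
    another quarter.\<close>
  define c where "c = min (1 / a) (min (1 / (8 * real k * C)) ((1 / (4 * C)) powr (1 / p) / (C * a)))"
  have c0: "c > 0" using a k C by (simp add: c_def)
  have c1: "a * c \<le> 1"
  proof -
    have "c \<le> 1 / a" by (simp add: c_def)
    then show ?thesis using a by (simp add: field_simps)
  qed
  have c2: "(2 * real k * c) * C \<le> 1 / 4"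
  proof -
    have "c \<le> 1 / (8 * real k * C)" by (simp add: c_def)
    then show ?thesis using k C by (simp add: field_simps)
  qed
  have c3: "(C * a * c) powr p * C \<le> 1 / 4"
  proof -
    have "c \<le> (1 / (4 * C)) powr (1 / p) / (C * a)" by (simp add: c_def)
    then have "C * a * c \<le> (1 / (4 * C)) powr (1 / p)" using C a by (simp add: field_simps)
    then have "(C * a * c) powr p \<le> ((1 / (4 * C)) powr (1 / p)) powr p"
      using C a c0 p by (intro powr_mono2) auto
    also have "\<dots> = 1 / (4 * C)" using p C by (simp add: powr_powr)
    finally show ?thesis using C by (simp add: field_simps)
  qed
  define M where "M = r + k"
  \<comment> \<open>The 2 comes from the absorption, 2^M from comparing sin \<tau> with 2 sin
    \<theta>.\<close>
  define E where "E = 2 * (2 ^ M) powr p"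
  show ?thesis
  proof (rule exI[of _ E], rule exI[of _ c], intro conjI allI impI)
    show "0 < E" by (simp add: E_def)
    show "0 < c" by (rule c0)
    fix m :: nat and P :: "real poly" and h :: real
    assume m: "1 \<le> m" and deg: "(r + k) + degree ((pderiv ^^ k) P) \<le> B * m"
      and h: "0 < h" and hm: "h * real m \<le> c"
    let ?G = "(pderiv ^^ k) P"
    let ?T = "weighted_trig M ?G"
    let ?N = "trig_mass p M ?G"
    define F where "F x = ennreal (\<bar>dt_phi x ^ r * dt_diff k h (poly P) x\<bar> powr p)" for x
    have [measurable]: "F \<in> borel_measurable borel" unfolding F_def[abs_def] by measurable
    define X where "X = (\<integral>\<^sup>+x\<in>main_part k h. F x \<partial>lborel)"
    from *[rule_format, OF m deg] obtain H where [measurable]: "H \<in> borel_measurable borel"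
      and HI: "(\<integral>\<^sup>+\<theta>\<in>{0..pi}. H \<theta> \<partial>lborel) \<le> ennreal C * ?N"
      and Hb: "\<And>\<theta>. \<exists>b\<ge>0. (\<forall>\<tau>. \<bar>\<tau> - \<theta>\<bar> \<le> 1 / real m \<longrightarrow>
               \<bar>?T \<tau>\<bar> \<le> b \<and> \<bar>?T \<tau> - ?T \<theta>\<bar> \<le> C * (real m * \<bar>\<tau> - \<theta>\<bar>) * b) \<and>
             ennreal (b powr p * (\<bar>sin \<theta>\<bar> + 1 / real m)) \<le> H \<theta>"
      unfolding M_def by blast
    define d where "d = a * h"
    have md: "real m * d \<le> a * c" using mult_left_mono[OF hm, of a] a by (simp add: d_def mult_ac)
    have dm: "d \<le> 1 / real m"
    proof -
      have "real m * d \<le> 1" using md c1 by linarith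
      then show ?thesis using m by (simp add: field_simps)
    qed
    define \<epsilon> where "\<epsilon> = (C * a * c) powr p + 2 * real k * c"
    have \<epsilon>0: "0 \<le> \<epsilon>" using c0 by (simp add: \<epsilon>_def)
    have \<epsilon>C: "\<epsilon> * C \<le> 1 / 2" using c2 c3 by (simp add: \<epsilon>_def algebra_simps)
    have main: "ennreal (\<bar>?T \<theta>\<bar> powr p * sin \<theta>) \<le>
        ennreal ((2 ^ M) powr p / (h ^ k) powr p) * (F (cos \<theta>) * indicator (main_part k h) (cos \<theta>) * ennreal (sin \<theta>))
        + ennreal \<epsilon> * H \<theta>" if \<theta>: "\<theta> \<in> {0..pi}" for \<theta>
    proof -
      obtain b where b0: "b \<ge> 0" and b: "\<And>\<tau>. \<bar>\<tau> - \<theta>\<bar> \<le> 1 / real m \<Longrightarrow> \<bar>?T \<tau>\<bar> \<le> b"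
          "\<And>\<tau>. \<bar>\<tau> - \<theta>\<bar> \<le> 1 / real m \<Longrightarrow> \<bar>?T \<tau> - ?T \<theta>\<bar> \<le> C * (real m * \<bar>\<tau> - \<theta>\<bar>) * b"
        and bH: "ennreal (b powr p * (\<bar>sin \<theta>\<bar> + 1 / real m)) \<le> H \<theta>" using Hb[of \<theta>] by blast
      have s0: "0 \<le> sin \<theta>" using \<theta> by (simp add: sin_ge_zero)
      show ?thesis
      proof (cases "2 * real k * h \<le> sin \<theta>")
        case False
        have "\<bar>?T \<theta>\<bar> powr p * sin \<theta> \<le> b powr p * (2 * real k * h)"
          using b(1)[of \<theta>] p False s0 by (intro mult_mono powr_mono2) auto
        also have "\<dots> = (2 * real k * (h * real m)) * (b powr p * (1 / real m))" using m by simp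
        also have "\<dots> \<le> (2 * real k * c) * (b powr p * (\<bar>sin \<theta>\<bar> + 1 / real m))"
          using hm k h c0 by (intro mult_mono) auto
        also have "\<dots> \<le> \<epsilon> * (b powr p * (\<bar>sin \<theta>\<bar> + 1 / real m))"
          by (intro mult_right_mono) (auto simp: \<epsilon>_def)
        finally have "ennreal (\<bar>?T \<theta>\<bar> powr p * sin \<theta>) \<le> ennreal \<epsilon> * ennreal (b powr p * (\<bar>sin \<theta>\<bar> + 1 / real m))"
          using \<epsilon>0 by (simp flip: ennreal_mult add: ennreal_leI)
        also have "\<dots> \<le> ennreal \<epsilon> * H \<theta>" by (intro mult_left_mono bH) simp
        finally show ?thesis by (rule order_trans) simp
      next
        case True
        let ?x = "cos \<theta>"
        have phi: "dt_phi ?x = sin \<theta>" using s0 by (simp add: dt_phi_cos)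
        have "(2 * real k * h)\<^sup>2 \<le> (sin \<theta>)\<^sup>2" using True h by (intro power_mono) auto
        then have "2 * (real k)\<^sup>2 * h\<^sup>2 \<le> 1 - \<bar>?x\<bar>"
          using sin_square_le[OF \<theta>] by (simp add: power_mult_distrib)
        then have xm: "?x \<in> main_part k h" by (auto simp: main_part_def abs_if split: if_splits)
        have valid: "real k / 2 * h * sin \<theta> \<le> 1 - \<bar>?x\<bar>"
        proof -
          have "real k / 2 * h \<le> sin \<theta> / 4" using True by (simp add: field_simps)
          then have "real k / 2 * h * sin \<theta> \<le> sin \<theta> / 4 * sin \<theta>" using s0 by (rule mult_right_mono)
          also have "\<dots> \<le> (sin \<theta>)\<^sup>2 / 2" by (simp add: power2_eq_square)
          also have "\<dots> \<le> 1 - \<bar>?x\<bar>" using sin_square_le[OF \<theta>] by simp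
          finally show ?thesis .
        qed
        \<comment> \<open>The point \<xi> lies in the stencil of x = cos \<theta>, hence its angle
          \<tau> is within d of \<theta>. The value T(\<tau>) is read off the difference;
          T(\<theta>) differs from it by the local Lipschitz bound.\<close>
        obtain \<xi> where \<xi>: "\<bar>\<xi> - ?x\<bar> \<le> real k / 2 * \<bar>h * sin \<theta>\<bar>"
          "central_diff k (h * sin \<theta>) (poly P) ?x = (h * sin \<theta>) ^ k * poly ?G \<xi>"
          using central_diff_poly_mean_value by blast
        have \<xi>x: "\<bar>\<xi> - ?x\<bar> \<le> real k / 2 * h * sin \<theta>" using \<xi>(1) h s0 by (simp add: abs_mult)
        have \<xi>1: "\<xi> \<in> {-1..1}" using \<xi>x valid by (auto simp: abs_if split: if_splits)
        define \<tau> where "\<tau> = arccos \<xi>"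
        have \<tau>: "\<tau> \<in> {0..pi}" "cos \<tau> = \<xi>" using \<xi>1 by (auto simp: \<tau>_def arccos_lbound arccos_ubound)
        have "\<bar>\<tau> - \<theta>\<bar> \<le> pi * (real k / 2 * h)"
          using \<xi>x \<tau> h by (intro angle_distance_le[OF \<theta>]) auto
        then have \<tau>d: "\<bar>\<tau> - \<theta>\<bar> \<le> d" by (simp add: d_def a_def)
        then have \<tau>m: "\<bar>\<tau> - \<theta>\<bar> \<le> 1 / real m" using dm by linarith
        have dd: "dt_diff k h (poly P) ?x = h ^ k * sin \<theta> ^ k * poly ?G \<xi>"
        proof -
          define e where "e = real k / 2 * h * sin \<theta>"
          have "0 \<le> e" using h s0 by (simp add: e_def)
          moreover have "e \<le> 1 - \<bar>?x\<bar>" using valid by (simp add: e_def)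
          ultimately have "?x + e \<in> {-1..1} \<and> ?x - e \<in> {-1..1}" by auto
          then show ?thesis
            unfolding dt_diff_central_diff phi e_def[symmetric] by (simp add: \<xi>(2) power_mult_distrib)
        qed
        have sin\<tau>: "sin \<tau> \<le> 2 * sin \<theta>"
        proof -
          have "\<bar>sin \<tau> - sin \<theta>\<bar> \<le> \<bar>\<tau> - \<theta>\<bar>"
          proof -
            have "\<bar>sin \<tau> - sin \<theta>\<bar> = 2 * \<bar>sin ((\<tau> - \<theta>) / 2)\<bar> * \<bar>cos ((\<tau> + \<theta>) / 2)\<bar>"
              by (simp add: sin_diff_sin abs_mult)
            also have "\<dots> \<le> 2 * \<bar>(\<tau> - \<theta>) / 2\<bar> * 1"
              using abs_sin_x_le_abs_x[of "(\<tau> - \<theta>) / 2"] by (intro mult_mono) auto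
            finally show ?thesis by simp
          qed
          also have "\<dots> \<le> pi * (real k / 2) * h" using \<tau>d by (simp add: d_def a_def)
          also have "\<dots> \<le> 2 * real k * h"
          proof -
            have "pi * (real k / 2) \<le> 4 * (real k / 2)" using pi_less_4 by (intro mult_right_mono) auto
            then show ?thesis using h by (intro mult_right_mono) auto
          qed
          also have "\<dots> \<le> sin \<theta>" by (rule True)
          finally show ?thesis by linarith
        qed
        have "\<bar>?T \<tau>\<bar> = sin \<tau> ^ M * \<bar>poly ?G \<xi>\<bar>"
          using \<tau> by (simp add: weighted_trig_def abs_mult power_abs sin_ge_zero)
        also have "\<dots> \<le> (2 * sin \<theta>) ^ M * \<bar>poly ?G \<xi>\<bar>"
          using sin\<tau> \<tau> by (intro mult_right_mono power_mono) (auto simp: sin_ge_zero)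
        also have "\<dots> = 2 ^ M / h ^ k * \<bar>dt_phi ?x ^ r * dt_diff k h (poly P) ?x\<bar>"
          using h s0 by (simp add: dd phi M_def abs_mult power_abs power_mult_distrib power_add)
        finally have T\<tau>: "\<bar>?T \<tau>\<bar> \<le> 2 ^ M / h ^ k * \<bar>dt_phi ?x ^ r * dt_diff k h (poly P) ?x\<bar>" (is "_ \<le> _ * ?D") .
        have "C * (real m * \<bar>\<tau> - \<theta>\<bar>) * b \<le> C * (a * c) * b"
          using C b0 mult_left_mono[OF \<tau>d, of "real m"] md by (intro mult_right_mono mult_left_mono) auto
        then have "\<bar>?T \<theta>\<bar> \<le> 2 ^ M / h ^ k * ?D + C * a * c * b"
          using b(2)[OF \<tau>m] T\<tau> by (simp add: mult.assoc)
        then have "\<bar>?T \<theta>\<bar> powr p \<le> (2 ^ M / h ^ k * ?D + C * a * c * b) powr p"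
          using p by (intro powr_mono2) auto
        also have "\<dots> \<le> (2 ^ M / h ^ k * ?D) powr p + (C * a * c * b) powr p"
          using h C a c0 b0 p by (intro powr_subadditive) auto
        also have "(2 ^ M / h ^ k * ?D) powr p = (2 ^ M) powr p / (h ^ k) powr p * ?D powr p"
          using h by (simp add: powr_mult powr_divide)
        also have "(C * a * c * b) powr p = (C * a * c) powr p * b powr p"
          using C a c0 b0 by (simp add: powr_mult)
        finally have "\<bar>?T \<theta>\<bar> powr p * sin \<theta> \<le>
            ((2 ^ M) powr p / (h ^ k) powr p * ?D powr p + (C * a * c) powr p * b powr p) * sin \<theta>"
          using s0 by (rule mult_right_mono)
        also have "\<dots> = (2 ^ M) powr p / (h ^ k) powr p * (?D powr p * sin \<theta>) + (C * a * c) powr p * (b powr p * sin \<theta>)"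
          by (simp add: algebra_simps)
        also have "\<dots> \<le> (2 ^ M) powr p / (h ^ k) powr p * (?D powr p * sin \<theta>) + \<epsilon> * (b powr p * (\<bar>sin \<theta>\<bar> + 1 / real m))"
          using c0 s0 by (intro add_left_mono mult_mono) (auto simp: \<epsilon>_def)
        finally have "ennreal (\<bar>?T \<theta>\<bar> powr p * sin \<theta>) \<le>
            ennreal ((2 ^ M) powr p / (h ^ k) powr p * (?D powr p * sin \<theta>) + \<epsilon> * (b powr p * (\<bar>sin \<theta>\<bar> + 1 / real m)))"
          by (rule ennreal_leI)
        also have "\<dots> = ennreal ((2 ^ M) powr p / (h ^ k) powr p) * (ennreal (?D powr p) * ennreal (sin \<theta>)) + ennreal \<epsilon> * ennreal (b powr p * (\<bar>sin \<theta>\<bar> + 1 / real m))"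
          using s0 \<epsilon>0 by (simp flip: ennreal_mult ennreal_plus)
        also have "\<dots> \<le> ennreal ((2 ^ M) powr p / (h ^ k) powr p) * (F ?x * indicator (main_part k h) ?x * ennreal (sin \<theta>)) + ennreal \<epsilon> * H \<theta>"
          using xm by (intro add_mono mult_left_mono bH) (auto simp: F_def)
        finally show ?thesis .
      qed
    qed
    have X: "(\<integral>\<^sup>+\<theta>\<in>{0..pi}. F (cos \<theta>) * indicator (main_part k h) (cos \<theta>) * ennreal (sin \<theta>) \<partial>lborel) = X"
    proof -
      have [measurable]: "main_part k h \<in> sets borel" by (simp add: main_part_def)
      have "(\<integral>\<^sup>+\<theta>\<in>{0..pi}. F (cos \<theta>) * indicator (main_part k h) (cos \<theta>) * ennreal (sin \<theta>) \<partial>lborel) =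
        (\<integral>\<^sup>+x\<in>{-1..1}. F x * indicator (main_part k h) x \<partial>lborel)"
        by (rule nn_integral_cos_substitution[symmetric]) measurable
      also have "\<dots> = X" unfolding X_def
        by (intro nn_integral_cong) (auto simp: indicator_def main_part_def intro: order_trans[rotated] order_trans)
      finally show ?thesis .
    qed
    let ?e = "(2 ^ M) powr p / (h ^ k) powr p"
    have "?N \<le> (\<integral>\<^sup>+\<theta>. ennreal ?e * (F (cos \<theta>) * indicator (main_part k h) (cos \<theta>) * ennreal (sin \<theta>) * indicator {0..pi} \<theta>)
        + ennreal \<epsilon> * (H \<theta> * indicator {0..pi} \<theta>) \<partial>lborel)"
      unfolding trig_mass_def
    proof (intro nn_integral_mono)
      fix \<theta>
      show "ennreal (\<bar>?T \<theta>\<bar> powr p * sin \<theta>) * indicator {0..pi} \<theta> \<le>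
        ennreal ?e * (F (cos \<theta>) * indicator (main_part k h) (cos \<theta>) * ennreal (sin \<theta>) * indicator {0..pi} \<theta>)
        + ennreal \<epsilon> * (H \<theta> * indicator {0..pi} \<theta>)"
        using main[of \<theta>] by (cases "\<theta> \<in> {0..pi}") auto
    qed
    also have "\<dots> = ennreal ?e * X + ennreal \<epsilon> * (\<integral>\<^sup>+\<theta>\<in>{0..pi}. H \<theta> \<partial>lborel)"
    proof -
      have [measurable]: "main_part k h \<in> sets borel" by (simp add: main_part_def)
      show ?thesis unfolding X[symmetric]
        by (subst nn_integral_add, measurable, subst nn_integral_cmult, measurable, subst nn_integral_cmult, measurable)
    qed
    also have "\<dots> \<le> ennreal ?e * X + ennreal \<epsilon> * (ennreal C * ?N)"
      by (intro add_left_mono mult_left_mono HI) simp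
    also have "ennreal \<epsilon> * (ennreal C * ?N) = ennreal (\<epsilon> * C) * ?N"
      using \<epsilon>0 C by (simp add: ennreal_mult mult.assoc)
    \<comment> \<open>At most half of the finite mass stands on the right and is subtracted.\<close>
    finally have absorb: "?N \<le> ennreal ?e * X + ennreal (\<epsilon> * C) * ?N" .
    define n where "n = enn2real ?N"
    have n: "?N = ennreal n" "0 \<le> n" using trig_mass_finite[OF p(1), of M ?G] by (simp_all add: n_def)
    have "?N \<le> ennreal (2 * ?e) * X"
    proof (cases "X = \<infinity>")
      case True
      then show ?thesis using h by (simp add: ennreal_mult_top)
    next
      case False
      then obtain x where x: "X = ennreal x" "0 \<le> x" by (cases X) auto
      have "ennreal n \<le> ennreal (?e * x + \<epsilon> * C * n)"
        using absorb x n \<epsilon>0 C by (simp flip: ennreal_mult ennreal_plus)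
      then have "n \<le> ?e * x + \<epsilon> * C * n" using x n \<epsilon>0 C by (subst (asm) ennreal_le_iff) auto
      also have "\<epsilon> * C * n \<le> 1 / 2 * n" using \<epsilon>C n by (intro mult_right_mono) auto
      finally have "n \<le> 2 * ?e * x" by simp
      then show ?thesis using x n by (simp flip: ennreal_mult add: ennreal_leI)
    qed
    then have "ennreal ((h ^ k) powr p) * ?N \<le> ennreal ((h ^ k) powr p) * (ennreal (2 * ?e) * X)"
      by (rule mult_left_mono) simp
    also have "\<dots> = ennreal E * X"
      unfolding mult.assoc[symmetric] using h by (simp flip: ennreal_mult add: E_def)
    finally show "ennreal ((h ^ k) powr p) * trig_mass p (r + k) ?G \<le>
      ennreal E * (\<integral>\<^sup>+x\<in>main_part k h. ennreal (\<bar>dt_phi x ^ r * dt_diff k h (poly P) x\<bar> powr p) \<partial>lborel)"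
      by (simp add: M_def X_def F_def)
  qed
qed

section \<open>Polynomials of large degree\<close>

lemma powr_sum_subadditive:
  fixes f :: "'a \<Rightarrow> real"
  assumes "finite I" "\<And>i. i \<in> I \<Longrightarrow> 0 \<le> f i" "0 < p" "p \<le> 1"
  shows "(\<Sum>i\<in>I. f i) powr p \<le> (\<Sum>i\<in>I. f i powr p)"
  using assms(1,2)
proof (induction I rule: finite_induct)
  case (insert i I)
  have "(f i + sum f I) powr p \<le> f i powr p + (sum f I) powr p"
  proof (rule powr_subadditive[OF _ _ assms(3,4)])
    show "0 \<le> f i" "0 \<le> sum f I" using insert.prems by (auto intro: sum_nonneg)
  qed
  also have "\<dots> \<le> f i powr p + (\<Sum>i\<in>I. f i powr p)" using insert by (intro add_left_mono) auto
  finally show ?case using insert by simp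
qed simp

text \<open>The interval $[0,\pi]$ is cut into 4m cells of length less than $1/m$, on each of which T is
  essentially constant; a cell near $\theta'$ is reached by the stencils of x from a set of measure
  at most a multiple of $|h|(\sin\theta' + 1/m)$.\<close>

lemma right_remainder_poly_rough:
  fixes p :: real and B r s :: nat
  assumes p: "0 < p" "p < 1" and r: "1 \<le> r" and s: "1 \<le> s"
  shows "\<exists>C>0. \<forall>m (D :: real poly) h. 1 \<le> m \<longrightarrow> r + degree D \<le> B * m \<longrightarrow> 1 \<le> real m * \<bar>h\<bar> \<longrightarrow>
    (\<exists>G\<in>borel_measurable borel. (\<forall>x. 0 \<le> G x) \<and>
      (\<forall>x. -1 \<le> x \<longrightarrow> x < 1 \<longrightarrow> x + real s / 2 * \<bar>h\<bar> * dt_phi x \<le> 1 \<longrightarrow>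
         right_remainder (real s / 2 * \<bar>h\<bar>) (r - 1) (poly D) x \<le> ennreal (G x)) \<and>
      (\<integral>\<^sup>+x. ennreal (G x powr p) \<partial>lborel)
        \<le> ennreal (C * (\<bar>h\<bar> ^ r) powr p * (real m * \<bar>h\<bar>) powr (1 - p)) * trig_mass p r D)"
proof -
  obtain C where C: "C > 0" and *: "\<forall>m M (P :: real poly). 1 \<le> m \<longrightarrow> M + degree P \<le> B * m \<longrightarrow>
    (\<exists>H\<in>borel_measurable borel.
       (\<integral>\<^sup>+\<theta>\<in>{0..pi}. H \<theta> \<partial>lborel) \<le> ennreal C * trig_mass p M P \<and>
       (\<forall>\<theta>. H \<theta> \<le> ennreal (C * real m) * trig_mass p M P) \<and>
       (\<forall>\<theta>. \<exists>b\<ge>0. (\<forall>\<tau>. \<bar>\<tau> - \<theta>\<bar> \<le> 1 / real m \<longrightarrow>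
               \<bar>weighted_trig M P \<tau>\<bar> \<le> b \<and>
               \<bar>weighted_trig M P \<tau> - weighted_trig M P \<theta>\<bar> \<le> C * (real m * \<bar>\<tau> - \<theta>\<bar>) * b) \<and>
             ennreal (b powr p * (\<bar>sin \<theta>\<bar> + 1 / real m)) \<le> H \<theta>))"
    using weighted_trig_local_bound[OF p(1), of B] by (elim exE conjE) (rule that)
  define c where "c = (real s ^ (r - 1)) powr p * (2 * (3 * real s + 1))"
  have c0: "0 < c" using s by (simp add: c_def)
  show ?thesis
  proof (rule exI[of _ "c * C"], intro conjI allI impI)
    show "0 < c * C" using c0 C by simp
    fix m :: nat and D :: "real poly" and h :: real
    assume m: "1 \<le> m" and deg: "r + degree D \<le> B * m" and mh: "1 \<le> real m * \<bar>h\<bar>"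
    define A where "A = real s / 2 * \<bar>h\<bar>"
    have h0: "0 < \<bar>h\<bar>" using mh by (cases "h = 0") auto
    have A0: "0 < A" using h0 s by (simp add: A_def)
    let ?T = "weighted_trig r D"
    from *[rule_format, OF m deg] obtain H where [measurable]: "H \<in> borel_measurable borel"
      and HI: "(\<integral>\<^sup>+\<theta>\<in>{0..pi}. H \<theta> \<partial>lborel) \<le> ennreal C * trig_mass p r D"
      and Hb: "\<And>\<theta>. \<exists>b\<ge>0. (\<forall>\<tau>. \<bar>\<tau> - \<theta>\<bar> \<le> 1 / real m \<longrightarrow>
               \<bar>?T \<tau>\<bar> \<le> b \<and> \<bar>?T \<tau> - ?T \<theta>\<bar> \<le> C * (real m * \<bar>\<tau> - \<theta>\<bar>) * b) \<and>
             ennreal (b powr p * (\<bar>sin \<theta>\<bar> + 1 / real m)) \<le> H \<theta>"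
      by blast
    \<comment> \<open>\<pi> < 4 makes each cell shorter than 1/m, and therefore also shorter than
      |h|.\<close>
    define n where "n = 4 * m"
    define cl where "cl = pi / real n"
    have cl0: "0 < cl" using m by (simp add: cl_def n_def)
    have clm: "cl \<le> 1 / real m" using m pi_less_4 by (simp add: cl_def n_def field_simps)
    have clh: "cl \<le> \<bar>h\<bar>"
    proof -
      have "1 / real m \<le> \<bar>h\<bar>" using mh m by (simp add: field_simps)
      then show ?thesis using clm by linarith
    qed
    define lo where "lo i = real i * cl" for i :: nat
    have lo_Suc: "lo (Suc i) = lo i + cl" for i by (simp add: lo_def algebra_simps)
    have lo_range: "0 \<le> lo i" "lo (Suc i) \<le> pi" if "i < n" for i
    proof -
      show "0 \<le> lo i" using cl0 by (simp add: lo_def)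
      have "lo (Suc i) \<le> real n * cl" unfolding lo_def using that cl0 by (intro mult_right_mono) auto
      then show "lo (Suc i) \<le> pi" using m by (simp add: cl_def n_def)
    qed
    have contT: "continuous_on S ?T" for S unfolding weighted_trig_def[abs_def] by (intro continuous_intros)
    \<comment> \<open>The maximum point of a cell lies within 1/m of every \<theta> in the cell, so
      the cell maximum is controlled by H at each of them; this allows averaging over the
      cell.\<close>
    have "\<exists>b\<ge>0. (\<forall>\<tau>\<in>{lo i..lo (Suc i)}. \<bar>?T \<tau>\<bar> \<le> b) \<and>
        (\<forall>\<theta>\<in>{lo i..lo (Suc i)}. ennreal (b powr p * (\<bar>sin \<theta>\<bar> + 1 / real m)) \<le> H \<theta>)" for i
    proof -
      have "\<exists>\<tau>\<in>{lo i..lo (Suc i)}. \<forall>\<theta>\<in>{lo i..lo (Suc i)}. \<bar>?T \<theta>\<bar> \<le> \<bar>?T \<tau>\<bar>"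
        by (rule continuous_attains_sup) (use cl0 contT in \<open>auto simp: lo_Suc intro!: continuous_intros\<close>)
      then obtain \<tau> where \<tau>: "\<tau> \<in> {lo i..lo (Suc i)}" "\<And>\<theta>. \<theta> \<in> {lo i..lo (Suc i)} \<Longrightarrow> \<bar>?T \<theta>\<bar> \<le> \<bar>?T \<tau>\<bar>" by blast
      have "ennreal (\<bar>?T \<tau>\<bar> powr p * (\<bar>sin \<theta>\<bar> + 1 / real m)) \<le> H \<theta>" if \<theta>: "\<theta> \<in> {lo i..lo (Suc i)}" for \<theta>
      proof -
        have "\<bar>\<tau> - \<theta>\<bar> \<le> 1 / real m" using \<tau>(1) \<theta> clm by (auto simp: lo_Suc abs_if)
        moreover obtain b where "b \<ge> 0" "\<And>\<tau>. \<bar>\<tau> - \<theta>\<bar> \<le> 1 / real m \<Longrightarrow> \<bar>?T \<tau>\<bar> \<le> b"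
          "ennreal (b powr p * (\<bar>sin \<theta>\<bar> + 1 / real m)) \<le> H \<theta>" using Hb[of \<theta>] by blast
        ultimately have "\<bar>?T \<tau>\<bar> powr p * (\<bar>sin \<theta>\<bar> + 1 / real m) \<le> b powr p * (\<bar>sin \<theta>\<bar> + 1 / real m)"
          using p by (intro mult_right_mono powr_mono2) auto
        then show ?thesis using \<open>ennreal (b powr p * _) \<le> H \<theta>\<close> by (meson ennreal_leI order_trans)
      qed
      then show ?thesis using \<tau>(2) by (intro exI[of _ "\<bar>?T \<tau>\<bar>"]) auto
    qed
    then obtain b where b: "\<And>i. 0 \<le> b i" "\<And>i \<tau>. \<tau> \<in> {lo i..lo (Suc i)} \<Longrightarrow> \<bar>?T \<tau>\<bar> \<le> b i"
      "\<And>i \<theta>. \<theta> \<in> {lo i..lo (Suc i)} \<Longrightarrow> ennreal (b i powr p * (\<bar>sin \<theta>\<bar> + 1 / real m)) \<le> H \<theta>"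
      by metis
    define X where "X i = {x. -1 \<le> x \<and> x < 1 \<and> x \<le> cos (lo i) \<and> cos (lo (Suc i)) \<le> x + A * dt_phi x \<and> x + A * dt_phi x \<le> 1}" for i
    have [measurable]: "X i \<in> sets borel" for i unfolding X_def by measurable
    \<comment> \<open>The largest contribution of cell i to the remainder. The weight \<phi>^(r-1)
      from the kernel and the Jacobian sin \<tau> together form the sin^r contained in T.\<close>
    define g where "g i = (2 * A) ^ (r - 1) * b i * cl" for i
    have g0: "0 \<le> g i" for i using A0 b cl0 by (simp add: g_def)
    define G where "G x = (\<Sum>i<n. g i * indicator (X i) x)" for x
    have G0: "0 \<le> G x" for x by (simp add: G_def sum_nonneg g0)
    have [measurable]: "G \<in> borel_measurable borel" unfolding G_def[abs_def] by measurable
    show "\<exists>G\<in>borel_measurable borel. (\<forall>x. 0 \<le> G x) \<and>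
      (\<forall>x. -1 \<le> x \<longrightarrow> x < 1 \<longrightarrow> x + real s / 2 * \<bar>h\<bar> * dt_phi x \<le> 1 \<longrightarrow>
         right_remainder (real s / 2 * \<bar>h\<bar>) (r - 1) (poly D) x \<le> ennreal (G x)) \<and>
      (\<integral>\<^sup>+x. ennreal (G x powr p) \<partial>lborel)
        \<le> ennreal (c * C * (\<bar>h\<bar> ^ r) powr p * (real m * \<bar>h\<bar>) powr (1 - p)) * trig_mass p r D"
    proof (intro bexI[of _ G] conjI allI impI G0)
      show "G \<in> borel_measurable borel" by measurable
      fix x assume x: "-1 \<le> x" "x < 1" "x + real s / 2 * \<bar>h\<bar> * dt_phi x \<le> 1"
      define \<psi> where "\<psi> = x + A * dt_phi x"
      have \<psi>1: "\<psi> \<le> 1" using x by (simp add: \<psi>_def A_def)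
      have "right_remainder A (r - 1) (poly D) x \<le>
          (\<integral>\<^sup>+t\<in>{-1..1}. ennreal ((2 * A * dt_phi t) ^ (r - 1) * \<bar>poly D t\<bar>) * indicator {x..\<psi>} t \<partial>lborel)"
        unfolding right_remainder_def \<psi>_def[symmetric]
      proof (intro nn_integral_mono)
        fix t
        show "ennreal ((\<psi> - t) ^ (r - 1) * \<bar>poly D t\<bar>) * indicator {x..\<psi>} t \<le>
          ennreal ((2 * A * dt_phi t) ^ (r - 1) * \<bar>poly D t\<bar>) * indicator {x..\<psi>} t * indicator {-1..1} t"
        proof (cases "t \<in> {x..\<psi>}")
          case True
          then have "x \<in> stencil_reach A t" using x \<psi>1 by (auto simp: stencil_reach_def \<psi>_def)
          from stencil_reach_pointwise[OF _ this] have "(\<psi> - t) ^ (r - 1) \<le> (2 * A * dt_phi t) ^ (r - 1)"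
            using A0 True by (intro power_mono) (auto simp: \<psi>_def)
          moreover have "t \<in> {-1..1}" using True x \<psi>1 by auto
          ultimately show ?thesis using True by (simp add: ennreal_leI mult_right_mono)
        qed simp
      qed
      also have "\<dots> = (\<integral>\<^sup>+\<tau>\<in>{0..pi}. ennreal ((2 * A * dt_phi (cos \<tau>)) ^ (r - 1) * \<bar>poly D (cos \<tau>)\<bar>) * indicator {x..\<psi>} (cos \<tau>) * ennreal (sin \<tau>) \<partial>lborel)"
        by (rule nn_integral_cos_substitution) measurable
      also have "\<dots> \<le> (\<integral>\<^sup>+\<tau>. (\<Sum>i<n. ennreal ((2 * A) ^ (r - 1) * b i) * indicator (X i) x * indicator {lo i..lo (Suc i)} \<tau>) \<partial>lborel)"
      proof (intro nn_integral_mono)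
        fix \<tau>
        show "ennreal ((2 * A * dt_phi (cos \<tau>)) ^ (r - 1) * \<bar>poly D (cos \<tau>)\<bar>) * indicator {x..\<psi>} (cos \<tau>) * ennreal (sin \<tau>) * indicator {0..pi} \<tau>
          \<le> (\<Sum>i<n. ennreal ((2 * A) ^ (r - 1) * b i) * indicator (X i) x * indicator {lo i..lo (Suc i)} \<tau>)"
        proof (cases "\<tau> \<in> {0..pi} \<and> cos \<tau> \<in> {x..\<psi>}")
          case True
          then have \<tau>: "\<tau> \<in> {0..pi}" "x \<le> cos \<tau>" "cos \<tau> \<le> \<psi>" by auto
          have s0: "0 \<le> sin \<tau>" using \<tau> by (simp add: sin_ge_zero)
          \<comment> \<open>The floor would put \<tau> = \<pi> into a cell beyond the last
            one.\<close>
          define i where "i = (if \<tau> = pi then n - 1 else nat \<lfloor>\<tau> / cl\<rfloor>)"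
          have i: "i < n \<and> \<tau> \<in> {lo i..lo (Suc i)}"
          proof (cases "\<tau> = pi")
            case True
            have "real n * cl = pi" using m by (simp add: cl_def n_def)
            moreover have "Suc (n - 1) = n" using m by (simp add: n_def)
            ultimately show ?thesis using True cl0 m
              by (auto simp: i_def lo_def n_def algebra_simps)
          next
            case False
            then have ii: "i = nat \<lfloor>\<tau> / cl\<rfloor>" by (simp add: i_def)
            have nn: "0 \<le> \<tau> / cl" using \<tau> cl0 by simp
            have ri: "real i = of_int \<lfloor>\<tau> / cl\<rfloor>" using nn by (simp add: ii)
            have "real i \<le> \<tau> / cl" "\<tau> / cl < real i + 1" unfolding ri by linarith+
            then have 1: "real i * cl \<le> \<tau>" "\<tau> < (real i + 1) * cl" using cl0 by (simp_all add: field_simps)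
            have "\<tau> < pi" using \<tau> False by auto
            then have "real i * cl < real n * cl" using 1 m by (simp add: cl_def n_def)
            then have "i < n" using cl0 by simp
            then show ?thesis using 1 by (auto simp: lo_def add.commute)
          qed
          have xX: "x \<in> X i"
          proof -
            have "cos \<tau> \<le> cos (lo i)" "cos (lo (Suc i)) \<le> cos \<tau>"
              using i lo_range[of i] \<tau> by (auto intro!: cos_monotone_0_pi_le)
            then show ?thesis using x \<tau> \<psi>1 by (auto simp: X_def \<psi>_def)
          qed
          have "(2 * A * dt_phi (cos \<tau>)) ^ (r - 1) * \<bar>poly D (cos \<tau>)\<bar> * sin \<tau> = (2 * A) ^ (r - 1) * \<bar>?T \<tau>\<bar>"
          proof -
            have "sin \<tau> ^ (r - 1) * sin \<tau> = sin \<tau> ^ r" using r by (cases r) auto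
            then show ?thesis using s0
              by (simp add: dt_phi_cos weighted_trig_def abs_mult power_abs power_mult_distrib mult_ac)
          qed
          also have "\<dots> \<le> (2 * A) ^ (r - 1) * b i" using b(2)[of \<tau> i] i A0 by (intro mult_left_mono) auto
          finally have "ennreal ((2 * A * dt_phi (cos \<tau>)) ^ (r - 1) * \<bar>poly D (cos \<tau>)\<bar>) * ennreal (sin \<tau>)
              \<le> ennreal ((2 * A) ^ (r - 1) * b i) * indicator (X i) x * indicator {lo i..lo (Suc i)} \<tau>"
            using s0 xX i A0 by (simp flip: ennreal_mult add: ennreal_leI dt_phi_cos)
          also have "\<dots> \<le> (\<Sum>i<n. ennreal ((2 * A) ^ (r - 1) * b i) * indicator (X i) x * indicator {lo i..lo (Suc i)} \<tau>)"
            using i by (intro member_le_sum) auto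
          finally show ?thesis using True by simp
        next
          case False
          then show ?thesis by (auto simp: indicator_def)
        qed
      qed
      also have "\<dots> = (\<Sum>i<n. ennreal ((2 * A) ^ (r - 1) * b i) * indicator (X i) x * emeasure lborel {lo i..lo (Suc i)})"
        by (subst nn_integral_sum) (auto simp: nn_integral_cmult_indicator)
      also have "\<dots> = (\<Sum>i<n. ennreal (g i * indicator (X i) x))"
        using A0 b(1) cl0
        by (intro sum.cong refl) (auto simp: lo_Suc g_def indicator_def simp flip: ennreal_mult)
      also have "\<dots> = ennreal (G x)" unfolding G_def by (rule sum_ennreal) (simp add: g0)
      finally show "right_remainder (real s / 2 * \<bar>h\<bar>) (r - 1) (poly D) x \<le> ennreal (G x)"
        by (simp add: A_def)
    next
      \<comment> \<open>Either the right half-stencil of x contains the left end t of the cell's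
        image under cos, and \<open>nn_integral_stencil_kernel_le\<close> with n = 0 measures such
        x, or x lies in the image itself.\<close>
      have muX: "emeasure lborel (X i) \<le> ennreal ((3 * real s + 1) * \<bar>h\<bar> * (\<bar>sin \<theta>\<bar> + 1 / real m))"
        if i: "i < n" and \<theta>: "\<theta> \<in> {lo i..lo (Suc i)}" for i \<theta>
      proof -
        let ?t = "cos (lo (Suc i))"
        let ?S = "\<bar>sin \<theta>\<bar> + 1 / real m"
        have near: "sin y \<le> ?S" if "y \<in> {lo i..lo (Suc i)}" for y
        proof -
          have "\<bar>sin y - sin \<theta>\<bar> = 2 * \<bar>sin ((y - \<theta>) / 2)\<bar> * \<bar>cos ((y + \<theta>) / 2)\<bar>"
            by (simp add: sin_diff_sin abs_mult)
          also have "\<dots> \<le> 2 * \<bar>(y - \<theta>) / 2\<bar> * 1"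
            using abs_sin_x_le_abs_x[of "(y - \<theta>) / 2"] by (intro mult_mono) auto
          finally have "\<bar>sin y - sin \<theta>\<bar> \<le> \<bar>y - \<theta>\<bar>" by simp
          also have "\<dots> \<le> cl" using that \<theta> by (auto simp: lo_Suc abs_le_iff)
          finally show ?thesis using clm by linarith
        qed
        have lr: "0 \<le> lo i" "lo (Suc i) \<le> pi" using lo_range[OF i] by auto
        have "emeasure lborel (stencil_reach A ?t) = (\<integral>\<^sup>+x\<in>stencil_reach A ?t. ennreal ((x + A * dt_phi x - ?t) ^ 0) \<partial>lborel)"
          by simp
        also have "\<dots> \<le> ennreal (3 * (2 * A * dt_phi ?t) ^ Suc 0)"
          by (rule nn_integral_stencil_kernel_le) (use A0 in auto)
        also have "\<dots> \<le> ennreal (3 * real s * \<bar>h\<bar> * ?S)"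
        proof (rule ennreal_leI)
          have "sin (lo (Suc i)) \<ge> 0" using lr cl0 by (intro sin_ge_zero) (auto simp: lo_Suc)
          then have "dt_phi ?t \<le> ?S" using near[of "lo (Suc i)"] cl0 by (simp add: dt_phi_cos lo_Suc)
          then have "(3 * real s * \<bar>h\<bar>) * dt_phi ?t \<le> (3 * real s * \<bar>h\<bar>) * ?S" by (intro mult_left_mono) auto
          then show "3 * (2 * A * dt_phi ?t) ^ Suc 0 \<le> 3 * real s * \<bar>h\<bar> * ?S" by (simp add: A_def)
        qed
        finally have m1: "emeasure lborel (stencil_reach A ?t) \<le> ennreal (3 * real s * \<bar>h\<bar> * ?S)" .
        have "cos (lo i) - ?t = 2 * sin ((lo i + lo (Suc i)) / 2) * sin (cl / 2)"
          by (simp add: cos_diff_cos lo_Suc)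
        also have "\<dots> \<le> 2 * ?S * (cl / 2)"
        proof (intro mult_mono)
          show "sin ((lo i + lo (Suc i)) / 2) \<le> ?S" using cl0 by (intro near) (auto simp: lo_Suc)
          show "0 \<le> sin ((lo i + lo (Suc i)) / 2)" using lr cl0 by (intro sin_ge_zero) (auto simp: lo_Suc)
          show "sin (cl / 2) \<le> cl / 2" using cl0 by (intro sin_x_le_x) simp
          have "cl \<le> pi" using lr by (simp add: lo_Suc)
          then show "0 \<le> sin (cl / 2)" using cl0 by (intro sin_ge_zero) auto
        qed auto
        also have "\<dots> = cl * ?S" by simp
        also have "\<dots> \<le> \<bar>h\<bar> * ?S" using clh by (intro mult_right_mono) auto
        finally have "cos (lo i) - ?t \<le> \<bar>h\<bar> * ?S" .
        then have m2: "emeasure lborel {?t..cos (lo i)} \<le> ennreal (\<bar>h\<bar> * ?S)"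
          by (cases "?t \<le> cos (lo i)") (auto intro: ennreal_leI)
        have "X i \<subseteq> stencil_reach A ?t \<union> {?t..cos (lo i)}"
          by (auto simp: X_def stencil_reach_def)
        then have "emeasure lborel (X i) \<le> emeasure lborel (stencil_reach A ?t \<union> {?t..cos (lo i)})"
          by (intro emeasure_mono) auto
        also have "\<dots> \<le> emeasure lborel (stencil_reach A ?t) + emeasure lborel {?t..cos (lo i)}"
          by (intro emeasure_subadditive) auto
        also have "\<dots> \<le> ennreal (3 * real s * \<bar>h\<bar> * ?S) + ennreal (\<bar>h\<bar> * ?S)" by (intro add_mono m1 m2)
        also have "\<dots> = ennreal ((3 * real s + 1) * \<bar>h\<bar> * ?S)"
          by (simp flip: ennreal_plus add: algebra_simps)
        finally show ?thesis .
      qed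
      define k where "k = ((2 * A) ^ (r - 1) * cl) powr p * ((3 * real s + 1) * \<bar>h\<bar>)"
      have k0: "0 \<le> k" by (simp add: k_def)
      \<comment> \<open>The estimate holds for each \<theta> of the cell and is averaged. Half-open
        cells are disjoint, so the integrals of H add up to at most its integral over
        [0, \<pi>].\<close>
      have cell: "ennreal (g i powr p) * emeasure lborel (X i) \<le>
          ennreal (k / cl) * (\<integral>\<^sup>+\<theta>. H \<theta> * indicator {lo i<..lo (Suc i)} \<theta> \<partial>lborel)" if i: "i < n" for i
      proof -
        have pt: "ennreal (g i powr p) * emeasure lborel (X i) \<le> ennreal k * H \<theta>"
          if \<theta>: "\<theta> \<in> {lo i..lo (Suc i)}" for \<theta>
        proof -
          have "ennreal (g i powr p) * emeasure lborel (X i) \<le> ennreal (g i powr p) * ennreal ((3 * real s + 1) * \<bar>h\<bar> * (\<bar>sin \<theta>\<bar> + 1 / real m))"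
            by (intro mult_left_mono muX i \<theta>) simp
          also have "\<dots> = ennreal k * ennreal (b i powr p * (\<bar>sin \<theta>\<bar> + 1 / real m))"
          proof -
            have "g i powr p = ((2 * A) ^ (r - 1) * cl) powr p * b i powr p"
              using A0 cl0 b(1)[of i] by (simp add: g_def powr_mult mult_ac)
            then show ?thesis using k0 by (simp flip: ennreal_mult add: k_def mult_ac)
          qed
          also have "\<dots> \<le> ennreal k * H \<theta>" by (intro mult_left_mono b(3) \<theta>) simp
          finally show ?thesis .
        qed
        have "ennreal cl * (ennreal (g i powr p) * emeasure lborel (X i)) =
           (\<integral>\<^sup>+\<theta>. ennreal (g i powr p) * emeasure lborel (X i) * indicator {lo i<..lo (Suc i)} \<theta> \<partial>lborel)"
          using cl0 by (subst nn_integral_cmult_indicator) (auto simp: lo_Suc mult.commute)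
        also have "\<dots> \<le> (\<integral>\<^sup>+\<theta>. ennreal k * (H \<theta> * indicator {lo i<..lo (Suc i)} \<theta>) \<partial>lborel)"
          using pt by (intro nn_integral_mono) (auto simp: indicator_def)
        also have "\<dots> = ennreal k * (\<integral>\<^sup>+\<theta>. H \<theta> * indicator {lo i<..lo (Suc i)} \<theta> \<partial>lborel)"
          by (rule nn_integral_cmult) measurable
        finally have le: "ennreal cl * (ennreal (g i powr p) * emeasure lborel (X i)) \<le> ennreal k * (\<integral>\<^sup>+\<theta>. H \<theta> * indicator {lo i<..lo (Suc i)} \<theta> \<partial>lborel)" .
        have "ennreal (g i powr p) * emeasure lborel (X i) = ennreal (1 / cl) * (ennreal cl * (ennreal (g i powr p) * emeasure lborel (X i)))"
          using cl0 by (simp add: mult.assoc[symmetric] flip: ennreal_mult)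
        also have "\<dots> \<le> ennreal (1 / cl) * (ennreal k * (\<integral>\<^sup>+\<theta>. H \<theta> * indicator {lo i<..lo (Suc i)} \<theta> \<partial>lborel))"
          by (intro mult_left_mono le) simp
        also have "\<dots> = ennreal (k / cl) * (\<integral>\<^sup>+\<theta>. H \<theta> * indicator {lo i<..lo (Suc i)} \<theta> \<partial>lborel)"
          using cl0 k0 by (simp add: mult.assoc[symmetric] flip: ennreal_mult)
        finally show ?thesis .
      qed
      have "(\<integral>\<^sup>+x. ennreal (G x powr p) \<partial>lborel) \<le> (\<integral>\<^sup>+x. (\<Sum>i<n. ennreal (g i powr p) * indicator (X i) x) \<partial>lborel)"
      proof (intro nn_integral_mono)
        fix x
        \<comment> \<open>Here the loss occurs: a stencil meets about m|h| cells, and the p-th power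
          is merely subadditive over them.\<close>
        have "G x powr p \<le> (\<Sum>i<n. (g i * indicator (X i) x) powr p)"
          unfolding G_def using p g0 by (intro powr_sum_subadditive) auto
        also have "\<dots> = (\<Sum>i<n. g i powr p * indicator (X i) x)"
          using p by (intro sum.cong) (auto simp: indicator_def)
        finally have "ennreal (G x powr p) \<le> ennreal (\<Sum>i<n. g i powr p * indicator (X i) x)" by (rule ennreal_leI)
        also have "\<dots> = (\<Sum>i<n. ennreal (g i powr p) * indicator (X i) x)"
          by (subst sum_ennreal[symmetric]) (auto simp: ennreal_mult ennreal_indicator)
        finally show "ennreal (G x powr p) \<le> (\<Sum>i<n. ennreal (g i powr p) * indicator (X i) x)" .
      qed
      also have "\<dots> = (\<Sum>i<n. ennreal (g i powr p) * emeasure lborel (X i))"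
        by (subst nn_integral_sum) (auto simp: nn_integral_cmult_indicator)
      also have "\<dots> \<le> (\<Sum>i<n. ennreal (k / cl) * (\<integral>\<^sup>+\<theta>. H \<theta> * indicator {lo i<..lo (Suc i)} \<theta> \<partial>lborel))"
        by (intro sum_mono cell) simp
      also have "\<dots> = ennreal (k / cl) * (\<integral>\<^sup>+\<theta>. (\<Sum>i<n. H \<theta> * indicator {lo i<..lo (Suc i)} \<theta>) \<partial>lborel)"
        by (subst nn_integral_sum) (auto simp: sum_distrib_left)
      also have "\<dots> \<le> ennreal (k / cl) * (\<integral>\<^sup>+\<theta>\<in>{0..pi}. H \<theta> \<partial>lborel)"
      proof (intro mult_left_mono nn_integral_mono)
        fix \<theta>
        have disj: "disjoint_family_on (\<lambda>i. {lo i<..lo (Suc i)}) {..<n}"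
          unfolding disjoint_family_on_def
        proof (intro ballI impI)
          have "{lo i<..lo (Suc i)} \<inter> {lo j<..lo (Suc j)} = {}" if "i < j" for i j
          proof -
            have "lo (Suc i) \<le> lo j" unfolding lo_def using that cl0 by (intro mult_right_mono) auto
            then show ?thesis by auto
          qed
          then show "{lo i<..lo (Suc i)} \<inter> {lo j<..lo (Suc j)} = {}" if "i \<noteq> j" for i j
            using that by (metis Int_commute linorder_neq_iff)
        qed
        have "(\<Sum>i<n. H \<theta> * indicator {lo i<..lo (Suc i)} \<theta>) = H \<theta> * indicator (\<Union>i<n. {lo i<..lo (Suc i)}) \<theta>"
          by (simp add: indicator_UN_disjoint[OF _ disj] sum_distrib_left)
        also have "\<dots> \<le> H \<theta> * indicator {0..pi} \<theta>"
        proof (rule mult_left_mono)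
          have "(\<Union>i<n. {lo i<..lo (Suc i)}) \<subseteq> {0..pi}" using lo_range by fastforce
          then show "indicator (\<Union>i<n. {lo i<..lo (Suc i)}) \<theta> \<le> (indicator {0..pi} \<theta> :: ennreal)"
          proof (cases "\<theta> \<in> (\<Union>i<n. {lo i<..lo (Suc i)})")
            case True
            with \<open>_ \<subseteq> {0..pi}\<close> have "\<theta> \<in> {0..pi}" by (rule subsetD)
            then show ?thesis unfolding indicator_simps(1)[OF True] by simp
          next
            case False
            then show ?thesis unfolding indicator_simps(2)[OF False] by simp
          qed
        qed simp
        finally show "(\<Sum>i<n. H \<theta> * indicator {lo i<..lo (Suc i)} \<theta>) \<le> H \<theta> * indicator {0..pi} \<theta>" .
      qed simp
      also have "\<dots> \<le> ennreal (k / cl) * (ennreal C * trig_mass p r D)" by (intro mult_left_mono HI) simp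
      also have "\<dots> = ennreal (k / cl * C) * trig_mass p r D"
        using k0 cl0 C by (subst ennreal_mult) (auto simp: mult.assoc)
      also have "\<dots> \<le> ennreal (c * C * (\<bar>h\<bar> ^ r) powr p * (real m * \<bar>h\<bar>) powr (1 - p)) * trig_mass p r D"
      proof (intro mult_right_mono ennreal_leI)
        have r1: "r = Suc (r - 1)" using r by simp
        \<comment> \<open>The p-th power of the cell length against the length itself leaves
          (1/cl)^(1-p), of order m^(1-p). With one factor |h| from the measure of X i this becomes
          |h|^p (m|h|)^(1-p).\<close>
        have "k / cl = ((2 * A) ^ (r - 1)) powr p * ((3 * real s + 1) * \<bar>h\<bar>) * (cl powr p / cl)"
          using A0 cl0 by (simp add: k_def powr_mult)
        also have "cl powr p / cl = (1 / cl) powr (1 - p)"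
          using cl0 by (simp add: powr_diff powr_divide)
        also have "((2 * A) ^ (r - 1)) powr p * ((3 * real s + 1) * \<bar>h\<bar>) * (1 / cl) powr (1 - p) \<le>
            ((2 * A) ^ (r - 1)) powr p * ((3 * real s + 1) * \<bar>h\<bar>) * (2 * real m powr (1 - p))"
        proof (intro mult_left_mono)
          have "(1 / cl) powr (1 - p) \<le> (2 * real m) powr (1 - p)"
          proof (rule powr_mono2)
            show "1 / cl \<le> 2 * real m" using pi_gt3 m by (simp add: cl_def n_def field_simps)
          qed (use p cl0 in auto)
          also have "\<dots> = 2 powr (1 - p) * real m powr (1 - p)" by (simp add: powr_mult)
          also have "\<dots> \<le> 2 powr 1 * real m powr (1 - p)" using p by (intro mult_right_mono powr_mono) auto
          finally show "(1 / cl) powr (1 - p) \<le> 2 * real m powr (1 - p)" by simp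
        qed auto
        also have "\<dots> = c * (\<bar>h\<bar> ^ (r - 1)) powr p * (\<bar>h\<bar> * real m powr (1 - p))"
          by (simp add: c_def A_def power_mult_distrib powr_mult mult_ac)
        also have "\<bar>h\<bar> * real m powr (1 - p) = \<bar>h\<bar> powr p * (real m * \<bar>h\<bar>) powr (1 - p)"
          using h0 by (simp add: powr_mult powr_diff)
        also have "c * (\<bar>h\<bar> ^ (r - 1)) powr p * (\<bar>h\<bar> powr p * (real m * \<bar>h\<bar>) powr (1 - p)) =
            c * (\<bar>h\<bar> ^ r) powr p * (real m * \<bar>h\<bar>) powr (1 - p)"
          by (subst (2) r1) (simp add: powr_mult mult_ac)
        finally have "k / cl * C \<le> c * (\<bar>h\<bar> ^ r) powr p * (real m * \<bar>h\<bar>) powr (1 - p) * C"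
          using C by (intro mult_right_mono) auto
        then show "k / cl * C \<le> c * C * (\<bar>h\<bar> ^ r) powr p * (real m * \<bar>h\<bar>) powr (1 - p)"
          by (simp only: mult_ac)
      qed simp
      finally show "(\<integral>\<^sup>+x. ennreal (G x powr p) \<partial>lborel)
        \<le> ennreal (c * C * (\<bar>h\<bar> ^ r) powr p * (real m * \<bar>h\<bar>) powr (1 - p)) * trig_mass p r D" .
    qed
  qed
qed

section \<open>Differences on the main part\<close>

text \<open>On the main part 2(kh)^2 <= 1 - |x| <= \<phi>(x)^2. The constant 3/4 is a rational bound
  for the square root of 1/2.\<close>

lemma main_part_dt_phi:
  assumes x: "x \<in> main_part k h" and k: "1 \<le> k" and h: "0 < h"
  shows "-1 < x" "x < 1" "real k * h \<le> 3 / 4 * dt_phi x" "0 < dt_phi x"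
proof -
  have kh: "0 < real k * h" using k h by simp
  then have sq: "0 < (real k * h)\<^sup>2" by (rule zero_less_power)
  have ax: "2 * (real k * h)\<^sup>2 \<le> 1 - \<bar>x\<bar>"
    using x by (auto simp: main_part_def abs_if power_mult_distrib)
  then have x1: "\<bar>x\<bar> < 1" using sq by linarith
  then show "-1 < x" "x < 1" by auto
  then have "(dt_phi x)\<^sup>2 = (1 - \<bar>x\<bar>) * (1 + \<bar>x\<bar>)"
    by (auto simp: dt_phi_square abs_if)
  moreover have "(1 - \<bar>x\<bar>) * 1 \<le> (1 - \<bar>x\<bar>) * (1 + \<bar>x\<bar>)" using x1 by (intro mult_left_mono) auto
  ultimately have "1 - \<bar>x\<bar> \<le> (dt_phi x)\<^sup>2" by (simp only: mult_1_right)
  with ax have "2 * (real k * h)\<^sup>2 \<le> (dt_phi x)\<^sup>2" by (rule order_trans)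
  moreover have "a \<le> 9 / 16 * b" if "0 < a" "2 * a \<le> b" for a b :: real using that by linarith
  ultimately have "(real k * h)\<^sup>2 \<le> 9 / 16 * (dt_phi x)\<^sup>2" using sq by blast
  also have "\<dots> = (3 / 4 * dt_phi x)\<^sup>2" by (simp add: power_mult_distrib power2_eq_square)
  finally have "(real k * h)\<^sup>2 \<le> (3 / 4 * dt_phi x)\<^sup>2" .
  then show *: "real k * h \<le> 3 / 4 * dt_phi x"
  proof (rule power2_le_imp_le)
    show "0 \<le> 3 / 4 * dt_phi x" using x1 dt_phi_nonneg[of x] by (auto simp: abs_less_iff)
  qed
  have "0 < 3 / 4 * dt_phi x" using kh * by (rule less_le_trans)
  then show "0 < dt_phi x" by simp
qed

text \<open>A node is at distance at most (3/8)\<phi>(x)^2 from x, and \<phi>(x)^2 <= 2(1 - |x|)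
  keeps it inside. Then \<phi>^2 drops by (y - x)(y + x), at most three quarters of its value, so
  \<phi> is at worst halved.\<close>

lemma main_part_shift:
  assumes x: "x \<in> main_part k h" and k: "1 \<le> k" and h: "0 < h" and c: "\<bar>c\<bar> \<le> real k / 2"
    and y: "y = x + c * h * dt_phi x"
  shows "y \<in> {-1..1}" "dt_phi x \<le> 2 * dt_phi y"
proof -
  note X = main_part_dt_phi[OF x k h]
  have "\<bar>c * h * dt_phi x\<bar> = \<bar>c\<bar> * h * dt_phi x" using h X by (simp add: abs_mult)
  also have "\<dots> \<le> real k / 2 * h * dt_phi x" using c h X by (intro mult_right_mono) auto
  also have "\<dots> = real k * h * (dt_phi x / 2)" by simp
  also have "\<dots> \<le> 3 / 4 * dt_phi x * (dt_phi x / 2)" using X by (intro mult_right_mono) auto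
  finally have d: "\<bar>y - x\<bar> \<le> 3 / 8 * (dt_phi x)\<^sup>2" by (simp add: y power2_eq_square)
  have "(dt_phi x)\<^sup>2 = (1 - \<bar>x\<bar>) * (1 + \<bar>x\<bar>)" using X by (auto simp: dt_phi_square abs_if)
  also have "\<dots> \<le> (1 - \<bar>x\<bar>) * 2" using X by (intro mult_left_mono) auto
  finally have "3 / 8 * (dt_phi x)\<^sup>2 \<le> 1 - \<bar>x\<bar>" using X by (auto simp: abs_if split: if_splits)
  with d show y1: "y \<in> {-1..1}" by (auto simp: abs_if split: if_splits)
  have "(y - x) * (y + x) \<le> \<bar>y - x\<bar> * \<bar>y + x\<bar>" by (simp flip: abs_mult)
  also have "\<dots> \<le> \<bar>y - x\<bar> * 2" using X y1 by (intro mult_left_mono) auto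
  also have "\<dots> \<le> 3 / 4 * (dt_phi x)\<^sup>2" using d by simp
  finally have "(y - x) * (y + x) \<le> 3 / 4 * (dt_phi x)\<^sup>2" .
  moreover have "(dt_phi y)\<^sup>2 = (dt_phi x)\<^sup>2 - (y - x) * (y + x)"
    using X y1 by (simp add: dt_phi_square algebra_simps)
  ultimately have "(dt_phi x)\<^sup>2 \<le> (2 * dt_phi y)\<^sup>2" by (simp add: power_mult_distrib)
  then show "dt_phi x \<le> 2 * dt_phi y" by (rule power2_le_imp_le) (use dt_phi_nonneg[OF y1] in simp)
qed

lemma dt_phi_has_derivative:
  assumes "-1 < x" "x < 1"
  shows "(dt_phi has_real_derivative (- x / dt_phi x)) (at x)"
proof -
  have "x\<^sup>2 < 1" using assms by (simp add: abs_square_less_1)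
  then show ?thesis unfolding dt_phi_def[abs_def]
    by (auto intro!: derivative_eq_intros simp: field_simps)
qed

lemma main_part_measurable [measurable]: "main_part k h \<in> sets borel"
  by (simp add: main_part_def)

text \<open>The map from x to a node has derivative 1 - c h x/\<phi>(x), at least 1 - 3/8 on the
  main part, so a change of variables costs less than a factor 2. If the main part is empty or a
  point, both integrals are compared trivially.\<close>

lemma nn_integral_main_part_shift_le:
  fixes H :: "real \<Rightarrow> ennreal"
  assumes [measurable]: "H \<in> borel_measurable borel" and k: "1 \<le> k" and h: "0 < h" and c: "\<bar>c\<bar> \<le> real k / 2"
  shows "(\<integral>\<^sup>+x\<in>main_part k h. H (x + c * h * dt_phi x) \<partial>lborel) \<le> 2 * (\<integral>\<^sup>+x\<in>{-1..1}. H x \<partial>lborel)"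
proof -
  define \<alpha> where "\<alpha> = -1 + 2 * (real k)\<^sup>2 * h\<^sup>2"
  define \<beta> where "\<beta> = 1 - 2 * (real k)\<^sup>2 * h\<^sup>2"
  have mp: "main_part k h = {\<alpha>..\<beta>}" by (simp add: main_part_def \<alpha>_def \<beta>_def)
  define g where "g x = x + c * h * dt_phi x" for x
  define g' where "g' x = 1 + c * h * (- x / dt_phi x)" for x
  show ?thesis
  proof (cases "\<alpha> < \<beta>")
    case False
    have "(\<integral>\<^sup>+x\<in>main_part k h. H (x + c * h * dt_phi x) \<partial>lborel) = (\<integral>\<^sup>+(x::real). 0 \<partial>lborel)"
    proof (rule nn_integral_cong_AE)
      have "AE x in lborel. x \<noteq> \<alpha>" by (rule AE_lborel_singleton)
      then show "AE x in lborel. H (x + c * h * dt_phi x) * indicator (main_part k h) x = 0"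
        by eventually_elim (use False in \<open>auto simp: mp indicator_def\<close>)
    qed
    then show ?thesis by simp
  next
    case True
    have half: "1 / 2 \<le> g' x" if "x \<in> {\<alpha>..\<beta>}" for x
    proof -
      note X = main_part_dt_phi[OF that[folded mp] k h]
      have "\<bar>c * h * (x / dt_phi x)\<bar> = \<bar>c\<bar> * h * \<bar>x\<bar> / dt_phi x" using h X by (simp add: abs_mult)
      also have "\<dots> \<le> real k / 2 * h * 1 / dt_phi x"
        using c h X by (intro divide_right_mono mult_mono) auto
      also have "\<dots> \<le> (3 / 8 * dt_phi x) / dt_phi x"
        using X(3,4) by (intro divide_right_mono) (auto simp: mult_ac)
      also have "\<dots> = 3 / 8" using X by simp
      finally have "\<bar>c * h * (x / dt_phi x)\<bar> \<le> 3 / 8" .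
      moreover have "g' x = 1 - c * h * (x / dt_phi x)" by (simp add: g'_def)
      ultimately show ?thesis by linarith
    qed
    have der: "(g has_real_derivative g' x) (at x)" if "x \<in> {\<alpha>..\<beta>}" for x
      unfolding g_def g'_def using main_part_dt_phi[OF that[folded mp] k h]
      by (auto intro!: derivative_eq_intros dt_phi_has_derivative)
    have cont: "continuous_on {\<alpha>..\<beta>} g'"
    proof -
      have "continuous_on {\<alpha>..\<beta>} dt_phi" unfolding dt_phi_def[abs_def] by (intro continuous_intros)
      moreover have "\<And>x. x \<in> {\<alpha>..\<beta>} \<Longrightarrow> dt_phi x \<noteq> 0"
        using main_part_dt_phi(4)[OF _ k h] mp by fastforce
      ultimately show ?thesis unfolding g'_def by (intro continuous_intros) auto
    qed
    have range: "{g \<alpha>..g \<beta>} \<subseteq> {-1..1}"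
      using main_part_shift(1)[OF _ k h c, of \<alpha> "g \<alpha>"] main_part_shift(1)[OF _ k h c, of \<beta> "g \<beta>"] True
      by (auto simp: mp g_def)
    have [measurable]: "g \<in> borel_measurable borel" unfolding g_def[abs_def] by measurable
    have "(\<integral>\<^sup>+x\<in>main_part k h. H (x + c * h * dt_phi x) \<partial>lborel) \<le>
        (\<integral>\<^sup>+x. 2 * (H (g x) * ennreal (g' x) * indicator {\<alpha>..\<beta>} x) \<partial>lborel)"
    proof (intro nn_integral_mono)
      fix x
      show "H (x + c * h * dt_phi x) * indicator (main_part k h) x \<le> 2 * (H (g x) * ennreal (g' x) * indicator {\<alpha>..\<beta>} x)"
      proof (cases "x \<in> {\<alpha>..\<beta>}")
        case True
        have "1 \<le> ennreal (2 * g' x)" using half[OF True] by simp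
        also have "\<dots> = 2 * ennreal (g' x)" using half[OF True] by (simp add: ennreal_mult)
        finally have "H (g x) * 1 \<le> H (g x) * (2 * ennreal (g' x))" by (rule mult_left_mono) simp
        then show ?thesis using True by (simp add: mp g_def mult_ac)
      qed (simp add: mp)
    qed
    also have "\<dots> = 2 * (\<integral>\<^sup>+x. H (g x) * ennreal (g' x) * indicator {\<alpha>..\<beta>} x \<partial>lborel)"
    proof (rule nn_integral_cmult)
      have [measurable]: "g' \<in> borel_measurable borel" unfolding g'_def[abs_def] by measurable
      show "(\<lambda>x. H (g x) * ennreal (g' x) * indicator {\<alpha>..\<beta>} x) \<in> borel_measurable lborel" by measurable
    qed
    also have "(\<integral>\<^sup>+x. H (g x) * ennreal (g' x) * indicator {\<alpha>..\<beta>} x \<partial>lborel) = (\<integral>\<^sup>+x. H x * indicator {g \<alpha>..g \<beta>} x \<partial>lborel)"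
    proof (rule nn_integral_substitution_aux[symmetric])
      show "0 \<le> g' x" if "x \<in> {\<alpha>..\<beta>}" for x using half[OF that] by simp
    qed (use der cont True in auto)
    also have "2 * \<dots> \<le> 2 * (\<integral>\<^sup>+x\<in>{-1..1}. H x \<partial>lborel)"
      using range by (intro mult_left_mono nn_integral_mono) (auto simp: indicator_def)
    finally show ?thesis .
  qed
qed

text \<open>Boundedness of weighted differences on the main part, used to exchange f^(r) for its
  approximant. At each node the weight is comparable up to 2^r, and the shift costs a factor
  2.\<close>

lemma nn_integral_dt_diff_main_part_le:
  assumes [measurable]: "G \<in> borel_measurable borel" and k: "1 \<le> k" and h: "0 < h" and p: "0 < p" "p \<le> 1"
  shows "(\<integral>\<^sup>+x\<in>main_part k h. ennreal (\<bar>dt_phi x ^ r * dt_diff k h G x\<bar> powr p) \<partial>lborel) \<le>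
    ennreal (\<Sum>j\<le>k. 2 * (2 ^ r * real (k choose j)) powr p) * (\<integral>\<^sup>+x\<in>{-1..1}. ennreal (\<bar>dt_phi x ^ r * G x\<bar> powr p) \<partial>lborel)"
proof -
  define c where "c j = real k / 2 - real j" for j
  define a where "a j = (2 ^ r * real (k choose j)) powr p" for j
  define F where "F y = ennreal (\<bar>dt_phi y ^ r * G y\<bar> powr p)" for y
  have [measurable]: "F \<in> borel_measurable borel" unfolding F_def[abs_def] by measurable
  have cj: "\<bar>c j\<bar> \<le> real k / 2" if "j \<le> k" for j using that by (auto simp: c_def abs_if)
  let ?I = "\<integral>\<^sup>+x\<in>{-1..1}. F x \<partial>lborel"
  have "(\<integral>\<^sup>+x\<in>main_part k h. ennreal (\<bar>dt_phi x ^ r * dt_diff k h G x\<bar> powr p) \<partial>lborel) \<le>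
     (\<integral>\<^sup>+x. (\<Sum>j\<le>k. ennreal (a j) * (F (x + c j * h * dt_phi x) * indicator (main_part k h) x)) \<partial>lborel)"
  proof (intro nn_integral_mono)
    fix x
    show "ennreal (\<bar>dt_phi x ^ r * dt_diff k h G x\<bar> powr p) * indicator (main_part k h) x \<le>
      (\<Sum>j\<le>k. ennreal (a j) * (F (x + c j * h * dt_phi x) * indicator (main_part k h) x))"
    proof (cases "x \<in> main_part k h")
      case True
      note X = main_part_dt_phi[OF True k h]
      define y where "y j = x + c j * h * dt_phi x" for j
      have wy: "dt_phi x ^ r \<le> 2 ^ r * dt_phi (y j) ^ r" if "j \<le> k" for j
        using power_mono[OF main_part_shift(2)[OF True k h cj[OF that] y_def], of r] X
        by (simp add: power_mult_distrib)
      have "\<bar>dt_diff k h G x\<bar> \<le> (\<Sum>j\<le>k. real (k choose j) * \<bar>G (y j)\<bar>)"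
      proof -
        have "\<bar>\<Sum>j\<le>k. (-1) ^ j * real (k choose j) * G (x + (real k / 2 - real j) * h * dt_phi x)\<bar> \<le> (\<Sum>j\<le>k. real (k choose j) * \<bar>G (y j)\<bar>)"
          by (rule order_trans[OF sum_abs]) (auto simp: abs_mult y_def c_def intro!: sum_mono)
        then show ?thesis by (auto simp: dt_diff_def sum_nonneg)
      qed
      then have "dt_phi x ^ r * \<bar>dt_diff k h G x\<bar> \<le> dt_phi x ^ r * (\<Sum>j\<le>k. real (k choose j) * \<bar>G (y j)\<bar>)"
        using X by (intro mult_left_mono) auto
      also have "\<dots> = (\<Sum>j\<le>k. real (k choose j) * (dt_phi x ^ r * \<bar>G (y j)\<bar>))"
        by (simp add: sum_distrib_left mult_ac)
      also have "\<dots> \<le> (\<Sum>j\<le>k. real (k choose j) * (2 ^ r * dt_phi (y j) ^ r * \<bar>G (y j)\<bar>))"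
        by (intro sum_mono mult_left_mono mult_right_mono wy) auto
      also have "\<dots> = (\<Sum>j\<le>k. (2 ^ r * real (k choose j)) * \<bar>dt_phi (y j) ^ r * G (y j)\<bar>)"
      proof (intro sum.cong refl)
        fix j assume "j \<in> {..k}"
        then have "0 \<le> dt_phi (y j)"
          using main_part_shift(1)[OF True k h cj y_def] by (intro dt_phi_nonneg) auto
        then show "real (k choose j) * (2 ^ r * dt_phi (y j) ^ r * \<bar>G (y j)\<bar>) =
            (2 ^ r * real (k choose j)) * \<bar>dt_phi (y j) ^ r * G (y j)\<bar>"
          by (simp add: abs_mult power_abs mult_ac)
      qed
      finally have "\<bar>dt_phi x ^ r * dt_diff k h G x\<bar> powr p \<le> (\<Sum>j\<le>k. (2 ^ r * real (k choose j)) * \<bar>dt_phi (y j) ^ r * G (y j)\<bar>) powr p"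
        using X p by (intro powr_mono2) (auto simp: abs_mult)
      also have "\<dots> \<le> (\<Sum>j\<le>k. ((2 ^ r * real (k choose j)) * \<bar>dt_phi (y j) ^ r * G (y j)\<bar>) powr p)"
        using p by (intro powr_sum_subadditive) auto
      also have "\<dots> = (\<Sum>j\<le>k. a j * \<bar>dt_phi (y j) ^ r * G (y j)\<bar> powr p)"
        by (intro sum.cong refl) (simp add: a_def powr_mult)
      finally have "ennreal (\<bar>dt_phi x ^ r * dt_diff k h G x\<bar> powr p) \<le> ennreal \<dots>" by (rule ennreal_leI)
      also have "\<dots> = (\<Sum>j\<le>k. ennreal (a j) * F (y j))"
        by (subst sum_ennreal[symmetric]) (auto simp: F_def a_def ennreal_mult)
      finally show ?thesis using True by (simp add: y_def)
    qed simp
  qed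
  also have "\<dots> = (\<Sum>j\<le>k. ennreal (a j) * (\<integral>\<^sup>+x\<in>main_part k h. F (x + c j * h * dt_phi x) \<partial>lborel))"
    by (subst nn_integral_sum, measurable, intro sum.cong refl nn_integral_cmult, measurable)
  also have "\<dots> \<le> (\<Sum>j\<le>k. ennreal (a j) * (2 * ?I))"
    by (intro sum_mono mult_left_mono nn_integral_main_part_shift_le[OF _ k h cj]) auto
  also have "\<dots> = ennreal (\<Sum>j\<le>k. 2 * a j) * ?I"
  proof -
    have "ennreal (\<Sum>j\<le>k. 2 * a j) = (\<Sum>j\<le>k. ennreal (2 * a j))" by (subst sum_ennreal) (auto simp: a_def)
    also have "\<dots> = (\<Sum>j\<le>k. ennreal (a j) * 2)" by (intro sum.cong refl) (simp add: a_def ennreal_mult mult.commute)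
    finally show ?thesis by (simp add: sum_distrib_right mult.assoc)
  qed
  finally show ?thesis by (simp add: F_def a_def)
qed

lemma trig_mass_reflect: "trig_mass p M (pcompose D [:0, -1:]) = trig_mass p M D"
proof -
  have "trig_mass p M (pcompose D [:0, -1:]) =
    (\<integral>\<^sup>+x. ennreal (\<bar>dt_phi (- x) ^ M * poly D (- x)\<bar> powr p) * indicator {-1..1} (- x) \<partial>lborel)"
    unfolding trig_mass_eq by (intro nn_integral_cong) (auto simp: poly_pcompose indicator_def)
  also have "\<dots> = trig_mass p M D"
    unfolding trig_mass_eq by (rule nn_integral_lborel_uminus) measurable
  finally show ?thesis .
qed

lemma dt_diff_0: "1 \<le> s \<Longrightarrow> dt_diff s 0 g x = 0"
proof -
  assume s: "1 \<le> s"
  have "central_diff s 0 g x = central_diff s 0 (poly [:g x:]) x" by (simp add: central_diff_def)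
  also have "\<dots> = 0" using s by (intro central_diff_poly_eq_0) auto
  finally show ?thesis by (simp add: dt_diff_central_diff)
qed

text \<open>The left half of the stencil is the right half for the polynomial reflected at 0, which
  has the same degree and the same mass. So the one-sided estimate is used twice.\<close>

lemma dt_diff_poly_rough_step:
  fixes p :: real and B r s :: nat
  assumes p: "0 < p" "p < 1" and r: "1 \<le> r" "r \<le> s"
  shows "\<exists>C>0. \<forall>m Q h. 1 \<le> m \<longrightarrow> r + degree ((pderiv ^^ r) Q) \<le> B * m \<longrightarrow> 1 \<le> real m * \<bar>h\<bar> \<longrightarrow>
    (\<integral>\<^sup>+x\<in>{-1..1}. ennreal (\<bar>dt_diff s h (poly Q) x\<bar> powr p) \<partial>lborel)
      \<le> ennreal (C * (\<bar>h\<bar> ^ r) powr p * (real m * \<bar>h\<bar>) powr (1 - p)) * trig_mass p r ((pderiv ^^ r) Q)"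
proof -
  have s: "1 \<le> s" using r by simp
  obtain C where C: "C > 0" and *: "\<forall>m (D :: real poly) h. 1 \<le> m \<longrightarrow> r + degree D \<le> B * m \<longrightarrow> 1 \<le> real m * \<bar>h\<bar> \<longrightarrow>
    (\<exists>G\<in>borel_measurable borel. (\<forall>x. 0 \<le> G x) \<and>
      (\<forall>x. -1 \<le> x \<longrightarrow> x < 1 \<longrightarrow> x + real s / 2 * \<bar>h\<bar> * dt_phi x \<le> 1 \<longrightarrow>
         right_remainder (real s / 2 * \<bar>h\<bar>) (r - 1) (poly D) x \<le> ennreal (G x)) \<and>
      (\<integral>\<^sup>+x. ennreal (G x powr p) \<partial>lborel)
        \<le> ennreal (C * (\<bar>h\<bar> ^ r) powr p * (real m * \<bar>h\<bar>) powr (1 - p)) * trig_mass p r D)"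
    using right_remainder_poly_rough[OF p r(1) s, of B] by (elim exE conjE) (rule that)
  define E where "E = (2 ^ s) powr p * (2 * C)"
  show ?thesis
  proof (rule exI[of _ E], intro conjI allI impI)
    show "0 < E" using C by (simp add: E_def)
    fix m :: nat and Q :: "real poly" and h :: real
    assume m: "1 \<le> m" and deg: "r + degree ((pderiv ^^ r) Q) \<le> B * m" and mh: "1 \<le> real m * \<bar>h\<bar>"
    let ?D = "(pderiv ^^ r) Q"
    let ?D' = "pcompose ?D [:0, -1:]"
    define A where "A = real s / 2 * \<bar>h\<bar>"
    define K where "K = C * (\<bar>h\<bar> ^ r) powr p * (real m * \<bar>h\<bar>) powr (1 - p)"
    have K0: "0 \<le> K" using C by (simp add: K_def)
    have deg': "r + degree ?D' \<le> B * m" using deg by (simp add: degree_pcompose)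
    obtain G1 where [measurable]: "G1 \<in> borel_measurable borel" and G1: "\<And>x. 0 \<le> G1 x"
      "\<And>x. -1 \<le> x \<Longrightarrow> x < 1 \<Longrightarrow> x + A * dt_phi x \<le> 1 \<Longrightarrow> right_remainder A (r - 1) (poly ?D) x \<le> ennreal (G1 x)"
      "(\<integral>\<^sup>+x. ennreal (G1 x powr p) \<partial>lborel) \<le> ennreal K * trig_mass p r ?D"
      using *[rule_format, OF m deg mh] unfolding A_def K_def by blast
    obtain G2 where [measurable]: "G2 \<in> borel_measurable borel" and G2: "\<And>x. 0 \<le> G2 x"
      "\<And>x. -1 \<le> x \<Longrightarrow> x < 1 \<Longrightarrow> x + A * dt_phi x \<le> 1 \<Longrightarrow> right_remainder A (r - 1) (poly ?D') x \<le> ennreal (G2 x)"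
      "(\<integral>\<^sup>+x. ennreal (G2 x powr p) \<partial>lborel) \<le> ennreal K * trig_mass p r ?D"
      using *[rule_format, OF m deg' mh] unfolding A_def K_def trig_mass_reflect by blast
    have pD': "poly ?D' = (\<lambda>t. poly ?D (- t))" by (auto simp: poly_pcompose)
    have pt: "\<bar>dt_diff s h (poly Q) x\<bar> powr p \<le> (2 ^ s) powr p * (G1 x powr p + G2 (- x) powr p)"
      if x: "x \<in> {-1..1}" "x \<noteq> 1" "x \<noteq> -1" for x
    proof (cases "x + A * dt_phi x \<le> 1 \<and> -1 \<le> x - A * dt_phi x")
      case True
      have "ennreal \<bar>dt_diff s h ((\<lambda>i. poly ((pderiv ^^ i) Q)) 0) x\<bar> \<le> 2 ^ s *
        (right_remainder A (r - 1) (poly ?D) x * indicator {x. -1 \<le> x \<and> x \<le> 1 \<and> x + A * dt_phi x \<le> 1} x +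
         left_remainder A (r - 1) (poly ?D) x * indicator {x. -1 \<le> x \<and> x \<le> 1 \<and> -1 \<le> x - A * dt_phi x} x)"
        by (rule dt_diff_le_remainders[OF deriv_chain_poly r A_def x(1)]) (rule r)
      also have "\<dots> \<le> 2 ^ s * (ennreal (G1 x) * 1 + ennreal (G2 (- x)) * 1)"
      proof (intro mult_left_mono add_mono mult_mono)
        show "right_remainder A (r - 1) (poly ?D) x \<le> ennreal (G1 x)" using G1(2)[of x] x True by auto
        have "left_remainder A (r - 1) (poly ?D) x = right_remainder A (r - 1) (poly ?D') (- x)"
          unfolding pD' by (rule left_remainder_eq) measurable
        also have "\<dots> \<le> ennreal (G2 (- x))" using G2(2)[of "- x"] x True by auto
        finally show "left_remainder A (r - 1) (poly ?D) x \<le> ennreal (G2 (- x))" .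
      qed (auto simp: indicator_def)
      also have "\<dots> = ennreal (2 ^ s * (G1 x + G2 (- x)))"
      proof -
        have "(2 ^ s :: ennreal) = ennreal (2 ^ s)" by (simp flip: ennreal_power)
        then show ?thesis using G1(1) G2(1) by (simp flip: ennreal_plus ennreal_mult)
      qed
      finally have "\<bar>dt_diff s h (poly Q) x\<bar> \<le> 2 ^ s * (G1 x + G2 (- x))"
        using G1(1) G2(1) by (simp add: ennreal_le_iff)
      then have "\<bar>dt_diff s h (poly Q) x\<bar> powr p \<le> (2 ^ s * (G1 x + G2 (- x))) powr p"
        using p by (intro powr_mono2) auto
      also have "\<dots> = (2 ^ s) powr p * (G1 x + G2 (- x)) powr p" using G1(1) G2(1) by (simp add: powr_mult)
      also have "\<dots> \<le> (2 ^ s) powr p * (G1 x powr p + G2 (- x) powr p)"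
        using G1(1) G2(1) p by (intro mult_left_mono powr_subadditive) auto
      finally show ?thesis .
    next
      case False
      then have "dt_diff s h (poly Q) x = 0"
        using x by (auto simp: dt_diff_central_diff A_def abs_if split: if_splits)
      then show ?thesis by simp
    qed
    have "(\<integral>\<^sup>+x\<in>{-1..1}. ennreal (\<bar>dt_diff s h (poly Q) x\<bar> powr p) \<partial>lborel) \<le>
      (\<integral>\<^sup>+x. ennreal ((2 ^ s) powr p) * (ennreal (G1 x powr p) + ennreal (G2 (- x) powr p)) \<partial>lborel)"
    proof (rule nn_integral_mono_AE)
      have "AE x in lborel. x \<noteq> (1::real)" "AE x in lborel. x \<noteq> (-1::real)" by (rule AE_lborel_singleton)+
      then show "AE x in lborel. ennreal (\<bar>dt_diff s h (poly Q) x\<bar> powr p) * indicator {-1..1} x \<le>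
        ennreal ((2 ^ s) powr p) * (ennreal (G1 x powr p) + ennreal (G2 (- x) powr p))"
        by eventually_elim
          (use pt in \<open>auto simp: indicator_def intro!: ennreal_leI simp flip: ennreal_plus ennreal_mult\<close>)
    qed
    also have "\<dots> = ennreal ((2 ^ s) powr p) * ((\<integral>\<^sup>+x. ennreal (G1 x powr p) \<partial>lborel) + (\<integral>\<^sup>+x. ennreal (G2 (- x) powr p) \<partial>lborel))"
      by (subst nn_integral_cmult, measurable, subst nn_integral_add, measurable)
    also have "(\<integral>\<^sup>+x. ennreal (G2 (- x) powr p) \<partial>lborel) = (\<integral>\<^sup>+x. ennreal (G2 x powr p) \<partial>lborel)"
      by (rule nn_integral_lborel_uminus) measurable
    also have "ennreal ((2 ^ s) powr p) * ((\<integral>\<^sup>+x. ennreal (G1 x powr p) \<partial>lborel) + (\<integral>\<^sup>+x. ennreal (G2 x powr p) \<partial>lborel)) \<le>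
        ennreal ((2 ^ s) powr p) * (ennreal K * trig_mass p r ?D + ennreal K * trig_mass p r ?D)"
      by (intro mult_left_mono add_mono G1 G2) auto
    also have "\<dots> = ennreal (E * (\<bar>h\<bar> ^ r) powr p * (real m * \<bar>h\<bar>) powr (1 - p)) * trig_mass p r ?D"
    proof -
      have "E * (\<bar>h\<bar> ^ r) powr p * (real m * \<bar>h\<bar>) powr (1 - p) = (2 ^ s) powr p * (K + K)"
        by (simp add: E_def K_def)
      moreover have "ennreal ((2 ^ s) powr p * (K + K)) = ennreal ((2 ^ s) powr p) * (ennreal K + ennreal K)"
        unfolding ennreal_plus[OF K0 K0, symmetric] by (rule ennreal_mult) (use K0 in auto)
      ultimately have "ennreal (E * (\<bar>h\<bar> ^ r) powr p * (real m * \<bar>h\<bar>) powr (1 - p)) = ennreal ((2 ^ s) powr p) * (ennreal K + ennreal K)"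
        by (simp only:)
      then show ?thesis by (simp add: distrib_right mult.assoc)
    qed
    finally show "(\<integral>\<^sup>+x\<in>{-1..1}. ennreal (\<bar>dt_diff s h (poly Q) x\<bar> powr p) \<partial>lborel)
      \<le> ennreal (E * (\<bar>h\<bar> ^ r) powr p * (real m * \<bar>h\<bar>) powr (1 - p)) * trig_mass p r ?D" .
  qed
qed

text \<open>The modulus also ranges over steps shorter than 1/m. For these m is raised to about
  1/|h|, which the degree condition permits, and m|h| stays bounded. The exponent 1 - p is relaxed
  to 2 - 2p, allowed by m \<delta> >= 1.\<close>

lemma dt_diff_poly_rough:
  fixes p :: real and B r s :: nat
  assumes p: "0 < p" "p < 1" and r: "1 \<le> r" "r \<le> s"
  shows "\<exists>C>0. \<forall>m Q h \<delta>. 1 \<le> m \<longrightarrow> r + degree ((pderiv ^^ r) Q) \<le> B * m \<longrightarrow> \<bar>h\<bar> \<le> \<delta> \<longrightarrow> \<delta> \<le> 1 \<longrightarrow> 1 \<le> real m * \<delta> \<longrightarrow>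
    (\<integral>\<^sup>+x\<in>{-1..1}. ennreal (\<bar>dt_diff s h (poly Q) x\<bar> powr p) \<partial>lborel)
      \<le> ennreal (C * (\<delta> ^ r) powr p * (real m * \<delta>) powr (2 - 2 * p)) * trig_mass p r ((pderiv ^^ r) Q)"
proof -
  obtain C where C: "C > 0" and *: "\<forall>m Q h. 1 \<le> m \<longrightarrow> r + degree ((pderiv ^^ r) Q) \<le> B * m \<longrightarrow> 1 \<le> real m * \<bar>h\<bar> \<longrightarrow>
    (\<integral>\<^sup>+x\<in>{-1..1}. ennreal (\<bar>dt_diff s h (poly Q) x\<bar> powr p) \<partial>lborel)
      \<le> ennreal (C * (\<bar>h\<bar> ^ r) powr p * (real m * \<bar>h\<bar>) powr (1 - p)) * trig_mass p r ((pderiv ^^ r) Q)"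
    using dt_diff_poly_rough_step[OF p r, of B] by (elim exE conjE) (rule that)
  show ?thesis
  proof (rule exI[of _ "2 * C"], intro conjI allI impI)
    show "0 < 2 * C" using C by simp
    fix m :: nat and Q :: "real poly" and h \<delta> :: real
    assume m: "1 \<le> m" and deg: "r + degree ((pderiv ^^ r) Q) \<le> B * m" and h: "\<bar>h\<bar> \<le> \<delta>" and d: "\<delta> \<le> 1" "1 \<le> real m * \<delta>"
    show "(\<integral>\<^sup>+x\<in>{-1..1}. ennreal (\<bar>dt_diff s h (poly Q) x\<bar> powr p) \<partial>lborel)
      \<le> ennreal (2 * C * (\<delta> ^ r) powr p * (real m * \<delta>) powr (2 - 2 * p)) * trig_mass p r ((pderiv ^^ r) Q)"
    proof (cases "h = 0")
      case True
      then show ?thesis using r by (simp add: dt_diff_0)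
    next
      case False
      \<comment> \<open>The least enlargement of m that makes m'|h| >= 1; it keeps m'|h| <= 2 m
        \<delta>.\<close>
      define m' where "m' = max m (nat \<lceil>1 / \<bar>h\<bar>\<rceil>)"
      have m'1: "1 \<le> m'" "m \<le> m'" using m by (auto simp: m'_def)
      have deg': "r + degree ((pderiv ^^ r) Q) \<le> B * m'"
        using deg m'1 by (meson le_trans mult_le_mono2)
      have ce: "1 / \<bar>h\<bar> \<le> real (nat \<lceil>1 / \<bar>h\<bar>\<rceil>)" "real (nat \<lceil>1 / \<bar>h\<bar>\<rceil>) \<le> 1 / \<bar>h\<bar> + 1"
      proof -
        have "0 \<le> \<lceil>1 / \<bar>h\<bar>\<rceil>" by (simp add: ceiling_le_zero order_less_le_trans[of "-1" 0])
        then have "real (nat \<lceil>1 / \<bar>h\<bar>\<rceil>) = of_int \<lceil>1 / \<bar>h\<bar>\<rceil>" by simp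
        then show "1 / \<bar>h\<bar> \<le> real (nat \<lceil>1 / \<bar>h\<bar>\<rceil>)" "real (nat \<lceil>1 / \<bar>h\<bar>\<rceil>) \<le> 1 / \<bar>h\<bar> + 1" by linarith+
      qed
      have mh: "1 \<le> real m' * \<bar>h\<bar>"
      proof -
        have "real (nat \<lceil>1 / \<bar>h\<bar>\<rceil>) \<le> real m'" unfolding m'_def of_nat_le_iff by (rule max.cobounded2)
        with ce(1) have "1 / \<bar>h\<bar> \<le> real m'" by (rule order_trans)
        then show ?thesis using False by (simp add: field_simps)
      qed
      have mh2: "real m' * \<bar>h\<bar> \<le> 2 * (real m * \<delta>)"
      proof (cases "m' = m")
        case True
        have "real m * \<bar>h\<bar> \<le> real m * \<delta>" using h by (intro mult_left_mono) auto
        then show ?thesis using True d by simp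
      next
        case m: False
        then have "real m' \<le> 1 / \<bar>h\<bar> + 1" using ce(2) by (simp add: m'_def max_def split: if_splits)
        then have "real m' * \<bar>h\<bar> \<le> (1 / \<bar>h\<bar> + 1) * \<bar>h\<bar>" by (rule mult_right_mono) simp
        also have "\<dots> = 1 + \<bar>h\<bar>" using False by (simp add: field_simps)
        finally show ?thesis using h d by linarith
      qed
      have "C * (\<bar>h\<bar> ^ r) powr p * (real m' * \<bar>h\<bar>) powr (1 - p) \<le> C * (\<delta> ^ r) powr p * (2 * (real m * \<delta>) powr (2 - 2 * p))"
      proof (intro mult_mono)
        show "(\<bar>h\<bar> ^ r) powr p \<le> (\<delta> ^ r) powr p" using h p by (intro powr_mono2 power_mono) auto
        have "(real m' * \<bar>h\<bar>) powr (1 - p) \<le> (2 * (real m * \<delta>)) powr (1 - p)" using mh2 p by (intro powr_mono2) auto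
        also have "\<dots> = 2 powr (1 - p) * (real m * \<delta>) powr (1 - p)" using d by (intro powr_mult)
        also have "\<dots> \<le> 2 powr 1 * (real m * \<delta>) powr (2 - 2 * p)"
          using p d by (intro mult_mono powr_mono) auto
        finally show "(real m' * \<bar>h\<bar>) powr (1 - p) \<le> 2 * (real m * \<delta>) powr (2 - 2 * p)" by simp
      qed (use C in auto)
      then have "ennreal (C * (\<bar>h\<bar> ^ r) powr p * (real m' * \<bar>h\<bar>) powr (1 - p)) * trig_mass p r ((pderiv ^^ r) Q)
        \<le> ennreal (2 * C * (\<delta> ^ r) powr p * (real m * \<delta>) powr (2 - 2 * p)) * trig_mass p r ((pderiv ^^ r) Q)"
        by (intro mult_right_mono ennreal_leI) (auto simp: mult_ac)
      then show ?thesis using *[rule_format, OF m'1(1) deg' mh] by (rule order_trans[rotated])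
    qed
  qed
qed

section \<open>Telescoping over near-best approximants\<close>

text \<open>The p-th power of the weighted quasi-norm, without the root: in this form it is
  subadditive for p <= 1.\<close>

definition wLp :: "real \<Rightarrow> nat \<Rightarrow> (real \<Rightarrow> real) \<Rightarrow> ennreal" where
  "wLp p r g = (\<integral>\<^sup>+x\<in>{-1..1}. ennreal (\<bar>dt_phi x ^ r * g x\<bar> powr p) \<partial>lborel)"

lemma trig_mass_diff_le:
  assumes p: "0 < p" "p \<le> 1" and [measurable]: "w \<in> borel_measurable borel"
    and b: "wLp p r (\<lambda>x. w x - poly P x) \<le> ennreal \<beta>" "wLp p r (\<lambda>x. w x - poly Q x) \<le> ennreal \<gamma>"
    and nn: "0 \<le> \<beta>" "0 \<le> \<gamma>"
  shows "trig_mass p r (Q - P) \<le> ennreal (\<beta> + \<gamma>)"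
proof -
  have "trig_mass p r (Q - P) \<le> (\<integral>\<^sup>+x. ennreal (\<bar>dt_phi x ^ r * (w x - poly P x)\<bar> powr p) * indicator {-1..1} x
      + ennreal (\<bar>dt_phi x ^ r * (w x - poly Q x)\<bar> powr p) * indicator {-1..1} x \<partial>lborel)"
    unfolding trig_mass_eq
  proof (intro nn_integral_mono)
    fix x
    have "\<bar>dt_phi x ^ r * poly (Q - P) x\<bar> \<le> \<bar>dt_phi x ^ r * (w x - poly P x)\<bar> + \<bar>dt_phi x ^ r * (w x - poly Q x)\<bar>"
    proof -
      have "dt_phi x ^ r * poly (Q - P) x = dt_phi x ^ r * (w x - poly P x) - dt_phi x ^ r * (w x - poly Q x)"
        by (simp add: algebra_simps)
      then show ?thesis by (simp only: abs_triangle_ineq4)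
    qed
    then have "\<bar>dt_phi x ^ r * poly (Q - P) x\<bar> powr p \<le> (\<bar>dt_phi x ^ r * (w x - poly P x)\<bar> + \<bar>dt_phi x ^ r * (w x - poly Q x)\<bar>) powr p"
      using p by (intro powr_mono2) auto
    also have "\<dots> \<le> \<bar>dt_phi x ^ r * (w x - poly P x)\<bar> powr p + \<bar>dt_phi x ^ r * (w x - poly Q x)\<bar> powr p"
      using p by (intro powr_subadditive) auto
    finally have *: "\<bar>dt_phi x ^ r * poly (Q - P) x\<bar> powr p \<le>
      \<bar>dt_phi x ^ r * (w x - poly P x)\<bar> powr p + \<bar>dt_phi x ^ r * (w x - poly Q x)\<bar> powr p" .
    have "ennreal (\<bar>dt_phi x ^ r * poly (Q - P) x\<bar> powr p) \<le>
      ennreal (\<bar>dt_phi x ^ r * (w x - poly P x)\<bar> powr p) + ennreal (\<bar>dt_phi x ^ r * (w x - poly Q x)\<bar> powr p)"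
      using ennreal_leI[OF *] by simp
    then show "ennreal (\<bar>dt_phi x ^ r * poly (Q - P) x\<bar> powr p) * indicator {-1..1} x \<le>
      ennreal (\<bar>dt_phi x ^ r * (w x - poly P x)\<bar> powr p) * indicator {-1..1} x
      + ennreal (\<bar>dt_phi x ^ r * (w x - poly Q x)\<bar> powr p) * indicator {-1..1} x"
      by (cases "x \<in> {-1..1}") auto
  qed
  also have "\<dots> = wLp p r (\<lambda>x. w x - poly P x) + wLp p r (\<lambda>x. w x - poly Q x)"
    unfolding wLp_def by (rule nn_integral_add) measurable
  also have "\<dots> \<le> ennreal \<beta> + ennreal \<gamma>" by (intro add_mono b)
  finally show ?thesis using nn by simp
qed

text \<open>By the Nikolskii inequality the L_1 masses x j of the increments are at most y j to the
  power 1/p, where y is summable. Summability of \<beta> alone makes P j converge to w almost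
  everywhere, so w - P J is the sum of the later increments and inherits the tail of x as its L_1
  bound.\<close>

lemma weighted_L1_tail:
  fixes p :: real and r N :: nat and P :: "nat \<Rightarrow> real poly"
  assumes p: "0 < p" "p < 1" and [measurable]: "w \<in> borel_measurable borel"
    and N: "1 \<le> N" "r \<le> N"
    and deg: "\<And>j. degree (P j) \<le> 2 ^ (j + 1) * N - r"
    and \<beta>: "\<And>j. 0 \<le> \<beta> j" "\<And>j. wLp p r (\<lambda>x. w x - poly (P j) x) \<le> ennreal (\<beta> j)"
    and sm: "summable (\<lambda>j. real (2 ^ (j + 1) * N) powr (2 - 2 * p) * \<beta> j)"
    and \<eta>: "0 < \<eta>"
  obtains J where "(\<integral>\<^sup>+x\<in>{-1..1}. ennreal (dt_phi x ^ r * \<bar>w x - poly (P J) x\<bar>) \<partial>lborel) \<le> ennreal \<eta>"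
proof -
  define M where "M j = 2 ^ (j + 1) * N" for j :: nat
  define b where "b j = real (M j) powr (2 - 2 * p) * \<beta> j" for j
  have smb: "summable b" using sm by (simp add: b_def[abs_def] M_def)
  define D where "D j = P (Suc j) - P j" for j
  have M1: "1 \<le> M j" for j using N by (simp add: M_def)
  have Mr: "r \<le> M j" for j
  proof -
    have "N \<le> M j" by (simp add: M_def)
    then show ?thesis using N by linarith
  qed
  have MSuc: "M (Suc j) = 2 * M j" for j by (simp add: M_def)
  obtain C where C: "C > 0" and *: "\<forall>m M (P :: real poly). 1 \<le> m \<longrightarrow> M + degree P \<le> 1 * m \<longrightarrow>
    trig_mass 1 M P \<le> ennreal ((C * real m powr (2 - 2 * p) * enn2real (trig_mass p M P)) powr (1 / p))"
    using nikolskii_weighted[OF p, of 1] by (elim exE conjE) (rule that)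
  define x where "x j = enn2real (trig_mass 1 r (D j))" for j
  have tx: "trig_mass 1 r (D j) = ennreal (x j)" for j
    using trig_mass_finite[of 1 r "D j"] by (simp add: x_def)
  define y where "y j = C * (b (Suc j) + 2 powr (2 - 2 * p) * b j)" for j
  have b0: "0 \<le> b j" for j using \<beta>(1)[of j] by (simp add: b_def)
  have y0: "0 \<le> y j" for j using C b0[of j] b0[of "Suc j"] by (simp add: y_def)
  have smy: "summable y" unfolding y_def[abs_def]
    by (intro summable_mult summable_add smb) (simp add: summable_Suc_iff smb)
  have xy: "x j \<le> y j powr (1 / p)" for j
  proof -
    have "degree (D j) \<le> M (Suc j) - r"
      unfolding D_def
    proof (rule degree_diff_le)
      show "degree (P (Suc j)) \<le> M (Suc j) - r" using deg[of "Suc j"] by (simp add: M_def)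
      show "degree (P j) \<le> M (Suc j) - r" using deg[of j] by (simp add: M_def)
    qed
    then have "r + degree (D j) \<le> 1 * M (Suc j)" using Mr[of "Suc j"] by simp
    from *[rule_format, OF M1 this]
    have "ennreal (x j) \<le> ennreal ((C * real (M (Suc j)) powr (2 - 2 * p) * enn2real (trig_mass p r (D j))) powr (1 / p))"
      by (simp add: tx)
    then have "x j \<le> (C * real (M (Suc j)) powr (2 - 2 * p) * enn2real (trig_mass p r (D j))) powr (1 / p)"
      by (simp add: ennreal_le_iff)
    also have "\<dots> \<le> y j powr (1 / p)"
    proof (rule powr_mono2)
      have "trig_mass p r (D j) \<le> ennreal (\<beta> j + \<beta> (Suc j))"
        unfolding D_def using p \<beta> by (intro trig_mass_diff_le[where w = w]) auto
      then have "enn2real (trig_mass p r (D j)) \<le> \<beta> j + \<beta> (Suc j)"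
        using \<beta>(1) by (intro enn2real_leI) (auto intro: add_nonneg_nonneg)
      then have "C * real (M (Suc j)) powr (2 - 2 * p) * enn2real (trig_mass p r (D j)) \<le> C * real (M (Suc j)) powr (2 - 2 * p) * (\<beta> j + \<beta> (Suc j))"
        using C by (intro mult_left_mono) auto
      also have "\<dots> = C * (real (M (Suc j)) powr (2 - 2 * p) * \<beta> (Suc j) + real (M (Suc j)) powr (2 - 2 * p) * \<beta> j)"
        by (simp add: algebra_simps)
      also have "real (M (Suc j)) powr (2 - 2 * p) * \<beta> j = 2 powr (2 - 2 * p) * b j"
        by (simp add: MSuc b_def powr_mult)
      also have "real (M (Suc j)) powr (2 - 2 * p) * \<beta> (Suc j) = b (Suc j)" by (simp add: b_def)
      finally show "C * real (M (Suc j)) powr (2 - 2 * p) * enn2real (trig_mass p r (D j)) \<le> y j" by (simp add: y_def)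
    qed (use C p in auto)
    finally show ?thesis .
  qed
  \<comment> \<open>As soon as y j < 1, raising it to the exponent 1/p > 1 can only decrease
    it.\<close>
  have smx: "summable x"
  proof (rule summable_comparison_test_ev[OF _ smy])
    have "y \<longlonglongrightarrow> 0" using smy by (rule summable_LIMSEQ_zero)
    then have "\<forall>\<^sub>F j in sequentially. y j < 1" by (rule order_tendstoD) simp
    then show "\<forall>\<^sub>F j in sequentially. norm (x j) \<le> y j"
    proof eventually_elim
      case (elim j)
      have "y j powr (1 / p) \<le> y j powr 1" using elim y0[of j] p by (intro powr_mono') auto
      then show ?case using xy[of j] y0[of j] by (simp add: x_def)
    qed
  qed
  obtain J where J: "norm (\<Sum>i. x (i + J)) < \<eta>" using suminf_exist_split[OF \<eta> smx] by blast
  have smxJ: "summable (\<lambda>i. x (i + J))" using smx by (rule summable_ignore_initial_segment)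
  have sm\<beta>: "summable \<beta>"
  proof (rule summable_comparison_test[OF _ smb])
    have "\<beta> j \<le> b j" for j
    proof -
      have "1 \<le> real (M j) powr (2 - 2 * p)" using M1[of j] p by (intro ge_one_powr_ge_zero) auto
      from mult_right_mono[OF this \<beta>(1)[of j]] show ?thesis by (simp add: b_def)
    qed
    then show "\<exists>N. \<forall>n\<ge>N. norm (\<beta> n) \<le> b n" using \<beta>(1) by auto
  qed
  then have sm\<beta>J: "summable (\<lambda>i. \<beta> (i + J))" by (rule summable_ignore_initial_segment)
  define u where "u i z = dt_phi z ^ r * \<bar>w z - poly (P (i + J)) z\<bar>" for i z
  have [measurable]: "u i \<in> borel_measurable borel" for i unfolding u_def[abs_def] by measurable
  have "(\<integral>\<^sup>+z. (\<Sum>i. ennreal (\<bar>u i z\<bar> powr p) * indicator {-1..1} z) \<partial>lborel) = (\<Sum>i. \<integral>\<^sup>+z. ennreal (\<bar>u i z\<bar> powr p) * indicator {-1..1} z \<partial>lborel)"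
    by (rule nn_integral_suminf) measurable
  also have "\<dots> = (\<Sum>i. wLp p r (\<lambda>z. w z - poly (P (i + J)) z))"
    unfolding wLp_def u_def by (simp add: abs_mult)
  also have "\<dots> \<le> (\<Sum>i. ennreal (\<beta> (i + J)))" by (intro suminf_le \<beta>(2)) auto
  also have "\<dots> = ennreal (\<Sum>i. \<beta> (i + J))" using \<beta>(1) sm\<beta>J by (intro suminf_ennreal2) auto
  finally have "(\<integral>\<^sup>+z. (\<Sum>i. ennreal (\<bar>u i z\<bar> powr p) * indicator {-1..1} z) \<partial>lborel) \<noteq> \<infinity>"
    by (auto simp: top_unique)
  \<comment> \<open>A finite sum of p-th powers of the errors forces the errors to tend to 0 at
    almost every point.\<close>
  then have AEfin: "AE z in lborel. (\<Sum>i. ennreal (\<bar>u i z\<bar> powr p) * indicator {-1..1} z) \<noteq> \<infinity>"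
    by (intro nn_integral_noteq_infinite) measurable
  have pt: "ennreal (u 0 z) \<le> (\<Sum>i. ennreal (dt_phi z ^ r * \<bar>poly (D (i + J)) z\<bar>))"
    if z: "z \<in> {-1..1}" and fin: "(\<Sum>i. ennreal (\<bar>u i z\<bar> powr p)) \<noteq> \<infinity>" for z
  proof (rule ennreal_le_epsilon)
    fix e :: real assume e: "0 < e"
    have "summable (\<lambda>i. \<bar>u i z\<bar> powr p)" using fin by (intro summable_suminf_not_top) auto
    then have "(\<lambda>i. \<bar>u i z\<bar> powr p) \<longlonglongrightarrow> 0" by (rule summable_LIMSEQ_zero)
    then have "\<forall>\<^sub>F i in sequentially. \<bar>u i z\<bar> powr p < e powr p" using e by (intro order_tendstoD) auto
    then obtain L where L: "\<bar>u L z\<bar> powr p < e powr p" by (meson eventually_sequentially order_refl)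
    then have uL: "u L z < e" using e p by (meson abs_ge_self less_le_trans not_less powr_mono2 less_imp_le)
    have "w z - poly (P J) z = (\<Sum>i<L. poly (D (i + J)) z) + (w z - poly (P (L + J)) z)"
      by (induction L) (auto simp: D_def)
    then have "\<bar>w z - poly (P J) z\<bar> \<le> (\<Sum>i<L. \<bar>poly (D (i + J)) z\<bar>) + \<bar>w z - poly (P (L + J)) z\<bar>"
      using sum_abs[of "\<lambda>i. poly (D (i + J)) z" "{..<L}"] by linarith
    then have "dt_phi z ^ r * \<bar>w z - poly (P J) z\<bar> \<le> dt_phi z ^ r * ((\<Sum>i<L. \<bar>poly (D (i + J)) z\<bar>) + \<bar>w z - poly (P (L + J)) z\<bar>)"
      using dt_phi_nonneg[OF z] by (intro mult_left_mono) auto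
    then have "u 0 z \<le> (\<Sum>i<L. dt_phi z ^ r * \<bar>poly (D (i + J)) z\<bar>) + u L z"
      by (simp add: u_def algebra_simps sum_distrib_left)
    also have "\<dots> \<le> (\<Sum>i<L. dt_phi z ^ r * \<bar>poly (D (i + J)) z\<bar>) + e" using uL by simp
    finally have "ennreal (u 0 z) \<le> ennreal ((\<Sum>i<L. dt_phi z ^ r * \<bar>poly (D (i + J)) z\<bar>) + e)" by (rule ennreal_leI)
    also have "\<dots> = ennreal (\<Sum>i<L. dt_phi z ^ r * \<bar>poly (D (i + J)) z\<bar>) + ennreal e"
      by (rule ennreal_plus) (use e dt_phi_nonneg[OF z] in \<open>auto intro!: sum_nonneg\<close>)
    also have "ennreal (\<Sum>i<L. dt_phi z ^ r * \<bar>poly (D (i + J)) z\<bar>) = (\<Sum>i<L. ennreal (dt_phi z ^ r * \<bar>poly (D (i + J)) z\<bar>))"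
      using dt_phi_nonneg[OF z] by (subst sum_ennreal) auto
    also have "\<dots> + ennreal e \<le> (\<Sum>i. ennreal (dt_phi z ^ r * \<bar>poly (D (i + J)) z\<bar>)) + ennreal e"
      by (intro add_right_mono sum_le_suminf) auto
    finally show "ennreal (u 0 z) \<le> (\<Sum>i. ennreal (dt_phi z ^ r * \<bar>poly (D (i + J)) z\<bar>)) + ennreal e" .
  qed
  have "(\<integral>\<^sup>+z\<in>{-1..1}. ennreal (dt_phi z ^ r * \<bar>w z - poly (P J) z\<bar>) \<partial>lborel) \<le>
      (\<integral>\<^sup>+z. (\<Sum>i. ennreal (dt_phi z ^ r * \<bar>poly (D (i + J)) z\<bar>) * indicator {-1..1} z) \<partial>lborel)"
  proof (rule nn_integral_mono_AE, rule AE_mp[OF AEfin], rule AE_I2, rule impI)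
    fix z assume fin: "(\<Sum>i. ennreal (\<bar>u i z\<bar> powr p) * indicator {-1..1} z) \<noteq> \<infinity>"
    show "ennreal (dt_phi z ^ r * \<bar>w z - poly (P J) z\<bar>) * indicator {-1..1} z \<le> (\<Sum>i. ennreal (dt_phi z ^ r * \<bar>poly (D (i + J)) z\<bar>) * indicator {-1..1} z)"
    proof (cases "z \<in> {-1..1}")
      case True
      with fin have "(\<Sum>i. ennreal (\<bar>u i z\<bar> powr p)) \<noteq> \<infinity>" by (simp only: indicator_simps mult_1_right not_False_eq_True)
      from pt[OF True this] True show ?thesis by (simp only: indicator_simps mult_1_right u_def add_0)
    qed simp
  qed
  also have "\<dots> = (\<Sum>i. \<integral>\<^sup>+z. ennreal (dt_phi z ^ r * \<bar>poly (D (i + J)) z\<bar>) * indicator {-1..1} z \<partial>lborel)"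
    by (rule nn_integral_suminf) measurable
  also have "\<dots> = (\<Sum>i. ennreal (x (i + J)))"
  proof (intro suminf_cong)
    fix i
    show "(\<integral>\<^sup>+z. ennreal (dt_phi z ^ r * \<bar>poly (D (i + J)) z\<bar>) * indicator {-1..1} z \<partial>lborel) = ennreal (x (i + J))"
      unfolding tx[symmetric] trig_mass_eq
      using dt_phi_nonneg by (intro nn_integral_cong) (auto simp: indicator_def abs_mult)
  qed
  also have "\<dots> = ennreal (\<Sum>i. x (i + J))" using smxJ by (intro suminf_ennreal2) (auto simp: x_def)
  also have "\<dots> \<le> ennreal \<eta>" using J by (intro ennreal_leI) auto
  finally show thesis by (rule that)
qed

lemma pderiv_sum: "pderiv (\<Sum>i\<in>I. f i) = (\<Sum>i\<in>I. pderiv (f i :: real poly))"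
  by (induction I rule: infinite_finite_induct) (auto simp: pderiv_add)

lemma poly_antiderivative: "\<exists>Q :: real poly. pderiv Q = P"
proof (induction P)
  case 0
  then show ?case by (intro exI[of _ 0]) simp
next
  case (pCons a P)
  have mon: "pderiv (monom (c / real (Suc n)) (Suc n)) = monom c n" for c :: real and n
    by (simp add: pderiv_monom)
  define Q where "Q = (\<Sum>i\<le>degree (pCons a P). monom (coeff (pCons a P) i / real (Suc i)) (Suc i))"
  have "pderiv Q = (\<Sum>i\<le>degree (pCons a P). pderiv (monom (coeff (pCons a P) i / real (Suc i)) (Suc i)))"
    unfolding Q_def by (rule pderiv_sum)
  also have "\<dots> = pCons a P" unfolding mon by (rule poly_as_sum_of_monoms)
  finally show ?case by blast
qed

lemma poly_higher_antiderivative: "\<exists>Q :: real poly. (pderiv ^^ r) Q = P"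
proof (induction r arbitrary: P)
  case (Suc r)
  obtain R where R: "pderiv R = P" using poly_antiderivative by blast
  obtain Q where "(pderiv ^^ r) Q = R" using Suc.IH by blast
  then show ?case using R by auto
qed auto

lemma deriv_chain_diff_poly:
  assumes ch: "deriv_chain r D w a b" and r: "1 \<le> r"
  shows "deriv_chain r (\<lambda>i x. D i x - poly ((pderiv ^^ i) Q) x) (\<lambda>x. w x - poly ((pderiv ^^ r) Q) x) a b"
proof -
  have ch': "deriv_chain r (\<lambda>i. poly ((pderiv ^^ i) Q)) (poly ((pderiv ^^ r) Q)) a b"
    by (rule deriv_chain_poly[OF r])
  have [measurable]: "w \<in> borel_measurable borel" using ch by (simp add: deriv_chain_def)
  show ?thesis unfolding deriv_chain_def
  proof (intro conjI allI impI ballI)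
    fix i t assume "i < r - 1" "t \<in> {a..b}"
    then show "((\<lambda>x. D i x - poly ((pderiv ^^ i) Q) x) has_vector_derivative D (Suc i) t - poly ((pderiv ^^ Suc i) Q) t) (at t within {a..b})"
      using ch ch' unfolding deriv_chain_def by (intro has_vector_derivative_diff) auto
  next
    fix c d assume "a \<le> c" "c \<le> d" "d \<le> b"
    then have "(w has_integral (D (r - 1) d - D (r - 1) c)) {c..d}"
      "(poly ((pderiv ^^ r) Q) has_integral (poly ((pderiv ^^ (r - 1)) Q) d - poly ((pderiv ^^ (r - 1)) Q) c)) {c..d}"
      using ch ch' unfolding deriv_chain_def by blast+
    from has_integral_diff[OF this]
    show "((\<lambda>x. w x - poly ((pderiv ^^ r) Q) x) has_integral
        D (r - 1) d - poly ((pderiv ^^ (r - 1)) Q) d - (D (r - 1) c - poly ((pderiv ^^ (r - 1)) Q) c)) {c..d}"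
      by (simp add: algebra_simps)
  next
    show "(\<lambda>x. w x - poly ((pderiv ^^ r) Q) x) absolutely_integrable_on {a..b}"
      using ch ch' unfolding deriv_chain_def by (intro set_integral_diff) auto
    show "(\<lambda>x. w x - poly ((pderiv ^^ r) Q) x) \<in> borel_measurable borel" by measurable
  qed
qed

lemma dt_diff_diff: "dt_diff s h (\<lambda>x. f x - g x) x = dt_diff s h f x - dt_diff s h g x"
  by (simp add: dt_diff_central_diff central_diff_diff)

text \<open>A substitute for Hoelder's inequality: it turns smallness in L_1 on a bounded interval
  into smallness in L_p by integrating a majorant that is linear in v.\<close>

lemma powr_le_linear:
  fixes v a p :: real
  assumes "0 \<le> v" "0 < a" "0 < p" "p \<le> 1"
  shows "v powr p \<le> a powr (p - 1) * v + a powr p"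
proof (cases "v \<le> a")
  case True
  then have "v powr p \<le> a powr p" using assms by (intro powr_mono2) auto
  moreover have "0 \<le> a powr (p - 1) * v" using assms by simp
  ultimately show ?thesis by linarith
next
  case False
  have "v powr p = v powr (p - 1) * v" using assms False by (simp add: powr_diff)
  also have "\<dots> \<le> a powr (p - 1) * v" using assms False by (intro mult_right_mono powr_mono2') auto
  finally show ?thesis by (smt (verit) powr_ge_zero)
qed

lemma nat_floor_inverse_bounds:
  fixes \<delta> :: real
  assumes "0 < \<delta>" "\<delta> \<le> 1 / 2"
  shows "real (nat \<lfloor>1 / \<delta>\<rfloor>) \<le> 1 / \<delta>" "1 \<le> 2 * real (nat \<lfloor>1 / \<delta>\<rfloor>) * \<delta>" "1 \<le> nat \<lfloor>1 / \<delta>\<rfloor>"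
proof -
  have "2 \<le> 1 / \<delta>" using assms by (simp add: field_simps)
  then have "0 \<le> \<lfloor>1 / \<delta>\<rfloor>" by linarith
  then have eq: "real (nat \<lfloor>1 / \<delta>\<rfloor>) = of_int \<lfloor>1 / \<delta>\<rfloor>" by simp
  then show "real (nat \<lfloor>1 / \<delta>\<rfloor>) \<le> 1 / \<delta>" by simp
  have "1 / \<delta> - 1 \<le> real (nat \<lfloor>1 / \<delta>\<rfloor>)" unfolding eq by linarith
  moreover have "1 / (2 * \<delta>) \<le> 1 / \<delta> - 1" using assms by (simp add: field_simps)
  ultimately have "1 / (2 * \<delta>) \<le> real (nat \<lfloor>1 / \<delta>\<rfloor>)" by linarith
  then show "1 \<le> 2 * real (nat \<lfloor>1 / \<delta>\<rfloor>) * \<delta>" using assms by (simp add: field_simps)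
  show "1 \<le> nat \<lfloor>1 / \<delta>\<rfloor>" using \<open>2 \<le> 1 / \<delta>\<close> by linarith
qed

text \<open>A chain of three estimates: the difference of Q of order r + k by the weighted
  derivative of order k of P = Q^(r); this derivative by differences of P with step c\<delta> on the
  main part; these by the differences of w plus the approximation error. The powers \<delta>^(r+k)
  and (c\<delta>)^(-k) leave \<delta>^r.\<close>

lemma near_best_polynomial_part:
  fixes p :: real and r k :: nat
  assumes p: "0 < p" "p < 1" and r: "1 \<le> r" and k: "1 \<le> k"
  shows "\<exists>c C. 0 < c \<and> c \<le> 1 \<and> 0 < C \<and>
    (\<forall>w \<delta> h Q \<beta>. w \<in> borel_measurable borel \<longrightarrow> 0 < \<delta> \<longrightarrow> \<delta> \<le> 1 / (2 * real (r + k)) \<longrightarrow> \<bar>h\<bar> \<le> \<delta> \<longrightarrow>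
      degree ((pderiv ^^ r) Q) \<le> 2 * nat \<lfloor>1 / \<delta>\<rfloor> \<longrightarrow> wLp p r (\<lambda>x. w x - poly ((pderiv ^^ r) Q) x) \<le> \<beta> \<longrightarrow>
      (\<integral>\<^sup>+x\<in>{-1..1}. ennreal (\<bar>dt_diff (r + k) h (poly Q) x\<bar> powr p) \<partial>lborel)
        \<le> ennreal (C * (\<delta> ^ r) powr p) *
          ((\<integral>\<^sup>+x\<in>main_part k (c * \<delta>). ennreal (\<bar>dt_phi x ^ r * dt_diff k (c * \<delta>) w x\<bar> powr p) \<partial>lborel) + \<beta>))"
proof -
  define s where "s = r + k"
  have s2: "2 \<le> s" using r k by (simp add: s_def)
  \<comment> \<open>With m about 1/(2 s \<delta>), the number [1/\<delta>] is at most 4 s m. Twice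
    this, plus s <= s m, is at most 9 s m.\<close>
  define B where "B = 9 * s"
  obtain C1 where C1: "C1 > 0" and upper: "\<forall>m Q h. 1 \<le> m \<longrightarrow> s + degree ((pderiv ^^ s) Q) \<le> B * m \<longrightarrow> pi * (real s / 2 * \<bar>h\<bar>) \<le> 1 / real m \<longrightarrow>
    (\<integral>\<^sup>+x\<in>{-1..1}. ennreal (\<bar>dt_diff s h (poly Q) x\<bar> powr p) \<partial>lborel)
      \<le> ennreal (C1 * (\<bar>h\<bar> ^ s) powr p) * trig_mass p s ((pderiv ^^ s) Q)"
    using dt_diff_poly_upper[OF p(1) s2, of B] by (elim exE conjE) (rule that)
  have p1: "p \<le> 1" using p by simp
  obtain C2 c2 where C2: "C2 > 0" and c2: "c2 > 0" and lower: "\<forall>m P h. 1 \<le> m \<longrightarrow> (r + k) + degree ((pderiv ^^ k) P) \<le> B * m \<longrightarrow>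
    0 < h \<longrightarrow> h * real m \<le> c2 \<longrightarrow>
    ennreal ((h ^ k) powr p) * trig_mass p (r + k) ((pderiv ^^ k) P) \<le>
      ennreal C2 * (\<integral>\<^sup>+x\<in>main_part k h. ennreal (\<bar>dt_phi x ^ r * dt_diff k h (poly P) x\<bar> powr p) \<partial>lborel)"
    using poly_deriv_le_dt_diff[OF p(1) p1 k, of r B] by (elim exE conjE) (rule that)
  define K where "K = (\<Sum>j\<le>k. 2 * (2 ^ r * real (k choose j)) powr p)"
  have K0: "0 \<le> K" unfolding K_def by (intro sum_nonneg) auto
  \<comment> \<open>The bound 1 keeps c\<delta> among the steps of the modulus; c2 is the smallness
    needed for absorption.\<close>
  define c where "c = min 1 c2"
  have c: "0 < c" "c \<le> 1" "c \<le> c2" using c2 by (auto simp: c_def)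
  define C where "C = C1 / (c ^ k) powr p * C2 * (1 + K)"
  show ?thesis
  proof (rule exI[of _ c], rule exI[of _ C], intro conjI allI impI c)
    show "0 < C" using C1 C2 K0 c by (simp add: C_def)
    fix w :: "real \<Rightarrow> real" and \<delta> h :: real and Q :: "real poly" and \<beta> :: ennreal
    assume w[measurable]: "w \<in> borel_measurable borel" and \<delta>: "0 < \<delta>" "\<delta> \<le> 1 / (2 * real (r + k))" and h: "\<bar>h\<bar> \<le> \<delta>"
      and deg: "degree ((pderiv ^^ r) Q) \<le> 2 * nat \<lfloor>1 / \<delta>\<rfloor>" and \<beta>: "wLp p r (\<lambda>x. w x - poly ((pderiv ^^ r) Q) x) \<le> \<beta>"
    define P where "P = (pderiv ^^ r) Q"
    have sP: "(pderiv ^^ s) Q = (pderiv ^^ k) P"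
      unfolding s_def P_def by (simp add: add.commute[of r] funpow_add)
    have sr: "0 < real s" using s2 by simp
    have d12: "\<delta> \<le> 1 / 2"
    proof -
      have "1 / (2 * real (r + k)) \<le> 1 / 2" using r by (simp add: field_simps)
      then show ?thesis using \<delta> by linarith
    qed
    \<comment> \<open>The largest scale that still admits every step up to \<delta>: \<pi> s|h|/2 <=
      2 s \<delta> = 1/y.\<close>
    define y where "y = 1 / (2 * real s * \<delta>)"
    have y1: "1 \<le> y"
    proof -
      have "\<delta> \<le> 1 / (2 * real s)" using \<delta> by (simp add: s_def)
      then have "2 * real s * \<delta> \<le> 1" using sr by (simp add: field_simps)
      then show ?thesis using \<delta> sr by (simp add: y_def le_divide_eq)
    qed
    define m where "m = nat \<lfloor>y\<rfloor>"
    have m: "1 \<le> m" "real m \<le> y" "y \<le> 2 * real m"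
    proof -
      have eq: "real m = of_int \<lfloor>y\<rfloor>" using y1 by (simp add: m_def)
      have f1: "1 \<le> \<lfloor>y\<rfloor>" using y1 by simp
      show "1 \<le> m" unfolding m_def using f1 by linarith
      show "real m \<le> y" unfolding eq by simp
      have "y < real_of_int \<lfloor>y\<rfloor> + 1" by linarith
      moreover have "1 \<le> real_of_int \<lfloor>y\<rfloor>" using f1 by linarith
      ultimately show "y \<le> 2 * real m" unfolding eq by linarith
    qed
    have degk: "degree ((pderiv ^^ k) P) \<le> degree P"
      by (induction k) (auto simp: degree_pderiv intro: le_trans[OF diff_le_self])
    have sdeg: "s + degree ((pderiv ^^ k) P) \<le> B * m"
    proof -
      have "real (nat \<lfloor>1 / \<delta>\<rfloor>) \<le> 1 / \<delta>" using \<delta>(1) d12 by (rule nat_floor_inverse_bounds)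
      also have "1 / \<delta> = 2 * real s * y" using \<delta> sr by (simp add: y_def field_simps)
      also have "\<dots> \<le> 2 * real s * (2 * real m)" using m by (intro mult_left_mono) auto
      finally have "real (nat \<lfloor>1 / \<delta>\<rfloor>) \<le> real (4 * s * m)" by simp
      then have "nat \<lfloor>1 / \<delta>\<rfloor> \<le> 4 * s * m" by (simp only: of_nat_le_iff)
      moreover have "s * 1 \<le> s * m" using m(1) by (rule mult_le_mono2)
      ultimately have "s + 2 * nat \<lfloor>1 / \<delta>\<rfloor> \<le> 9 * s * m" unfolding mult.assoc by linarith
      then show ?thesis using degk deg by (simp add: B_def P_def)
    qed
    have hm: "pi * (real s / 2 * \<bar>h\<bar>) \<le> 1 / real m"
    proof -
      have "pi * (real s / 2 * \<bar>h\<bar>) \<le> 4 * (real s / 2 * \<delta>)"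
        using pi_less_4 h by (intro mult_mono) auto
      also have "\<dots> = 1 / y" using \<delta> sr by (simp add: y_def)
      also have "\<dots> \<le> 1 / real m" using m by (intro divide_left_mono) auto
      finally show ?thesis .
    qed
    define h1 where "h1 = c * \<delta>"
    have h1: "0 < h1" using c \<delta> by (simp add: h1_def)
    have h1m: "h1 * real m \<le> c2"
    proof -
      have "\<delta> * real m \<le> \<delta> * y" using m \<delta> by (intro mult_left_mono) auto
      also have "\<dots> = 1 / (2 * real s)" using \<delta> by (simp add: y_def)
      also have "\<dots> \<le> 1" using s2 by (simp add: field_simps)
      finally have "c * (\<delta> * real m) \<le> c * 1" using c by (intro mult_left_mono) auto
      also have "c * 1 \<le> c2" using c by simp
      finally show ?thesis by (simp add: h1_def mult.assoc)
    qed
    let ?X = "\<integral>\<^sup>+x\<in>main_part k h1. ennreal (\<bar>dt_phi x ^ r * dt_diff k h1 w x\<bar> powr p) \<partial>lborel"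
    have XP: "(\<integral>\<^sup>+x\<in>main_part k h1. ennreal (\<bar>dt_phi x ^ r * dt_diff k h1 (poly P) x\<bar> powr p) \<partial>lborel) \<le> ?X + ennreal K * \<beta>"
    proof -
      have "(\<integral>\<^sup>+x\<in>main_part k h1. ennreal (\<bar>dt_phi x ^ r * dt_diff k h1 (poly P) x\<bar> powr p) \<partial>lborel) \<le>
        (\<integral>\<^sup>+x. ennreal (\<bar>dt_phi x ^ r * dt_diff k h1 w x\<bar> powr p) * indicator (main_part k h1) x +
           ennreal (\<bar>dt_phi x ^ r * dt_diff k h1 (\<lambda>x. w x - poly P x) x\<bar> powr p) * indicator (main_part k h1) x \<partial>lborel)"
      proof (intro nn_integral_mono)
        fix x
        let ?a = "dt_phi x ^ r * dt_diff k h1 w x" and ?b = "dt_phi x ^ r * dt_diff k h1 (\<lambda>x. w x - poly P x) x"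
        have "dt_phi x ^ r * dt_diff k h1 (poly P) x = ?a - ?b" by (simp add: dt_diff_diff algebra_simps)
        then have "\<bar>dt_phi x ^ r * dt_diff k h1 (poly P) x\<bar> \<le> \<bar>?a\<bar> + \<bar>?b\<bar>" by (simp only: abs_triangle_ineq4)
        then have "\<bar>dt_phi x ^ r * dt_diff k h1 (poly P) x\<bar> powr p \<le> (\<bar>?a\<bar> + \<bar>?b\<bar>) powr p"
          using p by (intro powr_mono2) auto
        also have "\<dots> \<le> \<bar>?a\<bar> powr p + \<bar>?b\<bar> powr p" using p by (intro powr_subadditive) auto
        finally have "ennreal (\<bar>dt_phi x ^ r * dt_diff k h1 (poly P) x\<bar> powr p) \<le> ennreal (\<bar>?a\<bar> powr p) + ennreal (\<bar>?b\<bar> powr p)"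
          using ennreal_leI by fastforce
        then show "ennreal (\<bar>dt_phi x ^ r * dt_diff k h1 (poly P) x\<bar> powr p) * indicator (main_part k h1) x \<le>
          ennreal (\<bar>?a\<bar> powr p) * indicator (main_part k h1) x + ennreal (\<bar>?b\<bar> powr p) * indicator (main_part k h1) x"
          by (cases "x \<in> main_part k h1") auto
      qed
      also have "\<dots> = ?X + (\<integral>\<^sup>+x\<in>main_part k h1. ennreal (\<bar>dt_phi x ^ r * dt_diff k h1 (\<lambda>x. w x - poly P x) x\<bar> powr p) \<partial>lborel)"
        by (rule nn_integral_add) measurable
      also have "\<dots> \<le> ?X + ennreal K * \<beta>"
      proof (rule add_left_mono)
        have "(\<integral>\<^sup>+x\<in>main_part k h1. ennreal (\<bar>dt_phi x ^ r * dt_diff k h1 (\<lambda>x. w x - poly P x) x\<bar> powr p) \<partial>lborel)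
          \<le> ennreal K * (\<integral>\<^sup>+x\<in>{-1..1}. ennreal (\<bar>dt_phi x ^ r * (w x - poly P x)\<bar> powr p) \<partial>lborel)"
          unfolding K_def by (rule nn_integral_dt_diff_main_part_le[OF _ k h1 p(1) p1]) measurable
        also have "\<dots> \<le> ennreal K * \<beta>" using \<beta> by (intro mult_left_mono) (auto simp: wLp_def P_def)
        finally show "(\<integral>\<^sup>+x\<in>main_part k h1. ennreal (\<bar>dt_phi x ^ r * dt_diff k h1 (\<lambda>x. w x - poly P x) x\<bar> powr p) \<partial>lborel) \<le> ennreal K * \<beta>" .
      qed
      finally show ?thesis .
    qed
    define E where "E = C1 / (c ^ k) powr p * (\<delta> ^ r) powr p"
    have E0: "0 \<le> E" using C1 by (simp add: E_def)
    have ds: "(\<delta> ^ s) powr p = (\<delta> ^ r) powr p * ((h1 ^ k) powr p / (c ^ k) powr p)"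
      using \<delta> c by (simp add: s_def h1_def power_add powr_mult power_mult_distrib)
    have "(\<integral>\<^sup>+x\<in>{-1..1}. ennreal (\<bar>dt_diff s h (poly Q) x\<bar> powr p) \<partial>lborel) \<le> ennreal (C1 * (\<bar>h\<bar> ^ s) powr p) * trig_mass p s ((pderiv ^^ k) P)"
      using upper[rule_format, OF m(1) _ hm, of Q] sdeg by (simp add: sP)
    also have "\<dots> \<le> ennreal (C1 * (\<delta> ^ s) powr p) * trig_mass p s ((pderiv ^^ k) P)"
      using C1 h p by (intro mult_right_mono ennreal_leI mult_left_mono powr_mono2 power_mono) auto
    also have "C1 * (\<delta> ^ s) powr p = E * (h1 ^ k) powr p" unfolding ds by (simp add: E_def)
    also have "ennreal (E * (h1 ^ k) powr p) * trig_mass p s ((pderiv ^^ k) P) = ennreal E * (ennreal ((h1 ^ k) powr p) * trig_mass p s ((pderiv ^^ k) P))"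
      using E0 by (simp add: ennreal_mult mult.assoc)
    also have "\<dots> \<le> ennreal E * (ennreal C2 * (?X + ennreal K * \<beta>))"
    proof (intro mult_left_mono)
      have "ennreal ((h1 ^ k) powr p) * trig_mass p s ((pderiv ^^ k) P) \<le> ennreal C2 * (\<integral>\<^sup>+x\<in>main_part k h1. ennreal (\<bar>dt_phi x ^ r * dt_diff k h1 (poly P) x\<bar> powr p) \<partial>lborel)"
        using lower[rule_format, OF m(1) sdeg[unfolded s_def] h1 h1m] by (simp add: s_def)
      also have "\<dots> \<le> ennreal C2 * (?X + ennreal K * \<beta>)" by (intro mult_left_mono XP) simp
      finally show "ennreal ((h1 ^ k) powr p) * trig_mass p s ((pderiv ^^ k) P) \<le> ennreal C2 * (?X + ennreal K * \<beta>)" .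
    qed simp
    also have "\<dots> \<le> ennreal E * (ennreal C2 * (ennreal (1 + K) * (?X + \<beta>)))"
    proof (intro mult_left_mono)
      have "?X + ennreal K * \<beta> \<le> ennreal (1 + K) * ?X + ennreal (1 + K) * \<beta>"
      proof (intro add_mono)
        have "1 * ?X \<le> ennreal (1 + K) * ?X" using K0 by (intro mult_right_mono) auto
        then show "?X \<le> ennreal (1 + K) * ?X" by simp
        show "ennreal K * \<beta> \<le> ennreal (1 + K) * \<beta>" by (intro mult_right_mono ennreal_leI) auto
      qed
      then show "?X + ennreal K * \<beta> \<le> ennreal (1 + K) * (?X + \<beta>)" by (simp only: distrib_left)
    qed auto
    also have "\<dots> = ennreal (E * C2 * (1 + K)) * (?X + \<beta>)"
      using E0 C2 K0 by (simp only: ennreal_mult mult.assoc mult_nonneg_nonneg less_imp_le add_nonneg_nonneg zero_le_one)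
    also have "E * C2 * (1 + K) = C * (\<delta> ^ r) powr p" by (simp add: E_def C_def)
    finally show "(\<integral>\<^sup>+x\<in>{-1..1}. ennreal (\<bar>dt_diff (r + k) h (poly Q) x\<bar> powr p) \<partial>lborel)
        \<le> ennreal (C * (\<delta> ^ r) powr p) *
          ((\<integral>\<^sup>+x\<in>main_part k (c * \<delta>). ennreal (\<bar>dt_phi x ^ r * dt_diff k (c * \<delta>) w x\<bar> powr p) \<partial>lborel) + \<beta>)"
      by (simp add: s_def h1_def)
  qed
qed

text \<open>The scale a in the linear majorant is chosen equal to the L_1 bound: a^(p-1) times a,
  plus a^p times the length 2 of the interval, gives 3 a^p.\<close>

lemma dt_diff_Lp_le_of_weighted_L1:
  assumes ch: "deriv_chain r D w (-1) 1" and r: "1 \<le> r" "r \<le> s" and p: "0 < p" "p \<le> 1" and a: "0 < a"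
    and small: "ennreal (6 * 2 ^ s * real s ^ r * \<bar>h\<bar> ^ r) * (\<integral>\<^sup>+t\<in>{-1..1}. ennreal (dt_phi t ^ r * \<bar>w t\<bar>) \<partial>lborel) \<le> ennreal a"
  obtains M where "M \<in> borel_measurable borel"
    "\<And>x. x \<in> {-1..1} \<Longrightarrow> ennreal (\<bar>dt_diff s h (D 0) x\<bar> powr p) \<le> M x"
    "(\<integral>\<^sup>+x\<in>{-1..1}. M x \<partial>lborel) \<le> ennreal (3 * a powr p)"
proof -
  obtain M0 where [measurable]: "M0 \<in> borel_measurable borel" and
    M0: "\<And>x. x \<in> {-1..1} \<Longrightarrow> ennreal \<bar>dt_diff s h (D 0) x\<bar> \<le> M0 x"
    "(\<integral>\<^sup>+x. M0 x \<partial>lborel) \<le> ennreal (6 * 2 ^ s * real s ^ r * \<bar>h\<bar> ^ r) *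
       (\<integral>\<^sup>+t\<in>{-1..1}. ennreal (dt_phi t ^ r * \<bar>w t\<bar>) \<partial>lborel)"
    using dt_diff_L1_majorant[OF ch r, of h] by blast
  let ?M = "\<lambda>x. ennreal (a powr (p - 1)) * M0 x + ennreal (a powr p)"
  show thesis
  proof (rule that[of ?M])
    show "?M \<in> borel_measurable borel" by measurable
    fix x :: real assume x: "x \<in> {-1..1}"
    let ?v = "\<bar>dt_diff s h (D 0) x\<bar>"
    have "ennreal (?v powr p) \<le> ennreal (a powr (p - 1) * ?v + a powr p)"
      by (intro ennreal_leI powr_le_linear) (use a p in auto)
    also have "\<dots> = ennreal (a powr (p - 1)) * ennreal ?v + ennreal (a powr p)"
      by (simp add: ennreal_mult)
    also have "\<dots> \<le> ?M x" by (intro add_right_mono mult_left_mono M0 x) simp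
    finally show "ennreal (?v powr p) \<le> ?M x" .
  next
    have "(\<integral>\<^sup>+x\<in>{-1..1}. ?M x \<partial>lborel) \<le> (\<integral>\<^sup>+x. ennreal (a powr (p - 1)) * M0 x + ennreal (a powr p) * indicator {-1..1} x \<partial>lborel)"
      by (intro nn_integral_mono) (auto simp: indicator_def)
    also have "\<dots> = ennreal (a powr (p - 1)) * (\<integral>\<^sup>+x. M0 x \<partial>lborel) + ennreal (a powr p) * ennreal 2"
      by (subst nn_integral_add, measurable, subst nn_integral_cmult, measurable)
        (simp add: nn_integral_cmult_indicator)
    also have "\<dots> \<le> ennreal (a powr (p - 1)) * ennreal a + ennreal (a powr p) * ennreal 2"
      by (intro add_right_mono mult_left_mono order_trans[OF M0(2) small]) simp
    also have "\<dots> = ennreal (a powr (p - 1) * a + a powr p * 2)"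
      using a by (simp only: ennreal_mult ennreal_plus powr_ge_zero less_imp_le mult_nonneg_nonneg zero_le_numeral)
    also have "a powr (p - 1) * a + a powr p * 2 = 3 * a powr p" using a by (simp add: powr_diff)
    finally show "(\<integral>\<^sup>+x\<in>{-1..1}. ?M x \<partial>lborel) \<le> ennreal (3 * a powr p)" .
  qed
qed

text \<open>The telescoping decomposition: with $Q_j^{(r)} = P_j$, the function is the sum of $Q_0$, of the
  increments $Q_{j+1} - Q_j$ for $j < J$, and of a remainder that is negligible in $L_p$ for large J.\<close>

lemma dt_diff_Lp_le_telescoped:
  fixes p :: real and r k :: nat
  assumes p: "0 < p" "p < 1" and r: "1 \<le> r" and k: "1 \<le> k"
  shows "\<exists>c C. 0 < c \<and> c \<le> 1 \<and> 0 < C \<and>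
    (\<forall>D w \<delta> h P \<beta>. deriv_chain r D w (-1) 1 \<longrightarrow> 0 < \<delta> \<longrightarrow> \<delta> \<le> 1 / (2 * real (r + k)) \<longrightarrow> \<bar>h\<bar> \<le> \<delta> \<longrightarrow>
      (\<forall>j. degree (P j) \<le> 2 ^ (j + 1) * nat \<lfloor>1 / \<delta>\<rfloor> - r) \<longrightarrow> (\<forall>j. 0 \<le> \<beta> j) \<longrightarrow>
      (\<forall>j. wLp p r (\<lambda>x. w x - poly (P j) x) \<le> ennreal (\<beta> j)) \<longrightarrow>
      summable (\<lambda>j. real (2 ^ (j + 1) * nat \<lfloor>1 / \<delta>\<rfloor>) powr (2 - 2 * p) * \<beta> j) \<longrightarrow>
      (\<integral>\<^sup>+x\<in>{-1..1}. ennreal (\<bar>dt_diff (r + k) h (D 0) x\<bar> powr p) \<partial>lborel) \<le>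
        ennreal (C * (\<delta> ^ r) powr p) *
          (\<integral>\<^sup>+x\<in>main_part k (c * \<delta>). ennreal (\<bar>dt_phi x ^ r * dt_diff k (c * \<delta>) w x\<bar> powr p) \<partial>lborel)
        + ennreal (C * (\<delta> ^ r) powr p * \<delta> powr (2 - 2 * p) *
            (\<Sum>j. real (2 ^ (j + 1) * nat \<lfloor>1 / \<delta>\<rfloor>) powr (2 - 2 * p) * \<beta> j)))"
proof -
  define s where "s = r + k"
  have rs: "r \<le> s" by (simp add: s_def)
  have p1: "p \<le> 1" using p by simp
  obtain c C1 where c: "0 < c" "c \<le> 1" and C1: "0 < C1" and
    Q0: "\<forall>w \<delta> h Q \<beta>. w \<in> borel_measurable borel \<longrightarrow> 0 < \<delta> \<longrightarrow> \<delta> \<le> 1 / (2 * real (r + k)) \<longrightarrow> \<bar>h\<bar> \<le> \<delta> \<longrightarrow>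
      degree ((pderiv ^^ r) Q) \<le> 2 * nat \<lfloor>1 / \<delta>\<rfloor> \<longrightarrow> wLp p r (\<lambda>x. w x - poly ((pderiv ^^ r) Q) x) \<le> \<beta> \<longrightarrow>
      (\<integral>\<^sup>+x\<in>{-1..1}. ennreal (\<bar>dt_diff (r + k) h (poly Q) x\<bar> powr p) \<partial>lborel)
        \<le> ennreal (C1 * (\<delta> ^ r) powr p) *
          ((\<integral>\<^sup>+x\<in>main_part k (c * \<delta>). ennreal (\<bar>dt_phi x ^ r * dt_diff k (c * \<delta>) w x\<bar> powr p) \<partial>lborel) + \<beta>)"
    using near_best_polynomial_part[OF p r k] by (elim exE conjE) (rule that)
  obtain C2 where C2: "0 < C2" and rough: "\<forall>m Q h \<delta>. 1 \<le> m \<longrightarrow> r + degree ((pderiv ^^ r) Q) \<le> 1 * m \<longrightarrow> \<bar>h\<bar> \<le> \<delta> \<longrightarrow> \<delta> \<le> 1 \<longrightarrow> 1 \<le> real m * \<delta> \<longrightarrow>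
    (\<integral>\<^sup>+x\<in>{-1..1}. ennreal (\<bar>dt_diff s h (poly Q) x\<bar> powr p) \<partial>lborel)
      \<le> ennreal (C2 * (\<delta> ^ r) powr p * (real m * \<delta>) powr (2 - 2 * p)) * trig_mass p r ((pderiv ^^ r) Q)"
    using dt_diff_poly_rough[OF p r rs, of 1] by (elim exE conjE) (rule that)
  \<comment> \<open>Increment j costs b (Suc j) + 4 b j, the 4 bounding 2^(2-2p); summed over j this
    is at most five times the series.\<close>
  define C where "C = C1 + 5 * C2"
  show ?thesis
  proof (rule exI[of _ c], rule exI[of _ C], intro conjI allI impI c)
    show "0 < C" using C1 C2 by (simp add: C_def)
    fix D :: "nat \<Rightarrow> real \<Rightarrow> real" and w :: "real \<Rightarrow> real" and \<delta> h :: real and P :: "nat \<Rightarrow> real poly" and \<beta> :: "nat \<Rightarrow> real"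
    assume ch: "deriv_chain r D w (-1) 1" and \<delta>: "0 < \<delta>" "\<delta> \<le> 1 / (2 * real (r + k))" and h: "\<bar>h\<bar> \<le> \<delta>"
      and deg': "\<forall>j. degree (P j) \<le> 2 ^ (j + 1) * nat \<lfloor>1 / \<delta>\<rfloor> - r" and \<beta>0': "\<forall>j. 0 \<le> \<beta> j"
      and \<beta>': "\<forall>j. wLp p r (\<lambda>x. w x - poly (P j) x) \<le> ennreal (\<beta> j)"
      and sm: "summable (\<lambda>j. real (2 ^ (j + 1) * nat \<lfloor>1 / \<delta>\<rfloor>) powr (2 - 2 * p) * \<beta> j)"
    have [measurable]: "w \<in> borel_measurable borel" using ch by (simp add: deriv_chain_def)
    define N where "N = nat \<lfloor>1 / \<delta>\<rfloor>"
    define M where "M j = 2 ^ (j + 1) * N" for j :: nat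
    have deg: "degree (P j) \<le> M j - r" for j using deg' by (simp add: M_def N_def)
    have \<beta>0: "0 \<le> \<beta> j" for j using \<beta>0' by simp
    have \<beta>: "wLp p r (\<lambda>x. w x - poly (P j) x) \<le> ennreal (\<beta> j)" for j using \<beta>' by simp
    define b where "b j = real (M j) powr (2 - 2 * p) * \<beta> j" for j
    have smb: "summable b" using sm by (simp add: b_def[abs_def] M_def N_def)
    have b0: "0 \<le> b j" for j using \<beta>0[of j] by (simp add: b_def)
    have d12: "\<delta> \<le> 1 / 2"
    proof -
      have "1 / (2 * real (r + k)) \<le> 1 / 2" using r by (simp add: field_simps)
      then show ?thesis using \<delta> by linarith
    qed
    have N1: "1 \<le> N" "1 \<le> 2 * real N * \<delta>"
      using nat_floor_inverse_bounds[OF \<delta>(1) d12] by (auto simp: N_def)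
    \<comment> \<open>Makes the natural subtraction in the degree bounds \<open>M j - r\<close> a
      genuine one.\<close>
    have rN: "r \<le> N"
    proof -
      have "real r \<le> 1 / \<delta>"
      proof -
        have "\<delta> * real r \<le> 1 / (2 * real (r + k)) * real r" using \<delta> by (intro mult_right_mono) auto
        also have "\<dots> \<le> 1" using r by (simp add: field_simps)
        finally show ?thesis using \<delta> by (simp add: field_simps)
      qed
      then show ?thesis unfolding N_def by (simp add: le_nat_floor)
    qed
    have MN: "N \<le> M j" for j by (simp add: M_def)
    have MSuc: "M (Suc j) = 2 * M j" for j by (simp add: M_def)
    have M\<delta>: "1 \<le> real (M j) * \<delta>" for j
    proof -
      have "1 * (2 * real N * \<delta>) \<le> 2 ^ j * (2 * real N * \<delta>)" using \<delta> by (intro mult_right_mono) auto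
      then show ?thesis using N1 by (simp add: M_def mult_ac)
    qed
    define R where "R = (\<delta> ^ r) powr p * \<delta> powr (2 - 2 * p)"
    have R0: "0 < R" using \<delta> by (simp add: R_def)
    define X where "X = (\<integral>\<^sup>+x\<in>main_part k (c * \<delta>). ennreal (\<bar>dt_phi x ^ r * dt_diff k (c * \<delta>) w x\<bar> powr p) \<partial>lborel)"
    have "\<forall>j. \<exists>Q. (pderiv ^^ r) Q = P j" using poly_higher_antiderivative by blast
    then obtain Q where Q: "\<And>j. (pderiv ^^ r) (Q j) = P j" by (elim choice[THEN exE]) (rule that, blast)
    define G where "G j = Q (Suc j) - Q j" for j
    have I0: "(\<integral>\<^sup>+x\<in>{-1..1}. ennreal (\<bar>dt_diff s h (poly (Q 0)) x\<bar> powr p) \<partial>lborel) \<le> ennreal (C1 * (\<delta> ^ r) powr p) * X + ennreal (C1 * R * b 0)"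
    proof -
      have "degree ((pderiv ^^ r) (Q 0)) \<le> 2 * nat \<lfloor>1 / \<delta>\<rfloor>" using deg[of 0] by (simp add: Q M_def N_def)
      from Q0[rule_format, OF _ \<delta> h this, of w "ennreal (\<beta> 0)"]
      have "(\<integral>\<^sup>+x\<in>{-1..1}. ennreal (\<bar>dt_diff s h (poly (Q 0)) x\<bar> powr p) \<partial>lborel) \<le> ennreal (C1 * (\<delta> ^ r) powr p) * (X + ennreal (\<beta> 0))"
        using \<beta>[of 0] by (simp add: Q s_def X_def)
      also have "\<dots> = ennreal (C1 * (\<delta> ^ r) powr p) * X + ennreal (C1 * (\<delta> ^ r) powr p * \<beta> 0)"
        using C1 \<beta>0[of 0] by (simp only: distrib_left ennreal_mult mult_nonneg_nonneg less_imp_le powr_ge_zero)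
      also have "\<dots> \<le> ennreal (C1 * (\<delta> ^ r) powr p) * X + ennreal (C1 * R * b 0)"
      proof (intro add_left_mono ennreal_leI)
        \<comment> \<open>Since M 0 \<delta> >= 1, inserting this factor turns the error of Q 0 into
          the first term of the series.\<close>
        have "1 \<le> (real (M 0) * \<delta>) powr (2 - 2 * p)" using M\<delta>[of 0] p by (intro ge_one_powr_ge_zero) auto
        then have "(C1 * (\<delta> ^ r) powr p * \<beta> 0) * 1 \<le> (C1 * (\<delta> ^ r) powr p * \<beta> 0) * (real (M 0) * \<delta>) powr (2 - 2 * p)"
          using C1 \<beta>0[of 0] by (intro mult_left_mono) auto
        also have "\<dots> = C1 * R * b 0" using \<delta> by (simp add: R_def b_def powr_mult)
        finally show "C1 * (\<delta> ^ r) powr p * \<beta> 0 \<le> C1 * R * b 0" by simp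
      qed
      finally show ?thesis .
    qed
    have Ij: "(\<integral>\<^sup>+x\<in>{-1..1}. ennreal (\<bar>dt_diff s h (poly (G j)) x\<bar> powr p) \<partial>lborel) \<le> ennreal (C2 * R * (b (Suc j) + 4 * b j))" for j
    proof -
      have GP: "(pderiv ^^ r) (G j) = P (Suc j) - P j" by (simp add: G_def higher_pderiv_diff Q)
      have "degree (P (Suc j) - P j) \<le> M (Suc j) - r"
      proof (rule degree_diff_le)
        show "degree (P (Suc j)) \<le> M (Suc j) - r" by (rule deg)
        have "M j \<le> M (Suc j)" by (simp add: MSuc)
        then show "degree (P j) \<le> M (Suc j) - r" using deg[of j] by linarith
      qed
      then have dg: "r + degree ((pderiv ^^ r) (G j)) \<le> 1 * M (Suc j)" using rN MN[of "Suc j"] by (simp add: GP)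
      have M1: "1 \<le> M (Suc j)" using N1(1) MN[of "Suc j"] by linarith
      have d1: "\<delta> \<le> 1" using d12 by simp
      have "(\<integral>\<^sup>+x\<in>{-1..1}. ennreal (\<bar>dt_diff s h (poly (G j)) x\<bar> powr p) \<partial>lborel) \<le>
          ennreal (C2 * (\<delta> ^ r) powr p * (real (M (Suc j)) * \<delta>) powr (2 - 2 * p)) * trig_mass p r (P (Suc j) - P j)"
        using rough[rule_format, OF M1 dg h d1 M\<delta>] by (simp add: GP)
      also have "\<dots> \<le> ennreal (C2 * (\<delta> ^ r) powr p * (real (M (Suc j)) * \<delta>) powr (2 - 2 * p)) * ennreal (\<beta> j + \<beta> (Suc j))"
        by (intro mult_left_mono trig_mass_diff_le[OF p(1) p1 _ \<beta> \<beta> \<beta>0 \<beta>0]) auto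
      also have "\<dots> = ennreal (C2 * (\<delta> ^ r) powr p * (real (M (Suc j)) * \<delta>) powr (2 - 2 * p) * (\<beta> j + \<beta> (Suc j)))"
        using C2 \<beta>0[of j] \<beta>0[of "Suc j"] by (intro ennreal_mult[symmetric]) auto
      also have "\<dots> \<le> ennreal (C2 * R * (b (Suc j) + 4 * b j))"
      proof (rule ennreal_leI)
        have two: "2 powr (2 - 2 * p) \<le> (4 :: real)"
          using powr_mono[of "2 - 2 * p" 2 "2 :: real"] p by simp
        have "C2 * (\<delta> ^ r) powr p * (real (M (Suc j)) * \<delta>) powr (2 - 2 * p) * (\<beta> j + \<beta> (Suc j)) =
            C2 * R * (real (M (Suc j)) powr (2 - 2 * p) * \<beta> (Suc j) + real (M (Suc j)) powr (2 - 2 * p) * \<beta> j)"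
          using \<delta> by (simp add: R_def powr_mult algebra_simps)
        also have "\<dots> = C2 * R * (b (Suc j) + 2 powr (2 - 2 * p) * b j)"
          by (simp add: b_def MSuc powr_mult)
        also have "\<dots> \<le> C2 * R * (b (Suc j) + 4 * b j)"
          using C2 R0 b0[of j] two by (intro mult_left_mono add_left_mono mult_right_mono) auto
        finally show "C2 * (\<delta> ^ r) powr p * (real (M (Suc j)) * \<delta>) powr (2 - 2 * p) * (\<beta> j + \<beta> (Suc j)) \<le> C2 * R * (b (Suc j) + 4 * b j)" .
      qed
      finally show ?thesis .
    qed
    have sum_b: "(\<Sum>j<J. b (Suc j) + 4 * b j) \<le> 5 * suminf b" for J
    proof -
      have "(\<Sum>j<J. b (Suc j)) \<le> (\<Sum>j<Suc J. b j)" using b0[of 0] by (subst sum.lessThan_Suc_shift) simp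
      also have "\<dots> \<le> suminf b" by (intro sum_le_suminf smb) (auto simp: b0)
      finally have "(\<Sum>j<J. b (Suc j)) \<le> suminf b" .
      moreover have "(\<Sum>j<J. b j) \<le> suminf b" by (intro sum_le_suminf smb) (auto simp: b0)
      ultimately show ?thesis by (simp add: sum.distrib sum_distrib_left[symmetric])
    qed
    have b_le: "b 0 \<le> suminf b" using sum_le_suminf[OF smb, of "{0}"] b0 by simp
    have sb0: "0 \<le> suminf b" using b_le b0[of 0] by linarith
    have "(\<integral>\<^sup>+x\<in>{-1..1}. ennreal (\<bar>dt_diff s h (D 0) x\<bar> powr p) \<partial>lborel) \<le>
        ennreal (C * (\<delta> ^ r) powr p) * X + ennreal (C * R * suminf b)"
    proof (rule ennreal_le_epsilon)
      fix e :: real assume e: "0 < e"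
      \<comment> \<open>So that 3 a^p = e in the bound for the remainder. The index J depends on e,
        whereas the estimates for the other pieces are uniform in J.\<close>
      define a where "a = (e / 3) powr (1 / p)"
      have a: "0 < a" "3 * a powr p = e" using e p by (auto simp: a_def powr_powr)
      define E where "E = 6 * 2 ^ s * real s ^ r * \<delta> ^ r"
      have E: "0 < E" using \<delta> r by (simp add: E_def s_def)
      obtain J where J: "(\<integral>\<^sup>+x\<in>{-1..1}. ennreal (dt_phi x ^ r * \<bar>w x - poly (P J) x\<bar>) \<partial>lborel) \<le> ennreal (a / E)"
      proof (rule weighted_L1_tail[OF p _ N1(1) rN, of w P \<beta> "a / E"])
        show "degree (P j) \<le> 2 ^ (j + 1) * N - r" for j using deg[of j] by (simp add: M_def)
        show "summable (\<lambda>j. real (2 ^ (j + 1) * N) powr (2 - 2 * p) * \<beta> j)" using sm by (simp add: N_def)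
      qed (use \<beta>0 \<beta> a E that in auto)
      have chJ: "deriv_chain r (\<lambda>i x. D i x - poly ((pderiv ^^ i) (Q J)) x) (\<lambda>x. w x - poly (P J) x) (-1) 1"
        using deriv_chain_diff_poly[OF ch r, of "Q J"] by (simp add: Q)
      have small: "ennreal (6 * 2 ^ s * real s ^ r * \<bar>h\<bar> ^ r) * (\<integral>\<^sup>+t\<in>{-1..1}. ennreal (dt_phi t ^ r * \<bar>w t - poly (P J) t\<bar>) \<partial>lborel) \<le> ennreal a"
      proof -
        have "6 * 2 ^ s * real s ^ r * \<bar>h\<bar> ^ r \<le> E" unfolding E_def using h by (intro mult_left_mono power_mono) auto
        then have "ennreal (6 * 2 ^ s * real s ^ r * \<bar>h\<bar> ^ r) * (\<integral>\<^sup>+t\<in>{-1..1}. ennreal (dt_phi t ^ r * \<bar>w t - poly (P J) t\<bar>) \<partial>lborel) \<le> ennreal E * ennreal (a / E)"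
          using J by (intro mult_mono ennreal_leI) auto
        also have "\<dots> = ennreal a" using E a by (simp flip: ennreal_mult)
        finally show ?thesis .
      qed
      obtain T where [measurable]: "T \<in> borel_measurable borel" and
        T: "\<And>x. x \<in> {-1..1} \<Longrightarrow> ennreal (\<bar>dt_diff s h (\<lambda>x. D 0 x - poly (Q J) x) x\<bar> powr p) \<le> T x"
        "(\<integral>\<^sup>+x\<in>{-1..1}. T x \<partial>lborel) \<le> ennreal e"
        using dt_diff_Lp_le_of_weighted_L1[OF chJ r rs p(1) p1 a(1) small] a(2) by auto
      let ?q = "\<lambda>x. ennreal (\<bar>dt_diff s h (poly (Q 0)) x\<bar> powr p)"
      let ?g = "\<lambda>j x. ennreal (\<bar>dt_diff s h (poly (G j)) x\<bar> powr p)"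
      have pt: "ennreal (\<bar>dt_diff s h (D 0) x\<bar> powr p) \<le> T x + ((\<Sum>j<J. ?g j x) + ?q x)" if x: "x \<in> {-1..1}" for x
      proof -
        have poly_sub: "dt_diff s h (poly (A - B)) x = dt_diff s h (poly A) x - dt_diff s h (poly B) x" for A B
          unfolding dt_diff_diff[symmetric] by (simp add: poly_diff[abs_def])
        have poly_G: "dt_diff s h (poly (G j)) x = dt_diff s h (poly (Q (Suc j))) x - dt_diff s h (poly (Q j)) x" for j
          unfolding G_def by (rule poly_sub)
        have tele: "dt_diff s h (poly (Q J)) x = (\<Sum>j<J. dt_diff s h (poly (G j)) x) + dt_diff s h (poly (Q 0)) x"
          by (induction J) (auto simp: poly_G)
        let ?t = "dt_diff s h (\<lambda>x. D 0 x - poly (Q J) x) x"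
        have "dt_diff s h (D 0) x = ?t + ((\<Sum>j<J. dt_diff s h (poly (G j)) x) + dt_diff s h (poly (Q 0)) x)"
          by (simp add: dt_diff_diff tele)
        then have "\<bar>dt_diff s h (D 0) x\<bar> \<le> \<bar>?t\<bar> + ((\<Sum>j<J. \<bar>dt_diff s h (poly (G j)) x\<bar>) + \<bar>dt_diff s h (poly (Q 0)) x\<bar>)"
          using sum_abs[of "\<lambda>j. dt_diff s h (poly (G j)) x" "{..<J}"] by linarith
        then have "\<bar>dt_diff s h (D 0) x\<bar> powr p \<le> (\<bar>?t\<bar> + ((\<Sum>j<J. \<bar>dt_diff s h (poly (G j)) x\<bar>) + \<bar>dt_diff s h (poly (Q 0)) x\<bar>)) powr p"
          using p by (intro powr_mono2) auto
        also have "\<dots> \<le> \<bar>?t\<bar> powr p + ((\<Sum>j<J. \<bar>dt_diff s h (poly (G j)) x\<bar>) + \<bar>dt_diff s h (poly (Q 0)) x\<bar>) powr p"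
          using p by (intro powr_subadditive) (auto intro!: add_nonneg_nonneg sum_nonneg)
        also have "\<dots> \<le> \<bar>?t\<bar> powr p + ((\<Sum>j<J. \<bar>dt_diff s h (poly (G j)) x\<bar>) powr p + \<bar>dt_diff s h (poly (Q 0)) x\<bar> powr p)"
          using p by (intro add_left_mono powr_subadditive) (auto intro!: sum_nonneg)
        also have "\<dots> \<le> \<bar>?t\<bar> powr p + ((\<Sum>j<J. \<bar>dt_diff s h (poly (G j)) x\<bar> powr p) + \<bar>dt_diff s h (poly (Q 0)) x\<bar> powr p)"
          using p by (intro add_left_mono add_right_mono powr_sum_subadditive) auto
        finally have "ennreal (\<bar>dt_diff s h (D 0) x\<bar> powr p) \<le> ennreal (\<bar>?t\<bar> powr p + ((\<Sum>j<J. \<bar>dt_diff s h (poly (G j)) x\<bar> powr p) + \<bar>dt_diff s h (poly (Q 0)) x\<bar> powr p))"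
          by (rule ennreal_leI)
        also have "\<dots> = ennreal (\<bar>?t\<bar> powr p) + ((\<Sum>j<J. ?g j x) + ?q x)"
          by (simp add: sum_nonneg sum_ennreal)
        also have "\<dots> \<le> T x + ((\<Sum>j<J. ?g j x) + ?q x)" by (intro add_right_mono T x)
        finally show ?thesis .
      qed
      have "(\<integral>\<^sup>+x\<in>{-1..1}. ennreal (\<bar>dt_diff s h (D 0) x\<bar> powr p) \<partial>lborel) \<le>
        (\<integral>\<^sup>+x. T x * indicator {-1..1} x + ((\<Sum>j<J. ?g j x * indicator {-1..1} x) + ?q x * indicator {-1..1} x) \<partial>lborel)"
      proof (intro nn_integral_mono)
        fix x
        show "ennreal (\<bar>dt_diff s h (D 0) x\<bar> powr p) * indicator {-1..1} x \<le>
          T x * indicator {-1..1} x + ((\<Sum>j<J. ?g j x * indicator {-1..1} x) + ?q x * indicator {-1..1} x)"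
          using pt[of x] by (cases "x \<in> {-1..1}") auto
      qed
      also have "\<dots> = (\<integral>\<^sup>+x\<in>{-1..1}. T x \<partial>lborel) + ((\<Sum>j<J. \<integral>\<^sup>+x\<in>{-1..1}. ?g j x \<partial>lborel) + (\<integral>\<^sup>+x\<in>{-1..1}. ?q x \<partial>lborel))"
        by (subst nn_integral_add, measurable, subst nn_integral_add, measurable, subst nn_integral_sum, measurable)
      also have "\<dots> \<le> ennreal e + ((\<Sum>j<J. ennreal (C2 * R * (b (Suc j) + 4 * b j))) + (ennreal (C1 * (\<delta> ^ r) powr p) * X + ennreal (C1 * R * b 0)))"
        by (intro add_mono sum_mono T Ij I0)
      also have "(\<Sum>j<J. ennreal (C2 * R * (b (Suc j) + 4 * b j))) = ennreal (\<Sum>j<J. C2 * R * (b (Suc j) + 4 * b j))"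
        using C2 R0 b0 by (intro sum_ennreal) (auto intro!: mult_nonneg_nonneg add_nonneg_nonneg)
      also have "\<dots> \<le> ennreal (C2 * R * (5 * suminf b))"
        unfolding sum_distrib_left[symmetric] using C2 R0 by (intro ennreal_leI mult_left_mono sum_b) auto
      also have "ennreal (C1 * R * b 0) \<le> ennreal (C1 * R * suminf b)"
        using C1 R0 b_le by (intro ennreal_leI mult_left_mono) auto
      also have "ennreal (C1 * (\<delta> ^ r) powr p) * X \<le> ennreal (C * (\<delta> ^ r) powr p) * X"
        using C2 by (intro mult_right_mono ennreal_leI) (auto simp: C_def)
      finally have "(\<integral>\<^sup>+x\<in>{-1..1}. ennreal (\<bar>dt_diff s h (D 0) x\<bar> powr p) \<partial>lborel) \<le>
          ennreal e + (ennreal (C2 * R * (5 * suminf b)) + (ennreal (C * (\<delta> ^ r) powr p) * X + ennreal (C1 * R * suminf b)))"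
        by (simp add: add_left_mono add_right_mono)
      also have "\<dots> = ennreal (C * (\<delta> ^ r) powr p) * X + ennreal (C * R * suminf b) + ennreal e"
      proof -
        have "C * R * suminf b = C2 * R * (5 * suminf b) + C1 * R * suminf b" by (simp add: C_def algebra_simps)
        then have "ennreal (C * R * suminf b) = ennreal (C2 * R * (5 * suminf b)) + ennreal (C1 * R * suminf b)"
          using C1 C2 R0 sb0 by simp
        then show ?thesis by (simp add: add_ac)
      qed
      finally show "(\<integral>\<^sup>+x\<in>{-1..1}. ennreal (\<bar>dt_diff s h (D 0) x\<bar> powr p) \<partial>lborel) \<le>
          ennreal (C * (\<delta> ^ r) powr p) * X + ennreal (C * R * suminf b) + ennreal e" .
    qed
    then show "(\<integral>\<^sup>+x\<in>{-1..1}. ennreal (\<bar>dt_diff (r + k) h (D 0) x\<bar> powr p) \<partial>lborel) \<le>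
        ennreal (C * (\<delta> ^ r) powr p) *
          (\<integral>\<^sup>+x\<in>main_part k (c * \<delta>). ennreal (\<bar>dt_phi x ^ r * dt_diff k (c * \<delta>) w x\<bar> powr p) \<partial>lborel)
        + ennreal (C * (\<delta> ^ r) powr p * \<delta> powr (2 - 2 * p) *
            (\<Sum>j. real (2 ^ (j + 1) * nat \<lfloor>1 / \<delta>\<rfloor>) powr (2 - 2 * p) * \<beta> j))"
      by (simp add: X_def s_def R_def b_def[abs_def] M_def N_def mult.assoc)
  qed
qed

section \<open>From near-best polynomials to best approximation\<close>

lemma ennpowr_mono:
  assumes "x \<le> y" "0 < a"
  shows "ennpowr x a \<le> ennpowr y a"
proof (cases "y = \<infinity>")
  case False
  then have "x \<noteq> \<infinity>" using assms by (auto simp: top_unique)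
  then show ?thesis using False assms
    by (auto simp: ennpowr_def intro!: ennreal_leI powr_mono2 enn2real_mono simp: less_top)
qed (simp add: ennpowr_def)

lemma ennreal_pos_mult_infinity: "0 < b \<Longrightarrow> ennreal b * \<infinity> = \<infinity>"
  by (simp add: ennreal_mult_top)

lemma ennpowr_ennreal: "0 \<le> x \<Longrightarrow> ennpowr (ennreal x) a = ennreal (x powr a)"
  by (simp add: ennpowr_def)

lemma ennpowr_add_le:
  assumes "0 < a"
  shows "ennpowr (x + y) a \<le> ennreal (2 powr a) * (ennpowr x a + ennpowr y a)"
proof (cases "x = \<infinity> \<or> y = \<infinity>")
  case True
  then have "ennpowr x a + ennpowr y a = \<infinity>" by (auto simp: ennpowr_def)
  then have "ennreal (2 powr a) * (ennpowr x a + ennpowr y a) = \<infinity>"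
    by (simp only: infinity_ennreal_def ennreal_mult_eq_top_iff) auto
  then show ?thesis by simp
next
  case False
  then obtain u v where uv: "x = ennreal u" "0 \<le> u" "y = ennreal v" "0 \<le> v"
    by (cases x; cases y) auto
  have "(u + v) powr a \<le> (2 * max u v) powr a" using uv assms by (intro powr_mono2) auto
  also have "\<dots> = 2 powr a * max u v powr a" using uv by (simp add: powr_mult)
  also have "\<dots> \<le> 2 powr a * (u powr a + v powr a)"
    by (intro mult_left_mono) (auto simp: max_def)
  finally have "ennreal ((u + v) powr a) \<le> ennreal (2 powr a * (u powr a + v powr a))" by (rule ennreal_leI)
  also have "\<dots> = ennreal (2 powr a) * (ennreal (u powr a) + ennreal (v powr a))"
    by (simp add: ennreal_mult)
  finally show ?thesis using uv by (simp add: ennpowr_ennreal flip: ennreal_plus)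
qed

lemma ennpowr_cmult:
  assumes "0 < c" "0 < a"
  shows "ennpowr (ennreal c * x) a = ennreal (c powr a) * ennpowr x a"
proof (cases x)
  case (real u)
  then show ?thesis using assms by (simp add: ennpowr_ennreal powr_mult flip: ennreal_mult)
next
  case top
  then show ?thesis using assms by (simp add: ennpowr_def ennreal_mult_top)
qed

lemma sum_le_infsum_ennreal:
  fixes f :: "nat \<Rightarrow> ennreal"
  assumes "finite F" "F \<subseteq> A"
  shows "sum f F \<le> infsum f A"
  using assms by (subst nonneg_infsum_complete) (auto intro!: SUP_upper)

text \<open>The terms of index between L and 2L dominate the single term of index 2L, because the exponent
  $2-2p$ exceeds $1-2p$ by one and the errors decrease.\<close>

lemma dyadic_block_bound:
  fixes p :: real and E :: "nat \<Rightarrow> real"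
  assumes p: "0 < p" "p < 1" and L: "1 \<le> L"
    and E: "\<And>\<nu>. L \<le> \<nu> \<Longrightarrow> \<nu> \<le> 2 * L \<Longrightarrow> E (2 * L) \<le> E \<nu>" "0 \<le> E (2 * L)"
  shows "real (2 * L) powr (2 - 2 * p) * E (2 * L) \<le> 4 * (\<Sum>\<nu>\<in>{L..<2 * L}. real \<nu> powr (1 - 2 * p) * E \<nu>)"
proof -
  have L0: "0 < real L" using L by simp
  \<comment> \<open>The exponent 1 - 2p changes sign at p = 1/2, but 2L and \<nu> differ by at most
    a factor 2, so either sign costs at most 2.\<close>
  have pt: "real (2 * L) powr (2 - 2 * p) \<le> 4 * real L * real \<nu> powr (1 - 2 * p)" if \<nu>: "\<nu> \<in> {L..<2 * L}" for \<nu>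
  proof -
    have \<nu>': "real L \<le> real \<nu>" "real \<nu> \<le> 2 * real L" "0 < real \<nu>" using \<nu> L by auto
    have "real (2 * L) powr (1 - 2 * p) \<le> 2 * real \<nu> powr (1 - 2 * p)"
    proof (cases "0 \<le> 1 - 2 * p")
      case True
      have "real (2 * L) powr (1 - 2 * p) \<le> (2 * real \<nu>) powr (1 - 2 * p)" using True \<nu>' by (intro powr_mono2) auto
      also have "\<dots> = 2 powr (1 - 2 * p) * real \<nu> powr (1 - 2 * p)" by (simp add: powr_mult)
      also have "\<dots> \<le> 2 powr 1 * real \<nu> powr (1 - 2 * p)" using p by (intro mult_right_mono powr_mono) auto
      finally show ?thesis by simp
    next
      case False
      have "real (2 * L) powr (1 - 2 * p) \<le> real \<nu> powr (1 - 2 * p)" using False \<nu>' by (intro powr_mono2') auto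
      also have "\<dots> \<le> 2 * real \<nu> powr (1 - 2 * p)" by simp
      finally show ?thesis .
    qed
    then have "real (2 * L) * real (2 * L) powr (1 - 2 * p) \<le> real (2 * L) * (2 * real \<nu> powr (1 - 2 * p))"
      by (intro mult_left_mono) auto
    moreover have "real (2 * L) powr (2 - 2 * p) = real (2 * L) * real (2 * L) powr (1 - 2 * p)"
    proof -
      have "real (2 * L) powr (2 - 2 * p) = real (2 * L) powr (1 + (1 - 2 * p))" by simp
      also have "\<dots> = real (2 * L) powr 1 * real (2 * L) powr (1 - 2 * p)" by (rule powr_add)
      finally show ?thesis using L0 by simp
    qed
    ultimately show ?thesis by (simp add: mult_ac)
  qed
  have "real L * (real (2 * L) powr (2 - 2 * p) * E (2 * L)) = (\<Sum>\<nu>\<in>{L..<2 * L}. real (2 * L) powr (2 - 2 * p) * E (2 * L))"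
    by simp
  also have "\<dots> \<le> (\<Sum>\<nu>\<in>{L..<2 * L}. 4 * real L * real \<nu> powr (1 - 2 * p) * E \<nu>)"
  proof (intro sum_mono mult_mono pt)
    fix \<nu> assume "\<nu> \<in> {L..<2 * L}"
    then show "E (2 * L) \<le> E \<nu>" by (intro E) auto
  qed (use E in auto)
  also have "\<dots> = real L * (4 * (\<Sum>\<nu>\<in>{L..<2 * L}. real \<nu> powr (1 - 2 * p) * E \<nu>))"
    by (simp add: sum_distrib_left mult_ac)
  finally show ?thesis using L0 by simp
qed

text \<open>The x with some node in the exceptional null set again form a null set, because each
  node map pulls null sets back to null sets on the main part. This passes from the Borel
  representative w to the derivative of f itself.\<close>

lemma AE_dt_diff_main_part_cong:
  assumes ae: "AE x in lborel. x \<in> {-1..1} \<longrightarrow> g x = w x" and k: "1 \<le> k" and h: "0 < h"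
  shows "AE x in lborel. x \<in> main_part k h \<longrightarrow> dt_diff k h g x = dt_diff k h w x"
proof -
  obtain Z where Z: "{x. \<not> (x \<in> {-1..1} \<longrightarrow> g x = w x)} \<subseteq> Z" "Z \<in> null_sets lborel"
    using ae by (auto elim!: AE_E3 simp: eventually_ae_filter)
  have [measurable]: "Z \<in> sets borel" using Z by auto
  have node: "AE x in lborel. x \<in> main_part k h \<longrightarrow> x + (real k / 2 - real j) * h * dt_phi x \<notin> Z" if j: "j \<in> {..k}" for j
  proof -
    have c: "\<bar>real k / 2 - real j\<bar> \<le> real k / 2" using j by (auto simp: abs_if)
    have "(\<integral>\<^sup>+x\<in>main_part k h. indicator Z (x + (real k / 2 - real j) * h * dt_phi x) \<partial>lborel) \<le>
       2 * (\<integral>\<^sup>+x\<in>{-1..1}. indicator Z x \<partial>lborel)"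
      by (rule nn_integral_main_part_shift_le[OF _ k h c]) measurable
    also have "(\<integral>\<^sup>+x\<in>{-1..1}. indicator Z x \<partial>lborel) \<le> (\<integral>\<^sup>+x. indicator Z x \<partial>lborel)"
      by (intro nn_integral_mono) (auto simp: indicator_def)
    also have "(\<integral>\<^sup>+x. indicator Z x \<partial>lborel) = 0" using Z by auto
    finally have "(\<integral>\<^sup>+x\<in>main_part k h. indicator Z (x + (real k / 2 - real j) * h * dt_phi x) \<partial>lborel) = 0"
      by (simp add: mult_left_mono)
    then have "AE x in lborel. indicator Z (x + (real k / 2 - real j) * h * dt_phi x) * indicator (main_part k h) x = (0::ennreal)"
      by (subst (asm) nn_integral_0_iff_AE) auto
    then show ?thesis by eventually_elim (auto simp: indicator_def split: if_splits)
  qed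
  have "AE x in lborel. \<forall>j\<in>{..k}. x \<in> main_part k h \<longrightarrow> x + (real k / 2 - real j) * h * dt_phi x \<notin> Z"
    by (subst AE_ball_countable) (use node in auto)
  then show ?thesis
  proof eventually_elim
    case (elim x)
    show ?case
    proof
      assume x: "x \<in> main_part k h"
      have "g (x + (real k / 2 - real j) * h * dt_phi x) = w (x + (real k / 2 - real j) * h * dt_phi x)" if "j \<in> {..k}" for j
      proof -
        have "\<bar>real k / 2 - real j\<bar> \<le> real k / 2" using that by (auto simp: abs_if)
        then have "x + (real k / 2 - real j) * h * dt_phi x \<in> {-1..1}" by (rule main_part_shift(1)[OF x k h _ refl])
        then show ?thesis using elim x that Z(1) by blast
      qed
      then show "dt_diff k h g x = dt_diff k h w x"
        unfolding dt_diff_def by (intro if_cong refl sum.cong arg_cong2[where f = "(*)"]) auto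
    qed
  qed
qed

text \<open>The entry point of the hypothesis on f. The derivative of order r is replaced by a Borel
  function w equal to it almost everywhere.\<close>

lemma deriv_chain_of_nderiv_AC:
  assumes AC: "nderiv_AC (r - 1) f" and r: "1 \<le> r"
  obtains w where "deriv_chain r (\<lambda>i. nderiv i f) w (-1) 1" "w \<in> borel_measurable borel"
    "AE x in lborel. x \<in> {-1..1} \<longrightarrow> nderiv r f x = w x"
proof -
  have ac: "abs_continuous_on (-1) 1 (nderiv (r - 1) f)" using AC by (simp add: nderiv_AC_def)
  obtain w where w: "integrable lborel w" "w \<in> borel_measurable borel"
    "\<And>x y. -1 \<le> x \<Longrightarrow> x \<le> y \<Longrightarrow> y \<le> 1 \<Longrightarrow> (w has_integral (nderiv (r - 1) f y - nderiv (r - 1) f x)) {x..y}"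
    "AE x in lborel. x \<in> {-1..1} \<longrightarrow> vector_derivative (nderiv (r - 1) f) (at x within {-1..1}) = w x"
    using AC_indefinite_integral[OF ac] by auto
  have "deriv_chain r (\<lambda>i. nderiv i f) w (-1) 1"
    unfolding deriv_chain_def
  proof (intro conjI allI impI ballI)
    fix i t assume "i < r - 1" "t \<in> {-1..1::real}"
    then have "nderiv i f differentiable (at t within {-1..1})"
      using AC by (auto simp: nderiv_AC_def differentiable_on_def)
    then show "(nderiv i f has_vector_derivative nderiv (Suc i) f t) (at t within {-1..1})"
      by (simp add: vector_derivative_works)
  next
    have "set_integrable lborel {-1..1} w"
      using w(1) unfolding set_integrable_def by (intro integrable_mult_indicator) auto
    then show "w absolutely_integrable_on {-1..1}"
      unfolding set_integrable_def using w(2) by (subst integrable_completion) auto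
  qed (use w in auto)
  moreover have "nderiv r f = (\<lambda>x. vector_derivative (nderiv (r - 1) f) (at x within {-1..1}))"
    using r by (cases r) auto
  ultimately show thesis using that w(2,4) by metis
qed

text \<open>Cauchy condensation: the blocks from 2^j N to 2^(j+1) N tile the range, and each
  dominates the term at its upper end.\<close>

lemma dyadic_sum_bound:
  fixes p :: real and E :: "nat \<Rightarrow> real"
  assumes p: "0 < p" "p < 1" and N: "1 \<le> N" and E: "\<And>\<mu> \<nu>. N \<le> \<mu> \<Longrightarrow> \<mu> \<le> \<nu> \<Longrightarrow> E \<nu> \<le> E \<mu>" "\<And>\<nu>. 0 \<le> E \<nu>"
  shows "(\<Sum>j<J. real (2 ^ (j + 1) * N) powr (2 - 2 * p) * E (2 ^ (j + 1) * N)) \<le>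
    4 * (\<Sum>\<nu>\<in>{N..<2 ^ J * N}. real \<nu> powr (1 - 2 * p) * E \<nu>)"
proof (induction J)
  case (Suc J)
  define L where "L = 2 ^ J * N"
  have NL: "N \<le> L" by (simp add: L_def)
  have "real (2 * L) powr (2 - 2 * p) * E (2 * L) \<le> 4 * (\<Sum>\<nu>\<in>{L..<2 * L}. real \<nu> powr (1 - 2 * p) * E \<nu>)"
    using NL N by (intro dyadic_block_bound p E) auto
  moreover have "(\<Sum>\<nu>\<in>{N..<2 * L}. real \<nu> powr (1 - 2 * p) * E \<nu>) =
      (\<Sum>\<nu>\<in>{N..<L}. real \<nu> powr (1 - 2 * p) * E \<nu>) + (\<Sum>\<nu>\<in>{L..<2 * L}. real \<nu> powr (1 - 2 * p) * E \<nu>)"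
    using NL by (intro sum.atLeastLessThan_concat[symmetric]) auto
  moreover have "2 ^ (J + 1) * N = 2 * L" "2 ^ Suc J * N = 2 * L" by (simp_all add: L_def)
  ultimately show ?case using Suc.IH by (simp only: sum.lessThan_Suc L_def[symmetric] distrib_left)
qed simp

lemma near_best_polynomial:
  assumes p: "0 < p" and ae: "AE x in lborel. x \<in> {-1..1} \<longrightarrow> g x = w x"
    and fin: "best_approx n g p (\<lambda>x. dt_phi x ^ r) \<noteq> \<infinity>" and \<epsilon>: "0 < \<epsilon>"
  shows "\<exists>P. degree P \<le> n \<and> wLp p r (\<lambda>x. w x - poly P x) \<le>
    ennreal (enn2real (ennpowr (best_approx n g p (\<lambda>x. dt_phi x ^ r)) p) + \<epsilon>)"
proof -
  define e where "e = enn2real (best_approx n g p (\<lambda>x. dt_phi x ^ r))"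
  have e: "best_approx n g p (\<lambda>x. dt_phi x ^ r) = ennreal e" "0 \<le> e" using fin by (auto simp: e_def less_top)
  have "(e powr p) powr (1 / p) < (e powr p + \<epsilon>) powr (1 / p)" using \<epsilon> p by (intro powr_less_mono2) auto
  then have "e < (e powr p + \<epsilon>) powr (1 / p)" using e p by (simp add: powr_powr)
  then have "best_approx n g p (\<lambda>x. dt_phi x ^ r) < ennreal ((e powr p + \<epsilon>) powr (1 / p))"
    using e by (simp add: ennreal_less_iff)
  then obtain P where P: "degree P \<le> n"
    "Lp_norm p {-1..1} (\<lambda>x. dt_phi x ^ r * (g x - poly P x)) < ennreal ((e powr p + \<epsilon>) powr (1 / p))"
    unfolding best_approx_def INF_less_iff by auto
  have "(\<integral>\<^sup>+x\<in>{-1..1}. ennreal (\<bar>dt_phi x ^ r * (g x - poly P x)\<bar> powr p) \<partial>lebesgue) = wLp p r (\<lambda>x. w x - poly P x)"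
    unfolding wLp_def nn_integral_completion using ae
    by (intro nn_integral_cong_AE) (auto simp: indicator_def)
  then have "ennpowr (wLp p r (\<lambda>x. w x - poly P x)) (1 / p) < ennreal ((e powr p + \<epsilon>) powr (1 / p))"
    using P(2) by (simp add: Lp_norm_def)
  then have "wLp p r (\<lambda>x. w x - poly P x) \<le> ennreal (e powr p + \<epsilon>)"
  proof (rule contrapos_pp)
    assume "\<not> wLp p r (\<lambda>x. w x - poly P x) \<le> ennreal (e powr p + \<epsilon>)"
    then have "ennpowr (ennreal (e powr p + \<epsilon>)) (1 / p) \<le> ennpowr (wLp p r (\<lambda>x. w x - poly P x)) (1 / p)"
      using p by (intro ennpowr_mono) (auto simp only: not_le less_imp_le zero_less_divide_1_iff)
    moreover have "0 \<le> e powr p + \<epsilon>" using \<epsilon> by (intro add_nonneg_nonneg) auto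
    ultimately show "\<not> ennpowr (wLp p r (\<lambda>x. w x - poly P x)) (1 / p) < ennreal ((e powr p + \<epsilon>) powr (1 / p))"
      by (simp only: ennpowr_ennreal not_less)
  qed
  moreover have "enn2real (ennpowr (best_approx n g p (\<lambda>x. dt_phi x ^ r)) p) = e powr p"
    using e by (simp add: ennpowr_ennreal)
  ultimately show ?thesis using P(1) by auto
qed

text \<open>Still in p-th powers. If the series is infinite nothing is to be shown; otherwise
  near-best polynomials are fed into the telescoped estimate, condensation bounds the dyadic series,
  and the total slack \<eta> tends to 0.\<close>

lemma dt_diff_Lp_le_best_approx:
  fixes p :: real and r k :: nat
  assumes p: "0 < p" "p < 1" and r: "1 \<le> r" and k: "1 \<le> k"
  shows "\<exists>c C. 0 < c \<and> c \<le> 1 \<and> 0 < C \<and>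
    (\<forall>D w g \<delta> h. deriv_chain r D w (-1) 1 \<longrightarrow> (AE x in lborel. x \<in> {-1..1} \<longrightarrow> g x = w x) \<longrightarrow>
      0 < \<delta> \<longrightarrow> \<delta> \<le> 1 / (2 * real (r + k)) \<longrightarrow> \<bar>h\<bar> \<le> \<delta> \<longrightarrow>
      (\<integral>\<^sup>+x\<in>{-1..1}. ennreal (\<bar>dt_diff (r + k) h (D 0) x\<bar> powr p) \<partial>lborel) \<le>
        ennreal (C * (\<delta> ^ r) powr p) *
          (\<integral>\<^sup>+x\<in>main_part k (c * \<delta>). ennreal (\<bar>dt_phi x ^ r * dt_diff k (c * \<delta>) w x\<bar> powr p) \<partial>lborel)
        + ennreal (C * (\<delta> ^ r) powr p * \<delta> powr (2 - 2 * p)) *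
            (\<Sum>\<^sub>\<infinity>\<nu>\<in>{nat \<lfloor>1 / \<delta>\<rfloor>..}. ennreal (real \<nu> powr (1 - 2 * p)) *
               ennpowr (best_approx (\<nu> - r) g p (\<lambda>x. dt_phi x ^ r)) p))"
proof -
  obtain c C where c: "0 < c" "c \<le> 1" and C: "0 < C" and
    core: "\<forall>D w \<delta> h P \<beta>. deriv_chain r D w (-1) 1 \<longrightarrow> 0 < \<delta> \<longrightarrow> \<delta> \<le> 1 / (2 * real (r + k)) \<longrightarrow> \<bar>h\<bar> \<le> \<delta> \<longrightarrow>
      (\<forall>j. degree (P j) \<le> 2 ^ (j + 1) * nat \<lfloor>1 / \<delta>\<rfloor> - r) \<longrightarrow> (\<forall>j. 0 \<le> \<beta> j) \<longrightarrow>
      (\<forall>j. wLp p r (\<lambda>x. w x - poly (P j) x) \<le> ennreal (\<beta> j)) \<longrightarrow>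
      summable (\<lambda>j. real (2 ^ (j + 1) * nat \<lfloor>1 / \<delta>\<rfloor>) powr (2 - 2 * p) * \<beta> j) \<longrightarrow>
      (\<integral>\<^sup>+x\<in>{-1..1}. ennreal (\<bar>dt_diff (r + k) h (D 0) x\<bar> powr p) \<partial>lborel) \<le>
        ennreal (C * (\<delta> ^ r) powr p) *
          (\<integral>\<^sup>+x\<in>main_part k (c * \<delta>). ennreal (\<bar>dt_phi x ^ r * dt_diff k (c * \<delta>) w x\<bar> powr p) \<partial>lborel)
        + ennreal (C * (\<delta> ^ r) powr p * \<delta> powr (2 - 2 * p) *
            (\<Sum>j. real (2 ^ (j + 1) * nat \<lfloor>1 / \<delta>\<rfloor>) powr (2 - 2 * p) * \<beta> j))"
    using dt_diff_Lp_le_telescoped[OF p r k] by (elim exE conjE) (rule that)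
  have main: "(\<integral>\<^sup>+x\<in>{-1..1}. ennreal (\<bar>dt_diff (r + k) h (D 0) x\<bar> powr p) \<partial>lborel) \<le>
        ennreal (4 * C * (\<delta> ^ r) powr p) *
          (\<integral>\<^sup>+x\<in>main_part k (c * \<delta>). ennreal (\<bar>dt_phi x ^ r * dt_diff k (c * \<delta>) w x\<bar> powr p) \<partial>lborel)
        + ennreal (4 * C * (\<delta> ^ r) powr p * \<delta> powr (2 - 2 * p)) *
            (\<Sum>\<^sub>\<infinity>\<nu>\<in>{nat \<lfloor>1 / \<delta>\<rfloor>..}. ennreal (real \<nu> powr (1 - 2 * p)) *
               ennpowr (best_approx (\<nu> - r) g p (\<lambda>x. dt_phi x ^ r)) p)"
    (is "?J \<le> ennreal ?A4 * ?X + ennreal ?B4 * ?S")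
    if chain: "deriv_chain r D w (-1) 1" and ae: "AE x in lborel. x \<in> {-1..1} \<longrightarrow> g x = w x"
      and \<delta>: "0 < \<delta>" "\<delta> \<le> 1 / (2 * real (r + k))" and h: "\<bar>h\<bar> \<le> \<delta>" for D w g \<delta> h
  proof (cases "?S = \<infinity>")
    case True
    have "0 < ?B4" using C \<delta> by simp
    then have "ennreal ?B4 * ?S = \<infinity>" unfolding True by (rule ennreal_pos_mult_infinity)
    then have "ennreal ?A4 * ?X + ennreal ?B4 * ?S = \<infinity>" by simp
    then show ?thesis by (simp only: infinity_ennreal_def top_greatest)
  next
    case False
    define N where "N = nat \<lfloor>1 / \<delta>\<rfloor>"
    define A where "A = C * (\<delta> ^ r) powr p"
    define B where "B = A * \<delta> powr (2 - 2 * p)"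
    have AB: "0 < A" "0 < B" using C \<delta> by (auto simp: A_def B_def)
    have N1: "1 \<le> N"
    proof -
      have "1 / (2 * real (r + k)) \<le> 1" using r by (simp add: field_simps)
      then have "1 \<le> 1 / \<delta>" using \<delta> by (simp add: field_simps)
      then have "1 \<le> \<lfloor>1 / \<delta>\<rfloor>" by (simp only: le_floor_iff of_int_1)
      then show ?thesis unfolding N_def by linarith
    qed
    let ?b = "\<lambda>\<nu>. best_approx (\<nu> - r) g p (\<lambda>x. dt_phi x ^ r)"
    define E where "E = (\<lambda>\<nu>. enn2real (ennpowr (?b \<nu>) p))"
    define S' where "S' = enn2real ?S"
    have S': "?S = ennreal S'" "0 \<le> S'" using False by (auto simp: S'_def less_top)
    \<comment> \<open>An infinite error would make the series infinite, its coefficient being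
      positive.\<close>
    have fin: "?b \<nu> \<noteq> \<infinity>" if "N \<le> \<nu>" for \<nu>
    proof
      assume inf: "?b \<nu> = \<infinity>"
      have "(\<Sum>\<nu>\<in>{\<nu>}. ennreal (real \<nu> powr (1 - 2 * p)) * ennpowr (?b \<nu>) p) \<le> ?S"
        using that by (intro sum_le_infsum_ennreal) (auto simp: N_def)
      moreover have "0 < real \<nu> powr (1 - 2 * p)" using that N1 by simp
      ultimately show False using inf False by (simp add: ennpowr_def ennreal_mult_top top_unique)
    qed
    then have finp: "ennpowr (?b \<nu>) p = ennreal (E \<nu>)" if "N \<le> \<nu>" for \<nu>
      using that by (simp add: E_def ennpowr_def)
    have E0: "0 \<le> E \<nu>" for \<nu> by (simp add: E_def)
    have Emono: "E \<nu> \<le> E \<mu>" if "N \<le> \<mu>" "\<mu> \<le> \<nu>" for \<mu> \<nu>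
    proof -
      have "?b \<nu> \<le> ?b \<mu>" unfolding best_approx_def using that by (intro INF_superset_mono) auto
      then have "ennpowr (?b \<nu>) p \<le> ennpowr (?b \<mu>) p" using p by (intro ennpowr_mono)
      then show ?thesis using that finp[of \<mu>] finp[of \<nu>] E0 by simp
    qed
    have Ssum: "(\<Sum>\<nu>\<in>{N..<m}. real \<nu> powr (1 - 2 * p) * E \<nu>) \<le> S'" for m
    proof -
      have "ennreal (\<Sum>\<nu>\<in>{N..<m}. real \<nu> powr (1 - 2 * p) * E \<nu>) = (\<Sum>\<nu>\<in>{N..<m}. ennreal (real \<nu> powr (1 - 2 * p) * E \<nu>))"
        using E0 by (intro sum_ennreal[symmetric]) auto
      also have "\<dots> = (\<Sum>\<nu>\<in>{N..<m}. ennreal (real \<nu> powr (1 - 2 * p)) * ennpowr (?b \<nu>) p)"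
        using E0 finp by (intro sum.cong) (auto simp: ennreal_mult)
      also have "\<dots> \<le> ?S" by (intro sum_le_infsum_ennreal) (auto simp: N_def)
      finally show ?thesis using S' by simp
    qed
    have key: "?J \<le> ennreal A * ?X + ennreal (4 * B * S') + ennreal \<eta>" if \<eta>: "0 < \<eta>" for \<eta>
    proof -
      \<comment> \<open>The dyadic sequence starts at 2N and not at N: the term at 2N is dominated
        by the indices from N to 2N, while for N itself the series contains no preceding
        block.\<close>
      define M where "M = (\<lambda>j. 2 ^ (j + 1) * N)"
      have M: "N \<le> M j" "1 \<le> M j" for j using N1 by (auto simp: M_def)
      \<comment> \<open>Cancels the weight M^(2-2p), so that the slacks contribute at most \<eta>/B
        to the series, and \<eta> after multiplication by B.\<close>
      define \<epsilon> where "\<epsilon> = (\<lambda>j. \<eta> / B * (1 / 2) ^ (j + 1) * real (M j) powr - (2 - 2 * p))"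
      have \<epsilon>: "0 < \<epsilon> j" for j
        unfolding \<epsilon>_def using \<eta> AB M(2)[of j] by (intro mult_pos_pos divide_pos_pos) auto
      define \<beta> where "\<beta> = (\<lambda>j. E (M j) + \<epsilon> j)"
      have "\<exists>P. degree P \<le> M j - r \<and> wLp p r (\<lambda>x. w x - poly P x) \<le> ennreal (\<beta> j)" for j
        unfolding \<beta>_def E_def using near_best_polynomial[OF p(1) ae fin[OF M(1)] \<epsilon>] .
      then obtain P where P: "\<And>j. degree (P j) \<le> M j - r" "\<And>j. wLp p r (\<lambda>x. w x - poly (P j) x) \<le> ennreal (\<beta> j)"
        by metis
      have \<beta>0: "0 \<le> \<beta> j" for j using E0 \<epsilon>[of j] by (simp add: \<beta>_def add_nonneg_nonneg less_imp_le)
      have term_eq: "real (M j) powr (2 - 2 * p) * \<beta> j =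
          real (M j) powr (2 - 2 * p) * E (M j) + \<eta> / B * (1 / 2) ^ (j + 1)" for j
      proof -
        have "real (M j) powr (2 - 2 * p) * real (M j) powr - (2 - 2 * p) = 1"
          using M(2)[of j] by (simp flip: powr_add)
        then have "real (M j) powr (2 - 2 * p) * \<epsilon> j = \<eta> / B * (1 / 2) ^ (j + 1)"
          unfolding \<epsilon>_def by (metis (no_types, opaque_lifting) mult.left_commute mult.right_neutral)
        then show ?thesis by (simp only: \<beta>_def distrib_left)
      qed
      have partial: "(\<Sum>j<J. real (M j) powr (2 - 2 * p) * \<beta> j) \<le> 4 * S' + \<eta> / B" for J
      proof -
        have "(\<Sum>j<J. (1 / 2 :: real) ^ (j + 1)) \<le> 1"
        proof -
          have "(\<Sum>j<J. (1 / 2 :: real) ^ (j + 1)) = 1 - (1 / 2) ^ J" by (induction J) auto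
          then show ?thesis by simp
        qed
        then have "\<eta> / B * (\<Sum>j<J. (1 / 2 :: real) ^ (j + 1)) \<le> \<eta> / B * 1"
          using \<eta> AB by (intro mult_left_mono) auto
        then have 1: "(\<Sum>j<J. \<eta> / B * (1 / 2) ^ (j + 1)) \<le> \<eta> / B" by (simp only: sum_distrib_left mult_1_right)
        have 2: "(\<Sum>j<J. real (M j) powr (2 - 2 * p) * E (M j)) \<le> 4 * S'"
          using dyadic_sum_bound[of p N E J, OF p N1 Emono E0] Ssum[of "2 ^ J * N"] unfolding M_def by linarith
        show ?thesis unfolding term_eq sum.distrib using 1 2 by linarith
      qed
      have t0: "0 \<le> real (M j) powr (2 - 2 * p) * \<beta> j" for j using \<beta>0 by simp
      have summ: "summable (\<lambda>j. real (M j) powr (2 - 2 * p) * \<beta> j)"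
        using partial t0 by (intro summableI_nonneg_bounded)
      have le: "(\<Sum>j. real (M j) powr (2 - 2 * p) * \<beta> j) \<le> 4 * S' + \<eta> / B"
        using partial summ by (intro suminf_le_const)
      have "?J \<le> ennreal A * ?X + ennreal (B * (\<Sum>j. real (M j) powr (2 - 2 * p) * \<beta> j))"
        using core[rule_format, OF chain \<delta> h, of P \<beta>] P \<beta>0 summ unfolding M_def N_def A_def B_def by blast
      moreover have "ennreal (B * (\<Sum>j. real (M j) powr (2 - 2 * p) * \<beta> j)) \<le> ennreal (4 * B * S') + ennreal \<eta>"
      proof -
        have "B * (\<Sum>j. real (M j) powr (2 - 2 * p) * \<beta> j) \<le> B * (4 * S' + \<eta> / B)"
          using le AB by (intro mult_left_mono) auto
        also have "\<dots> = 4 * B * S' + \<eta>" using AB by (simp add: field_simps)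
        finally have "ennreal (B * (\<Sum>j. real (M j) powr (2 - 2 * p) * \<beta> j)) \<le> ennreal (4 * B * S' + \<eta>)"
          by (rule ennreal_leI)
        also have "\<dots> = ennreal (4 * B * S') + ennreal \<eta>" using AB S' \<eta> by (intro ennreal_plus) auto
        finally show ?thesis .
      qed
      ultimately show ?thesis unfolding add.assoc by (meson add_left_mono order_trans)
    qed
    have "?J \<le> ennreal A * ?X + ennreal (4 * B * S')"
      by (rule ennreal_le_epsilon) (use key in auto)
    also have "\<dots> \<le> ennreal ?A4 * ?X + ennreal ?B4 * ?S"
    proof (intro add_mono mult_right_mono ennreal_leI)
      show "A \<le> ?A4" using C by (simp add: A_def)
      have "ennreal (4 * B * S') = ennreal (4 * B) * ennreal S'" using AB S' by (intro ennreal_mult) auto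
      moreover have "4 * B = ?B4" by (simp add: A_def B_def mult_ac)
      ultimately show "ennreal (4 * B * S') \<le> ennreal ?B4 * ?S" by (simp only: S' order_refl)
    qed auto
    finally show ?thesis .
  qed
  show ?thesis
  proof (rule exI[of _ c], rule exI[of _ "4 * C"], intro conjI allI impI)
    show "0 < c" "c \<le> 1" "0 < 4 * C" using c C by auto
  qed (rule main; assumption)
qed

theorem theorem4p5:
  fixes p :: real and r k :: nat
  assumes "0 < p" and "p < 1" and "r \<ge> 1" and "k \<ge> 1"
  shows "\<exists>\<delta>\<^sub>0 C :: real. 0 < \<delta>\<^sub>0 \<and> real r * \<delta>\<^sub>0 \<le> 1 \<and> 0 < C \<and>
    (\<forall>(f :: real \<Rightarrow> real) (\<delta> :: real).
       nderiv_AC (r - 1) f \<longrightarrow>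
       set_integrable lebesgue {-1..1} (\<lambda>x. dt_phi x ^ r * nderiv r f x) \<longrightarrow>
       0 < \<delta> \<longrightarrow> \<delta> < \<delta>\<^sub>0 \<longrightarrow>
       dt_modulus (r + k) f \<delta> p
         \<le> ennreal (C * \<delta> ^ r) * main_part_modulus k (nderiv r f) \<delta> p (\<lambda>x. dt_phi x ^ r)
           + ennreal (C * \<delta> powr (real r + 2 / p - 2))
             * ennpowr
                 (\<Sum>\<^sub>\<infinity>\<nu>\<in>{nat \<lfloor>1 / \<delta>\<rfloor>..}.
                    ennreal (real \<nu> powr (1 - 2 * p))
                    * ennpowr (best_approx (\<nu> - r) (nderiv r f) p (\<lambda>x. dt_phi x ^ r)) p)
                 (1 / p))"
proof -
  note p = assms(1,2) and r = assms(3) and k = assms(4)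
  obtain c C where c: "0 < c" "c \<le> 1" and C: "0 < C" and
    power_form: "\<forall>D w g \<delta> h. deriv_chain r D w (-1) 1 \<longrightarrow> (AE x in lborel. x \<in> {-1..1} \<longrightarrow> g x = w x) \<longrightarrow>
      0 < \<delta> \<longrightarrow> \<delta> \<le> 1 / (2 * real (r + k)) \<longrightarrow> \<bar>h\<bar> \<le> \<delta> \<longrightarrow>
      (\<integral>\<^sup>+x\<in>{-1..1}. ennreal (\<bar>dt_diff (r + k) h (D 0) x\<bar> powr p) \<partial>lborel) \<le>
        ennreal (C * (\<delta> ^ r) powr p) *
          (\<integral>\<^sup>+x\<in>main_part k (c * \<delta>). ennreal (\<bar>dt_phi x ^ r * dt_diff k (c * \<delta>) w x\<bar> powr p) \<partial>lborel)
        + ennreal (C * (\<delta> ^ r) powr p * \<delta> powr (2 - 2 * p)) *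
            (\<Sum>\<^sub>\<infinity>\<nu>\<in>{nat \<lfloor>1 / \<delta>\<rfloor>..}. ennreal (real \<nu> powr (1 - 2 * p)) *
               ennpowr (best_approx (\<nu> - r) g p (\<lambda>x. dt_phi x ^ r)) p)"
    using dt_diff_Lp_le_best_approx[OF p r k] by (elim exE conjE) (rule that)
  \<comment> \<open>Below this bound [1/\<delta>] >= r, so the degrees \<nu> - r in the series are
    not truncated at 0.\<close>
  define \<delta>\<^sub>0 where "\<delta>\<^sub>0 = 1 / (2 * real (r + k))"
  \<comment> \<open>2^(1/p) is the quasi-triangle constant paid for splitting the p-th root of a
    sum; C^(1/p) is the constant of the p-th power estimate.\<close>
  define K where "K = (2 * C) powr (1 / p)"
  have K: "0 < K" using C by (simp add: K_def)
  have main: "Lp_norm p {-1..1} (dt_diff (r + k) h f)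
         \<le> ennreal (K * \<delta> ^ r) * main_part_modulus k (nderiv r f) \<delta> p (\<lambda>x. dt_phi x ^ r)
           + ennreal (K * \<delta> powr (real r + 2 / p - 2))
             * ennpowr
                 (\<Sum>\<^sub>\<infinity>\<nu>\<in>{nat \<lfloor>1 / \<delta>\<rfloor>..}.
                    ennreal (real \<nu> powr (1 - 2 * p))
                    * ennpowr (best_approx (\<nu> - r) (nderiv r f) p (\<lambda>x. dt_phi x ^ r)) p)
                 (1 / p)" (is "_ \<le> _ * ?\<Omega> + _ * ennpowr ?S _")
    if AC: "nderiv_AC (r - 1) f" and \<delta>: "0 < \<delta>" "\<delta> < \<delta>\<^sub>0" and h: "h \<in> {-\<delta>..\<delta>}" for f \<delta> h
  proof -
    obtain w where w: "deriv_chain r (\<lambda>i. nderiv i f) w (-1) 1" "AE x in lborel. x \<in> {-1..1} \<longrightarrow> nderiv r f x = w x"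
      using deriv_chain_of_nderiv_AC[OF AC r] by metis
    define X where "X = (\<integral>\<^sup>+x\<in>main_part k (c * \<delta>). ennreal (\<bar>dt_phi x ^ r * dt_diff k (c * \<delta>) w x\<bar> powr p) \<partial>lborel)"
    define A where "A = C * (\<delta> ^ r) powr p"
    define B where "B = C * (\<delta> ^ r) powr p * \<delta> powr (2 - 2 * p)"
    have AB: "0 < A" "0 < B" using C \<delta> by (auto simp: A_def B_def)
    have J: "(\<integral>\<^sup>+x\<in>{-1..1}. ennreal (\<bar>dt_diff (r + k) h f x\<bar> powr p) \<partial>lborel) \<le> ennreal A * X + ennreal B * ?S"
      using power_form[rule_format, OF w(1) w(2) \<delta>(1), of h] \<delta> h by (simp add: A_def B_def X_def \<delta>\<^sub>0_def abs_le_iff)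
    \<comment> \<open>The integral is a single member, for the step c\<delta>, of the supremum
      defining the modulus. Neither the replacement of w by the derivative of f nor the passage to
      the completed measure changes its value.\<close>
    have X: "ennpowr X (1 / p) \<le> ?\<Omega>"
    proof -
      have "X = (\<integral>\<^sup>+x\<in>main_part k (c * \<delta>). ennreal (\<bar>dt_phi x ^ r * dt_diff k (c * \<delta>) (nderiv r f) x\<bar> powr p) \<partial>lebesgue)"
        unfolding X_def nn_integral_completion
      proof (rule nn_integral_cong_AE)
        have "AE x in lborel. x \<in> main_part k (c * \<delta>) \<longrightarrow> dt_diff k (c * \<delta>) (nderiv r f) x = dt_diff k (c * \<delta>) w x"
          using c \<delta> by (intro AE_dt_diff_main_part_cong w k) auto
        then show "AE x in lborel. ennreal (\<bar>dt_phi x ^ r * dt_diff k (c * \<delta>) w x\<bar> powr p) * indicator (main_part k (c * \<delta>)) x =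
            ennreal (\<bar>dt_phi x ^ r * dt_diff k (c * \<delta>) (nderiv r f) x\<bar> powr p) * indicator (main_part k (c * \<delta>)) x"
          by eventually_elim (auto simp: indicator_def)
      qed
      then have "ennpowr X (1 / p) = Lp_norm p (main_part k (c * \<delta>)) (\<lambda>x. dt_phi x ^ r * dt_diff k (c * \<delta>) (nderiv r f) x)"
        by (simp add: Lp_norm_def)
      moreover have "c * \<delta> \<in> {-\<delta>..\<delta>}"
      proof -
        have "c * \<delta> \<le> 1 * \<delta>" "0 \<le> c * \<delta>" using c \<delta> by (auto intro!: mult_right_mono)
        then show ?thesis using \<delta> by simp
      qed
      ultimately show ?thesis unfolding main_part_modulus_def main_part_def by (auto intro: SUP_upper)
    qed
    have pow: "((\<delta> ^ r) powr p) powr (1 / p) = \<delta> ^ r" using p \<delta> by (simp add: powr_powr)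
    have cA: "2 powr (1 / p) * A powr (1 / p) = K * \<delta> ^ r"
      using C \<delta> pow by (simp add: A_def K_def powr_mult)
    have "2 powr (1 / p) * B powr (1 / p) = K * \<delta> ^ r * \<delta> powr ((2 - 2 * p) / p)"
      using C \<delta> pow by (simp add: B_def K_def powr_mult powr_powr)
    also have "\<dots> = K * (\<delta> powr real r * \<delta> powr ((2 - 2 * p) / p))" using \<delta> by (simp add: powr_realpow)
    also have "\<dots> = K * \<delta> powr (real r + 2 / p - 2)" using p by (simp add: powr_add[symmetric] field_simps)
    finally have cB: "2 powr (1 / p) * B powr (1 / p) = K * \<delta> powr (real r + 2 / p - 2)" .
    have "Lp_norm p {-1..1} (dt_diff (r + k) h f) \<le> ennpowr (ennreal A * X + ennreal B * ?S) (1 / p)"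
      unfolding Lp_norm_def nn_integral_completion using J p by (intro ennpowr_mono) auto
    also have "\<dots> \<le> ennreal (2 powr (1 / p)) * (ennpowr (ennreal A * X) (1 / p) + ennpowr (ennreal B * ?S) (1 / p))"
      using p by (intro ennpowr_add_le) auto
    also have "\<dots> = ennreal (2 powr (1 / p)) * (ennreal (A powr (1 / p)) * ennpowr X (1 / p) + ennreal (B powr (1 / p)) * ennpowr ?S (1 / p))"
      using p AB by (simp only: ennpowr_cmult zero_less_divide_1_iff)
    also have "\<dots> = ennreal (K * \<delta> ^ r) * ennpowr X (1 / p) + ennreal (K * \<delta> powr (real r + 2 / p - 2)) * ennpowr ?S (1 / p)"
      unfolding cA[symmetric] cB[symmetric] by (simp add: ennreal_mult distrib_left mult.assoc)
    also have "\<dots> \<le> ennreal (K * \<delta> ^ r) * ?\<Omega> + ennreal (K * \<delta> powr (real r + 2 / p - 2)) * ennpowr ?S (1 / p)"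
      using X by (intro add_right_mono mult_left_mono) auto
    finally show ?thesis .
  qed
  have "0 < \<delta>\<^sub>0" "real r * \<delta>\<^sub>0 \<le> 1" using r by (auto simp: \<delta>\<^sub>0_def field_simps)
  with K main show ?thesis
    unfolding dt_modulus_def by (intro exI[of _ \<delta>\<^sub>0] exI[of _ K]) (intro conjI allI impI SUP_least; assumption?)
qed

end
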